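(* Let $h:\mathbb{R}^d\to\mathbb{R}^d$ be measurable with, for some $K'>0$, $\max_{z\in K_h(x)}\|z\|\le K'(1+\|x\|)$ for all $x\in\mathbb{R}^d$. Let $$x(n+1)=x(n)+a(n)\bigl(z(n)+M(n+1)\bigr),\quad z(n)=h(x(n)),\quad n\ge 0,$$ where: $a(n)\ge 0$ for all $n\ge0$, $\sum_n a(n)=\infty$, $\sum_n a(n)^2<\infty$; $\{M(n)\}$ is an $\mathbb{R}^d$-valued martingale difference sequence with respect to $\mathcal{F}_n:=\sigma(x(0),M(m),m\le n)$ with $\sup_nE[\|M(n)\|^4]<\infty$ and, for some $K>0$, $E[\|M(n+1)\|^2\mid\mathcal{F}_n]\le K(1+\|x(n)\|^2)$ for all $n$; and $\sup_n\|x(n)\|<\infty$ a.s. Let $(\dagger)$ denote the condition: for every $n\ge 0$ the law of $(x(n),M(n+1))$ is absolutely continuous with respect to Lebesgue measure on $\mathbb{R}^d\times\mathbb{R}^d$. Then there is a zero probability set $\Phi$ such that for every sample point outside $\Phi$ the following holds. One has $\sup_n\|x(n)\|<\infty$, and for compact convex sets $B,D\subset\mathbb{R}^d$ with $(x(n),h(x(n)))\in B\times D$ for all $n$ (such sets exist), with the space $\mathcal{U}$ and the averaged empirical measures $\check\mu(dxdz|\cdot)\in\mathcal{U}$ defined in the context, any limit point of $\check\mu(dxdz|t+\cdot)$ in $\mathcal{U}$ as $t\uparrow\infty$ is of the form $\mu^*(dxdz)$ (i.e., is a constant element of $\mathcal{U}$), such that: 1. $\mu^*$ is supported on the graph of $K_h(\cdot)$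 and, if $(\dagger)$ holds, on the graph of $F_h(\cdot)$; and 2. there exists a stationary process $(X(\cdot),Z(\cdot))$ satisfying $\dot{X}(t)=Z(t)$ for which the marginal law of $(X(t),Z(t))$ is $\mu^*$ for all $t$. Furthermore, $Z(\cdot)$ may be viewed as corresponding to a stationary Markov relaxed control $v(X(\cdot))$ for some measurable $v:x\in\mathbb{R}^d\mapsto v(x)\in\mathcal{P}(K_h(x))$ ($v(x)\in\mathcal{P}(F_h(x))$ if $(\dagger)$ holds), i.e., $v(X(t))$ is the (conditional) law of $Z(t)$ (given $X(t)$) for all $t\ge 0$.
   Context: The Krasovskii and Filippov maps of $h$ are $$K_h(x):=\bigcap_{\delta>0}\overline{co}\bigl(\{h(y):\|y-x\|<\delta\}\bigr),\qquad F_h(x):=\bigcap_{N\in\mathcal{N}}\bigcap_{\delta>0}\overline{co}\bigl(\{h(y):\|y-x\|<\delta,\ y\notin N\}\bigr),$$ where $\mathcal{N}$ is the collection of Lebesgue-null subsets of $\mathbb{R}^d$ and $\overline{co}$ denotes closed convex hull. The graph of a set-valued map $H$ is $\{(x,z):z\in H(x)\}$. $\mathcal{P}(S)$ is the space of probability measures on a Polish space $S$ with the Prohorov topology. Put $t(0):=0$, $t(n):=\sum_{m=0}^{n-1}a(m)$. For $t\in[0,\infty)$ define $$\mu(dxdz|t):=\delta_{(x(n),z(n))}(dxdz),\qquad t(n)\le t<t(n+1),\ n\ge 0,$$ with $\delta_{(x',z')}$ the Dirac measure at $(x',z')$. For a fixed sample path and fixed $B,D$ as in the claim, $\mathcal{U}$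 is the space of measurable maps $[0,\infty)\to\mathcal{P}(B\times D)$ (identified when a.e. equal) with the coarsest topology making continuous all the maps $$\mu(dxdu|\cdot)\in\mathcal{U}\mapsto\int_s^t g(y)\int_{B\times D}f(x,u)\,\mu(dxdu|y)\,dy,\quad f\in C(B\times D),\ g\in L_2[s,t],\ t>s\ge 0;$$ this topology is compact and metrizable. The averaged empirical measures $\check\mu(dxdz|\cdot)\in\mathcal{U}$ are defined for $t>0$ by $$\int f(x,z)\,\check\mu(dxdz|t):=\frac1t\int_0^t\int f(x,z)\,\mu(dxdz|s)\,ds$$ for all twice continuously differentiable $f\in C_b(B\times D)$ with bounded first and second partial derivatives. For $t\ge 0$, $\check\mu(dxdz|t+\cdot)\in\mathcal{U}$ denotes the shifted map $s\mapsto\check\mu(dxdz|t+s)$.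
   Formalization: Ẋ(t)=Z(t) cannot hold pathwise in general (chattering between velocities 1 and -1 at 0 gives X=0, Z=±1); it is read as: X(t)-X(s) is the weak (Pettis) integral of Z, and a.s. X(t)=X(0)+∫_0^t∫z v(X(s))(dz)ds. *)

theory Defs
  imports "HOL-Probability.Probability"
begin

subsection \<open>Krasovskii and Filippov maps\<close>

definition krasovskii_map :: "('a::euclidean_space \<Rightarrow> 'a) \<Rightarrow> 'a \<Rightarrow> 'a set" where
  "krasovskii_map h x = (\<Inter>\<delta>\<in>{0<..}. closure (convex hull (h ` ball x \<delta>)))"

definition filippov_map :: "('a::euclidean_space \<Rightarrow> 'a) \<Rightarrow> 'a \<Rightarrow> 'a set" where
  "filippov_map h x =
     (\<Inter>N\<in>null_sets lebesgue. \<Inter>\<delta>\<in>{0<..}. closure (convex hull (h ` (ball x \<delta> - N))))"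

definition set_graph :: "('a \<Rightarrow> 'b set) \<Rightarrow> ('a \<times> 'b) set" where
  "set_graph H = {(x, z). z \<in> H x}"


subsection \<open>Noise\<close>

definition noise_filtration ::
  "'w measure \<Rightarrow> ('w \<Rightarrow> 'a::euclidean_space) \<Rightarrow> (nat \<Rightarrow> 'w \<Rightarrow> 'a) \<Rightarrow> nat \<Rightarrow> 'w measure" where
  "noise_filtration P x0 M n =
     sigma (space P) ({x0 -` A \<inter> space P | A. A \<in> sets borel} \<union>
                      (\<Union>m\<le>n. {M m -` A \<inter> space P | A. A \<in> sets borel}))"

text \<open>The library only has conditional expectations of real-valued functions; for vector-valued
  ones they are taken componentwise.\<close>

definition martingale_difference ::
  "'w measure \<Rightarrow> (nat \<Rightarrow> 'w measure) \<Rightarrow> (nat \<Rightarrow> 'w \<Rightarrow> 'a::euclidean_space) \<Rightarrow> bool" where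
  "martingale_difference P F M \<longleftrightarrow>
     (\<forall>n. M n \<in> borel_measurable (F n) \<and> integrable P (M n)) \<and>
     (\<forall>n. \<forall>b\<in>Basis. AE \<omega> in P. real_cond_exp P (F n) (\<lambda>\<omega>. M (Suc n) \<omega> \<bullet> b) \<omega> = 0)"

definition joint_law_abs_cont ::
  "'w measure \<Rightarrow> (nat \<Rightarrow> 'w \<Rightarrow> 'a::euclidean_space) \<Rightarrow> (nat \<Rightarrow> 'w \<Rightarrow> 'a) \<Rightarrow> bool" where
  "joint_law_abs_cont P x M \<longleftrightarrow>
     (\<forall>n. absolutely_continuous (lborel :: ('a \<times> 'a) measure)
            (distr P borel (\<lambda>\<omega>. (x n \<omega>, M (Suc n) \<omega>))))"


subsection \<open>Probability measures on a closed set\<close>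

text \<open>For closed \<open>S\<close>, a probability measure on \<open>S\<close> is represented by the Borel probability
  measure on the ambient space that gives \<open>S\<close> full mass. Measurability of measure-valued maps is
  with respect to \<^const>\<open>prob_algebra\<close>, whose \<open>\<sigma>\<close>-algebra is, on a Polish space, the Borel
  \<open>\<sigma>\<close>-algebra of the Prohorov topology.\<close>

definition prob_on :: "'b::topological_space set \<Rightarrow> 'b measure set" where
  "prob_on S = {m \<in> space (prob_algebra borel). emeasure m S = 1}"


subsection \<open>The space of measure-valued maps on the half-line\<close>

definition relaxed_maps :: "'b::topological_space set \<Rightarrow> (real \<Rightarrow> 'b measure) set" where
  "relaxed_maps S = {\<nu> \<in> restrict_space borel {0..} \<rightarrow>\<^sub>M prob_algebra borel. \<forall>t\<ge>0. \<nu> t \<in> prob_on S}"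

definition relaxed_rel ::
  "'b::topological_space set \<Rightarrow> ((real \<Rightarrow> 'b measure) \<times> (real \<Rightarrow> 'b measure)) set" where
  "relaxed_rel S = {(\<nu>, \<nu>'). \<nu> \<in> relaxed_maps S \<and> \<nu>' \<in> relaxed_maps S \<and>
                             (AE t in lborel. 0 \<le> t \<longrightarrow> \<nu> t = \<nu>' t)}"

definition relaxed_class ::
  "'b::topological_space set \<Rightarrow> (real \<Rightarrow> 'b measure) \<Rightarrow> (real \<Rightarrow> 'b measure) set" where
  "relaxed_class S \<nu> = relaxed_rel S `` {\<nu>}"

definition relaxed_pairing ::
  "'b::topological_space set \<Rightarrow> ('b \<Rightarrow> real) \<Rightarrow> (real \<Rightarrow> real) \<Rightarrow> real \<Rightarrow> real \<Rightarrow>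
   (real \<Rightarrow> 'b measure) \<Rightarrow> real" where
  "relaxed_pairing S f g s t \<nu> = (LINT y:{s..t}|lborel. g y * (LINT p:S|\<nu> y. f p))"

text \<open>Points are equivalence classes. The pairings do not depend on the representative, so each
  generator is the preimage of the open set \<open>V\<close> under one of the required functionals.\<close>

definition relaxed_topology ::
  "'b::topological_space set \<Rightarrow> (real \<Rightarrow> 'b measure) set topology" where
  "relaxed_topology S = topology_generated_by
     {{c \<in> relaxed_maps S // relaxed_rel S. \<exists>\<nu>\<in>c. relaxed_pairing S f g s t \<nu> \<in> V} | f g s t V.
        continuous_on S f \<and> 0 \<le> s \<and> s < t \<and>
        set_borel_measurable lborel {s..t} g \<and> set_integrable lborel {s..t} (\<lambda>y. (g y)\<^sup>2) \<and>
        open V}"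

text \<open>Limit points as the real parameter tends to infinity. They are sequential since the topology
  above is metrizable for compact \<open>S\<close>.\<close>

definition limit_point_at_top :: "'c topology \<Rightarrow> (real \<Rightarrow> 'c) \<Rightarrow> 'c \<Rightarrow> bool" where
  "limit_point_at_top T \<phi> c \<longleftrightarrow>
     (\<exists>\<tau>. filterlim \<tau> at_top sequentially \<and> limitin T (\<lambda>k. \<phi> (\<tau> k)) c sequentially)"


subsection \<open>Empirical measures\<close>

definition algo_time :: "(nat \<Rightarrow> real) \<Rightarrow> nat \<Rightarrow> real" where
  "algo_time a n = (\<Sum>m<n. a m)"

definition empirical_measure ::
  "(nat \<Rightarrow> real) \<Rightarrow> (nat \<Rightarrow> 'b::topological_space) \<Rightarrow> real \<Rightarrow> 'b measure" where
  "empirical_measure a y t =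
     return borel (y (THE n. algo_time a n \<le> t \<and> t < algo_time a (Suc n)))"

definition C2_bounded :: "('b::real_normed_vector \<Rightarrow> real) \<Rightarrow> bool" where
  "C2_bounded f \<longleftrightarrow>
     (\<exists>(f' :: 'b \<Rightarrow> 'b \<Rightarrow>\<^sub>L real) (f'' :: 'b \<Rightarrow> 'b \<Rightarrow>\<^sub>L ('b \<Rightarrow>\<^sub>L real)).
        (\<forall>p. (f has_derivative blinfun_apply (f' p)) (at p)) \<and>
        (\<forall>p. (f' has_derivative blinfun_apply (f'' p)) (at p)) \<and>
        continuous_on UNIV f'' \<and>
        bounded (range f) \<and> bounded (range f') \<and> bounded (range f''))"

text \<open>The average is determined by its integrals of test functions, and only for \<open>t > 0\<close>; the value
  at the single relevant remaining time \<open>t = 0\<close> is a convention, immaterial up to a.e. equality.\<close>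

definition averaged_empirical ::
  "'b::real_normed_vector set \<Rightarrow> (nat \<Rightarrow> real) \<Rightarrow> (nat \<Rightarrow> 'b) \<Rightarrow> real \<Rightarrow> 'b measure" where
  "averaged_empirical S a y t =
     (if t > 0 then
        (THE m. m \<in> prob_on S \<and>
           (\<forall>f. C2_bounded f \<longrightarrow>
              (LINT p:S|m. f p) =
                1 / t * (LINT s:{0..t}|lborel. (LINT p:S|empirical_measure a y s. f p))))
      else empirical_measure a y 0)"


subsection \<open>Stationary processes and relaxed controls\<close>

text \<open>The law of the process on the product \<open>\<sigma>\<close>-algebra is determined by the finite-dimensional
  distributions, so this is invariance of the latter under time shifts.\<close>

definition stationary_process ::
  "'w measure \<Rightarrow> (real \<Rightarrow> 'w \<Rightarrow> 'b::topological_space) \<Rightarrow> bool" where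
  "stationary_process Q Y \<longleftrightarrow>
     prob_space Q \<and> (\<forall>t\<ge>0. Y t \<in> borel_measurable Q) \<and>
     (\<forall>\<tau>\<ge>0. distr Q (Pi\<^sub>M {0..} (\<lambda>_. borel)) (\<lambda>\<omega>. \<lambda>t\<in>{0..}. Y (t + \<tau>) \<omega>) =
             distr Q (Pi\<^sub>M {0..} (\<lambda>_. borel)) (\<lambda>\<omega>. \<lambda>t\<in>{0..}. Y t \<omega>))"

text \<open>\<open>dX/dt = Z\<close> in integrated form, \<open>X t - X s\<close> being the weak (Pettis) integral of \<open>Z\<close> over
  \<open>[s, t]\<close>. If \<open>Z\<close> is bounded and jointly measurable in time and sample point, this is the pathwise
  identity, almost surely. Joint measurability cannot be demanded: a scheme that chatters between
  the velocities 1 and -1 around 0 has a limit \<open>X = 0\<close> with \<open>Z t\<close> equal to 1 or -1.\<close>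

definition weak_velocity ::
  "'w measure \<Rightarrow> (real \<Rightarrow> 'w \<Rightarrow> 'a::euclidean_space) \<Rightarrow> (real \<Rightarrow> 'w \<Rightarrow> 'a) \<Rightarrow> bool" where
  "weak_velocity Q X Z \<longleftrightarrow>
     (\<forall>(W :: 'w \<Rightarrow> real) s t.
        W \<in> borel_measurable Q \<and> bounded (range W) \<and> 0 \<le> s \<and> s \<le> t \<longrightarrow>
        set_integrable lborel {s..t} (\<lambda>r. LINT \<omega>|Q. W \<omega> *\<^sub>R Z r \<omega>) \<and>
        (LINT \<omega>|Q. W \<omega> *\<^sub>R (X t \<omega> - X s \<omega>)) = (LINT r:{s..t}|lborel. (LINT \<omega>|Q. W \<omega> *\<^sub>R Z r \<omega>)))"

text \<open>The same equation for almost every path, with the velocity replaced by the stationary Markov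
  relaxed control \<open>v\<close>, that is, by the mean of \<open>v (X t)\<close>.\<close>

definition relaxed_dynamics ::
  "'w measure \<Rightarrow> (real \<Rightarrow> 'w \<Rightarrow> 'a::euclidean_space) \<Rightarrow> ('a \<Rightarrow> 'a measure) \<Rightarrow> bool" where
  "relaxed_dynamics Q X v \<longleftrightarrow>
     (AE \<omega> in Q. \<forall>t\<ge>0.
        set_integrable lborel {0..t} (\<lambda>s. LINT z|v (X s \<omega>). z) \<and>
        X t \<omega> = X 0 \<omega> + (LINT s:{0..t}|lborel. (LINT z|v (X s \<omega>). z)))"

definition is_conditional_law ::
  "'w measure \<Rightarrow> ('w \<Rightarrow> 'a::euclidean_space) \<Rightarrow> ('w \<Rightarrow> 'a) \<Rightarrow> ('a \<Rightarrow> 'a measure) \<Rightarrow> bool" where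
  "is_conditional_law Q X Z v \<longleftrightarrow>
     (\<forall>A\<in>sets borel. AE \<omega> in Q.
        real_cond_exp Q (vimage_algebra (space Q) X borel) (\<lambda>\<omega>. indicator A (Z \<omega>)) \<omega>
          = measure (v (X \<omega>)) A)"

end

theory Submission
  imports Defs
begin

text \<open>The velocities of the algorithm equal \<open>z n = h (x n)\<close>, but a limit point of the averaged
 empirical measures only retains the law of a pair (position, velocity). The theorem says that this
 law \<open>mu\<close> is the marginal of a stationary motion driven by a Markov relaxed control.

 Noise. By Kolmogorov's maximal inequality the series of the \<open>a n *R M (Suc n)\<close> converges almost
 surely (\<open>noise_series_converges\<close>), so the piecewise constant interpolation of the iterates differs
 from the primitive of the interpolated velocities by a convergent function of time
 (\<open>interpolated_path_converges\<close>). From here on the argument is about one path.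

 The limit measure. Shifting an average over \<open>[0, T]\<close> by \<open>r\<close> changes it by \<open>O(r / T)\<close>. Hence a limit
 in the topology of relaxed maps cannot depend on time, and its value \<open>mu\<close> is the weak limit of time
 averages along a sequence of horizons (\<open>limit_point_averages\<close>). The pairs \<open>(x n, z n)\<close> lie in the
 closed graph of the Krasovskii map, and in that of the Filippov map if the iterates avoid the null
 set of \<open>ex_null_set_filippov\<close>; so \<open>mu\<close> is carried by that graph.

 The control. Let \<open>nu\<close> be the first marginal of \<open>mu\<close>. Disintegration is obtained in functional form:
 \<open>mu\<close> is the law of \<open>(x, G (x, u))\<close> with \<open>x\<close> distributed as \<open>nu\<close> and \<open>u\<close> uniform and independent
 (\<open>ex_randomization\<close>). Then \<open>v x\<close> is the law of \<open>G (x, u)\<close> and \<open>vb x\<close> denotes its mean.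

 The motion. Weak limits of the shifted paths of the algorithm are stationary, but their velocity
 may depend on the whole past, not only on the present position. A Markov substitute is built from the
 same data. Observing the path at a uniformly chosen time and \<open>(1/2) ^ i\<close> later gives couplings of
 \<open>nu\<close> with itself, of displacement at most \<open>C * (1/2) ^ i\<close>, whose mean displacement is \<open>(1/2) ^ i\<close>
 times \<open>vb\<close> in the weak sense (\<open>joint_window_limit\<close>). Averages of finitely many of these couplings have
 a drift close to \<open>vb\<close> in \<open>L1\<close>, since suitable averages of a bounded weakly convergent sequence converge strongly
 (\<open>one_step_kernel\<close>). The Markov chains with these kernels preserve \<open>nu\<close>; their martingale parts vanish
 in the limit (\<open>mart_second\<close>), and by Prokhorov's theorem they converge along a subsequence at all
 dyadic times (\<open>dyadic_limit\<close>). The limit extends to Lipschitz paths with \<open>X' = vb (X)\<close> (\<open>ode\<close>).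

 The velocities. Independent uniform variables, one for every time \<open>t\<close>, turn \<open>X t\<close> into the pair
 \<open>(X t, G (X t, u t))\<close> of law \<open>mu\<close>, and stationarity is inherited from \<open>X\<close>. This process is not
 jointly measurable. Its deviations from \<open>vb (X t)\<close> are however pairwise orthogonal, so by Bessel's
 inequality every bounded random variable is uncorrelated with all but countably many of them
 (\<open>countable_correlated\<close>). Integrals over time do not see countable sets, which yields the velocity
 equation in the weak sense.\<close>

notation (input) LIMSEQ (infix "---->" 60)
notation (input) pair_measure (infixr "><" 80)
notation (input) measurable (infixr "->M" 60)
notation (input) scaleR (infixr "*R" 75)
notation (input) inner (infix "<.>" 70)

lemmas bo_integrable_add = Bochner_Integration.integrable_add
lemmas bo_integrable_bound = Bochner_Integration.integrable_bound
lemmas bo_integrable_diff = Bochner_Integration.integrable_diff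
lemmas bo_integrable_sum = Bochner_Integration.integrable_sum
lemmas bo_integral_add = Bochner_Integration.integral_add
lemmas bo_integral_cong = Bochner_Integration.integral_cong
lemmas bo_integral_diff = Bochner_Integration.integral_diff
lemmas bo_integral_nonneg = Bochner_Integration.integral_nonneg
lemmas bo_integral_sum = Bochner_Integration.integral_sum
lemmas hk_integral_combine = Henstock_Kurzweil_Integration.integral_combine
lemmas hk_integral_cong = Henstock_Kurzweil_Integration.integral_cong
lemmas hk_integral_diff = Henstock_Kurzweil_Integration.integral_diff
lemmas mcompose = measurable_compose
lemmas continuous_borel = borel_measurable_continuous_onI

section \<open>Closed graphs, convex values and selections\<close>

lemma krasovskii_map_alt: "krasovskii_map h x = {z. ALL dl>0. z : closure (convex hull (h ` (ball x dl - {})))}"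
 by (auto simp: krasovskii_map_def)

lemma filippov_map_alt:
 "filippov_map h x = (\<Inter>N\<in>null_sets lebesgue. {z. ALL dl>0. z : closure (convex hull (h ` (ball x dl - N)))})"
 by (auto simp: filippov_map_def)

text \<open>The local closed convex hulls over a ball of radius \<open>d\<close> contain those over any ball of radius \<open>d / 2\<close> about a
 point within \<open>d / 2\<close>. This transfers membership from a convergent sequence in the graph to its limit.\<close>

lemma closed_graph_local_hull:
 fixes h :: "'a::euclidean_space => 'a"
 shows "closed {(x, z). ALL dl>0. z : closure (convex hull (h ` (ball x dl - N)))}"
 unfolding closed_sequential_limits
proof (intro allI impI, elim conjE)
 fix u :: "nat => 'a * 'a" and l
 assume u: "ALL n. u n : {(x, z). ALL dl>0. z : closure (convex hull (h ` (ball x dl - N)))}" and l: "u ----> l"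
 have "snd l : closure (convex hull (h ` (ball (fst l) dl - N)))" if "dl > 0" for dl
 proof (rule Lim_in_closed_set[OF closed_closure])
  show "((%n. snd (u n)) \<longlongrightarrow> snd l) sequentially" by (rule tendsto_snd[OF l])
  have "eventually (%n. dist (fst (u n)) (fst l) < dl / 2) sequentially"
   using tendstoD[OF tendsto_fst[OF l], of "dl / 2"] that by simp
  then show "eventually (%n. snd (u n) : closure (convex hull (h ` (ball (fst l) dl - N)))) sequentially"
  proof eventually_elim
   case (elim n)
   have "ball (fst (u n)) (dl/2) \<subseteq> ball (fst l) dl"
   proof
    fix y assume "y : ball (fst (u n)) (dl/2)"
    then show "y : ball (fst l) dl"
     using elim dist_triangle[of "fst l" y "fst (u n)"] by (auto simp: dist_commute)
   qed
   then have "closure (convex hull (h ` (ball (fst (u n)) (dl/2) - N))) \<subseteq> closure (convex hull (h ` (ball (fst l) dl - N)))"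
    by (intro closure_mono hull_mono image_mono) auto
   moreover have "snd (u n) : closure (convex hull (h ` (ball (fst (u n)) (dl/2) - N)))"
    using u that by (auto simp: case_prod_beta)
   ultimately show ?case by auto
  qed
 qed auto
 then show "l : {(x, z). ALL dl>0. z : closure (convex hull (h ` (ball x dl - N)))}"
  by (auto simp: case_prod_beta)
qed

lemma closed_graph_krasovskii: "closed (set_graph (krasovskii_map h))"
 using closed_graph_local_hull[of h "{}"] by (simp add: set_graph_def krasovskii_map_alt)

lemma closed_graph_filippov: "closed (set_graph (filippov_map h))"
proof -
 have "set_graph (filippov_map h) =
  (\<Inter>N\<in>null_sets lebesgue. {(x, z). ALL dl>0. z : closure (convex hull (h ` (ball x dl - N)))})"
  by (auto simp: set_graph_def filippov_map_alt)
 then show ?thesis by (simp add: closed_INT closed_graph_local_hull)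
qed

lemma convex_krasovskii: "convex (krasovskii_map h x)"
 unfolding krasovskii_map_def by (intro convex_INT convex_closure convex_convex_hull)

lemma convex_filippov: "convex (filippov_map h x)"
 unfolding filippov_map_def by (intro convex_INT convex_closure convex_convex_hull)

lemma filippov_subset_krasovskii: "filippov_map h x \<subseteq> krasovskii_map h x"
proof -
 have "{} : null_sets lebesgue" by simp
 then show ?thesis unfolding filippov_map_alt krasovskii_map_alt by blast
qed

lemma in_krasovskii: "h x : krasovskii_map h x"
 unfolding krasovskii_map_alt by (auto intro!: closure_subset[THEN subsetD] hull_inc)

lemma closed_section: "closed (set_graph H) ==> closed (H x)" for H :: "'a::euclidean_space => 'a set"
proof -
 assume *: "closed (set_graph H)"
 have "closed ((%z. (x, z)) -` set_graph H)"
  by (intro closed_vimage * continuous_intros)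
 then show ?thesis by (simp add: set_graph_def vimage_def)
qed

text \<open>If \<open>h y\<close> is not in the Filippov set at \<open>y\<close>, then some null set can be removed so that \<open>h\<close> stays away from
 \<open>h y\<close> near \<open>y\<close>; hence \<open>y\<close> lies in one of countably many null sets \<open>U \<inter> h -` W\<close> with basic \<open>U\<close>, \<open>W\<close>.\<close>

lemma ex_null_set_filippov:
 fixes h :: "'a::euclidean_space => 'a"
 assumes [measurable]: "h : borel_measurable borel"
 shows "EX N0:null_sets lborel. ALL y. y \<notin> N0 --> h y : filippov_map h y"
proof -
 obtain \<B> :: "'a set set" where \<B>: "countable \<B>" "topological_basis \<B>"
  using ex_countable_basis by blast
 define I where "I = {(U, W). U : \<B> & W : \<B> & U \<inter> h -` W : null_sets lborel}"
 define N0 where "N0 = (\<Union>(U, W)\<in>I. U \<inter> h -` W)"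
 have "I \<subseteq> \<B> \<times> \<B>" by (auto simp: I_def)
 then have "countable I" by (rule countable_subset) (intro countable_SIGMA \<B>)
 then have "N0 : null_sets lborel" unfolding N0_def
  by (intro null_sets_UN') (auto simp: I_def)
 moreover have "h y : filippov_map h y" if y: "y \<notin> N0" for y
  unfolding filippov_map_alt
 proof (intro INT_I CollectI allI impI)
  fix N :: "'a set" and dl :: real assume N: "N : null_sets lebesgue" and dl: "dl > 0"
  have "h y : closure (h ` (ball y dl - N))"
  proof (rule ccontr)
   let ?O = "- closure (h ` (ball y dl - N))"
   assume "h y \<notin> closure (h ` (ball y dl - N))"
   then obtain W where W: "W : \<B>" "h y : W" "W \<subseteq> ?O"
    using topological_basisE[OF \<B>(2), of ?O "h y"] by auto
   obtain U where U: "U : \<B>" "y : U" "U \<subseteq> ball y dl"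
    using topological_basisE[OF \<B>(2), of "ball y dl" y] dl by auto
   have sub: "U \<inter> h -` W \<subseteq> N"
   proof
    fix w assume w: "w : U \<inter> h -` W"
    show "w : N"
    proof (rule ccontr)
     assume "w \<notin> N"
     then have "h w : h ` (ball y dl - N)" using w U by auto
     then have "h w : closure (h ` (ball y dl - N))" using closure_subset by (rule subsetD[rotated])
     then show False using w W(3) by auto
    qed
   qed
   have "open U" "open W" using U W \<B>(2) topological_basis_open by auto
   then have meas: "U \<inter> h -` W : sets borel"
    using measurable_sets[of h borel borel W] by auto
   then have "U \<inter> h -` W : null_sets lebesgue"
    using null_sets_subset[OF N _ sub] by auto
   then have "U \<inter> h -` W : null_sets lborel"
    using meas by (simp add: null_sets_completion_iff)
   then have "(U, W) : I" using U W by (auto simp: I_def)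
   then show False using y U W by (auto simp: N0_def)
  qed
  then show "h y : closure (convex hull (h ` (ball y dl - N)))"
   using closure_mono[OF hull_subset] by blast
 qed
 ultimately show ?thesis by blast
qed

text \<open>Every point is a limit of points \<open>y\<close> with \<open>h y\<close> in the Filippov set at \<open>y\<close>. By linear growth the values
 \<open>h y\<close> have a convergent subsequence, and the graph is closed.\<close>

lemma filippov_nonempty:
 fixes h :: "'a::euclidean_space => 'a"
 assumes h: "h : borel_measurable borel"
  and growth: "!!y w. w : krasovskii_map h y ==> norm w <= K' * (1 + norm y)"
 shows "filippov_map h x ~= {}"
proof -
 obtain N0 where N0: "N0 : null_sets lborel" "!!y. y \<notin> N0 ==> h y : filippov_map h y"
  using ex_null_set_filippov[OF h] by blast
 have "negligible N0" using N0(1) by (auto simp: negligible_iff_null_sets null_sets_completionI)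
 have "EX y. y : ball x (1 / Suc n) & y \<notin> N0" for n
 proof (rule ccontr)
  assume "~ ?thesis"
  then have "ball x (1 / Suc n) \<subseteq> N0" by auto
  then have "negligible (ball x (1 / Suc n))" using \<open>negligible N0\<close> negligible_subset by blast
  then show False using open_not_negligible[of "ball x (1 / Suc n)"] by simp
 qed
 then obtain y where y: "!!n. y n : ball x (1 / Suc n)" "!!n. y n \<notin> N0" by metis
 have "y ----> x"
 proof (rule metric_LIMSEQ_I)
  fix r :: real assume "r > 0"
  then obtain n0 where "1 / Suc n0 < r" using nat_approx_posE by blast
  then have "dist (y n) x < r" if "n >= n0" for n
  proof -
   have "dist (y n) x < 1 / Suc n" using y(1)[of n] by (simp add: dist_commute)
   also have "... <= 1 / Suc n0" using that by (simp add: frac_le)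
   finally show ?thesis using \<open>1 / Suc n0 < r\<close> by simp
  qed
  then show "EX no. ALL n>=no. dist (y n) x < r" by blast
 qed
 have bd: "norm (h (y n)) <= \<bar>K'\<bar> * (2 + norm x)" for n
 proof -
  have "norm (h (y n)) <= K' * (1 + norm (y n))" by (rule growth[OF in_krasovskii])
  also have "... <= \<bar>K'\<bar> * (1 + norm (y n))" by (intro mult_right_mono) auto
  also have "norm (y n) <= norm x + 1"
  proof -
   have "dist x (y n) < 1 / Suc n" using y(1)[of n] by simp
   also have "1 / Suc n <= 1" by simp
   finally show ?thesis using norm_triangle_ineq2[of "y n" x] by (simp add: dist_norm norm_minus_commute)
  qed
  finally show ?thesis by (simp add: mult_left_mono)
 qed
 then have "bounded (range (%n. h (y n)))" by (auto simp: bounded_iff)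
 then obtain l r where r: "strict_mono (r :: nat => nat)" "((%n. h (y n)) \<circ> r) ----> l"
  using bounded_imp_convergent_subsequence by blast
 have "(%n. (y (r n), h (y (r n)))) ----> (x, l)"
  using r LIMSEQ_subseq_LIMSEQ[OF \<open>y ----> x\<close> r(1)] by (intro tendsto_Pair) (auto simp: comp_def)
 moreover have "(y (r n), h (y (r n))) : set_graph (filippov_map h)" for n
  using N0(2) y(2) by (simp add: set_graph_def)
 ultimately have "(x, l) : set_graph (filippov_map h)"
  using closed_sequentially[OF closed_graph_filippov[of h], of "%n. (y (r n), h (y (r n)))"] by auto
 then show ?thesis by (auto simp: set_graph_def)
qed

text \<open>The element of least norm depends measurably on the point, because by compactness of closed balls its norm
 is lower semicontinuous and the element is unique.\<close>

lemma ex_measurable_selection: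
 fixes H :: "'a::euclidean_space => 'a set"
 assumes cl: "closed (set_graph H)" and cv: "!!x. convex (H x)" and ne: "!!x. H x ~= {}"
 shows "EX s. s : borel_measurable borel & (ALL x. s x : H x)"
proof -
 note clx = closed_section[OF cl]
 define s where "s x = closest_point (H x) 0" for x
 have s_in: "s x : H x" for x unfolding s_def by (rule closest_point_in_set[OF clx ne])
 have s_le: "norm (s x) <= norm z" if "z : H x" for x z
  using closest_point_le[OF clx that, of 0] by (simp add: s_def)
 have s_unique: "z = s x" if "z : H x" "norm z <= norm (s x)" for x z
  unfolding s_def using that s_le
  by (intro closest_point_unique[OF cv clx]) (auto simp: dist_norm intro: order_trans)
 define A where "A C q = {x. EX z. z : cball 0 q \<inter> C & (x, z) : set_graph H}" for C and q :: real
 have A_closed: "closed (A C q)" if "closed C" for C q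
 proof -
  have "closed {x. EX z. z : cball 0 q \<inter> C & (z, x) : (%p. (snd p, fst p)) -` set_graph H}"
  proof (rule closed_compact_projection)
   show "compact (cball 0 q \<inter> C)" using that by (simp add: compact_Int_closed)
   show "closed ((%p. (snd p, fst p)) -` set_graph H)"
    by (intro closed_vimage cl continuous_intros)
  qed
  then show ?thesis by (simp add: A_def)
 qed
 have eq: "s -` C = (\<Inter>q\<in>\<rat>. - A UNIV q \<union> A C q)" if C: "closed C" for C
 proof (intro set_eqI iffI)
  fix x assume "x : s -` C"
  have "x : A C q" if A: "x : A UNIV q" for q
  proof -
   from A obtain z where "z : H x" "norm z <= q" by (auto simp: A_def set_graph_def)
   then have "norm (s x) <= q" using s_le by force
   then show ?thesis using \<open>x : s -` C\<close> s_in by (auto simp: A_def set_graph_def)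
  qed
  then show "x : (\<Inter>q\<in>\<rat>. - A UNIV q \<union> A C q)" by auto
 next
  fix x assume x: "x : (\<Inter>q\<in>\<rat>. - A UNIV q \<union> A C q)"
  have q: "x : A C q" if "q : \<rat>" "norm (s x) <= q" for q
   using that x s_in by (auto simp: A_def set_graph_def)
  obtain q0 where "q0 : \<rat>" "norm (s x) <= q0"
   using Rats_dense_in_real[of "norm (s x)" "norm (s x) + 1"] by auto
  from q[OF this] have ne': "H x \<inter> C ~= {}" by (auto simp: A_def set_graph_def)
  have cl': "closed (H x \<inter> C)" using clx C by blast
  define c where "c = closest_point (H x \<inter> C) 0"
  have c: "c : H x" "c : C" using closest_point_in_set[OF cl' ne', of 0] by (auto simp: c_def)
  have "norm c <= norm (s x)"
  proof (rule ccontr)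
   assume "~ ?thesis"
   then obtain q' where q': "q' : \<rat>" "norm (s x) < q'" "q' < norm c"
    using Rats_dense_in_real[of "norm (s x)" "norm c"] by auto
   then have "x : A C q'" by (intro q) auto
   then obtain z where "z : H x \<inter> C" "norm z <= q'" by (auto simp: A_def set_graph_def)
   with closest_point_le[OF cl' this(1), of 0] q' show False by (simp add: c_def)
  qed
  then show "x : s -` C" using s_unique[OF c(1)] c(2) by auto
 qed
 have "s : borel_measurable borel"
 proof (rule borel_measurableI)
  fix S :: "'a set" assume "open S"
  then have "closed (- S)" by auto
  have "s -` (- S) : sets borel"
   unfolding eq[OF \<open>closed (- S)\<close>]
   using A_closed[OF \<open>closed (- S)\<close>] A_closed[OF closed_UNIV] countable_rat
   by (intro sets.countable_INT') auto
  then have "- (s -` (- S)) : sets borel" by auto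
  then show "s -` S \<inter> space borel : sets borel" by (simp add: vimage_Compl)
 qed
 then show ?thesis using s_in by blast
qed

section \<open>Square-summable martingale differences\<close>

lemma integrable_mult_square:
 fixes f g :: "'w => real"
 assumes "f : borel_measurable P" "g : borel_measurable P"
  "integrable P (%om. (f om)\<^sup>2)" "integrable P (%om. (g om)\<^sup>2)"
 shows "integrable P (%om. f om * g om)"
proof (rule bo_integrable_bound)
 show "integrable P (%om. (f om)\<^sup>2 + (g om)\<^sup>2)" using assms by simp
 have "\<bar>f x * g x\<bar> <= (f x)\<^sup>2 + (g x)\<^sup>2" for x
 proof -
  have "2 * \<bar>f x * g x\<bar> <= (f x)\<^sup>2 + (g x)\<^sup>2"
   using sum_squares_bound[of "\<bar>f x\<bar>" "\<bar>g x\<bar>"] by (simp add: abs_mult)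
  then show ?thesis by linarith
 qed
 then show "AE x in P. norm (f x * g x) <= norm ((f x)\<^sup>2 + (g x)\<^sup>2)" by simp
qed (use assms in auto)

locale square_integrable_differences = prob_space P for P :: "'w measure" +
 fixes F :: "nat => 'w measure" and Y :: "nat => 'w => real"
 assumes sub: "!!n. subalgebra P (F n)"
  and mono: "!!m n. m <= n ==> sets (F m) \<subseteq> sets (F n)"
  and adapted: "!!n. Y n : borel_measurable (F (Suc n))"
  and sq: "!!n. integrable P (%om. (Y n om)\<^sup>2)"
  and centred: "!!n. AE om in P. real_cond_exp P (F n) (Y n) om = 0"
begin

lemma F_mono: "m <= n ==> f : borel_measurable (F m) ==> f : borel_measurable (F n)"
 using mono[of m n] sub by (auto simp: measurable_def subalgebra_def)

lemma F_P: "f : borel_measurable (F m) ==> f : borel_measurable P"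
 by (rule measurable_from_subalg[OF sub])

lemma Y_meas [measurable]: "Y n : borel_measurable P"
 using adapted by (rule F_P)

lemma int_past_zero:
 assumes g: "g : borel_measurable (F n)" and g2: "integrable P (%om. (g om)\<^sup>2)"
 shows "(LINT om|P. g om * Y n om) = 0"
proof -
 interpret S: sigma_finite_subalgebra P "F n"
  by (rule finite_measure_subalgebra_is_sigma_finite)
    (simp add: finite_measure_subalgebra_def finite_measure_subalgebra_axioms_def sub finite_measure_axioms)
 have "integrable P (%om. g om * Y n om)"
  by (intro integrable_mult_square F_P[OF g] Y_meas g2 sq)
 then have "(LINT om|P. g om * real_cond_exp P (F n) (Y n) om) = (LINT om|P. g om * Y n om)"
  by (intro S.real_cond_exp_intg(2) g Y_meas)
 moreover have "(LINT om|P. g om * real_cond_exp P (F n) (Y n) om) = (LINT om|P. 0)"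
  by (rule integral_cong_AE) (use centred[of n] F_P[OF g] in \<open>auto intro: borel_measurable_cond_exp2\<close>)
 ultimately show ?thesis by simp
qed

definition S where "S n m om = (\<Sum>k\<in>{n..<m}. Y k om)"

lemma S_meas: "S n m : borel_measurable (F m)"
 unfolding S_def by (intro borel_measurable_sum) (auto intro: F_mono[OF _ adapted])

lemma S_meas_P [measurable]: "S n m : borel_measurable P" using S_meas by (rule F_P)

lemma S_sq: "integrable P (%om. (S n m om)\<^sup>2)"
proof (induction m)
 case 0 then show ?case by (simp add: S_def)
next
 case (Suc m)
 show ?case
 proof (cases "n <= m")
  case True
  then have "(%om. (S n (Suc m) om)\<^sup>2) = (%om. (S n m om)\<^sup>2 + (Y m om)\<^sup>2 + 2 * (S n m om * Y m om))"
   by (auto simp: S_def power2_eq_square algebra_simps)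
  then show ?thesis using Suc sq integrable_mult_square[OF S_meas_P Y_meas Suc sq] by simp
 qed (simp add: S_def)
qed

text \<open>On the event that the partial sums first exceed the level at time \<open>k\<close>, the later increments are orthogonal
 to everything known at time \<open>k\<close>, so the second moment can only grow.\<close>

lemma maximal_step:
 assumes A: "A : sets (F k)" and "k <= m" "n <= k"
 shows "(LINT om|P. indicator A om * (S n k om)\<^sup>2) <= (LINT om|P. indicator A om * (S n m om)\<^sup>2)"
 using \<open>k <= m\<close>
proof (induction m rule: dec_induct)
 case (step m)
 have A': "A : sets (F m)" using mono[OF step(1)] A by auto
 have AP[measurable]: "A : sets P" using A sub[of k] by (auto simp: subalgebra_def)
 have g: "(%om. indicator A om * S n m om) : borel_measurable (F m)"
  by (intro borel_measurable_times borel_measurable_indicator A' S_meas)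
 have g2: "integrable P (%om. (indicator A om * S n m om)\<^sup>2)"
  by (rule bo_integrable_bound[OF S_sq[of n m]]) (auto split: split_indicator)
 have i1: "integrable P (%om. indicator A om * (S n m om)\<^sup>2)" for m
  by (rule bo_integrable_bound[OF S_sq[of n m]]) (auto split: split_indicator)
 have i2: "integrable P (%om. indicator A om * (Y m om)\<^sup>2)"
  by (rule bo_integrable_bound[OF sq[of m]]) (auto split: split_indicator)
 have i3: "integrable P (%om. (indicator A om * S n m om) * Y m om)"
  by (intro integrable_mult_square F_P[OF g] Y_meas g2 sq)
 have "(LINT om|P. indicator A om * (S n (Suc m) om)\<^sup>2) =
  (LINT om|P. indicator A om * (S n m om)\<^sup>2 + (indicator A om * (Y m om)\<^sup>2 + 2 * ((indicator A om * S n m om) * Y m om)))"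
  using step assms(3) by (intro bo_integral_cong) (auto simp: S_def power2_eq_square algebra_simps)
 also have "... = (LINT om|P. indicator A om * (S n m om)\<^sup>2) + ((LINT om|P. indicator A om * (Y m om)\<^sup>2) + 2 * (LINT om|P. (indicator A om * S n m om) * Y m om))"
  using i1[of m] i2 i3 by simp
 also have "(LINT om|P. (indicator A om * S n m om) * Y m om) = 0" by (rule int_past_zero[OF g g2])
 finally have "(LINT om|P. indicator A om * (S n (Suc m) om)\<^sup>2) >= (LINT om|P. indicator A om * (S n m om)\<^sup>2)"
  by (simp add: integral_nonneg_AE)
 with step show ?case by linarith
qed simp

lemma variance_S: "(LINT om|P. (S n m om)\<^sup>2) = (\<Sum>k\<in>{n..<m}. LINT om|P. (Y k om)\<^sup>2)"
proof (induction m)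
 case 0 then show ?case by (simp add: S_def)
next
 case (Suc m)
 show ?case
 proof (cases "n <= m")
  case True
  then have "(%om. (S n (Suc m) om)\<^sup>2) = (%om. (S n m om)\<^sup>2 + (Y m om)\<^sup>2 + 2 * (S n m om * Y m om))"
   by (auto simp: S_def power2_eq_square algebra_simps)
  then show ?thesis using True Suc sq S_sq integrable_mult_square[OF S_meas_P Y_meas S_sq sq]
    int_past_zero[OF S_meas S_sq] by simp
 qed (simp add: S_def)
qed

text \<open>The events of a first exceedance at time \<open>k\<close> are disjoint; adding the previous estimate over \<open>k\<close> bounds the
 probability that any partial sum exceeds the level by the total variance.\<close>

lemma maximal_inequality:
 assumes e: "e > 0"
 shows "measure P {om\<in>space P. EX k:{n..m}. \<bar>S n k om\<bar> >= e} <= (\<Sum>k\<in>{n..<m}. LINT om|P. (Y k om)\<^sup>2) / e\<^sup>2"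
proof -
 define A where "A k = {om\<in>space P. \<bar>S n k om\<bar> >= e & (ALL j:{n..<k}. \<bar>S n j om\<bar> < e)}" for k
 have sp: "space (F k) = space P" for k using sub[of k] by (auto simp: subalgebra_def)
 have [measurable]: "A k : sets (F k)" for k
 proof -
  have [measurable]: "S n j : borel_measurable (F k)" if "j <= k" for j using F_mono[OF that S_meas] .
  have "{om\<in>space (F k). \<bar>S n k om\<bar> >= e & (ALL j:{n..<k}. \<bar>S n j om\<bar> < e)} : sets (F k)"
   by (intro sets.sets_Collect_conj sets.sets_Collect_finite_All) auto
  then show ?thesis by (simp add: A_def sp)
 qed
 have AP[measurable]: "A k : sets P" for k using sub[of k] \<open>A k : sets (F k)\<close> by (auto simp: subalgebra_def)
 have disj: "disjoint_family_on A {n..m}"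
 proof (unfold disjoint_family_on_def, intro ballI impI)
  fix i j assume "i : {n..m}" "j : {n..m}" "i ~= j"
  then consider "i : {n..<j}" | "j : {n..<i}" by fastforce
  then show "A i \<inter> A j = {}" by cases (force simp: A_def)+
 qed
 have Un: "{om\<in>space P. EX k:{n..m}. \<bar>S n k om\<bar> >= e} = (\<Union>k\<in>{n..m}. A k)"
 proof (intro set_eqI iffI)
  fix om assume "om : {om\<in>space P. EX k:{n..m}. \<bar>S n k om\<bar> >= e}"
  then have om: "om : space P" "EX k. k : {n..m} & \<bar>S n k om\<bar> >= e" by auto
  define k where "k = (LEAST k. k : {n..m} & \<bar>S n k om\<bar> >= e)"
  have k: "k : {n..m}" "\<bar>S n k om\<bar> >= e" using LeastI_ex[OF om(2)] by (auto simp: k_def)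
  have "\<bar>S n j om\<bar> < e" if "j : {n..<k}" for j
   using not_less_Least[of j "%k. k : {n..m} & \<bar>S n k om\<bar> >= e"] that k unfolding k_def[symmetric] by auto
  then show "om : (\<Union>k\<in>{n..m}. A k)" using k om by (auto simp: A_def)
 qed (auto simp: A_def)
 have i1: "integrable P (%om. indicator (A k) om * (S n m om)\<^sup>2)" for k m
  by (rule bo_integrable_bound[OF S_sq[of n m]]) (auto split: split_indicator)
 have "e\<^sup>2 * measure P {om\<in>space P. EX k:{n..m}. \<bar>S n k om\<bar> >= e} = (\<Sum>k\<in>{n..m}. e\<^sup>2 * measure P (A k))"
  unfolding Un by (subst finite_measure_finite_Union[OF _ _ disj]) (auto simp: sum_distrib_left)
 also have "... <= (\<Sum>k\<in>{n..m}. LINT om|P. indicator (A k) om * (S n m om)\<^sup>2)"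
 proof (rule sum_mono)
  fix k assume k: "k : {n..m}"
  have "e\<^sup>2 * measure P (A k) = (LINT om|P. indicator (A k) om * e\<^sup>2)" by (simp add: emeasure_eq_measure)
  also have "... <= (LINT om|P. indicator (A k) om * (S n k om)\<^sup>2)"
   by (intro integral_mono i1) (use e in \<open>auto simp: A_def emeasure_eq_measure split: split_indicator simp flip: abs_le_square_iff\<close>)
  also have "... <= (LINT om|P. indicator (A k) om * (S n m om)\<^sup>2)"
   by (rule maximal_step) (use k in auto)
  finally show "e\<^sup>2 * measure P (A k) <= (LINT om|P. indicator (A k) om * (S n m om)\<^sup>2)" .
 qed
 also have "... = (LINT om|P. (\<Sum>k\<in>{n..m}. indicator (A k) om * (S n m om)\<^sup>2))"
  by (rule bo_integral_sum[symmetric]) (rule i1)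
 also have "... <= (LINT om|P. (S n m om)\<^sup>2)"
 proof (intro integral_mono S_sq bo_integrable_sum i1)
  fix om
  have "(\<Sum>k\<in>{n..m}. indicator (A k) om :: real) = indicator (\<Union>k\<in>{n..m}. A k) om"
   using disj by (subst indicator_UN_disjoint) auto
  then have "(\<Sum>k\<in>{n..m}. indicator (A k) om :: real) <= 1" by (simp add: indicator_le_1)
  then show "(\<Sum>k\<in>{n..m}. indicator (A k) om * (S n m om)\<^sup>2) <= (S n m om)\<^sup>2"
   unfolding sum_distrib_right[symmetric] using mult_right_mono[of _ 1 "(S n m om)\<^sup>2"] by simp
 qed
 finally show ?thesis using e by (simp add: variance_S field_simps)
qed

text \<open>The tails of the variance series tend to zero, so by the maximal inequality the oscillation of the partial
 sums beyond \<open>n\<close> tends to zero in probability, and, being monotone in \<open>n\<close>, almost surely.\<close>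

theorem AE_summable_differences:
 assumes "summable (%n. LINT om|P. (Y n om)\<^sup>2)"
 shows "AE om in P. summable (%n. Y n om)"
proof -
 define v where "v k = (LINT om|P. (Y k om)\<^sup>2)" for k
 have v0: "v k >= 0" for k by (simp add: v_def)
 have sv: "summable v" using assms by (simp add: v_def[abs_def])
 define T where "T n = (\<Sum>k. v (k + n))" for n
 have T0: "T ----> 0" unfolding T_def using suminf_exist_split2[OF sv] .
 have fin: "(\<Sum>k\<in>{n..<m}. v k) <= T n" for n m
 proof -
  have "(\<Sum>k\<in>{n..<m}. v k) = (\<Sum>k<m-n. v (k + n))"
   by (rule sum.reindex_bij_witness[of _ "%k. k + n" "%k. k - n"]) auto
  also have "... <= T n" unfolding T_def by (intro sum_le_suminf summable_ignore_initial_segment sv) (auto simp: v0)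
  finally show ?thesis .
 qed
 define E where "E e n = {om\<in>space P. EX k>=n. \<bar>S n k om\<bar> >= e}" for e n
 have [measurable]: "E e n : sets P" for e n unfolding E_def by measurable
 have PE: "measure P (E e n) <= T n / e\<^sup>2" if e: "e > 0" for e n
 proof -
  define B where "B m = {om\<in>space P. EX k:{n..m}. \<bar>S n k om\<bar> >= e}" for m
  have [measurable]: "B m : sets P" for m unfolding B_def by measurable
  have "incseq B" unfolding incseq_def B_def by (auto; meson order_trans atLeastAtMost_iff)
  have "(\<Union>m. B m) = E e n" by (force simp: B_def E_def)
  moreover have "range B \<subseteq> sets P" by auto
  ultimately have "(%m. measure P (B m)) ----> measure P (E e n)"
   using finite_Lim_measure_incseq[OF _ \<open>incseq B\<close>] by metis
  moreover have "measure P (B m) <= T n / e\<^sup>2" for m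
  proof -
   have "measure P (B m) <= (\<Sum>k\<in>{n..<m}. v k) / e\<^sup>2"
    unfolding B_def v_def by (rule maximal_inequality[OF e])
   also have "... <= T n / e\<^sup>2" by (intro divide_right_mono fin) auto
   finally show ?thesis .
  qed
  ultimately show ?thesis by (intro LIMSEQ_le_const2[of "%m. measure P (B m)"]) auto
 qed
 have "AE om in P. EX n. om \<notin> E (1 / Suc j) n" for j
 proof -
  define e :: real where "e = 1 / Suc j"
  have e: "e > 0" by (simp add: e_def)
  have [measurable]: "(\<Inter>n. E e n) : sets P" by measurable
  have "measure P (\<Inter>n. E e n) <= T n / e\<^sup>2" for n
  proof -
   have "measure P (\<Inter>n. E e n) <= measure P (E e n)" by (intro finite_measure_mono) auto
   then show ?thesis using PE[OF e, of n] by linarith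
  qed
  moreover have "(%n. T n / e\<^sup>2) ----> 0 / e\<^sup>2" by (intro tendsto_divide T0 tendsto_const) (use e in auto)
  ultimately have "measure P (\<Inter>n. E e n) <= 0" by (intro LIMSEQ_le_const[of "%n. T n / e\<^sup>2"]) auto
  then have "(\<Inter>n. E e n) : null_sets P"
   by (intro null_setsI) (auto simp: emeasure_eq_measure measure_le_0_iff)
  from AE_not_in[OF this] show ?thesis by (auto simp: e_def)
 qed
 then have "AE om in P. ALL j. EX n. om \<notin> E (1 / Suc j) n" by (simp add: AE_all_countable)
 with AE_space show ?thesis
 proof eventually_elim
  case (elim om)
  show ?case unfolding summable_Cauchy
  proof (intro allI impI)
   fix e :: real assume "e > 0"
   then obtain j where j: "1 / Suc j < e / 2" using nat_approx_posE[of "e/2"] by auto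
   obtain n where n: "om \<notin> E (1 / Suc j) n" using elim by blast
   have lt: "\<bar>S n k om\<bar> < e / 2" if "k >= n" for k
    using n elim(1) that j unfolding E_def by fastforce
   have "norm (sum (%n. Y n om) {a..<b}) < e" if "a >= n" for a b
   proof (cases "a <= b")
    case True
    then have "sum (%n. Y n om) {a..<b} = S n b om - S n a om"
     unfolding S_def using that sum.atLeastLessThan_concat[of n a b "%n. Y n om"] by simp
    then show ?thesis using lt[of a] lt[of b] that True by auto
   qed (use \<open>e > 0\<close> in auto)
   then show "EX N. ALL m>=N. ALL n. norm (sum (%n. Y n om) {m..<n}) < e" by blast
  qed
 qed
qed

end

section \<open>The noise series\<close>

text \<open>Coordinatewise, the terms are martingale differences, with variances bounded by a multiple of \<open>(a n)^2\<close>
 because the bounded fourth moments bound the second ones.\<close>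

theorem noise_series_converges:
 fixes P :: "'w measure" and M :: "nat => 'w => 'a::euclidean_space"
 assumes P: "prob_space P" and x0: "x0 : borel_measurable P"
  and md: "martingale_difference P (noise_filtration P x0 M) M"
  and fourth: "(SUP n. \<integral>\<^sup>+om. ennreal (norm (M n om) ^ 4) \<partial>P) < \<infinity>"
  and a_sq: "summable (%n. (a n)\<^sup>2)"
 shows "AE om in P. summable (%n. a n *R M (Suc n) om)"
proof -
 interpret prob_space P by fact
 let ?F = "noise_filtration P x0 M"
 have Mi: "integrable P (M n)" and MF: "M n : borel_measurable (?F n)" for n
  using md by (auto simp: martingale_difference_def)
 have Mm: "M n : borel_measurable P" for n by (rule borel_measurable_integrable[OF Mi])
 define gen where "gen n = {x0 -` A \<inter> space P | A. A : sets borel} \<union> (\<Union>m\<le>n. {M m -` A \<inter> space P | A. A : sets borel})" for n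
 have gen: "gen n \<subseteq> sets P" for n unfolding gen_def using measurable_sets[OF x0] measurable_sets[OF Mm] by auto
 have genPow: "gen n \<subseteq> Pow (space P)" for n using gen[of n] sets.space_closed by blast
 have F: "sets (?F n) = sigma_sets (space P) (gen n)" "space (?F n) = space P" for n
  unfolding noise_filtration_def gen_def[symmetric] using genPow[of n] by simp_all
 have sub: "subalgebra P (?F n)" for n
  unfolding subalgebra_def F using sets.sigma_sets_subset[OF gen[of n]] by simp
 have mono: "sets (?F m) \<subseteq> sets (?F n)" if "m <= n" for m n
 proof -
  have "gen m \<subseteq> gen n" unfolding gen_def using that by (intro Un_mono UN_mono) auto
  then show ?thesis unfolding F by (rule sigma_sets_subseteq)
 qed
 define S where "S = (SUP n. \<integral>\<^sup>+om. ennreal (norm (M n om) ^ 4) \<partial>P)"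
 obtain K where K: "S = ennreal K" "K >= 0" using fourth unfolding S_def[symmetric] by (cases S) auto
 have M4: "(\<integral>\<^sup>+om. ennreal (norm (M n om) ^ 4) \<partial>P) <= ennreal K" for n
  unfolding K(1)[symmetric] S_def by (rule SUP_upper) simp
 have i4: "integrable P (%om. norm (M n om) ^ 4)" for n
 proof (rule integrableI_bounded)
  show "(%om. norm (M n om) ^ 4) : borel_measurable P" using Mm by measurable
  show "(\<integral>\<^sup>+om. ennreal (norm (norm (M n om) ^ 4)) \<partial>P) < \<infinity>" using order_le_less_trans[OF M4[of n]] by simp
 qed
 have e4: "(LINT om|P. norm (M n om) ^ 4) <= K" for n
 proof -
  have "ennreal (LINT om|P. norm (M n om) ^ 4) <= ennreal K"
   using M4[of n] by (subst nn_integral_eq_integral[OF i4, symmetric]) auto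
  then show ?thesis using K(2) by simp
 qed
 have comp: "AE om in P. summable (%n. a n * (M (Suc n) om <.> b))" if b: "b : Basis" for b
 proof -
  define Y where "Y n om = a n * (M (Suc n) om <.> b)" for n om
  have Mb: "integrable P (%om. M n om <.> b)" for n by (rule integrable_inner_left) (rule Mi)
  have Y2: "(Y n om)\<^sup>2 <= (a n)\<^sup>2 * (1 + norm (M (Suc n) om) ^ 4)" for n om
  proof -
   define r where "r = (norm (M (Suc n) om))\<^sup>2"
   have "\<bar>M (Suc n) om <.> b\<bar>\<^sup>2 <= r" unfolding r_def by (intro power_mono Basis_le_norm[OF b]) auto
   also have "r <= 1 + r\<^sup>2" using sum_squares_bound[of 1 r] by (simp add: r_def) (smt (verit) zero_le_power2)
   also have "r\<^sup>2 = norm (M (Suc n) om) ^ 4" by (simp add: r_def power_mult[symmetric])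
   finally show ?thesis unfolding Y_def power_mult_distrib by (intro mult_left_mono) auto
  qed
  have Ym: "Y n : borel_measurable P" for n unfolding Y_def[abs_def] using borel_measurable_integrable[OF Mb] by measurable
  have Yi: "integrable P (%om. (Y n om)\<^sup>2)" for n
  proof (rule bo_integrable_bound)
   show "integrable P (%om. (a n)\<^sup>2 * (1 + norm (M (Suc n) om) ^ 4))" using i4 by simp
   have "norm ((Y n om)\<^sup>2) <= norm ((a n)\<^sup>2 * (1 + norm (M (Suc n) om) ^ 4))" for om
    using Y2[of n om] by simp
   then show "AE om in P. norm ((Y n om)\<^sup>2) <= norm ((a n)\<^sup>2 * (1 + norm (M (Suc n) om) ^ 4))" by simp
  qed (use Ym in measurable)
  interpret sq: square_integrable_differences P ?F Y
  proof unfold_locales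
   show "Y n : borel_measurable (?F (Suc n))" for n unfolding Y_def[abs_def] using MF[of "Suc n"] by measurable
   fix n
   interpret Fn: finite_measure_subalgebra P "?F n" by unfold_locales (rule sub)
   have "AE om in P. real_cond_exp P (?F n) (Y n) om = a n * real_cond_exp P (?F n) (%om. M (Suc n) om <.> b) om"
    unfolding Y_def[abs_def] by (rule Fn.real_cond_exp_cmult[OF Mb])
   moreover have "AE om in P. real_cond_exp P (?F n) (%om. M (Suc n) om <.> b) om = 0"
    using md b by (simp add: martingale_difference_def)
   ultimately show "AE om in P. real_cond_exp P (?F n) (Y n) om = 0" by eventually_elim simp
  qed (fact sub mono Yi)+
  have "summable (%n. LINT om|P. (Y n om)\<^sup>2)"
  proof (rule summable_comparison_test')
   show "summable (%n. (1 + K) * (a n)\<^sup>2)" by (rule summable_mult[OF a_sq])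
   fix n :: nat
   have "(LINT om|P. (Y n om)\<^sup>2) <= (LINT om|P. (a n)\<^sup>2 * (1 + norm (M (Suc n) om) ^ 4))"
    by (rule integral_mono[OF Yi _ Y2]) (use i4 in simp)
   also have "... = (a n)\<^sup>2 * (1 + (LINT om|P. norm (M (Suc n) om) ^ 4))" using i4 prob_space by simp
   also have "... <= (a n)\<^sup>2 * (1 + K)" using e4 by (intro mult_left_mono) auto
   finally show "norm (LINT om|P. (Y n om)\<^sup>2) <= (1 + K) * (a n)\<^sup>2" by (simp add: mult.commute)
  qed
  from sq.AE_summable_differences[OF this] show ?thesis by (simp add: Y_def)
 qed
 have "AE om in P. ALL b:Basis. summable (%n. a n * (M (Suc n) om <.> b))"
  by (subst AE_ball_countable) (use comp in \<open>auto intro: countable_finite\<close>)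
 then show ?thesis
 proof eventually_elim
  case (elim om)
  have "summable (%n. \<Sum>b\<in>Basis. (a n * (M (Suc n) om <.> b)) *R b)"
   by (intro summable_sum summable_scaleR_left) (use elim in auto)
  moreover have "(\<Sum>b\<in>Basis. (a n * (M (Suc n) om <.> b)) *R b) = a n *R M (Suc n) om" for n
   unfolding scaleR_scaleR[symmetric] scaleR_sum_right[symmetric] euclidean_representation ..
  ultimately show ?case by simp
 qed
qed

text \<open>The cylinder over a null set is null for the product Lebesgue measure.\<close>

lemma iterates_avoid_null_set:
 fixes P :: "'w measure" and x M :: "nat => 'w => 'a::euclidean_space"
 assumes x: "!!n. x n : borel_measurable P" and M: "!!n. M n : borel_measurable P"
  and ac: "joint_law_abs_cont P x M" and N0: "N0 : null_sets lborel"
 shows "AE om in P. ALL n. x n om \<notin> N0"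
proof -
 have "AE om in P. x n om \<notin> N0" for n
 proof -
  have m: "(%om. (x n om, M (Suc n) om)) : P ->M borel" by (rule borel_measurable_Pair[OF x M])
  have N0b: "N0 : sets lborel" using N0 by auto
  have "emeasure (lborel >< lborel) (N0 \<times> (UNIV :: 'a set)) = emeasure lborel N0 * emeasure lborel (UNIV :: 'a set)"
   by (rule lborel.emeasure_pair_measure_Times[OF N0b]) simp
  also have "... = 0" using N0 by (simp add: null_sets_def)
  finally have "N0 \<times> (UNIV :: 'a set) : null_sets (lborel >< lborel)" using pair_measureI[OF N0b, of UNIV lborel] by (simp add: null_sets_def)
  then have "N0 \<times> (UNIV :: 'a set) : null_sets lborel" by (simp only: lborel_prod)
  then have "N0 \<times> UNIV : null_sets (distr P borel (%om. (x n om, M (Suc n) om)))"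
   using ac unfolding joint_law_abs_cont_def absolutely_continuous_def by blast
  then have "(%om. (x n om, M (Suc n) om)) -` (N0 \<times> UNIV) \<inter> space P : null_sets P" by (simp add: null_sets_distr_iff[OF m])
  then show ?thesis by (rule AE_I') auto
 qed
 then show ?thesis by (simp add: AE_all_countable)
qed

section \<open>Weak compactness of laws of bounded sequences\<close>

definition digit :: "nat => real => nat" where
 "digit n c = nat (\<lfloor>4 ^ Suc n * c\<rfloor> mod 4)"

text \<open>Binary digits are written in base 4. Two such reals whose difference is small then have equal leading digits,
 so that, unlike in base 2, convergence of the codes implies convergence of every digit.\<close>

definition pack :: "(nat => nat) => real" where
 "pack b = (\<Sum>n. real (b n) / 4 ^ Suc n)"

lemma pack_summable:
 assumes "!!n. b n <= 1"
 shows "summable (%n. real (b n) / 4 ^ Suc n)"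
proof (rule summable_comparison_test)
 show "summable (%n. (1/4::real) ^ Suc n)"
  by (simp add: summable_geometric)
 have "real (b n) <= 1" for n using assms[of n] by simp
 then show "EX N. ALL n>=N. norm (real (b n) / 4 ^ Suc n) <= (1/4) ^ Suc n"
  by (auto simp: power_one_over divide_simps)
qed

lemma pack_Suc:
 assumes "!!n. b n <= 1"
 shows "4 * pack b = real (b 0) + pack (%n. b (Suc n))"
proof -
 have "pack b = (\<Sum>n. real (b (Suc n)) / 4 ^ Suc (Suc n)) + real (b 0) / 4 ^ Suc 0"
  unfolding pack_def using suminf_split_head[OF pack_summable[of b, OF assms]] by simp
 also have "(\<Sum>n. real (b (Suc n)) / 4 ^ Suc (Suc n)) = (1/4) * pack (%n. b (Suc n))"
  unfolding pack_def using pack_summable[of "%n. b (Suc n)"] assms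
  by (subst suminf_mult[symmetric]) (auto simp: field_simps)
 finally show ?thesis by simp
qed

lemma pack_bounds:
 assumes "!!n. b n <= 1"
 shows "0 <= pack b" "pack b <= 1/3"
proof -
 show "0 <= pack b" unfolding pack_def by (intro suminf_nonneg pack_summable assms) auto
 have 1: "(%n. (1/4::real) ^ Suc n) sums (1/3)"
  using sums_mult[OF geometric_sums[of "1/4::real"], of "1/4"] by simp
 have "real (b n) <= 1" for n using assms[of n] by simp
 then have "pack b <= (\<Sum>n. (1/4::real) ^ Suc n)"
  unfolding pack_def
  by (intro suminf_le pack_summable assms sums_summable[OF 1])
    (auto simp: power_one_over divide_simps)
 then show "pack b <= 1/3" using 1 by (simp add: sums_iff)
qed

lemma digit_pack:
 assumes "!!n. b n <= 1"
 shows "digit n (pack b) = b n"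
 using assms
proof (induction n arbitrary: b)
 case 0
 have "\<lfloor>real (b 0) + pack (%n. b (Suc n))\<rfloor> = int (b 0)"
  using pack_bounds[of "%n. b (Suc n)"] 0 by (intro floor_unique) (auto simp: less_le_trans)
 then have "\<lfloor>4 * pack b\<rfloor> = int (b 0)" by (simp add: pack_Suc[OF 0])
 moreover have "int (b 0) mod 4 = int (b 0)" using 0[of 0] by (intro mod_pos_pos_trivial) auto
 ultimately show ?case by (simp add: digit_def)
next
 case (Suc n)
 have "4 ^ Suc (Suc n) * pack b = 4 ^ Suc n * (4 * pack b)" by simp
 also have "... = 4 ^ Suc n * pack (%n. b (Suc n)) + of_int (4 ^ Suc n * int (b 0))"
  unfolding pack_Suc[OF Suc.prems] by (simp add: algebra_simps)
 finally have "\<lfloor>4 ^ Suc (Suc n) * pack b\<rfloor> = \<lfloor>4 ^ Suc n * pack (%n. b (Suc n))\<rfloor> + 4 * (4 ^ n * int (b 0))"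
  by (simp only: floor_add_int[symmetric]) simp
 then have "digit (Suc n) (pack b) = digit n (pack (%n. b (Suc n)))"
  unfolding digit_def by (simp only: mod_mult_self2)
 also have "... = b (Suc n)" using Suc by auto
 finally show ?case .
qed

lemma pack_close_imp_first_digit_eq:
 assumes "!!n. b n <= 1" "!!n. b' n <= 1" "\<bar>pack b - pack b'\<bar> < 1/6"
 shows "b 0 = b' 0"
proof -
 have "0 <= pack (%n. b (Suc n))" "pack (%n. b (Suc n)) <= 1/3"
  "0 <= pack (%n. b' (Suc n))" "pack (%n. b' (Suc n)) <= 1/3"
  using assms by (intro pack_bounds; simp)+
 moreover have "4 * pack b = real (b 0) + pack (%n. b (Suc n))"
  "4 * pack b' = real (b' 0) + pack (%n. b' (Suc n))"
  using assms by (intro pack_Suc; simp)+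
 ultimately have "\<bar>real (b 0) - real (b' 0)\<bar> < 1" using assms(3) by linarith
 then show ?thesis by linarith
qed

lemma pack_convergent_digits:
 assumes "!!k n. b k n <= 1" "convergent (%k. pack (b k))"
 shows "EX d. eventually (%k. b k n = d) sequentially"
 using assms
proof (induction n arbitrary: b)
 case (0 b)
 from 0(2) have "Cauchy (%k. pack (b k))" by (rule convergent_Cauchy)
 then obtain K where K: "!!k l. k >= K ==> l >= K ==> \<bar>pack (b k) - pack (b l)\<bar> < 1/6"
  unfolding Cauchy_def dist_real_def by (meson zero_less_divide_1_iff zero_less_numeral)
 have "b k 0 = b K 0" if "k >= K" for k
  by (rule pack_close_imp_first_digit_eq[OF 0(1) 0(1) K[OF that order.refl]])
 then show ?case by (auto simp: eventually_sequentially)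
next
 case (Suc n b)
 from Suc.prems(2) have "Cauchy (%k. pack (b k))" by (rule convergent_Cauchy)
 then obtain K where K: "!!k l. k >= K ==> l >= K ==> \<bar>pack (b k) - pack (b l)\<bar> < 1/6"
  unfolding Cauchy_def dist_real_def by (meson zero_less_divide_1_iff zero_less_numeral)
 have "b k 0 = b K 0" if "k >= K" for k
  by (rule pack_close_imp_first_digit_eq[OF Suc.prems(1) Suc.prems(1) K[OF that order.refl]])
 then obtain d where d: "eventually (%k. b k 0 = d) sequentially" by (auto simp: eventually_sequentially)
 obtain c where c: "(%k. pack (b k)) ----> c" using Suc.prems(2) by (auto simp: convergent_def)
 have "(%k. 4 * pack (b k) - real d) ----> 4 * c - real d" by (intro tendsto_intros c)
 then have "(%k. pack (%n. b k (Suc n))) ----> 4 * c - real d"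
  by (rule Lim_transform_eventually)
    (use d in eventually_elim, use Suc.prems(1) pack_Suc in auto)
 then have "convergent (%k. pack (%n. b k (Suc n)))" by (auto simp: convergent_def)
 from Suc.IH[of "%k n. b k (Suc n)", OF _ this] Suc.prems(1) show ?case by auto
qed

definition bit_of :: "nat => real => nat" where
 "bit_of j y = nat (\<lfloor>2 ^ Suc j * y\<rfloor> mod 2)"

lemma bit_of_le: "bit_of j y <= 1"
proof -
 have "\<lfloor>2 ^ Suc j * y\<rfloor> mod 2 < 2" by (rule pos_mod_bound) simp
 then show ?thesis unfolding bit_of_def by linarith
qed

lemma bits_sum:
 assumes "0 <= y" "y < 1"
 shows "(\<Sum>j<n. real (bit_of j y) / 2 ^ Suc j) = real_of_int \<lfloor>2 ^ n * y\<rfloor> / 2 ^ n"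
proof (induction n)
 case 0
 have "\<lfloor>y\<rfloor> = 0" using assms by (simp add: floor_eq_iff)
 then show ?case by simp
next
 case (Suc n)
 have "\<lfloor>2 ^ Suc n * y\<rfloor> div 2 = \<lfloor>2 ^ n * y\<rfloor>"
  using floor_divide_real_eq_div[of 2 "2 ^ Suc n * y"] by (simp add: field_simps)
 then have "real_of_int \<lfloor>2 ^ Suc n * y\<rfloor> = 2 * real_of_int \<lfloor>2 ^ n * y\<rfloor> + real (bit_of n y)"
  unfolding bit_of_def
  using div_mult_mod_eq[of "\<lfloor>2 ^ Suc n * y\<rfloor>" 2] pos_mod_sign[of 2 "\<lfloor>2 ^ Suc n * y\<rfloor>"]
  by (smt (verit, best) int_nat_eq of_int_add of_int_mult of_int_numeral of_int_of_nat_eq)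
 then show ?case using Suc by (simp add: field_simps)
qed

lemma bits_sums:
 assumes "0 <= y" "y < 1"
 shows "(%j. real (bit_of j y) / 2 ^ Suc j) sums y"
 unfolding sums_def bits_sum[OF assms]
proof (rule LIMSEQ_I)
 fix e :: real assume "0 < e"
 then obtain N where N: "(1/2) ^ N < e" using real_arch_pow_inv[of e "1/2"] by auto
 have "\<bar>real_of_int \<lfloor>2 ^ n * y\<rfloor> / 2 ^ n - y\<bar> < e" if "n >= N" for n
 proof -
  have "\<bar>real_of_int \<lfloor>2 ^ n * y\<rfloor> - 2 ^ n * y\<bar> <= 1" by linarith
  then have "\<bar>(real_of_int \<lfloor>2 ^ n * y\<rfloor> - 2 ^ n * y) / 2 ^ n\<bar> <= 1 / 2 ^ n"
   by (simp add: abs_divide divide_right_mono)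
  also have "1 / 2 ^ n = (1/2::real) ^ n" by (simp add: power_one_over)
  also have "... <= (1/2) ^ N" using that by (intro power_decreasing) auto
  finally show ?thesis using N by (simp add: diff_divide_distrib)
 qed
 then show "EX no. ALL n>=no. norm (real_of_int \<lfloor>2 ^ n * y\<rfloor> / 2 ^ n - y) < e" by auto
qed

definition seq_bits :: "real => (nat => 'a::euclidean_space) => nat => nat" where
 "seq_bits R V n =
   (let (i, m) = prod_decode n; (l, j) = prod_decode m
   in bit_of j ((V i <.> from_nat_into Basis l + R) / (2 * R)))"

definition seq_of_bits :: "real => (nat => nat) => nat => 'a::euclidean_space" where
 "seq_of_bits R d i =
   (\<Sum>b\<in>Basis. (2 * R * (\<Sum>j. real (d (prod_encode (i, prod_encode (to_nat_on Basis b, j)))) / 2 ^ Suc j) - R) *R b)"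

lemma seq_bits_le: "seq_bits R V n <= 1"
 using bit_of_le by (auto simp: seq_bits_def simp del: One_nat_def split: prod.split)

lemma seq_of_bits_seq_bits:
 fixes V :: "nat => 'a::euclidean_space"
 assumes "norm (V i) < R"
 shows "seq_of_bits R (seq_bits R V) i = V i"
proof -
 have "2 * R * (\<Sum>j. real (seq_bits R V (prod_encode (i, prod_encode (to_nat_on Basis b, j)))) / 2 ^ Suc j) - R = V i <.> b"
  if b: "b : Basis" for b :: 'a
 proof -
  have *: "from_nat_into (Basis :: 'a set) (to_nat_on Basis b) = b"
   using b by (intro from_nat_into_to_nat_on) (auto intro: countable_finite)
  have "\<bar>V i <.> b\<bar> < R" using Basis_le_norm[OF b, of "V i"] assms by linarith
  then have "0 <= (V i <.> b + R) / (2 * R)" "(V i <.> b + R) / (2 * R) < 1"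
   by (auto simp: field_simps)
  from bits_sums[OF this] show ?thesis
   using \<open>\<bar>V i <.> b\<bar> < R\<close> by (auto simp: sums_iff seq_bits_def * field_simps)
 qed
 then show ?thesis
  unfolding seq_of_bits_def by (simp add: euclidean_representation)
qed

lemma half_power_summable: "summable (%j. (1::real) / 2 ^ Suc j)"
 using summable_mult[OF summable_geometric[of "1/2::real"], of "1/2"] by (simp add: power_one_over)

lemma seq_of_bits_tendsto:
 assumes le: "!!k n. b k n <= 1" and ev: "!!n. eventually (%k. b k n = d n) sequentially"
 shows "(%k. seq_of_bits R (b k) i :: 'a::euclidean_space) ----> seq_of_bits R d i"
proof -
 have le': "real (b k n) <= 1" for k n using le[of k n] by simp
 have "(%k. \<Sum>j. real (b k (f j)) / 2 ^ Suc j) ----> (\<Sum>j. real (d (f j)) / 2 ^ Suc j)" for f :: "nat => nat"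
 proof (rule tannerys_theorem[where M="%j. 1 / 2 ^ Suc j", THEN conjunct2, THEN conjunct2])
  show "(%n. real (b n (f k)) / 2 ^ Suc k) ----> real (d (f k)) / 2 ^ Suc k" for k
   by (rule tendsto_eventually) (use ev[of "f k"] in eventually_elim, simp)
  show "\<forall>\<^sub>F (k, n) in at_top \<times>\<^sub>F sequentially. norm (real (b n (f k)) / 2 ^ Suc k) <= 1 / 2 ^ Suc k"
   using le' by (intro always_eventually) (auto simp: divide_simps)
 qed (use half_power_summable in auto)
 then show ?thesis unfolding seq_of_bits_def
  by (intro tendsto_sum tendsto_scaleR tendsto_diff tendsto_mult tendsto_const) auto
qed

lemma measurable_digit [measurable]: "digit n : borel ->M count_space UNIV"
 unfolding digit_def by measurable

lemma measurable_bit_of [measurable]: "bit_of n : borel ->M count_space UNIV"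
 unfolding bit_of_def by measurable

lemma measurable_coord: "(%y. y i) : (borel :: (nat => 'a::euclidean_space) measure) ->M borel"
 by (rule measurable_product_coordinates)

lemma measurable_pack_seq_bits [measurable]:
 "(%V. pack (seq_bits R V)) : (borel :: (nat => 'a::euclidean_space) measure) ->M borel"
proof -
 note [measurable] = measurable_coord
 have [measurable]: "(%V. seq_bits R V n) : (borel :: (nat => 'a) measure) ->M count_space UNIV" for n
  unfolding seq_bits_def by (cases "prod_decode n"; cases "prod_decode (snd (prod_decode n))") (simp add: mcompose)
 show ?thesis unfolding pack_def by measurable
qed

lemma measurable_seq_of_bits_digit [measurable]:
 "(%c. seq_of_bits R (%n. digit n c) i) : borel ->M (borel :: 'a::euclidean_space measure)"
 unfolding seq_of_bits_def by measurable

lemma tendsto_seq_coordinatewise: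
 fixes g :: "nat => nat => 'a::euclidean_space"
 assumes "!!i. (%k. g k i) ----> l i"
 shows "g ----> l"
 using assms limitin_componentwise[of "%_. euclidean" "UNIV::nat set" g l sequentially]
 by (simp add: euclidean_product_topology limitin_canonical_iff)

text \<open>Laws of sequences in a ball are transported to laws on the unit interval by coding all binary digits of all
 coordinates in one real number. On the line, tightness gives a weakly convergent subsequence and Skorohod's
 representation makes it almost surely convergent. Decoding is continuous along convergent sequences of codes,
 so dominated convergence applies.\<close>

theorem prokhorov_seq_ball:
 fixes N :: "nat => (nat => 'a::euclidean_space) measure"
 assumes prob: "!!k. prob_space (N k)" and sets: "!!k. sets (N k) = sets borel"
  and bd: "!!k. AE y in N k. ALL i. norm (y i) < R"
 shows "EX r L. strict_mono (r :: nat => nat) & prob_space L & sets L = sets (borel :: (nat => 'a) measure) &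
  (AE y in L. ALL i. norm (y i) <= R) &
  (ALL f B. continuous_on UNIV f & (ALL y. (ALL i. norm (y i) <= R) --> \<bar>f y\<bar> <= B) -->
    (%k. \<integral>y. f y \<partial>N (r k)) ----> (LINT y|L. (f y :: real)))"
proof -
 note [measurable_cong] = sets and [measurable] = measurable_coord
 interpret N: prob_space "N k" for k by (rule prob)
 define enc where "enc V = pack (seq_bits R V)" for V :: "nat => 'a"
 define dec where "dec c i = (seq_of_bits R (%n. digit n c) i :: 'a)" for c i
 define C where "C = {c. (ALL n. digit n c <= 1) & c = pack (%n. digit n c)}"
 define mu where "mu k = distr (N k) borel enc" for k
 have enc_meas [measurable]: "enc : borel ->M borel" unfolding enc_def by measurable
 have dec_i [measurable]: "(%c. dec c i) : borel ->M borel" for i unfolding dec_def by measurable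
 have dec_meas [measurable]: "dec : borel ->M borel"
  by (rule measurable_coordinatewise_then_product) (rule dec_i)
 have C_meas [measurable]: "C : sets borel" unfolding C_def pack_def by measurable
 have digit_enc: "digit n (enc V) = seq_bits R V n" for n V
  unfolding enc_def by (rule digit_pack) (rule seq_bits_le)
 have enc_C: "enc V : C" for V unfolding C_def using seq_bits_le[of R V] by (simp add: digit_enc) (simp add: enc_def)
 have dec_enc: "dec (enc V) = V" if "ALL i. norm (V i) < R" for V
  using that by (auto simp: dec_def digit_enc seq_of_bits_seq_bits)
 have enc_bd: "0 <= enc V" "enc V <= 1/3" for V unfolding enc_def by (intro pack_bounds seq_bits_le)+
 have realmu: "real_distribution (mu k)" for k
  unfolding real_distribution_def real_distribution_axioms_def mu_def
  by (auto intro: N.prob_space_distr)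
 have "tight mu"
 proof -
  have "EX a b. a < b & (ALL n. 1 - e < measure (mu n) {a<..b})" if "e > 0" for e :: real
  proof (intro exI conjI allI)
   show "(-1::real) < 1" by simp
   fix n
   have *: "enc -` {-1<..1} \<inter> space (N n) = space (N n)" using order_trans[OF enc_bd(2), of 1] less_le_trans[OF _ enc_bd(1), of "-1"] by auto
   have "measure (mu n) {-1<..1} = 1"
    unfolding mu_def by (subst measure_distr) (auto simp: * N.prob_space)
   then show "1 - e < measure (mu n) {-1<..1}" using that by simp
  qed
  then show ?thesis unfolding tight_def using realmu by auto
 qed
 from tight_imp_convergent_subsubsequence[OF this strict_mono_id]
 obtain r M where r: "strict_mono r" "real_distribution M" and "weak_conv_m (mu \<circ> id \<circ> r) M" by blast
 then have wc: "weak_conv_m (%k. mu (r k)) M" by (simp add: comp_def)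
 from Skorohod[OF _ r(2) this] realmu
 obtain Om :: "real measure" and Y Yi where
  Om: "prob_space Om" and Y [measurable]: "!!k. Y k : borel_measurable Om"
  and Y_distr: "!!k. distr Om borel (Y k) = mu (r k)"
  and Y_lim: "!!x. x : space Om ==> (%k. Y k x) ----> Yi x"
  by blast
 interpret Om: prob_space Om by fact
 define Wi where "Wi x i = lim (%k. dec (Y k x) i)" for x i
 have Wi_meas [measurable]: "Wi : Om ->M borel"
  by (rule measurable_coordinatewise_then_product) (simp add: Wi_def borel_measurable_lim_metric)
 have AE_C: "AE x in Om. ALL k. Y k x : C"
 proof (subst AE_all_countable, rule allI)
  fix k
  have "AE c in mu (r k). c : C" unfolding mu_def by (subst AE_distr_iff) (auto simp: enc_C)
  then show "AE x in Om. Y k x : C" unfolding Y_distr[symmetric] by (subst (asm) AE_distr_iff) auto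
 qed
 have W_conv: "(%k. dec (Y k x)) ----> Wi x" if "ALL k. Y k x : C" "x : space Om" for x
 proof (rule tendsto_seq_coordinatewise)
  fix i
  have 1: "digit n (Y k x) <= 1" for k n using that by (auto simp: C_def)
  have 2: "pack (%n. digit n (Y k x)) = Y k x" for k using that by (auto simp: C_def)
  have "convergent (%k. pack (%n. digit n (Y k x)))"
   unfolding 2 using Y_lim[OF that(2)] by (auto simp: convergent_def)
  from pack_convergent_digits[OF 1 this]
  obtain d where "!!n. eventually (%k. digit n (Y k x) = d n) sequentially" by metis
  from seq_of_bits_tendsto[OF 1 this, where R = R and i = i and 'a = 'a]
  have "(%k. dec (Y k x) i) ----> seq_of_bits R d i" unfolding dec_def .
  then show "(%k. dec (Y k x) i) ----> Wi x i" unfolding Wi_def by (simp add: limI)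
 qed
 have W_law: "distr Om borel (%x. dec (Y k x)) = N (r k)" for k
 proof -
  have "distr Om borel (%x. dec (Y k x)) = distr (distr Om borel (Y k)) borel dec"
   by (subst distr_distr) (auto simp: comp_def)
  also have "... = distr (N (r k)) borel (%V. dec (enc V))"
   unfolding Y_distr mu_def by (subst distr_distr) (auto simp: comp_def)
  also have "... = distr (N (r k)) borel (%V. V)"
   by (rule distr_cong_AE) (use bd[of "r k"] in \<open>auto elim!: eventually_mono simp: dec_enc\<close>)
  also have "... = N (r k)" by (rule distr_id2) (simp add: sets)
  finally show ?thesis .
 qed
 have AE_bd: "AE x in Om. ALL k i. norm (dec (Y k x) i) < R"
 proof (subst AE_all_countable, rule allI)
  fix k
  have "AE V in distr Om borel (%x. dec (Y k x)). ALL i. norm (V i) < R" unfolding W_law by (rule bd)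
  then show "AE x in Om. ALL i. norm (dec (Y k x) i) < R" by (rule AE_distrD[rotated]) measurable
 qed
 define L where "L = distr Om borel Wi"
 have AE_bdi: "AE x in Om. ALL i. norm (Wi x i) <= R"
  using AE_bd AE_C AE_space
 proof eventually_elim
  case (elim x)
  have "norm (lim (%k. dec (Y k x) i)) <= R" if "(%k. dec (Y k x) i) ----> l" for l i
   using that elim(1) limI[OF that]
   by (intro Lim_bounded[OF tendsto_norm, of _ _ 0]) (auto intro: less_imp_le)
  moreover have "EX l. (%k. dec (Y k x) i) ----> l" for i
  proof -
   have 1: "digit n (Y k x) <= 1" for k n using elim by (auto simp: C_def)
   have 2: "pack (%n. digit n (Y k x)) = Y k x" for k using elim by (auto simp: C_def)
   have "convergent (%k. pack (%n. digit n (Y k x)))"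
    unfolding 2 using Y_lim[OF elim(3)] by (auto simp: convergent_def)
   from pack_convergent_digits[OF 1 this]
   obtain d where d: "!!n. eventually (%k. digit n (Y k x) = d n) sequentially" by metis
   from seq_of_bits_tendsto[of "%k n. digit n (Y k x)" d, OF 1 d] show ?thesis unfolding dec_def by blast
  qed
  ultimately show ?case unfolding Wi_def by blast
 qed
 show ?thesis
 proof (intro exI conjI allI impI)
  show "strict_mono r" by fact
  show "prob_space L" unfolding L_def by (rule Om.prob_space_distr) simp
  show "sets L = sets borel" by (simp add: L_def)
  show "AE y in L. ALL i. norm (y i) <= R" unfolding L_def using AE_bdi by (subst AE_distr_iff) auto
  fix f :: "(nat => 'a) => real" and B
  assume f: "continuous_on UNIV f & (ALL y. (ALL i. norm (y i) <= R) --> \<bar>f y\<bar> <= B)"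
  then have [measurable]: "f : borel_measurable borel" by (intro continuous_borel) auto
  have "(%k. LINT x|Om. f (dec (Y k x))) ----> (LINT x|Om. f (Wi x))"
  proof (rule integral_dominated_convergence[where w = "%_. B"])
   show "AE x in Om. (%k. f (dec (Y k x))) ----> f (Wi x)"
    using AE_C AE_space
    by eventually_elim (rule continuous_on_tendsto_compose[of UNIV f], use f W_conv in auto)
   show "AE x in Om. norm (f (dec (Y k x))) <= B" for k
    using AE_bd by eventually_elim (use f in \<open>auto simp: less_imp_le\<close>)
  qed auto
  moreover have "(LINT x|Om. f (dec (Y k x))) = (\<integral>y. f y \<partial>N (r k))" for k
   unfolding W_law[symmetric] by (rule integral_distr[symmetric]) measurable
  moreover have "(LINT x|Om. f (Wi x)) = (LINT y|L. f y)"
   unfolding L_def by (rule integral_distr[symmetric]) measurable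
  ultimately show "(%k. \<integral>y. f y \<partial>N (r k)) ----> (LINT y|L. f y)" by simp
 qed
qed

section \<open>Disintegration by randomization\<close>

definition unif :: "real measure" where "unif = uniform_measure lborel {0..1}"

lemma sets_unif [simp, measurable_cong]: "sets unif = sets borel" by (simp add: unif_def)
lemma space_unif [simp]: "space unif = UNIV" by (simp add: unif_def)
lemma prob_space_unif: "prob_space unif"
 unfolding unif_def by (intro prob_space_uniform_measure) auto

lemma emeasure_unif_less: "emeasure unif {u. ennreal u < c} = min 1 c"
proof -
 have "{0..1} \<inter> {u. ennreal u < c} = (if c <= 1 then {0..<enn2real c} else {0..1::real})"
 proof (cases "c <= 1")
  case True
  then have c: "c = ennreal (enn2real c)" by (metis ennreal_enn2real ennreal_one_less_top le_less_trans)
  have "enn2real c <= 1" using True by (metis enn2real_mono enn2real_1 ennreal_one_less_top)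
  have "ennreal u < c \<longleftrightarrow> u < enn2real c" if "0 <= u" for u
   by (subst c) (use that ennreal_less_iff in blast)
  then show ?thesis using True \<open>enn2real c <= 1\<close> by auto
 next
  case False
  have "ennreal u < c" if "u <= 1" for u
   using that False by (metis ennreal_le_1 le_less_trans not_le)
  then show ?thesis using False by auto
 qed
 moreover have "emeasure lborel {0..<enn2real c} = c" if "c <= 1"
  using that by (metis emeasure_lborel_Ico enn2real_nonneg diff_zero ennreal_enn2real ennreal_one_less_top le_less_trans)
 moreover have "{u. ennreal u < c} : sets lborel" by measurable
 ultimately show ?thesis
  unfolding unif_def by (subst emeasure_uniform_measure) (auto simp: min_def divide_ennreal_def)
qed

lemma measurable_fst_snd_borel:
 assumes "sets M = sets (borel :: ('a::topological_space \<times> 'b::topological_space) measure)"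
 shows "fst : M ->M borel" "snd : M ->M borel"
 unfolding measurable_cong_sets[OF assms refl]
 by (intro continuous_borel continuous_intros)+

lemma borel_measurable_fst_snd [measurable]:
 "(fst :: 'a::topological_space \<times> 'b::topological_space => 'a) : borel_measurable borel"
 "(snd :: 'a::topological_space \<times> 'b::topological_space => 'b) : borel_measurable borel"
 by (rule measurable_fst_snd_borel[OF refl])+

lemma measure_eqI_rectangles:
 fixes M N :: "('a::second_countable_topology \<times> 'b::second_countable_topology) measure"
 assumes M: "sets M = sets borel" "finite_measure M" and N: "sets N = sets borel"
  and eq: "!!A B. A : sets borel ==> B : sets borel ==> emeasure M (A \<times> B) = emeasure N (A \<times> B)"
 shows "M = N"
proof -
 interpret finite_measure M by fact
 have s: "sets (borel :: ('a * 'b) measure) = sigma_sets UNIV {A \<times> B | A B. A : sets borel & B : sets borel}"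
  unfolding borel_prod[symmetric] sets_pair_measure by simp
 show ?thesis
 proof (rule measure_eqI_generator_eq[where A="%_. UNIV"])
  show "Int_stable {A \<times> B | A B. A : sets (borel :: 'a measure) & B : sets (borel :: 'b measure)}"
   by (rule Int_stable_pair_measure_generator)
  show "range (%_::nat. UNIV) \<subseteq> {A \<times> B | A B. A : sets (borel :: 'a measure) & B : sets (borel :: 'b measure)}"
   by (auto intro!: exI[of _ UNIV])
  show "emeasure M UNIV ~= \<infinity>" for i :: nat using emeasure_finite[of UNIV] by simp
 qed (auto simp: M N s eq)
qed

lemma AE_le_of_nn_integral_le:
 assumes [measurable]: "f : borel_measurable M" "g : borel_measurable M"
  and fin: "(\<integral>\<^sup>+x. g x \<partial>M) < \<infinity>"
  and le: "!!A. A : sets M ==> (\<integral>\<^sup>+x. f x * indicator A x \<partial>M) <= (\<integral>\<^sup>+x. g x * indicator A x \<partial>M)"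
 shows "AE x in M. f x <= (g x :: ennreal)"
proof -
 define A where "A = {x\<in>space M. g x < f x}"
 have [measurable]: "A : sets M" unfolding A_def by measurable
 have "(\<integral>\<^sup>+x. g x * indicator A x \<partial>M) <= (\<integral>\<^sup>+x. g x \<partial>M)"
  by (intro nn_integral_mono) (auto split: split_indicator)
 then have finA: "(\<integral>\<^sup>+x. g x * indicator A x \<partial>M) ~= \<infinity>" using fin by auto
 have "(\<integral>\<^sup>+x. f x * indicator A x - g x * indicator A x \<partial>M) =
   (\<integral>\<^sup>+x. f x * indicator A x \<partial>M) - (\<integral>\<^sup>+x. g x * indicator A x \<partial>M)"
  using finA by (intro nn_integral_diff) (auto simp: A_def split: split_indicator)
 also have "... = 0" using le[of A] finA by (auto simp: diff_eq_0_iff_ennreal less_top)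
 finally have "AE x in M. f x * indicator A x - g x * indicator A x = 0"
  by (subst (asm) nn_integral_0_iff_AE) auto
 then show ?thesis
 proof (rule AE_mp, intro AE_I2 impI)
  fix x assume x: "x : space M" "f x * indicator A x - g x * indicator A x = 0"
  show "f x <= g x"
  proof (rule ccontr)
   assume "~ f x <= g x"
   then have "x : A" "g x < f x" using x by (auto simp: A_def)
   then show False using x(2) diff_gt_0_iff_gt_ennreal[of "f x" "g x"] by simp
  qed
 qed
qed

text \<open>The Radon-Nikodym derivatives \<open>f q\<close> of the measures \<open>rho (_ \<times> {q<..})\<close> with respect to the first marginal are
 the conditional tail functions at rational levels. The quantile function of the conditional law, applied to a
 uniform variable, has this conditional law.\<close>

lemma ex_randomization_real:
 fixes rho :: "('a::euclidean_space \<times> real) measure"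
 assumes "prob_space rho" and sets: "sets rho = sets borel" and bd: "AE p in rho. 0 <= snd p & snd p <= 1"
 shows "EX g. g : borel_measurable borel &
  distr (distr rho borel fst >< unif) borel (%(x, u). (x, g (x, u) :: real)) = rho"
proof -
 interpret prob_space rho by fact
 note [measurable_cong] = sets
 interpret U: prob_space unif by (rule prob_space_unif)
 have fst_m[measurable]: "fst : rho ->M borel" "snd : rho ->M borel"
  by (rule measurable_fst_snd_borel[OF sets])+
 have sp: "space rho = UNIV" using sets by (metis sets_eq_imp_space_eq space_borel)
 define nu where "nu = distr rho borel fst"
 have [simp, measurable_cong]: "sets nu = sets borel" and [simp]: "space nu = UNIV" by (auto simp: nu_def)
 interpret nu: prob_space nu unfolding nu_def by (rule prob_space_distr) simp
 define D where "D q = distr (density rho (indicator {p. q < snd p})) borel fst" for q :: real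
 have mq: "{p. q < snd p} : sets rho" for q using measurable_sets[OF fst_m(2), of "{q<..}"] by (simp add: sp vimage_def)
 have rect: "A \<times> B : sets rho" if "A : sets borel" "B : sets borel" for A :: "'a set" and B :: "real set"
  using that by (simp add: sets borel_prod[symmetric])
 have D: "emeasure (D q) A = emeasure rho (A \<times> {q<..})" if "A : sets borel" for q A
 proof -
  have "emeasure (D q) A = (\<integral>\<^sup>+p. indicator {p. q < snd p} p * indicator (fst -` A) p \<partial>rho)"
   unfolding D_def using that mq measurable_sets[OF fst_m(1) that]
   by (subst emeasure_distr) (auto simp: sp emeasure_density)
  also have "... = (\<integral>\<^sup>+p. indicator (A \<times> {q<..}) p \<partial>rho)"
   by (intro nn_integral_cong) (auto split: split_indicator)
  finally show ?thesis using rect[OF that] by simp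
 qed
 have nu_eq: "emeasure nu A = emeasure rho (A \<times> UNIV)" if "A : sets borel" for A
  unfolding nu_def using that by (subst emeasure_distr) (auto simp: sp intro!: arg_cong[where f="emeasure rho"])
 have "EX f. f : borel_measurable nu & density nu f = D q" for q
 proof -
  have "absolutely_continuous nu (D q)"
   unfolding absolutely_continuous_def
  proof
   fix A assume A: "A : null_sets nu"
   then have "A : sets borel" by auto
   have "emeasure rho (A \<times> {q<..}) <= emeasure rho (A \<times> UNIV)"
    using rect[OF \<open>A : sets borel\<close>] by (intro emeasure_mono) auto
   also have "... = 0" using A nu_eq[OF \<open>A : sets borel\<close>] by (simp add: null_sets_def)
   finally show "A : null_sets (D q)" using \<open>A : sets borel\<close> D by (auto simp: null_sets_def D_def)
  qed
  from nu.Radon_Nikodym[OF this] show ?thesis by (auto simp: D_def)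
 qed
 then obtain f where f[measurable]: "!!q. f q : borel_measurable nu" and fD: "!!q. density nu (f q) = D q" by metis
 have fint: "(\<integral>\<^sup>+x. f q x * indicator A x \<partial>nu) = emeasure rho (A \<times> {q<..})" if "A : sets borel" for A q
  using that by (simp add: D[symmetric] fD[symmetric] emeasure_density)
 have mono: "AE x in nu. ALL p:\<rat>. ALL q:\<rat>. p <= q --> f q x <= f p x"
 proof -
  have "AE x in nu. f q x <= f p x" if "p <= q" for p q
  proof (rule AE_le_of_nn_integral_le)
   show "(\<integral>\<^sup>+x. f p x \<partial>nu) < \<infinity>" using fint[of UNIV p] by (simp add: emeasure_eq_measure)
   show "(\<integral>\<^sup>+x. f q x * indicator A x \<partial>nu) <= (\<integral>\<^sup>+x. f p x * indicator A x \<partial>nu)" if "A : sets nu" for A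
    using that \<open>p <= q\<close> rect[of A "{p<..}"] by (auto simp: fint intro!: emeasure_mono)
  qed auto
  then show ?thesis by (auto simp: AE_ball_countable countable_rat)
 qed
 have le1: "AE x in nu. ALL q:\<rat>. f q x <= 1"
 proof -
  have "AE x in nu. f q x <= 1" for q
  proof (rule AE_le_of_nn_integral_le)
   show "(\<integral>\<^sup>+x. f q x * indicator A x \<partial>nu) <= (\<integral>\<^sup>+x. 1 * indicator A x \<partial>nu)" if "A : sets nu" for A
    using that rect[of A UNIV] by (auto simp: fint nu_eq intro!: emeasure_mono)
  qed (auto simp: nu.emeasure_eq_measure)
  then show ?thesis by (auto simp: AE_ball_countable countable_rat)
 qed
 define g where "g p = (SUP q\<in>insert 0 {q\<in>\<rat>\<inter>{0..1}. ennreal (snd p) < f q (fst p)}. q)" for p :: "'a * real"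
 have bdd: "bdd_above ((%q. q) ` insert 0 {q\<in>\<rat>\<inter>{0..1}. ennreal (snd p) < f q (fst p)})" for p :: "'a * real"
  by (rule bdd_aboveI[of _ 1]) auto
 have g_gt: "r < g p \<longleftrightarrow> r < 0 \<or> (EX q:\<rat>\<inter>{0..1}. r < q & ennreal (snd p) < f q (fst p))" for r p
  unfolding g_def by (subst less_cSUP_iff[OF _ bdd]) auto
 have f'[measurable]: "f q : borel_measurable borel" for q using f[of q] by (simp cong: measurable_cong_sets)
 have g_meas[measurable]: "g : borel_measurable borel"
 proof (rule borel_measurableI_greater)
  fix r :: real
  have "{p. r < g p} = (if r < 0 then UNIV else (\<Union>q\<in>\<rat>\<inter>{0..1}\<inter>{r<..}. {p. ennreal (snd p) < f q (fst p)}))"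
   by (auto simp: g_gt)
  also have "... : sets borel"
  proof -
   have "{p. ennreal (snd p) < f q (fst p)} : sets borel" for q by measurable
   moreover have "countable (\<rat>\<inter>{0..1}\<inter>{r<..})" using countable_rat by auto
   ultimately show ?thesis by (auto intro: sets.countable_UN')
  qed
  finally show "{x : space borel. r < g x} : sets borel" by simp
 qed
 define L where "L = distr (nu >< unif) borel (%(x, u). (x, g (x, u)))"
 have [measurable]: "(%(x, u). (x, g (x, u))) : nu >< unif ->M borel" by measurable
 interpret NU: pair_prob_space nu unif ..
 interpret L: prob_space L unfolding L_def by (rule NU.prob_space_distr) measurable
 have L_eq: "emeasure L (A \<times> B) = (\<integral>\<^sup>+x. emeasure unif {u. g (x, u) : B} * indicator A x \<partial>nu)"
  if [measurable]: "A : sets borel" "B : sets borel" for A B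
 proof -
  have ab: "A \<times> B : sets borel" by (simp add: borel_prod[symmetric])
  have "emeasure L (A \<times> B) = (\<integral>\<^sup>+p. indicator (A \<times> B) (case p of (x, u) => (x, g (x, u))) \<partial>(nu >< unif))"
  proof -
   have "emeasure L (A \<times> B) = (\<integral>\<^sup>+p. indicator (A \<times> B) p \<partial>L)" using ab by (simp add: L_def)
   also have "... = (\<integral>\<^sup>+p. indicator (A \<times> B) (case p of (x, u) => (x, g (x, u))) \<partial>(nu >< unif))"
    unfolding L_def using ab by (intro nn_integral_distr borel_measurable_indicator) auto
   finally show ?thesis .
  qed
  also have "... = (\<integral>\<^sup>+x. \<integral>\<^sup>+u. indicator (A \<times> B) (x, g (x, u)) \<partial>unif \<partial>nu)"
   using ab by (subst U.nn_integral_fst[symmetric]) auto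
  also have "... = (\<integral>\<^sup>+x. emeasure unif {u. g (x, u) : B} * indicator A x \<partial>nu)"
  proof (intro nn_integral_cong)
   fix x
   have m: "{u. g (x, u) : B} : sets unif" by measurable
   have "(\<integral>\<^sup>+u. indicator (A \<times> B) (x, g (x, u)) \<partial>unif) = (\<integral>\<^sup>+u. indicator A x * indicator {u. g (x, u) : B} u \<partial>unif)"
    by (intro nn_integral_cong) (auto split: split_indicator)
   also have "... = emeasure unif {u. g (x, u) : B} * indicator A x"
    using m by (subst nn_integral_cmult_indicator) (auto simp: mult.commute)
   finally show "(\<integral>\<^sup>+u. indicator (A \<times> B) (x, g (x, u)) \<partial>unif) = emeasure unif {u. g (x, u) : B} * indicator A x" .
  qed
  finally show ?thesis .
 qed
 have key: "emeasure L (A \<times> {r<..}) = emeasure rho (A \<times> {r<..})" if [measurable]: "A : sets borel" for A r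
 proof -
  consider "r < 0" | "1 <= r" | "0 <= r" "r < 1" by linarith
  then show ?thesis
  proof cases
   case 1
   then have "{u. g (x, u) : {r<..}} = UNIV" for x by (auto simp: g_gt)
   then have "emeasure L (A \<times> {r<..}) = emeasure nu A"
    using U.emeasure_space_1 by (subst L_eq) auto
   also have "... = emeasure rho (A \<times> {r<..})"
    unfolding nu_eq[OF that] by (rule emeasure_eq_AE) (use bd 1 rect[OF that] in \<open>auto elim!: eventually_mono\<close>)
   finally show ?thesis .
  next
   case 2
   then have "{u. g (x, u) : {r<..}} = {}" for x by (auto simp: g_gt)
   then have "emeasure L (A \<times> {r<..}) = 0" by (subst L_eq) auto
   moreover have "emeasure rho (A \<times> {r<..}) = emeasure rho {}"
   proof (rule emeasure_eq_AE)
    show "AE p in rho. p : A \<times> {r<..} \<longleftrightarrow> p : {}" using bd by eventually_elim (use 2 in auto)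
   qed (use rect[OF that] in auto)
   ultimately show ?thesis by simp
  next
   case 3
   have "EX q. (ALL n::nat. q n : \<rat> & r < q n & q n <= 1) & decseq q & q ----> r"
   proof -
    have "EX q. ALL n. (q n : \<rat> & r < q n & q n < min 1 (r + 1 / Suc n)) & q (Suc n) < q n"
    proof (rule dependent_nat_choice)
     show "EX x. x : \<rat> & r < x & x < min 1 (r + 1 / real (Suc 0))"
      using Rats_dense_in_real[of r "min 1 (r + 1)"] 3 by auto
     fix x n assume "x : \<rat> & r < x & x < min 1 (r + 1 / real (Suc n))"
     then have "r < min x (min 1 (r + 1 / real (Suc (Suc n))))" using 3 by auto
     from Rats_dense_in_real[OF this]
     show "EX y. (y : \<rat> & r < y & y < min 1 (r + 1 / real (Suc (Suc n)))) & y < x" by auto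
    qed
    then obtain q where q: "!!n. q n : \<rat> & r < q n & q n < min 1 (r + 1 / Suc n)" "!!n. q (Suc n) < q n" by blast
    have "q ----> r"
    proof (rule tendsto_sandwich[of "%_. r" _ _ "%n. r + 1 / Suc n"])
     show "(%n. r + 1 / real (Suc n)) ----> r"
      using tendsto_add[OF tendsto_const LIMSEQ_Suc[OF lim_1_over_n], of r] by simp
     show "eventually (%n. r <= q n) sequentially" using q(1) by (intro always_eventually) (auto intro: less_imp_le)
     show "eventually (%n. q n <= r + 1 / Suc n) sequentially"
      using q(1) by (intro always_eventually allI) (meson less_imp_le min_less_iff_conj)
    qed auto
    then show ?thesis using q by (intro exI[of _ q]) (auto intro!: decseq_SucI less_imp_le)
   qed
   then obtain q where q: "!!n. q n : \<rat>" "!!n. r < q n" "!!n. q n <= 1" and dec: "decseq q" and lim: "q ----> r" by blast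
   have "emeasure L (A \<times> {r<..}) = (\<integral>\<^sup>+x. (SUP n. f (q n) x) * indicator A x \<partial>nu)"
   proof (subst L_eq, simp_all, rule nn_integral_cong_AE)
    show "AE x in nu. emeasure unif {u. r < g (x, u)} * indicator A x = (SUP n. f (q n) x) * indicator A x"
     using mono le1
    proof eventually_elim
     case (elim x)
     have "(EX p:\<rat>\<inter>{0..1}. r < p & ennreal u < f p x) \<longleftrightarrow> ennreal u < (SUP n. f (q n) x)" for u
     proof
      assume "EX p:\<rat>\<inter>{0..1}. r < p & ennreal u < f p x"
      then obtain p where p: "p : \<rat>" "r < p" "ennreal u < f p x" by auto
      have "eventually (%n. q n < p) sequentially" using lim p(2) by (rule order_tendstoD)
      then obtain n where "q n < p" by (auto simp: eventually_sequentially)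
      then have "f p x <= f (q n) x" using elim(1) p q(1) by auto
      also have "... <= (SUP n. f (q n) x)" by (rule SUP_upper) simp
      finally show "ennreal u < (SUP n. f (q n) x)" using p(3) by simp
     next
      assume "ennreal u < (SUP n. f (q n) x)"
      then obtain n where "ennreal u < f (q n) x" by (auto simp: less_SUP_iff)
      then show "EX p:\<rat>\<inter>{0..1}. r < p & ennreal u < f p x"
       using q[of n] 3 by (intro bexI[of _ "q n"]) auto
     qed
     then have "{u. r < g (x, u)} = {u. ennreal u < (SUP n. f (q n) x)}" using 3 by (auto simp: g_gt)
     moreover have "(SUP n. f (q n) x) <= 1" using elim(2) q(1) by (intro SUP_least) auto
     ultimately show ?case by (simp add: emeasure_unif_less min_absorb2)
    qed
   qed
   also have "... = (\<integral>\<^sup>+x. (SUP n. f (q n) x * indicator A x) \<partial>nu)"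
    by (simp add: SUP_mult_right_ennreal)
   also have "... = (SUP n. \<integral>\<^sup>+x. f (q n) x * indicator A x \<partial>nu)"
   proof (rule nn_integral_monotone_convergence_SUP_AE)
    show "AE x in nu. f (q i) x * indicator A x <= f (q (Suc i)) x * indicator A x" for i
     using mono by eventually_elim (use q(1) decseqD[OF dec, of i "Suc i"] in \<open>auto intro!: mult_right_mono\<close>)
    show "(%x. f (q n) x * indicator A x) : borel_measurable nu" for n by measurable
   qed
   also have "... = (SUP n. emeasure rho (A \<times> {q n<..}))" by (simp add: fint)
   also have "... = emeasure rho (\<Union>n. A \<times> {q n<..})"
   proof (rule SUP_emeasure_incseq)
    show "range (%n. A \<times> {q n<..}) \<subseteq> sets rho" using rect[OF that] by auto
    show "incseq (%n. A \<times> {q n<..})"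
     unfolding incseq_def using decseqD[OF dec] by (force intro: le_less_trans)
   qed
   also have "(\<Union>n. A \<times> {q n<..}) = A \<times> {r<..}"
   proof -
    have "EX n. q n < y" if "r < y" for y
     using order_tendstoD(2)[OF lim that] by (auto simp: eventually_sequentially)
    then show ?thesis using q(2) by (auto intro: less_trans)
   qed
   finally show ?thesis .
  qed
 qed
 have "L = rho"
 proof (rule measure_eqI_rectangles)
  fix A :: "'a set" and B :: "real set" assume A[measurable]: "A : sets borel" and B[measurable]: "B : sets borel"
  define sl where "sl M = distr (density M (indicator (A \<times> UNIV))) borel snd" for M :: "('a * real) measure"
  have sl: "emeasure (sl M) B = emeasure M (A \<times> B)" if M: "sets M = sets borel" "B : sets borel" for M B
  proof -
   note [measurable_cong] = M(1)
   have [measurable]: "snd : M ->M borel" using measurable_fst_snd_borel[OF M(1)] by auto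
   have spM: "space M = UNIV" using M(1) by (metis sets_eq_imp_space_eq space_borel)
   have [measurable]: "A \<times> UNIV : sets M" using M by (simp add: borel_prod[symmetric])
   have ab: "A \<times> B : sets M" using M by (simp add: borel_prod[symmetric])
   have "emeasure (sl M) B = (\<integral>\<^sup>+p. indicator (A \<times> UNIV) p * indicator (snd -` B) p \<partial>M)"
    unfolding sl_def using M(2) measurable_sets[of snd M borel B]
    by (subst emeasure_distr) (auto simp: spM emeasure_density)
   also have "... = (\<integral>\<^sup>+p. indicator (A \<times> B) p \<partial>M)"
    by (intro nn_integral_cong) (auto split: split_indicator)
   finally show ?thesis using ab by simp
  qed
  have sL: "sets L = sets borel" by (simp add: L_def)
  have "sl L = sl rho"
  proof (rule measure_eqI_lessThan)
   fix r
   show "emeasure (sl L) {r<..} = emeasure (sl rho) {r<..}" using sl[OF sL] sl[OF sets] key[OF A] by auto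
   show "emeasure (sl L) {r<..} < \<infinity>" using sl[OF sL] by (auto simp: L.emeasure_eq_measure)
  qed (auto simp: sl_def)
  then show "emeasure L (A \<times> B) = emeasure rho (A \<times> B)" using sl[OF sL B] sl[OF sets B] by simp
 qed (auto simp: sets L_def intro: NU.P.finite_measure_distr)
 then show ?thesis using g_meas unfolding L_def nu_def by blast
qed

text \<open>A bounded vector is a measurable function of one real code, to which the real case applies.\<close>

theorem ex_randomization:
 fixes rho :: "('a::euclidean_space \<times> 'b::euclidean_space) measure"
 assumes "prob_space rho" and sets: "sets rho = sets borel" and bd: "AE p in rho. norm (snd p) < R"
 shows "EX G. G : borel_measurable borel &
  distr (distr rho borel fst >< unif) borel (%(x, u). (x, G (x, u))) = rho"
proof -
 interpret prob_space rho by fact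
 note [measurable_cong] = sets
 define e where "e z = pack (seq_bits R (%_::nat. z))" for z :: 'b
 define d where "d c = (seq_of_bits R (%n. digit n c) 0 :: 'b)" for c
 have [measurable]: "d : borel_measurable borel" unfolding d_def by measurable
 have const_seq: "(%z i. z) : (borel :: 'b measure) ->M (borel :: (nat => 'b) measure)"
  by (rule measurable_coordinatewise_then_product) simp
 have e_meas[measurable]: "e : borel_measurable borel" unfolding e_def by (rule mcompose[OF const_seq measurable_pack_seq_bits])
 have de: "d (e z) = z" if "norm z < R" for z
  using that seq_of_bits_seq_bits[of "%_::nat. z" 0 R]
  by (simp add: d_def e_def digit_pack[OF seq_bits_le])
 have e: "0 <= e z" "e z <= 1" for z
  using pack_bounds[of "seq_bits R (%_. z)"] seq_bits_le[of R "%_. z"] by (auto simp: e_def)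
 define rho' where "rho' = distr rho borel (%p. (fst p, e (snd p)))"
 have fs[measurable]: "fst : rho ->M borel" "snd : rho ->M borel"
  by (rule measurable_fst_snd_borel[OF sets])+
 have "(%p. e (snd p)) : rho ->M borel" by (rule mcompose[OF fs(2) e_meas])
 then have pe[measurable]: "(%p. (fst p, e (snd p))) : rho ->M borel" by (intro borel_measurable_Pair fs(1))
 have 1: "prob_space rho'" unfolding rho'_def by (rule prob_space_distr[OF pe])
 have 2: "AE p in rho'. 0 <= snd p & snd p <= 1"
 proof -
  have "closed {p :: 'a * real. 0 <= snd p & snd p <= 1}"
   by (intro closed_Collect_conj closed_Collect_le continuous_intros)
  then show ?thesis unfolding rho'_def by (subst AE_distr_iff[OF pe]) (auto simp: e)
 qed
 obtain g where g[measurable]: "g : borel_measurable borel"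
  and g_law: "distr (distr rho' borel fst >< unif) borel (%(x, u). (x, g (x, u))) = rho'"
  using ex_randomization_real[OF 1 _ 2] by (auto simp: rho'_def)
 have fst': "distr rho' borel fst = distr rho borel fst"
  unfolding rho'_def by (subst distr_distr) (auto simp: comp_def)
 define G where "G p = d (g p)" for p
 have [measurable]: "G : borel_measurable borel" unfolding G_def by measurable
 have "distr (distr rho borel fst >< unif) borel (%(x, u). (x, G (x, u))) = distr rho' borel (%p. (fst p, d (snd p)))"
 proof -
  have m1: "(%(x, u). (x, g (x, u))) : distr rho borel fst >< unif ->M borel" by measurable
  have m2: "(%p :: 'a * real. (fst p, d (snd p))) : borel ->M borel" by (intro borel_measurable_Pair) measurable
  have "distr rho' borel (%p. (fst p, d (snd p))) =
   distr (distr (distr rho borel fst >< unif) borel (%(x, u). (x, g (x, u)))) borel (%p. (fst p, d (snd p)))"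
   using g_law fst' by simp
  also have "... = distr (distr rho borel fst >< unif) borel (%(x, u). (x, G (x, u)))"
   unfolding distr_distr[OF m2 m1] by (intro distr_cong) (auto simp: G_def)
  finally show ?thesis by simp
 qed
 also have "... = distr rho borel (%p. (fst p, d (e (snd p))))"
  unfolding rho'_def by (subst distr_distr) (auto simp: comp_def)
 also have "... = distr rho borel (%p. p)"
 proof (rule distr_cong_AE)
  show "AE p in rho. (fst p, d (e (snd p))) = p" using bd by eventually_elim (simp add: de)
  show "(%p. (fst p, d (e (snd p)))) : rho ->M borel"
   using mcompose[OF pe, of "%p. (fst p, d (snd p))" borel] by (simp add: borel_measurable_Pair)
  show "(%p. p) : rho ->M borel" by (rule measurable_ident_sets[OF sets])
 qed auto
 also have "... = rho" by (rule distr_id2) (simp add: sets)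
 finally show ?thesis by (intro exI[of _ G]) auto
qed

section \<open>Test functions and strong convergence of averages\<close>

definition bounded_lipschitz :: "('a::real_normed_vector => 'b::real_normed_vector) => bool" where
 "bounded_lipschitz w \<longleftrightarrow> bounded (range w) & (EX L. ALL x y. norm (w x - w y) <= L * norm (x - y))"

lemma bounded_lipschitzE:
 assumes "bounded_lipschitz w"
 obtains L C where "L > 0" "C > 0" "!!x y. norm (w x - w y) <= L * norm (x - y)" "!!x. norm (w x) <= C"
proof -
 from assms obtain L where L: "!!x y. norm (w x - w y) <= L * norm (x - y)" by (auto simp: bounded_lipschitz_def)
 from assms obtain C where C: "C > 0" "!!x. norm (w x) <= C"
  unfolding bounded_lipschitz_def bounded_pos by auto
 have "norm (w x - w y) <= (\<bar>L\<bar> + 1) * norm (x - y)" for x y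
  by (rule order_trans[OF L]) (intro mult_right_mono, auto)
 then show ?thesis using C by (intro that[of "\<bar>L\<bar> + 1" C]) auto
qed

lemma bounded_lipschitz_continuous: "bounded_lipschitz w ==> continuous_on A w"
proof (elim bounded_lipschitzE)
 fix L C assume *: "L > 0" "!!x y. norm (w x - w y) <= L * norm (x - y)"
 then have "L-lipschitz_on A w" by (intro lipschitz_onI) (auto simp: dist_norm)
 then show ?thesis by (rule lipschitz_on_continuous_on)
qed

lemma bounded_lipschitz_measurable:
 fixes w :: "'a::euclidean_space => 'b::euclidean_space"
 shows "bounded_lipschitz w ==> w : borel_measurable borel"
 by (intro continuous_borel bounded_lipschitz_continuous)

lemma bounded_lipschitz_add:
 assumes "bounded_lipschitz v" "bounded_lipschitz w"
 shows "bounded_lipschitz (%x. v x + w x)"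
proof -
 obtain L C where v: "!!x y. norm (v x - v y) <= L * norm (x - y)" "!!x. norm (v x) <= C"
  using bounded_lipschitzE[OF assms(1)] by metis
 obtain L' C' where w: "!!x y. norm (w x - w y) <= L' * norm (x - y)" "!!x. norm (w x) <= C'"
  using bounded_lipschitzE[OF assms(2)] by metis
 have "norm (v x + w x - (v y + w y)) <= (L + L') * norm (x - y)" for x y
 proof -
  have "norm (v x + w x - (v y + w y)) <= norm (v x - v y) + norm (w x - w y)"
   by (metis add_diff_add norm_triangle_ineq)
  also have "... <= L * norm (x - y) + L' * norm (x - y)" by (intro add_mono v w)
  finally show ?thesis by (simp add: algebra_simps)
 qed
 moreover have "norm (v x + w x) <= C + C'" for x
  by (rule norm_triangle_le) (intro add_mono v w)
 then have "bounded (range (%x. v x + w x))" by (auto simp: bounded_iff)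
 ultimately show ?thesis by (auto simp: bounded_lipschitz_def)
qed

lemma bounded_lipschitz_bump:
 fixes K :: "'a::euclidean_space set" and c :: "'b::euclidean_space"
 shows "bounded_lipschitz (%x. max 0 (1 - real n * infdist x K) *R c)"
proof -
 have "norm (max 0 (1 - real n * infdist x K) *R c - max 0 (1 - real n * infdist y K) *R c) <= (real n * norm c) * norm (x - y)" for x y
 proof -
  have "\<bar>max 0 (1 - real n * infdist x K) - max 0 (1 - real n * infdist y K)\<bar> <= \<bar>real n * infdist x K - real n * infdist y K\<bar>"
   by (auto simp: max_def)
  also have "... = real n * \<bar>infdist x K - infdist y K\<bar>" by (simp add: abs_mult right_diff_distrib[symmetric])
  also have "... <= real n * norm (x - y)"
   using infdist_triangle_abs[of x K y] by (intro mult_left_mono) (auto simp: dist_norm)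
  finally show ?thesis unfolding scaleR_diff_left[symmetric]
   using mult_right_mono[OF _ norm_ge_zero[of c]] by (fastforce simp: mult.assoc mult.commute[of "norm c"])
 qed
 moreover have "norm (max 0 (1 - real n * infdist x K) *R c) <= norm c" for x
  using infdist_nonneg[of x K] by (auto simp: max_def mult_left_le_one_le)
 then have "bounded (range (%x. max 0 (1 - real n * infdist x K) *R c))" by (auto simp: bounded_iff)
 ultimately show ?thesis by (auto simp: bounded_lipschitz_def)
qed

lemma bump_tendsto_indicator:
 fixes K :: "'a::metric_space set"
 assumes "closed K" "K ~= {}"
 shows "(%n. max 0 (1 - real n * infdist x K)) ----> indicator K x"
proof (cases "x : K")
 case False
 then have "infdist x K > 0" using assms by (simp add: infdist_pos_not_in_closed)
 then obtain n0 where n0: "1 < real n0 * infdist x K" using reals_Archimedean3 by blast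
 have "max 0 (1 - real n * infdist x K) = indicator K x" if "n >= n0" for n
 proof -
  have "real n0 * infdist x K <= real n * infdist x K" using that \<open>infdist x K > 0\<close> by simp
  then show ?thesis using n0 False by (simp add: max_def)
 qed
 then show ?thesis by (intro tendsto_eventually) (auto simp: eventually_sequentially)
qed simp

lemma bump_integral_tendsto:
 fixes K :: "'a::metric_space set"
 assumes "closed K" "K ~= {}" and M: "sets M = sets borel" "finite_measure M"
 shows "(%n. LINT x|M. max 0 (1 - real n * infdist x K)) ----> measure M K"
proof -
 interpret finite_measure M by fact
 have K: "K : sets M" using assms by simp
 have "(%n. LINT x|M. max 0 (1 - real n * infdist x K)) ----> (LINT x|M. indicat_real K x)"
 proof (rule integral_dominated_convergence[where w="%_. 1"])
  show "AE x in M. (%n. max 0 (1 - real n * infdist x K)) ----> indicat_real K x"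
   using bump_tendsto_indicator[OF assms(1,2)] by auto
  show "AE x in M. norm (max 0 (1 - real n * infdist x K)) <= 1" for n
   using infdist_nonneg[of _ K] by (auto simp: max_def)
  show "(%x. max 0 (1 - real n * infdist x K)) : borel_measurable M" for n
   unfolding measurable_cong_sets[OF M(1) refl]
   by (intro continuous_borel continuous_intros)
 qed (use K in auto)
 then show ?thesis using K sets.sets_into_space[OF K] by (simp add: Int_absorb2)
qed

lemma measure_eqI_continuous:
 fixes M N :: "'a::metric_space measure"
 assumes M: "sets M = sets borel" "finite_measure M" and N: "sets N = sets borel" "finite_measure N"
  and eq: "!!f :: 'a => real. continuous_on UNIV f ==> (!!x. 0 <= f x & f x <= 1) ==> (LINT x|M. f x) = (LINT x|N. f x)"
 shows "M = N"
proof (rule measure_eqI_generator_eq[where A="%_. UNIV" and E="Collect closed" and \<Omega>=UNIV])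
 fix K :: "'a set" assume "K : Collect closed"
 then have K: "closed K" by simp
 show "emeasure M K = emeasure N K"
 proof (cases "K = {}")
  case False
  have "(LINT x|M. max 0 (1 - real n * infdist x K)) = (LINT x|N. max 0 (1 - real n * infdist x K))" for n
   by (intro eq continuous_intros) (use infdist_nonneg[of _ K] in \<open>auto simp: max_def\<close>)
  then have "measure M K = measure N K"
   using LIMSEQ_unique[OF bump_integral_tendsto[OF K False M]] bump_integral_tendsto[OF K False N] by simp
  then show ?thesis using M N by (simp add: finite_measure.emeasure_eq_measure)
 qed simp
next
 show "Int_stable (Collect (closed :: 'a set => bool))" by (auto simp: Int_stable_def)
 show "sets M = sigma_sets UNIV (Collect closed)" "sets N = sigma_sets UNIV (Collect closed)"
  unfolding M N by (subst borel_eq_closed, simp)+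
 show "emeasure M UNIV ~= \<infinity>" using M(2) by (simp add: finite_measure.emeasure_finite)
qed auto

text \<open>Indicators are approximated by those of closed sets from inside, by regularity, and these by Lipschitz tents;
 sums and limits then reach every integrable function.\<close>

theorem bounded_lipschitz_dense_L1:
 fixes f :: "'a::euclidean_space => 'b::euclidean_space"
 assumes nu: "finite_measure nu" "sets nu = sets borel" and f: "integrable nu f" and e: "e > 0"
 shows "EX w. bounded_lipschitz w & (LINT x|nu. norm (f x - w x)) < e"
 using f e
proof (induction f arbitrary: e rule: integrable_induct)
 interpret finite_measure nu by fact
 note [measurable_cong] = nu(2)
 have int: "integrable nu w" if "bounded_lipschitz w" for w :: "'a => 'b"
  using that by (elim bounded_lipschitzE, intro integrable_const_bound)
   (auto simp: measurable_cong_sets[OF nu(2) refl] intro!: bounded_lipschitz_measurable that)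
 note bl_meas = bounded_lipschitz_measurable
 {
  case (base A c)
  define e' where "e' = e / (1 + norm c)"
  have np: "1 + norm c > 0" by (simp add: add_pos_nonneg)
  then have e': "e' > 0" using base by (simp add: e'_def)
  have A: "A : sets borel" using base nu by simp
  have "emeasure nu A = (SUP K\<in>{K. K \<subseteq> A & compact K}. emeasure nu K)"
   by (rule inner_regular[OF nu(2) _ A]) simp
  then have "EX K. K \<subseteq> A & compact K & measure nu A < measure nu K + e' / 2"
  proof -
   assume eq: "emeasure nu A = (SUP K\<in>{K. K \<subseteq> A & compact K}. emeasure nu K)"
   show ?thesis
   proof (cases "measure nu A < e' / 2")
    case True then show ?thesis by (intro exI[of _ "{}"]) auto
   next
    case False
    then have "ennreal (measure nu A - e' / 2) < emeasure nu A"
     unfolding emeasure_eq_measure using e' by (intro ennreal_lessI) auto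
    then obtain K where "K \<subseteq> A" "compact K" "ennreal (measure nu A - e' / 2) < emeasure nu K"
     unfolding eq by (auto simp: less_SUP_iff)
    then show ?thesis using False
     by (intro exI[of _ K]) (auto simp: emeasure_eq_measure ennreal_less_iff)
   qed
  qed
  then obtain K where K: "K \<subseteq> A" "compact K" "measure nu A < measure nu K + e' / 2" by blast
  have Ks: "K : sets nu" "A : sets nu" using K A by (auto simp: nu compact_imp_closed)
  have 1: "(LINT x|nu. norm (indicat_real A x *R c - indicat_real K x *R c)) = norm c * (measure nu A - measure nu K)"
  proof -
   have "(LINT x|nu. norm (indicat_real A x *R c - indicat_real K x *R c)) = (LINT x|nu. norm c * indicat_real (A - K) x)"
    using K by (intro bo_integral_cong) (auto split: split_indicator)
   also have "... = norm c * measure nu (A - K)" using Ks sets.sets_into_space[OF Ks(2)] by (simp add: Int_absorb2 Diff_subset[THEN subset_trans])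
   finally show ?thesis using K Ks by (simp add: finite_measure_Diff)
  qed
  have 2: "norm c * (measure nu A - measure nu K) <= norm c * (e' / 2)" using K by (intro mult_left_mono) auto
  have ex: "EX w. bounded_lipschitz w & (LINT x|nu. norm (indicat_real K x *R c - w x)) < e / 2"
  proof (cases "K = {}")
   case True
   then show ?thesis using base
    by (intro exI[of _ "%_. 0"]) (auto simp: bounded_lipschitz_def intro: exI[of _ 0])
  next
   case False
   define w where "w n x = max 0 (1 - real n * infdist x K) *R c" for n x
   have wbl: "bounded_lipschitz (w n)" for n unfolding w_def by (rule bounded_lipschitz_bump)
   have [measurable]: "w n : borel_measurable nu" for n
    using bl_meas[OF wbl[of n]] by (simp add: measurable_cong_sets[OF nu(2) refl])
   have [measurable]: "K : sets nu" by (rule Ks)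
   have "(%n. LINT x|nu. norm (indicat_real K x *R c - w n x)) ----> (LINT x|nu. 0)"
   proof (rule integral_dominated_convergence[where w="%_. norm c"])
    have "(%n. norm (indicat_real K x *R c - w n x)) ----> norm (indicat_real K x *R c - indicat_real K x *R c)" for x
     unfolding w_def
     by (intro tendsto_intros bump_tendsto_indicator False compact_imp_closed K)
    then show "AE x in nu. (%n. norm (indicat_real K x *R c - w n x)) ----> 0" by simp
    have "norm (indicat_real K x *R c - w n x) <= norm c" for n x
    proof -
     have "\<bar>indicat_real K x - max 0 (1 - real n * infdist x K)\<bar> <= 1"
      using infdist_nonneg[of x K] by (auto simp: max_def split: split_indicator)
     from mult_right_mono[OF this norm_ge_zero[of c]]
     show ?thesis unfolding w_def scaleR_diff_left[symmetric] by simp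
    qed
    then show "AE x in nu. norm (norm (indicat_real K x *R c - w n x)) <= norm c" for n by simp
   qed auto
   then have "eventually (%n. (LINT x|nu. norm (indicat_real K x *R c - w n x)) < e / 2) sequentially"
    using base by (intro order_tendstoD(2)) auto
   then show ?thesis using wbl by (auto simp: eventually_sequentially)
  qed
  then obtain w where w: "bounded_lipschitz w" "(LINT x|nu. norm (indicat_real K x *R c - w x)) < e / 2" by blast
  have i: "integrable nu (%x. indicat_real K x *R c)" "integrable nu (%x. indicat_real A x *R c)"
   using Ks by (auto intro!: integrable_scaleR_left integrable_real_indicator simp: emeasure_eq_measure)
  have "(LINT x|nu. norm (indicat_real A x *R c - w x)) <=
   (LINT x|nu. norm (indicat_real A x *R c - indicat_real K x *R c) + norm (indicat_real K x *R c - w x))"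
  proof (rule integral_mono)
   show "norm (indicat_real A x *R c - w x) <= norm (indicat_real A x *R c - indicat_real K x *R c) + norm (indicat_real K x *R c - w x)" for x
    by (rule order_trans[OF _ norm_triangle_ineq]) simp
  qed (use i int[OF w(1)] in auto)
  also have "... = norm c * (measure nu A - measure nu K) + (LINT x|nu. norm (indicat_real K x *R c - w x))"
   unfolding 1[symmetric] using i int[OF w(1)] by (intro bo_integral_add) auto
  also have "... < norm c * (e' / 2) + e / 2" using 2 w by linarith
  also have "norm c * (e' / 2) <= e / 2" unfolding e'_def using np base by (simp add: field_simps)
  finally show ?case using w by auto
 next
  case (add f g)
  from add(3)[of "e/2"] add(4)[of "e/2"] add(5) add obtain v w
   where vw: "bounded_lipschitz v" "(LINT x|nu. norm (f x - v x)) < e / 2"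
    "bounded_lipschitz w" "(LINT x|nu. norm (g x - w x)) < e / 2" by (metis half_gt_zero)
  have "(LINT x|nu. norm (f x + g x - (v x + w x))) <= (LINT x|nu. norm (f x - v x) + norm (g x - w x))"
  proof (rule integral_mono)
   show "norm (f x + g x - (v x + w x)) <= norm (f x - v x) + norm (g x - w x)" for x
    by (metis add_diff_add norm_triangle_ineq)
  qed (use add int[OF vw(1)] int[OF vw(3)] in auto)
  also have "... = (LINT x|nu. norm (f x - v x)) + (LINT x|nu. norm (g x - w x))"
   using add int[OF vw(1)] int[OF vw(3)] by (intro bo_integral_add) auto
  also have "... < e" using vw by linarith
  finally show ?case using bounded_lipschitz_add[OF vw(1,3)] by blast
 next
  case (lim f s)
  have "(%n. LINT x|nu. norm (f x - s n x)) ----> (LINT x|nu. 0)"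
  proof (rule integral_dominated_convergence[where w="%x. 3 * norm (f x)"])
   have "(%n. norm (f x - s n x)) ----> norm (f x - f x)" if "x : space nu" for x
    by (intro tendsto_intros lim that)
   then show "AE x in nu. (%n. norm (f x - s n x)) ----> 0" by simp
   have "norm (f x - s n x) <= 3 * norm (f x)" if "x : space nu" for n x
    using norm_triangle_ineq4[of "f x" "s n x"] lim(3)[OF that, of n] by simp
   then show "AE x in nu. norm (norm (f x - s n x)) <= 3 * norm (f x)" for n by simp
   have [measurable]: "f : borel_measurable nu" "s n : borel_measurable nu" for n using lim by auto
   show "(%x. norm (f x - s n x)) : borel_measurable nu" for n by measurable
  qed (use lim in auto)
  then have "eventually (%n. (LINT x|nu. norm (f x - s n x)) < e / 2) sequentially"
   using lim by (intro order_tendstoD(2)) auto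
  then obtain n where n: "(LINT x|nu. norm (f x - s n x)) < e / 2" by (auto simp: eventually_sequentially)
  obtain w where w: "bounded_lipschitz w" "(LINT x|nu. norm (s n x - w x)) < e / 2" using lim.IH[of "e/2" n] lim.prems by auto
  have "(LINT x|nu. norm (f x - w x)) <= (LINT x|nu. norm (f x - s n x) + norm (s n x - w x))"
  proof (rule integral_mono)
   show "norm (f x - w x) <= norm (f x - s n x) + norm (s n x - w x)" for x
    by (rule order_trans[OF _ norm_triangle_ineq]) simp
  qed (use lim int[OF w(1)] in auto)
  also have "... = (LINT x|nu. norm (f x - s n x)) + (LINT x|nu. norm (s n x - w x))"
   using lim int[OF w(1)] by (intro bo_integral_add) auto
  also have "... < e" using n w by linarith
  finally show ?case using w by blast
 }
qed

text \<open>Each new index is chosen so late that its correlation with the sum of the previous ones is at most a constant;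
 the second moment of the sum then grows linearly in the number of terms instead of quadratically.\<close>

lemma bounded_weak_null_sums:
 fixes beta :: "nat => 'a => 'b::euclidean_space"
 assumes "prob_space nu" and [measurable]: "!!i. beta i : borel_measurable nu"
  and bd: "!!i x. norm (beta i x) <= C"
  and weak: "!!g. g : borel_measurable nu ==> bounded (range g) ==> (%i. LINT x|nu. g x <.> beta i x) ----> 0"
 shows "EX F. finite F & F \<subseteq> {N..} & card F = n & (LINT x|nu. (norm (\<Sum>i\<in>F. beta i x))\<^sup>2) <= real n * (C\<^sup>2 + 1)"
proof (induction n)
 case 0
 show ?case by (intro exI[of _ "{}"]) auto
next
 case (Suc n)
 interpret prob_space nu by fact
 obtain F where F: "finite F" "F \<subseteq> {N..}" "card F = n" "(LINT x|nu. (norm (\<Sum>i\<in>F. beta i x))\<^sup>2) <= real n * (C\<^sup>2 + 1)"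
  using Suc by blast
 define g where "g x = (\<Sum>i\<in>F. beta i x)" for x
 have [measurable]: "g : borel_measurable nu" unfolding g_def by measurable
 have gb: "norm (g x) <= real n * C" for x
  unfolding g_def using norm_sum[of "%i. beta i x" F] sum_bounded_above[of F "%i. norm (beta i x)" C] bd F
  by (auto intro: order_trans)
 then have "bounded (range g)" by (auto simp: bounded_iff)
 from weak[OF _ this] have "eventually (%i. \<bar>\<integral>x. g x <.> beta i x \<partial>nu\<bar> < 1/2) sequentially"
  by (auto dest!: tendstoD[of _ 0 sequentially "1/2"] simp: dist_real_def)
 then obtain i0 where i0: "!!i. i >= i0 ==> \<bar>\<integral>x. g x <.> beta i x \<partial>nu\<bar> < 1/2" by (auto simp: eventually_sequentially)
 define i where "i = Max (insert i0 (insert N (Suc ` F)))"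
 have fin: "finite (insert i0 (insert N (Suc ` F)))" using F by simp
 have i: "i >= i0" "i >= N" "!!j. j : F ==> Suc j <= i" unfolding i_def by (rule Max_ge[OF fin]; simp)+
 then have nF: "i \<notin> F" by (meson not_less_eq_eq order_refl)
 have C0: "0 <= C" using bd[of 0 undefined] norm_ge_zero order_trans by blast
 have int1: "integrable nu (%x. (norm (g x))\<^sup>2)"
  by (rule integrable_const_bound[of _ "(real n * C)\<^sup>2"]) (auto intro!: power_mono gb)
 have int2: "integrable nu (%x. (norm (beta i x))\<^sup>2)"
  by (rule integrable_const_bound[of _ "C\<^sup>2"]) (auto intro!: power_mono bd)
 have int3: "integrable nu (%x. g x <.> beta i x)"
 proof (rule integrable_const_bound[of _ "(real n * C) * C"])
  have "\<bar>g x <.> beta i x\<bar> <= (real n * C) * C" for x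
   by (rule order_trans[OF Cauchy_Schwarz_ineq2]) (intro mult_mono gb bd, use C0 in auto)
  then show "AE x in nu. norm (g x <.> beta i x) <= (real n * C) * C" by simp
 qed auto
 have "(LINT x|nu. (norm (\<Sum>j\<in>insert i F. beta j x))\<^sup>2) = (LINT x|nu. (norm (g x))\<^sup>2 + (norm (beta i x))\<^sup>2 + 2 * (g x <.> beta i x))"
  using F nF by (intro bo_integral_cong)
   (auto simp: g_def power2_norm_eq_inner inner_add inner_commute algebra_simps)
 also have "... = (LINT x|nu. (norm (g x))\<^sup>2) + (LINT x|nu. (norm (beta i x))\<^sup>2) + 2 * (LINT x|nu. g x <.> beta i x)"
  using int1 int2 int3 by simp
 also have "(LINT x|nu. (norm (beta i x))\<^sup>2) <= (LINT x|nu. C\<^sup>2)"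
  by (intro integral_mono int2) (auto intro!: power_mono bd)
 also have "(LINT x|nu. C\<^sup>2) = C\<^sup>2" by (simp add: prob_space)
 finally have "(LINT x|nu. (norm (\<Sum>j\<in>insert i F. beta j x))\<^sup>2) <= real (Suc n) * (C\<^sup>2 + 1)"
  using F(4) i0[OF i(1)] by (simp add: g_def algebra_simps)
 then show ?case using F nF i by (intro exI[of _ "insert i F"]) auto
qed

text \<open>The Banach-Saks argument: with \<open>n\<close> terms of the previous lemma, the second moment of the average is \<open>O(1 / n)\<close>.\<close>

theorem bounded_weak_null_averages:
 fixes beta :: "nat => 'a => 'b::euclidean_space"
 assumes nu: "prob_space nu" and beta[measurable]: "!!i. beta i : borel_measurable nu"
  and bd: "!!i x. norm (beta i x) <= C"
  and weak: "!!g. g : borel_measurable nu ==> bounded (range g) ==> (%i. LINT x|nu. g x <.> beta i x) ----> 0"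
  and e: "e > 0"
 shows "EX F. finite F & F ~= {} & F \<subseteq> {N..} & (LINT x|nu. norm ((\<Sum>i\<in>F. beta i x) /\<^sub>R real (card F))) <= e"
proof -
 interpret prob_space nu by fact
 obtain n :: nat where n: "(C\<^sup>2 + 1) / e\<^sup>2 < real n" using reals_Archimedean2 by blast
 have "(C\<^sup>2 + 1) / e\<^sup>2 >= 0" by simp
 then have n0: "n > 0" using n by (metis of_nat_0_less_iff order_le_less_trans)
 obtain F where F: "finite F" "F \<subseteq> {N..}" "card F = n" "(LINT x|nu. (norm (\<Sum>i\<in>F. beta i x))\<^sup>2) <= real n * (C\<^sup>2 + 1)"
  using bounded_weak_null_sums[OF nu beta bd weak] by blast
 define g where "g x = norm ((\<Sum>i\<in>F. beta i x) /\<^sub>R real (card F))" for x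
 have [measurable]: "g : borel_measurable nu" unfolding g_def by measurable
 have gb: "g x <= C" for x
 proof -
  have "norm (\<Sum>i\<in>F. beta i x) <= real n * C"
   using norm_sum[of "%i. beta i x" F] sum_bounded_above[of F "%i. norm (beta i x)" C] bd F by (auto intro: order_trans)
  then show ?thesis using n0 F(3) by (simp add: g_def field_simps)
 qed
 have g0: "g x >= 0" for x by (simp add: g_def)
 have i1: "integrable nu (%x. (g x)\<^sup>2)"
  by (rule integrable_const_bound[of _ "C\<^sup>2"]) (auto intro!: power_mono gb g0)
 have i2: "integrable nu g"
  by (rule integrable_const_bound[of _ C]) (auto simp: gb g0)
 have "(LINT x|nu. (g x)\<^sup>2) = (LINT x|nu. (norm (\<Sum>i\<in>F. beta i x))\<^sup>2) / (real n)\<^sup>2"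
  unfolding g_def using F(3) by (simp add: power_mult_distrib power_inverse[symmetric] divide_inverse mult.commute)
 also have "... <= real n * (C\<^sup>2 + 1) / (real n)\<^sup>2" by (intro divide_right_mono F) auto
 also have "... = (C\<^sup>2 + 1) / real n" using n0 by (simp add: power2_eq_square)
 also have "... <= e\<^sup>2" using n n0 e by (simp add: field_simps)
 finally have g2: "(LINT x|nu. (g x)\<^sup>2) <= e\<^sup>2" .
 have "(LINT x|nu. g x) <= (LINT x|nu. e / 2 + (g x)\<^sup>2 / (2 * e))"
 proof (rule integral_mono)
  fix x
  have "2 * e * g x <= e\<^sup>2 + (g x)\<^sup>2" using sum_squares_bound[of e "g x"] by simp
  then show "g x <= e / 2 + (g x)\<^sup>2 / (2 * e)" using e by (simp add: field_simps power2_eq_square)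
 qed (use i1 i2 in auto)
 also have "... = e / 2 + (LINT x|nu. (g x)\<^sup>2) / (2 * e)" using i1 by (simp add: prob_space)
 also have "... <= e / 2 + e\<^sup>2 / (2 * e)" using g2 e by (intro add_left_mono divide_right_mono) auto
 also have "... = e" using e by (simp add: power2_eq_square)
 finally show ?thesis using F n0 by (intro exI[of _ F]) (auto simp: g_def)
qed

section \<open>Time averages\<close>

lemma bounded_borel_set_integrable:
 fixes f :: "real => 'b::euclidean_space"
 assumes [measurable]: "f : borel_measurable borel" and bd: "!!s. norm (f s) <= C"
 shows "set_integrable lborel {a..b} f"
 unfolding set_integrable_def
proof (rule integrableI_bounded_set[where A="{a..b}" and B=C])
 show "AE x in lborel. x : {a..b} --> norm (indicat_real {a..b} x *R f x) <= C"
  using bd by (auto split: split_indicator)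
qed (auto simp: emeasure_lborel_Icc_eq)

lemma bounded_borel_integrable_on:
 fixes f :: "real => 'b::euclidean_space"
 assumes "f : borel_measurable borel" "!!s. norm (f s) <= C"
 shows "f integrable_on {a..b}"
 by (rule set_borel_integral_eq_integral(1)[OF bounded_borel_set_integrable[OF assms]])

lemma integral_norm_le:
 fixes f :: "real => 'b::euclidean_space"
 assumes "f integrable_on {a..b}" "a <= b" "!!s. s : {a..b} ==> norm (f s) <= C"
 shows "norm (integral {a..b} f) <= C * (b - a)"
proof -
 have "0 <= C" using order_trans[OF norm_ge_zero assms(3)[of a]] assms(2) by simp
 have hi: "(f has_integral integral {a..b} f) (cbox a b)" using integrable_integral[OF assms(1)] by simp
 have "norm (integral {a..b} f) <= C * measure lborel (cbox a b)"
  by (rule has_integral_bound[OF \<open>0 <= C\<close> hi]) (use assms(3) in auto)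
 then show ?thesis using assms(2) by simp
qed

lemma integral_shift_borel:
 fixes f :: "real => 'b::euclidean_space"
 assumes f: "f : borel_measurable borel" "!!s. norm (f s) <= C"
 shows "integral {a..b} (%s. f (s + dl)) = integral {a+dl..b+dl} f"
proof -
 have f': "(%s. f (s + dl)) : borel_measurable borel" using f(1) by measurable
 have "integral {a+dl..b+dl} f = (LINT x|lborel. indicator {a+dl..b+dl} x *R f x)"
  using set_borel_integral_eq_integral(2)[OF bounded_borel_set_integrable[OF f]] by (simp add: set_lebesgue_integral_def)
 also have "... = (LINT x|lborel. indicator {a+dl..b+dl} (dl + 1 * x) *R f (dl + 1 * x))"
  by (subst lborel_integral_real_affine[of 1 _ dl]) auto
 also have "... = (LINT x|lborel. indicator {a..b} x *R f (x + dl))"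
  by (intro bo_integral_cong) (auto simp: add.commute split: split_indicator)
 also have "... = integral {a..b} (%s. f (s + dl))"
  using set_borel_integral_eq_integral(2)[OF bounded_borel_set_integrable[OF f', of C]] f(2)
  by (simp add: set_lebesgue_integral_def)
 finally show ?thesis by simp
qed

lemma integral_uniform_time:
 fixes f :: "real => 'b::euclidean_space"
 assumes [measurable]: "f : borel_measurable borel" and bd: "!!s. norm (f s) <= C" and "0 < T"
 shows "(\<integral>s. f s \<partial>uniform_measure lborel {0..T}) = (1 / T) *R integral {0..T} f"
proof -
 have "uniform_measure lborel {0..T} = density lborel (%s. ennreal (indicator {0..T} s / T))"
  unfolding uniform_measure_def using assms(3)
  by (intro density_cong) (auto simp: divide_ennreal[symmetric] split: split_indicator)
 then have "(\<integral>s. f s \<partial>uniform_measure lborel {0..T}) = (LINT s|lborel. (indicator {0..T} s / T) *R f s)"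
  using assms(3) by (simp add: integral_density)
 also have "... = (LINT s|lborel. (1 / T) *R (indicator {0..T} s *R f s))"
  by (intro bo_integral_cong) auto
 also have "... = (1 / T) *R integral {0..T} f"
  unfolding integral_scaleR_right
  using set_borel_integral_eq_integral(2)[OF bounded_borel_set_integrable[OF assms(1) bd, of 0 T]]
  by (simp add: set_lebesgue_integral_def)
 finally show ?thesis .
qed

text \<open>A bounded initial segment has no influence on long time averages.\<close>

lemma time_average_limsup:
 fixes p :: "real => real"
 assumes p: "p : borel_measurable borel" "!!s. \<bar>p s\<bar> <= B" and c: "!!s. s >= s0 ==> p s <= c" and e: "e > 0"
 shows "eventually (%T. integral {0..T} p <= (c + e) * T) at_top"
proof -
 define m where "m = max s0 0"
 have B: "B >= 0" using p(2)[of 0] by linarith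
 have int: "p integrable_on {a..b}" for a b using p by (intro bounded_borel_integrable_on) auto
 have "integral {0..T} p <= (c + e) * T" if T: "T >= m" "T >= (B + \<bar>c\<bar>) * m / e" for T
 proof -
  have "integral {0..T} p = integral {0..m} p + integral {m..T} p"
   using T by (intro hk_integral_combine[symmetric] int) (auto simp: m_def)
  also have "integral {0..m} p <= B * m"
   using integral_norm_le[OF int, of 0 m B] p(2) by (auto simp: m_def abs_le_iff)
  also have "integral {m..T} p <= integral {m..T} (%_. c)"
   using c by (intro integral_le int) (auto simp: m_def)
  also have "integral {m..T} (%_. c) = c * (T - m)" using T by simp
  finally have "integral {0..T} p <= c * T + (B * m - c * m)" by (simp add: algebra_simps)
  also have "B * m - c * m <= (B + \<bar>c\<bar>) * m"
  proof -
   have "- c * m <= \<bar>c\<bar> * m" by (rule mult_right_mono) (auto simp: m_def)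
   then show ?thesis by (simp add: algebra_simps)
  qed
  also have "... <= e * T" using T(2) e by (simp add: field_simps)
  finally show ?thesis by (simp add: algebra_simps)
 qed
 then show ?thesis
  by (intro eventually_at_top_linorderI[of "max m ((B + \<bar>c\<bar>) * m / e)"]) auto
qed

lemma primitive_lipschitz:
 fixes f :: "real => 'b::euclidean_space"
 assumes f: "f : borel_measurable borel" "!!s. norm (f s) <= C" and "0 <= s" "s <= t"
 shows "integral {0..t} f - integral {0..s} f = integral {s..t} f"
  "norm (integral {0..t} f - integral {0..s} f) <= C * (t - s)"
proof -
 have int: "f integrable_on {a..b}" for a b using f by (rule bounded_borel_integrable_on)
 show *: "integral {0..t} f - integral {0..s} f = integral {s..t} f"
  using hk_integral_combine[of 0 s t f] assms int by (simp add: algebra_simps)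
 show "norm (integral {0..t} f - integral {0..s} f) <= C * (t - s)"
  unfolding * by (rule integral_norm_le[OF int]) (use assms in auto)
qed

text \<open>Averaging over a moving window changes an integral only near the two ends of the interval.\<close>

lemma integral_window_average:
 fixes k :: "real => real"
 assumes k: "k : borel_measurable borel" "!!s. \<bar>k s\<bar> <= C" and "0 <= dl" "0 <= T"
 shows "\<bar>integral {0..T} (%s. integral {s..s+dl} k) - dl * integral {0..T} k\<bar> <= 2 * C * dl\<^sup>2"
proof -
 define H where "H t = integral {0..t} k" for t
 have k': "norm (k s) <= C" for s using k(2) by simp
 have Hdiff: "H t - H s = integral {s..t} k" "\<bar>H t - H s\<bar> <= C * (t - s)" if "0 <= s" "s <= t" for s t
  using primitive_lipschitz[OF k(1) k' that] by (auto simp: H_def)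
 have Hneg: "H t = 0" if "t <= 0" for t using that by (cases "t = 0") (auto simp: H_def)
 have C: "C >= 0" using k(2)[of 0] by linarith
 have cont: "continuous_on {0..b} H" for b
  unfolding H_def by (rule indefinite_integral_continuous_1) (rule bounded_borel_integrable_on[OF k(1) k'])
 have int: "H integrable_on {a..b}" if "0 <= a" for a b
  by (rule integrable_continuous_interval) (rule continuous_on_subset[OF cont[of b]], use that in auto)
 have int': "(%s. H (s + dl)) integrable_on {0..T}"
  by (rule integrable_continuous_interval)
    (rule continuous_on_compose2[OF cont[of "T + dl"]], use assms in \<open>auto intro!: continuous_intros\<close>)
 have "integral {0..T} (%s. integral {s..s+dl} k) = integral {0..T} (%s. H (s + dl) - H s)"
  using Hdiff assms by (intro hk_integral_cong) auto
 also have "... = integral {0..T} (%s. H (s + dl)) - integral {0..T} H"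
  using int' int by (intro hk_integral_diff) auto
 also have "integral {0..T} (%s. H (s + dl)) = integral {dl..T+dl} H"
 proof -
  have "((%s. H (s + dl)) has_integral integral {dl..T+dl} H) {0..T}"
  proof -
   have "(H has_integral integral {dl..T+dl} H) (cbox dl (T + dl))"
    using int[of dl "T+dl"] assms by (simp add: integrable_integral)
   from has_integral_affinity[OF this, of 1 dl] show ?thesis
    by (simp add: image_affinity_atLeastAtMost_diff)
  qed
  then show ?thesis by (rule integral_unique)
 qed
 also have "integral {dl..T+dl} H - integral {0..T} H = integral {T..T+dl} H - integral {0..dl} H"
  using hk_integral_combine[of 0 dl "T+dl" H] hk_integral_combine[of 0 T "T+dl" H] int[of 0 "T+dl"] assms by simp
 finally have eq: "integral {0..T} (%s. integral {s..s+dl} k) - dl * H T = (integral {T..T+dl} H - dl * H T) - integral {0..dl} H" by simp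
 have "integral {T..T+dl} H - dl * H T = integral {T..T+dl} (%s. H s - H T)"
  using int[of T "T+dl"] assms by (subst hk_integral_diff) auto
 moreover have "norm (integral {T..T+dl} (%s. H s - H T)) <= (C * dl) * ((T + dl) - T)"
 proof (rule integral_norm_le)
  fix s assume "s : {T..T+dl}"
  then have "\<bar>H s - H T\<bar> <= C * (s - T)" "s - T <= dl" using Hdiff(2)[of T s] assms by auto
  then show "norm (H s - H T) <= C * dl" using C by (auto intro: order_trans mult_left_mono)
 qed (use int[of T "T+dl"] assms in \<open>auto intro!: integrable_diff\<close>)
 moreover have "norm (integral {0..dl} H) <= (C * dl) * (dl - 0)"
 proof (rule integral_norm_le)
  fix s assume "s : {0..dl}"
  then have "\<bar>H s - H 0\<bar> <= C * s" "s <= dl" using Hdiff(2)[of 0 s] by auto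
  then show "norm (H s) <= C * dl" using C Hneg[of 0] by (auto intro: order_trans mult_left_mono)
 qed (use int[of 0 "dl"] assms in auto)
 ultimately show ?thesis unfolding H_def[symmetric] using eq by (simp add: power2_eq_square algebra_simps)
qed

section \<open>Couplings seen along a path\<close>

lemma primitive_continuous:
 fixes f :: "real => 'b::euclidean_space"
 assumes f: "f : borel_measurable borel" "!!s. norm (f s) <= C"
 shows "continuous_on UNIV (%t. integral {0..t} f)"
proof -
 define H where "H t = integral {0..t} f" for t
 have C: "C >= 0" using order_trans[OF norm_ge_zero f(2)] .
 have H0: "H t = H (max 0 t)" for t by (cases "t < 0") (auto simp: H_def max_def)
 have *: "norm (H t - H s) <= C * (t - s)" if "s <= t" for s t
 proof -
  have "norm (H (max 0 t) - H (max 0 s)) <= C * (max 0 t - max 0 s)"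
   unfolding H_def by (rule primitive_lipschitz(2)[OF f]) (use that in auto)
  also have "... <= C * (t - s)" using that C by (intro mult_left_mono) auto
  finally show ?thesis using H0 by metis
 qed
 have "C-lipschitz_on UNIV H"
 proof (rule lipschitz_onI)
  show "dist (H x) (H y) <= C * dist x y" for x y
   using *[of x y] *[of y x] by (cases "x <= y") (auto simp: dist_norm norm_minus_commute)
 qed (rule C)
 then show ?thesis unfolding H_def by (rule lipschitz_on_continuous_on)
qed

lemma tendsto_at_top_Cauchy:
 fixes P :: "real => 'a::euclidean_space"
 assumes "(P \<longlongrightarrow> p) at_top" "e > 0"
 obtains s0 where "s0 >= 0" "!!s t. s >= s0 ==> t >= s0 ==> norm (P t - P s) <= e"
proof -
 have "eventually (%t. dist (P t) p < e / 2) at_top" using tendstoD[OF assms(1), of "e / 2"] assms(2) by simp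
 then obtain s0 where s0: "!!t. t >= s0 ==> dist (P t) p < e / 2" by (auto simp: eventually_at_top_linorder)
 have "norm (P t - P s) <= e" if "s >= max s0 0" "t >= max s0 0" for s t
  using dist_triangle2[of "P t" "P s" p] s0[of s] s0[of t] that by (simp add: dist_norm)
 then show ?thesis by (intro that[of "max s0 0"]) auto
qed

text \<open>The sequence of the velocity, the position, and the positions \<open>(1/2) ^ i\<close> later, all at a uniformly distributed
 time, has weakly convergent subsequences. Shift invariance of time averages makes all positions equally distributed in the limit.
 Displacements are integrals of the velocity up to the convergent term \<open>P\<close>, which disappears at late times;
 replacing the velocity over a window by its value at the start costs, tested against a Lipschitz \<open>g\<close>, an error of second
 order in the window.\<close>

theorem joint_window_limit:
 fixes X Z :: "real => 'a::euclidean_space" and mu :: "('a * 'a) measure"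
 assumes X[measurable]: "X : borel_measurable borel" and XR: "!!s. norm (X s) < R"
  and Z[measurable]: "Z : borel_measurable borel" and ZC: "!!s. norm (Z s) <= C"
  and P: "((%t. X t - integral {0..t} Z) \<longlongrightarrow> p) at_top"
  and tau: "!!k. tau k > 0" "filterlim tau at_top sequentially"
  and mu: "prob_space mu" "sets mu = sets borel"
  and lim: "!!f. continuous_on UNIV f ==> bounded (range f) ==>
   (%k. 1 / tau k * integral {0..tau k} (%s. f (X s, Z s))) ----> (LINT q|mu. f q)"
 shows "EX Lam. prob_space Lam & sets Lam = sets (borel :: (nat => 'a) measure) &
  distr Lam borel (%y. (y 1, y 0)) = mu &
  (ALL i. distr Lam borel (%y. y (i + 2)) = distr mu borel fst) &
  (ALL i. AE y in Lam. norm (y (i + 2) - y 1) <= C * (1/2) ^ i) &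
  (ALL g. bounded_lipschitz g --> (EX K. ALL i.
    \<bar>\<integral>y. g (y 1) <.> (y (i + 2) - y 1) - (1/2) ^ i * (g (y 1) <.> y 0) \<partial>Lam\<bar> <= K * ((1/2) ^ i)\<^sup>2))"
proof -
 define P where "P t = X t - integral {0..t} Z" for t
 have Plim: "(P \<longlongrightarrow> p) at_top" using assms(5) by (simp add: P_def[abs_def])
 have C0: "C >= 0" using order_trans[OF norm_ge_zero ZC] .
 have [measurable]: "(%t. integral {0..t} Z) : borel_measurable borel"
  by (intro continuous_borel primitive_continuous[OF Z ZC])
 have [measurable]: "P : borel_measurable borel" unfolding P_def by measurable
 have incr: "X (s + dl) - X s = P (s + dl) - P s + integral {s..s+dl} Z" if "s >= 0" "dl >= 0" for s dl
  using primitive_lipschitz(1)[OF Z ZC, of s "s+dl"] that by (simp add: P_def algebra_simps)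
 have Zint: "Z integrable_on {a..b}" for a b by (rule bounded_borel_integrable_on[OF Z ZC])
 have incr_le: "norm (X (s + dl) - X s) <= norm (P (s + dl) - P s) + C * dl" if "s >= 0" "dl >= 0" for s dl
  unfolding incr[OF that]
  using integral_norm_le[OF Zint, of s "s+dl" C] ZC that norm_triangle_ineq[of "P (s+dl) - P s" "integral {s..s+dl} Z"] by simp
 define R0 where "R0 = max R (C + 1)"
 define V where "V s i = (case i of 0 => Z s | Suc 0 => X s | Suc (Suc j) => X (s + (1/2) ^ j))" for s i
 have V: "V s 0 = Z s" "V s 1 = X s" "V s (i + 2) = X (s + (1/2) ^ i)"
  "V s (Suc 0) = X s" "V s (Suc (Suc i)) = X (s + (1/2) ^ i)" for s i by (auto simp: V_def)
 have VR: "norm (V s i) < R0" for s i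
  using XR ZC[of s] by (auto simp: V_def R0_def less_max_iff_disj split: nat.split intro: le_less_trans)
 have V_meas[measurable]: "V : borel ->M borel"
 proof (rule measurable_coordinatewise_then_product)
  fix i show "(%s. V s i) : borel_measurable borel"
   unfolding V_def by (cases i; cases "i - 1") auto
 qed
 have Vm: "V : uniform_measure lborel A ->M borel" for A
  using V_meas by (subst measurable_cong_sets[OF _ refl, of _ borel]) simp_all
 define N where "N k = distr (uniform_measure lborel {0..tau k}) borel V" for k
 have unif: "prob_space (uniform_measure lborel {0..tau k})" for k
  using tau(1)[of k] by (intro prob_space_uniform_measure) auto
 have N1: "prob_space (N k)" for k unfolding N_def by (rule prob_space.prob_space_distr[OF unif Vm])
 have N2: "sets (N k) = sets borel" for k by (simp add: N_def)
 have N3: "AE y in N k. ALL i. norm (y i) < R0" for k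
 proof -
  note [measurable] = measurable_coord
  show ?thesis unfolding N_def by (subst AE_distr_iff[OF Vm]) (auto simp: VR)
 qed
 have intN: "(LINT y|(N k). f y) = 1 / tau k * integral {0..tau k} (%s. f (V s))"
  if f: "continuous_on UNIV f" "!!y. (ALL i. norm (y i) <= R0) ==> \<bar>f y\<bar> <= B" for f :: "(nat => 'a) => real" and k B
 proof -
  have [measurable]: "f : borel_measurable borel" by (rule continuous_borel[OF f(1)])
  have "(LINT y|(N k). f y) = (\<integral>s. f (V s) \<partial>uniform_measure lborel {0..tau k})"
   unfolding N_def by (rule integral_distr[OF Vm]) simp
  also have "... = (1 / tau k) *R integral {0..tau k} (%s. f (V s))"
   by (rule integral_uniform_time[of _ B]) (use f(2) VR tau(1) in \<open>auto intro: less_imp_le\<close>)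
  finally show ?thesis by simp
 qed
 from prokhorov_seq_ball[of N R0, OF N1 N2 N3]
 obtain r Lam where r: "strict_mono r" and Lam: "prob_space Lam" "sets Lam = sets (borel :: (nat => 'a) measure)"
  and LamR: "AE y in Lam. ALL i. norm (y i) <= R0"
  and conv': "ALL f B. continuous_on UNIV f & (ALL y. (ALL i. norm (y i) <= R0) --> \<bar>f y\<bar> <= B) -->
    (%k. \<integral>y. f y \<partial>N (r k)) ----> (LINT y|Lam. (f y :: real))"
  by (elim exE conjE) (rule that)
 have conv: "(%k. \<integral>y. f y \<partial>N (r k)) ----> (LINT y|Lam. (f y :: real))"
  if "continuous_on UNIV f" "!!y. (ALL i. norm (y i) <= R0) ==> \<bar>f y\<bar> <= B" for f B
  using that by (intro conv'[rule_format, of f B] conjI allI impI) auto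
 interpret Lam: prob_space Lam by fact
 note [measurable_cong] = Lam(2)
 have coord[measurable]: "(%y. y i) : Lam ->M borel" for i
  unfolding measurable_cong_sets[OF Lam(2) refl] by (rule measurable_coord)
 have taur: "filterlim (%k. tau (r k)) at_top sequentially"
  using filterlim_compose[OF tau(2) filterlim_subseq[OF r]] .
 have contc: "continuous_on UNIV (%y :: nat => 'a. y i)" for i by (rule continuous_on_product_coordinates)
 have lawmu: "distr Lam borel (%y. (y 1, y 0)) = mu"
 proof (rule measure_eqI_continuous)
  fix f :: "'a * 'a => real" assume f: "continuous_on UNIV f" "!!x. 0 <= f x & f x <= 1"
  have [measurable]: "f : borel_measurable borel" by (rule continuous_borel[OF f(1)])
  have c: "continuous_on UNIV (%y :: nat => 'a. f (y 1, y 0))"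
   by (rule continuous_on_compose2[OF f(1)]) (auto intro!: continuous_intros contc)
  have "(%k. 1 / tau (r k) * integral {0..tau (r k)} (%s. f (X s, Z s))) ----> (LINT q|mu. f q)"
   using LIMSEQ_subseq_LIMSEQ[OF lim[OF f(1)] r] f(2) by (auto simp: comp_def bounded_iff intro!: exI[of _ 1])
  moreover have "(%k. 1 / tau (r k) * integral {0..tau (r k)} (%s. f (X s, Z s))) ----> (LINT y|Lam. f (y 1, y 0))"
  proof -
   have cb: "\<bar>f (y 1, y 0)\<bar> <= 1" for y :: "nat => 'a" using f(2)[of "(y 1, y 0)"] by simp
   show ?thesis using conv[OF c cb] unfolding intN[OF c cb] V by simp
  qed
  ultimately have "(LINT y|Lam. f (y 1, y 0)) = (LINT q|mu. f q)" by (rule LIMSEQ_unique[rotated])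
  moreover have "(%y. (y 1, y 0)) : Lam ->M borel" by (intro borel_measurable_Pair coord)
  ultimately show "(\<integral>q. f q \<partial>distr Lam borel (%y. (y 1, y 0))) = (LINT q|mu. f q)"
   by (subst integral_distr) auto
 next
  show "finite_measure mu" using mu(1) by (simp add: prob_space_def)
  show "finite_measure (distr Lam borel (%y. (y 1, y 0)))"
   by (intro Lam.finite_measure_distr borel_measurable_Pair coord)
 qed (use mu in auto)
 have lawX: "distr Lam borel (%y. y (i + 2)) = distr mu borel fst" for i
 proof -
  define dl :: real where "dl = (1/2) ^ i"
  have dl: "dl > 0" by (simp add: dl_def)
  have "distr Lam borel (%y. y (i + 2)) = distr Lam borel (%y. y 1)"
  proof (rule measure_eqI_continuous)
   fix f :: "'a => real" assume f: "continuous_on UNIV f" "!!x. 0 <= f x & f x <= 1"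
   have [measurable]: "f : borel_measurable borel" by (rule continuous_borel[OF f(1)])
   define phi where "phi y = f (y (i + 2)) - f (y 1)" for y :: "nat => 'a"
   have c: "continuous_on UNIV phi" unfolding phi_def
    by (intro continuous_intros continuous_on_compose2[OF f(1) contc]) auto
   have phib: "\<bar>phi y\<bar> <= 1" for y unfolding phi_def using f(2)[of "y (i+2)"] f(2)[of "y 1"] by linarith
   have fX: "(%s. f (X s)) : borel_measurable borel" "(%s. f (X (s + dl))) : borel_measurable borel" by measurable
   have fXb: "norm (f x) <= 1" for x using f(2)[of x] by auto
   have fXi: "(%s. f (X s)) integrable_on {a..b}" "(%s. f (X (s + dl))) integrable_on {a..b}" for a b
    using bounded_borel_integrable_on[OF fX(1) fXb] bounded_borel_integrable_on[OF fX(2) fXb] by auto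
   have bnd: "\<bar>\<integral>y. phi y \<partial>N k\<bar> <= 2 * dl / tau k" for k
   proof -
    have "integral {0..tau k} (%s. phi (V s)) = integral {0..tau k} (%s. f (X (s + dl)) - f (X s))"
     by (simp add: phi_def V dl_def)
    also have "... = integral {0..tau k} (%s. f (X (s + dl))) - integral {0..tau k} (%s. f (X s))"
     using fXi by (intro hk_integral_diff) auto
    also have "integral {0..tau k} (%s. f (X (s + dl))) = integral {dl..tau k + dl} (%s. f (X s))"
     using integral_shift_borel[OF fX(1) fXb, of 0 "tau k" dl] by simp
    also have "... - integral {0..tau k} (%s. f (X s)) = integral {tau k..tau k+dl} (%s. f (X s)) - integral {0..dl} (%s. f (X s))"
     using hk_integral_combine[of 0 dl "tau k+dl" "%s. f (X s)"]
      hk_integral_combine[of 0 "tau k" "tau k+dl" "%s. f (X s)"] fXi dl tau(1)[of k] by simp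
    finally have "\<bar>integral {0..tau k} (%s. phi (V s))\<bar> <= 2 * dl"
     using integral_norm_le[OF fXi(1), of "tau k" "tau k+dl" 1] integral_norm_le[OF fXi(1), of 0 "dl" 1] fXb dl by simp
    then show ?thesis using tau(1)[of k] by (subst intN[OF c phib]) (simp add: abs_mult divide_right_mono)
   qed
   have "(%k. 2 * dl / tau (r k)) ----> 0"
    by (intro real_tendsto_divide_at_top[OF tendsto_const taur])
   then have "(%k. \<integral>y. phi y \<partial>N (r k)) ----> 0"
    by (rule Lim_null_comparison[rotated]) (use bnd in auto)
   from LIMSEQ_unique[OF this conv[OF c phib]] have "(LINT y|Lam. phi y) = 0" by simp
   moreover have "(LINT y|Lam. phi y) = (LINT y|Lam. f (y (i + 2))) - (LINT y|Lam. f (y 1))"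
    unfolding phi_def using fXb
    by (intro bo_integral_diff Lam.integrable_const_bound[of _ 1]) auto
   ultimately show "(\<integral>x. f x \<partial>distr Lam borel (%y. y (i + 2))) = (\<integral>x. f x \<partial>distr Lam borel (%y. y 1))"
    by (simp add: integral_distr)
  qed (auto intro!: Lam.finite_measure_distr)
  also have "... = distr (distr Lam borel (%y. (y 1, y 0))) borel fst"
   by (subst distr_distr) (auto simp: comp_def intro!: continuous_borel continuous_intros borel_measurable_Pair)
  finally show ?thesis unfolding lawmu .
 qed
 have close: "AE y in Lam. norm (y (i + 2) - y 1) <= C * (1/2) ^ i" for i
 proof -
  define dl :: real where "dl = (1/2) ^ i"
  have dl: "dl > 0" by (simp add: dl_def)
  define phi where "phi y = max 0 (norm (y (i + 2) - y 1) - C * dl)" for y :: "nat => 'a"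
  have c: "continuous_on UNIV phi" unfolding phi_def by (intro continuous_intros contc)
  have phi0: "0 <= phi y" for y by (simp add: phi_def)
  have phib: "\<bar>phi y\<bar> <= 2 * R0" if "ALL i. norm (y i) <= R0" for y
  proof -
   have "norm (y (i + 2) - y 1) <= R0 + R0" using that by (intro order_trans[OF norm_triangle_ineq4] add_mono) auto
   moreover have "0 <= C * dl" using C0 dl by simp
   moreover have "0 <= R0" using that norm_ge_zero order_trans by blast
   ultimately show ?thesis by (auto simp: phi_def max_def)
  qed
  have [measurable]: "phi : borel_measurable borel" by (rule continuous_borel[OF c])
  have "(LINT y|Lam. phi y) <= 2 * e" if e: "e > 0" for e
  proof -
   obtain s0 where s0: "s0 >= 0" "!!s t. s >= s0 ==> t >= s0 ==> norm (P t - P s) <= e"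
    using tendsto_at_top_Cauchy[OF Plim e] by blast
   have "eventually (%T. integral {0..T} (%s. phi (V s)) <= (e + e) * T) at_top"
   proof (rule time_average_limsup[where ?s0.0=s0 and B="2 * R0"])
    fix s assume "s >= s0"
    then show "phi (V s) <= e"
     using incr_le[of s dl] s0(1) s0(2)[of s "s+dl"] dl e by (simp add: phi_def V dl_def[symmetric])
   qed (use e phib VR in \<open>auto intro: less_imp_le\<close>)
   then have "eventually (%k. integral {0..tau (r k)} (%s. phi (V s)) <= (e + e) * tau (r k)) sequentially"
    using taur by (auto simp: filterlim_iff)
   then have "eventually (%k. (\<integral>y. phi y \<partial>N (r k)) <= 2 * e) sequentially"
   proof eventually_elim
    case (elim k)
    then show ?case using tau(1)[of "r k"] by (subst intN[OF c phib]) (auto simp: field_simps)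
   qed
   then show ?thesis by (intro tendsto_upperbound[OF conv[OF c phib]]) auto
  qed
  then have "(LINT y|Lam. phi y) <= 0" using field_le_epsilon[of "LINT y|Lam. phi y" 0]
   by (metis add_0 half_gt_zero mult.commute nonzero_mult_div_cancel_left times_divide_eq_right zero_neq_numeral)
  moreover have "(LINT y|Lam. phi y) >= 0" using phi0 by simp
  ultimately have "(LINT y|Lam. phi y) = 0" by simp
  moreover have "integrable Lam phi"
   by (rule Lam.integrable_const_bound[of _ "2 * R0"]) (use LamR phib in \<open>auto elim!: eventually_mono\<close>)
  ultimately have "AE y in Lam. phi y = 0" using phi0 by (subst (asm) integral_nonneg_eq_0_iff_AE) auto
  then show ?thesis by eventually_elim (auto simp: phi_def dl_def max_def split: if_splits)
 qed
 have drift: "EX K. ALL i. \<bar>\<integral>y. g (y 1) <.> (y (i + 2) - y 1) - (1/2) ^ i * (g (y 1) <.> y 0) \<partial>Lam\<bar> <= K * ((1/2) ^ i)\<^sup>2"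
  if g: "bounded_lipschitz g" for g :: "'a => 'a"
 proof -
  from g obtain L G where L: "L > 0" "!!x y. norm (g x - g y) <= L * norm (x - y)" and G: "G > 0" "!!x. norm (g x) <= G"
   by (rule bounded_lipschitzE) blast
  have gc: "continuous_on UNIV g" by (rule bounded_lipschitz_continuous[OF g])
  have [measurable]: "g : borel_measurable borel" by (rule bounded_lipschitz_measurable[OF g])
  define k where "k s = g (X s) <.> Z s" for s
  have k_meas[measurable]: "k : borel_measurable borel" unfolding k_def by measurable
  have kb: "norm (k s) <= G * C" for s
   unfolding k_def real_norm_def
   by (rule order_trans[OF Cauchy_Schwarz_ineq2]) (intro mult_mono G(2) ZC, use G(1) in auto)
  define H where "H t = integral {0..t} k" for t
  have H_cont: "continuous_on UNIV H" unfolding H_def[abs_def] by (rule primitive_continuous[OF k_meas kb])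
  have [measurable]: "H : borel_measurable borel" by (rule continuous_borel[OF H_cont])
  have kint: "k integrable_on {a..b}" for a b by (rule bounded_borel_integrable_on[OF k_meas kb])
  have "\<bar>\<integral>y. g (y 1) <.> (y (i + 2) - y 1) - (1/2) ^ i * (g (y 1) <.> y 0) \<partial>Lam\<bar> <= (C * C * L + 3) * ((1/2) ^ i)\<^sup>2" for i
  proof -
   define dl :: real where "dl = (1/2) ^ i"
   have dl: "dl > 0" by (simp add: dl_def)
   define phi where "phi y = g (y 1) <.> (y (i + 2) - y 1) - dl * (g (y 1) <.> y 0)" for y :: "nat => 'a"
   have c: "continuous_on UNIV phi" unfolding phi_def by (intro continuous_intros contc continuous_on_compose2[OF gc contc]) auto
   define B where "B = G * (R0 + R0) + dl * (G * R0)"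
   have phib: "\<bar>phi y\<bar> <= B" if y: "ALL i. norm (y i) <= R0" for y
   proof -
    have "norm (y (i + 2) - y 1) <= R0 + R0" using y by (intro order_trans[OF norm_triangle_ineq4] add_mono) auto
    then have "\<bar>g (y 1) <.> (y (i + 2) - y 1)\<bar> <= G * (R0 + R0)"
     using G by (intro order_trans[OF Cauchy_Schwarz_ineq2] mult_mono) auto
    moreover have "\<bar>g (y 1) <.> y 0\<bar> <= G * R0"
     using G y by (intro order_trans[OF Cauchy_Schwarz_ineq2] mult_mono) auto
    then have "\<bar>dl * (g (y 1) <.> y 0)\<bar> <= dl * (G * R0)" using dl by (simp add: abs_mult)
    ultimately show ?thesis unfolding phi_def B_def by linarith
   qed
   have [measurable]: "phi : borel_measurable borel" by (rule continuous_borel[OF c])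
   have VRle: "ALL i. norm (V s i) <= R0" for s using VR by (auto intro: less_imp_le)
   define E where "E s = phi (V s) + dl * k s - (H (s + dl) - H s)" for s
   have [measurable]: "E : borel_measurable borel" unfolding E_def by measurable
   have HHb: "\<bar>H (s + dl) - H s\<bar> <= G * C * dl" if "s >= 0" for s
    using primitive_lipschitz(2)[OF k_meas kb that, of "s + dl"] dl by (simp add: H_def)
   define E' where "E' s = E (max 0 s)" for s
   have [measurable]: "E' : borel_measurable borel" unfolding E'_def by measurable
   have E'b: "\<bar>E' s\<bar> <= B + dl * (G * C) + G * C * dl" for s
   proof -
    have "\<bar>dl * k (max 0 s)\<bar> <= dl * (G * C)" using kb[of "max 0 s"] dl by (simp add: abs_mult)
    moreover have "\<bar>H (max 0 s + dl) - H (max 0 s)\<bar> <= G * C * dl" by (rule HHb) simp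
    ultimately show ?thesis using phib[OF VRle, of "max 0 s"] unfolding E'_def E_def by linarith
   qed
   have Eeq: "E s = g (X s) <.> (P (s + dl) - P s) + integral {s..s+dl} (%u. (g (X s) - g (X u)) <.> Z u)" if "s >= 0" for s
   proof -
    have 1: "g (X s) <.> integral {s..s+dl} Z = integral {s..s+dl} (%u. g (X s) <.> Z u)"
     using integral_linear[OF Zint[of s "s+dl"] bounded_linear_inner_right[of "g (X s)"]] by (simp add: comp_def)
    have 2: "H (s + dl) - H s = integral {s..s+dl} k"
     unfolding H_def by (rule primitive_lipschitz(1)[OF k_meas kb]) (use that dl in auto)
    have 3: "(%u. g (X s) <.> Z u) integrable_on {s..s+dl}"
     using integrable_linear[OF Zint[of s "s+dl"] bounded_linear_inner_right[of "g (X s)"]] by (simp add: comp_def)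
    have "phi (V s) = g (X s) <.> (P (s + dl) - P s) + g (X s) <.> integral {s..s+dl} Z - dl * k s"
     using incr[OF that, of dl] dl by (simp add: phi_def V k_def inner_add_right dl_def[symmetric])
    then have "E s = g (X s) <.> (P (s + dl) - P s) + (integral {s..s+dl} (%u. g (X s) <.> Z u) - integral {s..s+dl} k)"
     unfolding E_def 2 1 by simp
    also have "integral {s..s+dl} (%u. g (X s) <.> Z u) - integral {s..s+dl} k = integral {s..s+dl} (%u. g (X s) <.> Z u - k u)"
     by (rule hk_integral_diff[symmetric, OF 3 kint])
    finally show ?thesis by (simp add: k_def inner_diff_left)
   qed
   \<comment> \<open>so small that late oscillations of \<open>P\<close> contribute at most the square of the window to the error\<close>
   define e where "e = dl\<^sup>2 / (G + L * C * dl + 1)"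
   have den: "G + L * C * dl + 1 > 0" using G L C0 dl by (intro add_pos_nonneg add_nonneg_pos) auto
   then have e: "e > 0" using dl by (simp add: e_def)
   obtain s0 where s0: "s0 >= 0" "!!s t. s >= s0 ==> t >= s0 ==> norm (P t - P s) <= e"
    using tendsto_at_top_Cauchy[OF Plim e] by blast
   have Eb: "\<bar>E s\<bar> <= (C * C * L + 1) * dl\<^sup>2" if s: "s >= s0" for s
   proof -
    have s': "s >= 0" using s s0 by simp
    have "\<bar>g (X s) <.> (P (s + dl) - P s)\<bar> <= G * e"
     using G s0(2)[of s "s+dl"] s dl by (intro order_trans[OF Cauchy_Schwarz_ineq2] mult_mono) auto
    moreover have "norm (integral {s..s+dl} (%u. (g (X s) - g (X u)) <.> Z u)) <= (L * (e + C * dl) * C) * (s + dl - s)"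
    proof (rule integral_norm_le)
     fix u assume u: "u : {s..s+dl}"
     have "norm (X u - X s) <= e + C * dl"
     proof -
      have "norm (X (s + (u - s)) - X s) <= norm (P (s + (u - s)) - P s) + C * (u - s)"
       by (rule incr_le) (use u s' in auto)
      also have "norm (P (s + (u - s)) - P s) <= e" using s0(2)[of s u] u s by simp
      also have "C * (u - s) <= C * dl" using u C0 by (intro mult_left_mono) auto
      finally show ?thesis by simp
     qed
     then have "norm (g (X s) - g (X u)) <= L * (e + C * dl)"
      using L(1) by (intro order_trans[OF L(2)] mult_left_mono) (auto simp: norm_minus_commute)
     then show "norm ((g (X s) - g (X u)) <.> Z u) <= L * (e + C * dl) * C"
      using ZC[of u] Cauchy_Schwarz_ineq2[of "g (X s) - g (X u)" "Z u"]
       mult_mono[of "norm (g (X s) - g (X u))" "L * (e + C * dl)" "norm (Z u)" C] L(1) C0 e dl by simp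
    next
     have "norm ((g (X s) - g (X u)) <.> Z u) <= 2 * G * C" for u
      using Cauchy_Schwarz_ineq2[of "g (X s) - g (X u)" "Z u"] norm_triangle_ineq4[of "g (X s)" "g (X u)"]
       mult_mono[of "norm (g (X s) - g (X u))" "2 * G" "norm (Z u)" C] G(2)[of "X s"] G(2)[of "X u"] G(1) ZC[of u] by simp
     then show "(%u. (g (X s) - g (X u)) <.> Z u) integrable_on {s..s+dl}"
      by (intro bounded_borel_integrable_on) auto
    qed (use dl in auto)
    moreover have "G * e + (L * (e + C * dl) * C) * dl = C * C * L * dl\<^sup>2 + e * (G + L * C * dl)"
     by (simp add: algebra_simps power2_eq_square)
    moreover have "e * (G + L * C * dl) <= dl\<^sup>2"
     unfolding e_def using den by (simp add: field_simps)
    moreover have "(C * C * L + 1) * dl\<^sup>2 = C * C * L * dl\<^sup>2 + dl\<^sup>2" by (simp add: algebra_simps)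
    moreover have "L * (e + C * dl) * C * (s + dl - s) = L * (e + C * dl) * C * dl" by simp
    moreover have "\<bar>a + b\<bar> <= \<bar>a\<bar> + \<bar>b\<bar>" for a b :: real by (rule abs_triangle_ineq)
    ultimately show ?thesis unfolding Eeq[OF s'] real_norm_def by (smt (verit))
   qed
   have ev1: "eventually (%T. integral {0..T} (%s. E' s) <= ((C * C * L + 1) * dl\<^sup>2 + dl\<^sup>2) * T) at_top"
   proof (rule time_average_limsup[where ?s0.0=s0])
    show "E' s <= (C * C * L + 1) * dl\<^sup>2" if "s >= s0" for s
     using Eb[OF that] that s0(1) by (simp add: E'_def max_def)
   qed (use E'b dl in auto)
   have ev2: "eventually (%T. integral {0..T} (%s. - E' s) <= ((C * C * L + 1) * dl\<^sup>2 + dl\<^sup>2) * T) at_top"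
   proof (rule time_average_limsup[where ?s0.0=s0])
    show "- E' s <= (C * C * L + 1) * dl\<^sup>2" if "s >= s0" for s
     using Eb[OF that] that s0(1) by (simp add: E'_def max_def)
    show "\<bar>- E' s\<bar> <= B + dl * (G * C) + G * C * dl" for s using E'b[of s] by simp
   qed (use dl in auto)
   have ev3: "eventually (%T. 2 * (G * C) * dl\<^sup>2 <= dl\<^sup>2 * T) at_top"
    using eventually_ge_at_top[of "2 * (G * C)"] by eventually_elim (use dl in \<open>auto simp: mult.commute\<close>)
   have fin: "eventually (%T. \<bar>integral {0..T} (%s. phi (V s))\<bar> <= (C * C * L + 3) * dl\<^sup>2 * T) at_top"
    using ev1 ev2 ev3 eventually_ge_at_top[of 0]
   proof eventually_elim
    case (elim T)
    have iE: "E' integrable_on {0..T}" by (rule bounded_borel_integrable_on[OF _ E'b[folded real_norm_def]]) simp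
    have iH: "(%s. integral {s..s+dl} k) integrable_on {0..T}"
    proof -
     have "(%s. H (s + dl) - H s) integrable_on {0..T}"
      by (intro integrable_continuous_interval continuous_intros continuous_on_compose2[OF H_cont]) auto
     moreover have "H (s + dl) - H s = integral {s..s+dl} k" if "s : {0..T}" for s
      unfolding H_def by (rule primitive_lipschitz(1)[OF k_meas kb]) (use that dl in auto)
     ultimately show ?thesis by (subst (asm) integrable_cong) auto
    qed
    have "integral {0..T} (%s. phi (V s)) = integral {0..T} (%s. E' s + (integral {s..s+dl} k - dl * k s))"
    proof (rule hk_integral_cong)
     fix s assume s: "s : {0..T}"
     have "H (s + dl) - H s = integral {s..s+dl} k"
      unfolding H_def by (rule primitive_lipschitz(1)[OF k_meas kb]) (use s dl in auto)
     then show "phi (V s) = E' s + (integral {s..s+dl} k - dl * k s)" using s by (simp add: E'_def E_def)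
    qed
    also have "... = integral {0..T} E' + (integral {0..T} (%s. integral {s..s+dl} k) - dl * integral {0..T} k)"
     by (intro integral_unique has_integral_add has_integral_diff has_integral_mult_right integrable_integral iE iH kint)
    finally have *: "integral {0..T} (%s. phi (V s)) = integral {0..T} E' + (integral {0..T} (%s. integral {s..s+dl} k) - dl * integral {0..T} k)" .
    have "\<bar>integral {0..T} (%s. integral {s..s+dl} k) - dl * integral {0..T} k\<bar> <= 2 * (G * C) * dl\<^sup>2"
     by (rule integral_window_average) (use kb elim dl in auto)
    then show ?case using * elim by (simp add: algebra_simps)
   qed
   have "eventually (%k. \<bar>\<integral>y. phi y \<partial>N (r k)\<bar> <= (C * C * L + 3) * dl\<^sup>2) sequentially"
   proof -
    have "eventually (%k. \<bar>integral {0..tau (r k)} (%s. phi (V s))\<bar> <= (C * C * L + 3) * dl\<^sup>2 * tau (r k)) sequentially"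
     using fin taur by (auto simp: filterlim_iff)
    then show ?thesis
    proof eventually_elim
     case (elim k)
     then show ?case using tau(1)[of "r k"] by (subst intN[OF c phib]) (auto simp: field_simps abs_mult)
    qed
   qed
   then have "\<bar>\<integral>y. phi y \<partial>Lam\<bar> <= (C * C * L + 3) * dl\<^sup>2"
    by (intro tendsto_upperbound[OF tendsto_rabs[OF conv[OF c phib]]]) auto
   then show ?thesis unfolding phi_def dl_def .
  qed
  then show ?thesis by blast
 qed
 show ?thesis using Lam lawmu lawX close drift by (intro exI[of _ Lam]) auto
qed

section \<open>Mean velocities of the couplings\<close>

text \<open>The interface to the path: coordinate 1 is the present position, coordinate \<open>i + 2\<close> the position \<open>(1/2) ^ i\<close> later. The
 field \<open>vb\<close> is the velocity that the constructed motion has to follow.\<close>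

locale mimicking =
 fixes Lam :: "(nat => 'a::euclidean_space) measure" and nu :: "'a measure"
  and vb :: "'a => 'a" and C R :: real and B :: "'a set"
 assumes Lam: "prob_space Lam" "sets Lam = sets borel"
  and law1: "distr Lam borel (%y. y 1) = nu"
  and law: "!!i. distr Lam borel (%y. y (i + 2)) = nu"
  and close: "!!i. AE y in Lam. norm (y (i + 2) - y 1) <= C * (1/2) ^ i"
  and vb: "vb : borel_measurable borel" "!!x. norm (vb x) <= C"
  and drift: "!!g. bounded_lipschitz g ==> EX K. ALL i.
    \<bar>(LINT y|Lam. g (y 1) <.> (y (i + 2) - y 1)) - (1/2) ^ i * (LINT x|nu. g x <.> vb x)\<bar> <= K * ((1/2) ^ i)\<^sup>2"
  and B: "compact B" "!!x. x : B ==> norm x < R" "AE x in nu. x : B"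
begin

sublocale L: prob_space Lam by (rule Lam)

lemma coord_meas: "(%y. y i) : Lam ->M borel"
 unfolding measurable_cong_sets[OF Lam(2) refl] by (rule measurable_coord)

sublocale N: prob_space nu
 unfolding law1[symmetric] by (rule L.prob_space_distr[OF coord_meas])

lemma sets_nu [simp, measurable_cong]: "sets nu = sets borel" unfolding law1[symmetric] by simp
lemma meas_nu: "f : borel_measurable borel ==> f : borel_measurable nu"
 by (simp cong: measurable_cong_sets)
lemma space_nu [simp]: "space nu = UNIV" unfolding law1[symmetric] by simp

sublocale U: prob_space unif by (rule prob_space_unif)
sublocale NU: pair_prob_space nu unif ..

lemma C_nonneg: "C >= 0" using order_trans[OF norm_ge_zero vb(2)] .

lemma B_meas [measurable]: "B : sets borel" using B(1) by (simp add: compact_imp_closed)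

lemma AE_coord_B: "AE y in Lam. y 1 : B" "AE y in Lam. y (i + 2) : B"
proof -
 have "AE x in distr Lam borel (%y. y 1). x : B" unfolding law1 by (rule B(3))
 then show "AE y in Lam. y 1 : B" by (rule AE_distrD[OF coord_meas])
 have "AE x in distr Lam borel (%y. y (i + 2)). x : B" unfolding law by (rule B(3))
 then show "AE y in Lam. y (i + 2) : B" by (rule AE_distrD[OF coord_meas])
qed

lemma pair_meas: "(%y. (y i, y j)) : Lam ->M borel"
 by (intro borel_measurable_Pair coord_meas)

lemma R_pos: "R > 0"
proof -
 have "B ~= {}"
 proof
  assume "B = {}"
  then have "AE x in nu. False" using B(3) by simp
  then show False by simp
 qed
 then obtain x where "x : B" by blast
 then show ?thesis using B(2)[of x] norm_ge_zero[of x] by linarith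
qed

text \<open>The later position is written as a function of the present one and a uniform variable, over which the displacement is
 averaged. Truncating the displacement at its almost sure bound makes the estimate hold everywhere.\<close>

lemma ex_mean_velocity:
 "EX b. b : borel_measurable borel & (ALL x. norm (b x) <= C) &
   (ALL g. g : borel_measurable borel & bounded (range g) -->
    (LINT y|Lam. g (y 1) <.> (y (i + 2) - y 1)) = (1/2) ^ i * (LINT x|nu. g x <.> b x))"
proof -
 define dl :: real where "dl = (1/2) ^ i"
 have dl: "dl > 0" by (simp add: dl_def)
 define rho where "rho = distr Lam borel (%y. (y 1, y (i + 2)))"
 have rho1: "prob_space rho" unfolding rho_def by (rule L.prob_space_distr[OF pair_meas])
 have rho2: "sets rho = sets borel" by (simp add: rho_def)
 have rho3: "AE p in rho. norm (snd p) < R"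
  unfolding rho_def using AE_coord_B(2)[of i] B(2)
  by (subst AE_distr_iff[OF pair_meas]) (auto elim!: eventually_mono)
 have fstrho: "distr rho borel fst = nu"
  unfolding rho_def by (subst distr_distr[OF borel_measurable_fst_snd(1) pair_meas]) (simp add: comp_def law1[simplified])
 obtain G where G[measurable]: "G : borel_measurable borel"
  and G_law: "distr (nu >< unif) borel (%(x, u). (x, G (x, u))) = rho"
  using ex_randomization[OF rho1 rho2 rho3] unfolding fstrho by blast
 have GM: "(%(x, u). (x, G (x, u))) : nu >< unif ->M borel" by measurable
 define D where "D x u = (if norm (G (x, u) - x) <= C * dl then G (x, u) - x else 0)" for x u
 have D_meas[measurable]: "(%(x, u). D x u) : borel_measurable (nu >< unif)" unfolding D_def by measurable
 have D_le: "norm (D x u) <= C * dl" for x u using C_nonneg dl by (simp add: D_def)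
 have D_u[measurable]: "D x : borel_measurable unif" for x using measurable_Pair2[OF D_meas, of x] by simp
 have D_int: "integrable unif (D x)" for x by (rule U.integrable_const_bound[of _ "C * dl"]) (auto simp: D_le)
 define b where "b x = (LINT u|unif. D x u) /\<^sub>R dl" for x
 have b_meas: "b : borel_measurable borel"
 proof -
  have "(%x. LINT u|unif. D x u) : borel_measurable nu" by (rule U.borel_measurable_lebesgue_integral) measurable
  then show ?thesis unfolding b_def by (simp cong: measurable_cong_sets)
 qed
 have b_le: "norm (b x) <= C" for x
 proof -
  have "norm (LINT u|unif. D x u) <= (LINT u|unif. norm (D x u))" by (rule integral_norm_bound)
  also have "... <= (LINT u|unif. C * dl)" by (intro integral_mono integrable_norm D_int) (auto simp: D_le)
  finally have "norm (LINT u|unif. D x u) <= C * dl" using U.prob_space by simp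
  then show ?thesis using dl by (simp add: b_def field_simps)
 qed
 have closeG: "AE p in nu >< unif. norm (G p - fst p) <= C * dl"
 proof -
  have "AE q in rho. norm (snd q - fst q) <= C * dl"
   unfolding rho_def using close[of i] by (subst AE_distr_iff[OF pair_meas]) (auto simp: dl_def)
  then have "AE p in nu >< unif. norm (snd ((%(x, u). (x, G (x, u))) p) - fst ((%(x, u). (x, G (x, u))) p)) <= C * dl"
   unfolding G_law[symmetric] by (rule AE_distrD[OF GM])
  then show ?thesis by (simp add: case_prod_beta)
 qed
 have "(LINT y|Lam. g (y 1) <.> (y (i + 2) - y 1)) = dl * (LINT x|nu. g x <.> b x)"
  if g: "g : borel_measurable borel" "bounded (range g)" for g
 proof -
  note [measurable] = g(1)
  obtain K where K: "!!x. norm (g x) <= K" using g(2) by (auto simp: bounded_iff)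
  have K0: "K >= 0" using order_trans[OF norm_ge_zero K] .
  define phi where "phi p = g (fst p) <.> (snd p - fst p)" for p :: "'a * 'a"
  have [measurable]: "phi : borel_measurable borel" unfolding phi_def by measurable
  have "(LINT y|Lam. g (y 1) <.> (y (i + 2) - y 1)) = (LINT p|rho. phi p)"
   unfolding rho_def by (subst integral_distr[OF pair_meas]) (auto simp: phi_def)
  also have "... = (LINT p|(nu >< unif). phi ((%(x, u). (x, G (x, u))) p))"
   unfolding G_law[symmetric] by (rule integral_distr[OF GM]) measurable
  also have "... = (LINT p|(nu >< unif). g (fst p) <.> D (fst p) (snd p))"
  proof (rule integral_cong_AE)
   show "AE p in nu >< unif. phi ((%(x, u). (x, G (x, u))) p) = g (fst p) <.> D (fst p) (snd p)"
    using closeG by eventually_elim (auto simp: phi_def D_def case_prod_beta)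
  qed measurable
  also have "... = (LINT x|nu. (LINT u|unif. g x <.> D x u))"
  proof -
   have "integrable (nu >< unif) (%p. g (fst p) <.> D (fst p) (snd p))"
   proof (rule NU.P.integrable_const_bound[of _ "K * (C * dl)"])
    have "\<bar>g x <.> D x u\<bar> <= K * (C * dl)" for x u
     by (rule order_trans[OF Cauchy_Schwarz_ineq2]) (intro mult_mono K D_le K0 norm_ge_zero)
    then show "AE p in nu >< unif. norm (g (fst p) <.> D (fst p) (snd p)) <= K * (C * dl)" by simp
   qed measurable
   from NU.integral_fst'[OF this] show ?thesis by simp
  qed
  also have "... = (LINT x|nu. dl * (g x <.> b x))"
   using dl D_int by (intro bo_integral_cong) (auto simp: b_def)
  finally show ?thesis by simp
 qed
 then show ?thesis using b_meas b_le unfolding dl_def by blast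
qed

definition mean_velocity :: "nat => 'a => 'a" where
 "mean_velocity i = (SOME b. b : borel_measurable borel & (ALL x. norm (b x) <= C) &
   (ALL g. g : borel_measurable borel & bounded (range g) -->
    (LINT y|Lam. g (y 1) <.> (y (i + 2) - y 1)) = (1/2) ^ i * (LINT x|nu. g x <.> b x)))"

lemma mean_velocity:
 shows "mean_velocity i : borel_measurable borel" "norm (mean_velocity i x) <= C"
  "g : borel_measurable borel ==> bounded (range g) ==>
    (LINT y|Lam. g (y 1) <.> (y (i + 2) - y 1)) = (1/2) ^ i * (LINT x|nu. g x <.> mean_velocity i x)"
 using someI_ex[OF ex_mean_velocity[of i]] unfolding mean_velocity_def by blast+

text \<open>The assumption on the drift gives convergence against Lipschitz functions, which are dense, and the mean velocities are
 bounded.\<close>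

lemma mean_velocity_weak_limit:
 assumes g: "g : borel_measurable borel" "bounded (range g)"
 shows "(%i. LINT x|nu. g x <.> (mean_velocity i x - vb x)) ----> 0"
proof (rule LIMSEQ_I)
 fix e :: real assume e: "e > 0"
 note [measurable] = g(1) mean_velocity(1) vb(1)
 obtain K where K: "!!x. norm (g x) <= K" using g(2) by (auto simp: bounded_iff)
 define e' where "e' = e / (2 * (2 * C + 1))"
 have e': "e' > 0" using e C_nonneg by (simp add: e'_def)
 have gi: "integrable nu g" by (rule N.integrable_const_bound[of _ K]) (auto simp: K intro: meas_nu g)
 obtain w where w: "bounded_lipschitz w" "(LINT x|nu. norm (g x - w x)) < e'"
  using bounded_lipschitz_dense_L1[OF N.finite_measure_axioms sets_nu gi e'] by blast
 obtain L K' where K': "!!x. norm (w x) <= K'" using bounded_lipschitzE[OF w(1)] by metis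
 have wb: "bounded (range w)" using K' by (auto simp: bounded_iff)
 have [measurable]: "w : borel_measurable borel" by (rule bounded_lipschitz_measurable[OF w(1)])
 obtain K1 where K1: "!!i. \<bar>(LINT y|Lam. w (y 1) <.> (y (i + 2) - y 1)) - (1/2) ^ i * (LINT x|nu. w x <.> vb x)\<bar> <= K1 * ((1/2) ^ i)\<^sup>2"
  using drift[OF w(1)] by blast
 define beta where "beta i x = mean_velocity i x - vb x" for i x
 have betam[measurable]: "beta i : borel_measurable borel" for i unfolding beta_def by measurable
 have betab: "norm (beta i x) <= 2 * C" for i x
  unfolding beta_def using norm_triangle_ineq4[of "mean_velocity i x" "vb x"] mean_velocity(2)[of i x] vb(2)[of x] by simp
 have inti: "integrable nu (%x. f x <.> v x)" if [measurable]: "f : borel_measurable borel" "v : borel_measurable borel"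
  and fv: "!!x. norm (f x) <= Kf" "!!x. norm (v x) <= Kv" for f v :: "'a => 'a" and Kf Kv
 proof (rule N.integrable_const_bound[of _ "Kf * Kv"])
  have "0 <= Kf" using order_trans[OF norm_ge_zero fv(1)] .
  then have "\<bar>f x <.> v x\<bar> <= Kf * Kv" for x
   by (intro order_trans[OF Cauchy_Schwarz_ineq2] mult_mono fv) auto
  then show "AE x in nu. norm (f x <.> v x) <= Kf * Kv" by simp
  show "(%x. f x <.> v x) : borel_measurable nu" by (rule meas_nu) measurable
 qed
 have wbeta: "\<bar>\<integral>x. w x <.> beta i x \<partial>nu\<bar> <= K1 * (1/2) ^ i" for i
 proof -
  have "(LINT x|nu. w x <.> beta i x) = (LINT x|nu. w x <.> mean_velocity i x) - (LINT x|nu. w x <.> vb x)"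
   unfolding beta_def inner_diff_right
   by (intro bo_integral_diff inti[OF _ _ K' mean_velocity(2)] inti[OF _ _ K' vb(2)]) measurable
  then have "(1/2) ^ i * (LINT x|nu. w x <.> beta i x) = (LINT y|Lam. w (y 1) <.> (y (i + 2) - y 1)) - (1/2) ^ i * (LINT x|nu. w x <.> vb x)"
   using mean_velocity(3)[OF bounded_lipschitz_measurable[OF w(1)] wb, of i] by (simp only: right_diff_distrib)
  then have "\<bar>(1/2) ^ i * (LINT x|nu. w x <.> beta i x)\<bar> <= K1 * ((1/2) ^ i)\<^sup>2"
   using K1[of i] by (simp only:)
  then have "(1/2) ^ i * \<bar>\<integral>x. w x <.> beta i x \<partial>nu\<bar> <= K1 * ((1/2) ^ i)\<^sup>2" by (simp add: abs_mult)
  also have "... = (1/2) ^ i * (K1 * (1/2) ^ i)" by (simp add: power2_eq_square)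
  finally show ?thesis by (subst (asm) mult_le_cancel_left_pos) auto
 qed
 have "(%i. K1 * (1/2) ^ i) ----> K1 * 0" by (intro tendsto_intros LIMSEQ_power_zero) auto
 then have "eventually (%i. K1 * (1/2) ^ i < e / 2) sequentially"
  using e by (intro order_tendstoD(2)) auto
 then obtain i0 where i0: "!!i. i >= i0 ==> K1 * (1/2) ^ i < e / 2" by (auto simp: eventually_sequentially)
 have "norm ((LINT x|nu. g x <.> beta i x) - 0) < e" if "i >= i0" for i
 proof -
  have wi: "integrable nu w"
   by (rule N.integrable_const_bound[of _ K']) (auto simp: K' intro: meas_nu bounded_lipschitz_measurable w)
  have "(LINT x|nu. g x <.> beta i x) - (LINT x|nu. w x <.> beta i x) = (LINT x|nu. (g x - w x) <.> beta i x)"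
   unfolding inner_diff_left
   by (intro bo_integral_diff[symmetric] inti[OF _ _ K betab] inti[OF _ _ K' betab]) measurable
  also have "\<bar>...\<bar> <= (LINT x|nu. norm (g x - w x) * (2 * C))"
  proof (rule order_trans[OF integral_abs_bound])
   show "(LINT x|nu. \<bar>(g x - w x) <.> beta i x\<bar>) <= (LINT x|nu. norm (g x - w x) * (2 * C))"
   proof (rule integral_mono)
    have "norm (g x - w x) <= K + K'" for x by (rule order_trans[OF norm_triangle_ineq4]) (intro add_mono K K')
    then show "integrable nu (%x. \<bar>(g x - w x) <.> beta i x\<bar>)"
     by (intro integrable_abs inti[OF _ _ _ betab]) measurable
    show "integrable nu (%x. norm (g x - w x) * (2 * C))" using gi wi by simp
    show "\<bar>(g x - w x) <.> beta i x\<bar> <= norm (g x - w x) * (2 * C)" for x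
     by (rule order_trans[OF Cauchy_Schwarz_ineq2]) (intro mult_left_mono betab norm_ge_zero)
   qed
  qed
  also have "... = (LINT x|nu. norm (g x - w x)) * (2 * C)" by simp
  also have "... <= e' * (2 * C)" using w(2) C_nonneg by (intro mult_right_mono) auto
  also have "... < e / 2" using e C_nonneg by (simp add: e'_def field_simps)
  finally show ?thesis using wbeta[of i] i0[OF that] unfolding real_norm_def by linarith
 qed
 then show "EX no. ALL i>=no. norm ((LINT x|nu. g x <.> (mean_velocity i x - vb x)) - 0) < e"
  unfolding beta_def by blast
qed

lemma ex_averaged_velocity:
 assumes "e > 0"
 shows "EX F. finite F & F ~= {} & F \<subseteq> {n..} &
  (LINT x|nu. norm ((\<Sum>i\<in>F. mean_velocity i x) /\<^sub>R real (card F) - vb x)) <= e"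
proof -
 note [measurable] = mean_velocity(1) vb(1)
 have "EX F. finite F & F ~= {} & F \<subseteq> {n..} &
   (LINT x|nu. norm ((\<Sum>i\<in>F. mean_velocity i x - vb x) /\<^sub>R real (card F))) <= e"
 proof (rule bounded_weak_null_averages[where C="2 * C"])
  show "norm (mean_velocity i x - vb x) <= 2 * C" for i x
   using norm_triangle_ineq4[of "mean_velocity i x" "vb x"] mean_velocity(2)[of i x] vb(2)[of x] by simp
  show "(%i. LINT x|nu. g x <.> (mean_velocity i x - vb x)) ----> 0"
   if "g : borel_measurable nu" "bounded (range g)" for g
   using that by (intro mean_velocity_weak_limit) (auto cong: measurable_cong_sets)
  show "(%x. mean_velocity i x - vb x) : borel_measurable nu" for i by (rule meas_nu) measurable
 qed (auto simp: N.prob_space_axioms assms)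
 then obtain F where F: "finite F" "F ~= {}" "F \<subseteq> {n..}"
   "(LINT x|nu. norm ((\<Sum>i\<in>F. mean_velocity i x - vb x) /\<^sub>R real (card F))) <= e" by blast
 have "(\<Sum>i\<in>F. mean_velocity i x - vb x) /\<^sub>R real (card F) = (\<Sum>i\<in>F. mean_velocity i x) /\<^sub>R real (card F) - vb x" for x
  using F by (simp add: sum_subtractf scaleR_diff_right sum_constant_scaleR)
 then show ?thesis using F by auto
qed

end

section \<open>The one-step kernel\<close>

context mimicking
begin

text \<open>With step \<open>eta = (1/2) ^ m\<close>, displacement \<open>i\<close> is used with probability \<open>p i = eta / (1/2) ^ i\<close>, and otherwise the chain stays put.
 This makes the mean velocity per step equal to \<open>mean_velocity i\<close> for each \<open>i\<close>, and hence equal to the average of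
 these over the set \<open>F\<close> for an equally weighted mixture. A second moment of order \<open>eta * (1/2) ^ i\<close> per step is small
 compared with \<open>eta\<close> for large \<open>i\<close>. Randomization turns the mixture of couplings into a function of the position and a uniform
 variable.\<close>

lemma one_step_kernel:
 assumes e: "e > 0"
 shows "EX m Gam c. (1/2) ^ m <= e & Gam : borel_measurable borel & c : borel_measurable borel &
  (ALL x u. x \<notin> B --> Gam (x, u) = x) & (ALL x:B. ALL u. Gam (x, u) : B) &
  distr (nu >< unif) borel Gam = nu &
  (LINT p|(nu >< unif). (norm (Gam p - fst p))\<^sup>2) <= (1/2) ^ m * e &
  (ALL x. (1/2) ^ m *R c x = (LINT u|unif. Gam (x, u) - x)) &
  (AE x in nu. norm (c x) <= C) & (LINT x|nu. norm (c x - vb x)) <= e"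
proof -
 have "(%i. C\<^sup>2 * (1/2) ^ i) ----> C\<^sup>2 * 0" by (intro tendsto_intros LIMSEQ_power_zero) auto
 then have "eventually (%i. C\<^sup>2 * (1/2) ^ i < e) sequentially" using e by (intro order_tendstoD(2)) auto
 then obtain N0 where N0: "!!i. i >= N0 ==> C\<^sup>2 * (1/2) ^ i < e" by (auto simp: eventually_sequentially)
 obtain F where F: "finite F" "F ~= {}" "F \<subseteq> {N0..}"
  and Fe: "(LINT x|nu. norm ((\<Sum>i\<in>F. mean_velocity i x) /\<^sub>R real (card F) - vb x)) <= e"
  using ex_averaged_velocity[OF e] by blast
 define n where "n = real (card F)"
 have n: "n > 0" using F by (simp add: n_def card_gt_0_iff)
 obtain k where k: "(1/2::real) ^ k < e" using real_arch_pow_inv[of e "1/2"] e by auto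
 define m where "m = Max (insert k F)"
 have mF: "i <= m" if "i : F" for i unfolding m_def using that F by (intro Max_ge) auto
 have mk: "k <= m" using F by (simp add: m_def)
 have "(1/2::real) ^ m <= (1/2) ^ k" using mk by (intro power_decreasing) auto
 then have me: "(1/2::real) ^ m <= e" using k by linarith
 define eta :: real where "eta = (1/2) ^ m"
 have eta: "eta > 0" by (simp add: eta_def)
 define p :: "nat => real" where "p i = (1/2) ^ (m - i)" for i
 have p: "0 <= p i" "p i <= 1" for i by (auto simp: p_def power_le_one)
 have pdl: "p i * (1/2) ^ i = eta" if "i : F" for i
  using mF[OF that] by (simp add: p_def eta_def flip: power_add)
 define q where "q = bind_pmf (pmf_of_set F) (%i. map_pmf (%h. if h then i + 2 else 1) (bernoulli_pmf (p i)))"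
 have Eq: "(LINT j|(measure_pmf q). f j) = (\<Sum>i\<in>F. p i * f (i + 2) + (1 - p i) * f 1) / n" for f :: "nat => real"
 proof -
  have "(LINT j|(measure_pmf q). f j) = (\<Sum>i\<in>F. pmf (pmf_of_set F) i *R
    (\<integral>j. f j \<partial>measure_pmf (map_pmf (%h. if h then i + 2 else 1) (bernoulli_pmf (p i)))))"
   unfolding q_def using F by (intro pmf_expectation_bind) auto
  also have "... = (\<Sum>i\<in>F. (1 / n) * (p i * f (i + 2) + (1 - p i) * f 1))"
   using F p by (intro sum.cong) (auto simp: n_def mult.commute)
  finally show ?thesis by (simp add: sum_divide_distrib)
 qed
 have set_q: "set_pmf q \<subseteq> insert 1 (range (%i. i + 2))"
  using F by (auto simp: q_def split: if_splits)
 have law_q: "distr Lam borel (%y. y j) = nu" if "j : set_pmf q" for j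
  using that set_q law law1 by auto
 have Qm[measurable]: "(%(j, y). (y 1, y j)) : measure_pmf q >< Lam ->M borel"
 proof -
  have "(%z. (snd z 1, snd z (fst z))) : measure_pmf q >< Lam ->M borel"
  proof (rule measurable_compose_countable[where f="%j z. (snd z 1, snd z j)" and g=fst])
   show "(%z. (snd z 1, snd z j)) : measure_pmf q >< Lam ->M borel" for j
    by (rule mcompose[OF measurable_snd pair_meas])
   show "fst : measure_pmf q >< Lam ->M count_space UNIV" by measurable
  qed
  then show ?thesis by (simp add: case_prod_beta)
 qed
 interpret Q: pair_prob_space "measure_pmf q" Lam ..
 define rho where "rho = distr (measure_pmf q >< Lam) borel (%(j, y). (y 1, y j))"
 have rho1: "prob_space rho" unfolding rho_def by (rule Q.prob_space_distr[OF Qm])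
 interpret rho: prob_space rho by fact
 have rho2[simp]: "sets rho = sets borel" by (simp add: rho_def)
 have fs[measurable]: "fst : rho ->M borel" "snd : rho ->M borel" by (rule measurable_fst_snd_borel[OF rho2])+
 have fstrho: "distr rho borel fst = nu" and sndrho: "distr rho borel snd = nu"
 proof -
  have gen: "distr (measure_pmf q >< Lam) borel (%(j, y). y (J j)) = nu"
   if J: "!!j. j : set_pmf q ==> distr Lam borel (%y. y (J j)) = nu" for J :: "nat => nat"
  proof (rule measure_eqI)
   have m: "(%(j, y). y (J j)) : measure_pmf q >< Lam ->M borel"
   proof -
    have "(%z. snd z (J (fst z))) : measure_pmf q >< Lam ->M borel"
    proof (rule measurable_compose_countable[where f="%j z. snd z (J j)" and g=fst])
     show "(%z. snd z (J j)) : measure_pmf q >< Lam ->M borel" for j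
      by (rule mcompose[OF measurable_snd coord_meas])
     show "fst : measure_pmf q >< Lam ->M count_space UNIV" by measurable
    qed
    then show ?thesis by (simp add: case_prod_beta)
   qed
   fix A assume "A : sets (distr (measure_pmf q >< Lam) borel (%(j, y). y (J j)))"
   then have A[measurable]: "A : sets borel" by simp
   have "emeasure (distr (measure_pmf q >< Lam) borel (%(j, y). y (J j))) A =
    (\<integral>\<^sup>+x. indicator A x \<partial>distr (measure_pmf q >< Lam) borel (%(j, y). y (J j)))" by simp
   also have "... = (\<integral>\<^sup>+z. indicator A (case z of (j, y) => y (J j)) \<partial>(measure_pmf q >< Lam))"
    by (rule nn_integral_distr[OF m]) simp
   also have "... = (\<integral>\<^sup>+j. \<integral>\<^sup>+y. indicator A (y (J j)) \<partial>Lam \<partial>measure_pmf q)"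
    using mcompose[OF m borel_measurable_indicator[OF A]]
    by (subst L.nn_integral_fst[symmetric]) auto
   also have "... = (\<integral>\<^sup>+j. emeasure nu A \<partial>measure_pmf q)"
   proof (rule nn_integral_cong_AE, rule AE_pmfI)
    fix j assume "j : set_pmf q"
    have "(\<integral>\<^sup>+y. indicator A (y (J j)) \<partial>Lam) = (\<integral>\<^sup>+x. indicator A x \<partial>distr Lam borel (%y. y (J j)))"
     by (rule nn_integral_distr[OF coord_meas, symmetric]) simp
    then show "(\<integral>\<^sup>+y. indicator A (y (J j)) \<partial>Lam) = emeasure nu A" using J[OF \<open>j : set_pmf q\<close>] by simp
   qed
   also have "... = emeasure nu A" by simp
   finally show "emeasure (distr (measure_pmf q >< Lam) borel (%(j, y). y (J j))) A = emeasure nu A" .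
  qed simp
  show "distr rho borel fst = nu"
   using gen[of "%_. 1", OF law1] unfolding rho_def
   by (subst distr_distr[OF borel_measurable_fst_snd(1) Qm]) (simp add: comp_def split_beta')
  show "distr rho borel snd = nu"
   using gen[of "%j. j", OF law_q] unfolding rho_def
   by (subst distr_distr[OF borel_measurable_fst_snd(2) Qm]) (simp add: comp_def split_beta')
 qed
 have Erho: "(LINT z|rho. phi z) = (\<Sum>i\<in>F. p i * (LINT y|Lam. phi (y 1, y (i + 2))) + (1 - p i) * (LINT y|Lam. phi (y 1, y 1))) / n"
  if phi[measurable]: "phi : borel_measurable borel" and K: "!!z. \<bar>phi z\<bar> <= K" for phi :: "'a * 'a => real" and K
 proof -
  have "(LINT z|rho. phi z) = (LINT z|(measure_pmf q >< Lam). phi ((%(j, y). (y 1, y j)) z))"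
   unfolding rho_def by (rule integral_distr[OF Qm phi])
  also have "... = (LINT j|(measure_pmf q). (LINT y|Lam. phi (y 1, y j)))"
  proof -
   have "integrable (measure_pmf q >< Lam) (%z. phi ((%(j, y). (y 1, y j)) z))"
   proof (rule Q.P.integrable_const_bound[of _ K])
    show "(%z. phi ((%(j, y). (y 1, y j)) z)) : borel_measurable (measure_pmf q >< Lam)"
     by (rule mcompose[OF Qm phi])
   qed (simp add: K)
   from Q.integral_fst'[OF this] show ?thesis by simp
  qed
  finally show ?thesis unfolding Eq .
 qed
 have rho3: "AE z in rho. norm (snd z) < R"
 proof -
  have "AE x in distr rho borel snd. norm x < R" unfolding sndrho using B(3) by eventually_elim (rule B(2))
  then show ?thesis by (rule AE_distrD[OF fs(2)])
 qed
 obtain G where G[measurable]: "G : borel_measurable borel"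
  and G_law: "distr (nu >< unif) borel (%(x, u). (x, G (x, u))) = rho"
  using ex_randomization[OF rho1 rho2 rho3] unfolding fstrho by blast
 have GM: "(%(x, u). (x, G (x, u))) : nu >< unif ->M borel" by measurable
 have GM': "G : nu >< unif ->M borel"
  using mcompose[OF GM borel_measurable_fst_snd(2)] by (simp add: case_prod_beta)
 have G_snd: "distr (nu >< unif) borel G = nu"
 proof -
  have "distr rho borel snd = distr (nu >< unif) borel G"
   unfolding G_law[symmetric] by (subst distr_distr[OF borel_measurable_fst_snd(2) GM]) (simp add: comp_def case_prod_beta)
  then show ?thesis using sndrho by simp
 qed
 define Gam where "Gam z = (if fst z : B & G z : B then G z else fst z)" for z
 have Gam_meas[measurable]: "Gam : borel_measurable borel" unfolding Gam_def by measurable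
 have GamG: "AE z in nu >< unif. Gam z = G z"
 proof -
  have 1: "AE z in nu >< unif. fst z : B"
  proof -
   have "AE z in rho. fst z : B" using B(3) unfolding fstrho[symmetric] by (rule AE_distrD[OF fs(1)])
   then have "AE z in nu >< unif. fst ((%(x, u). (x, G (x, u))) z) : B"
    unfolding G_law[symmetric] by (rule AE_distrD[OF GM])
   then show ?thesis by (simp add: case_prod_beta)
  qed
  have "AE x in distr (nu >< unif) borel G. x : B" unfolding G_snd by (rule B(3))
  then have 2: "AE z in nu >< unif. G z : B" by (rule AE_distrD[OF GM'])
  from 1 2 show ?thesis by eventually_elim (simp add: Gam_def)
 qed
 have GamM: "Gam : nu >< unif ->M borel" unfolding Gam_def using GM' by measurable
 have Gam_law: "distr (nu >< unif) borel Gam = nu"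
 proof -
  have "distr (nu >< unif) borel Gam = distr (nu >< unif) borel G"
   by (rule distr_cong_AE) (use GamG GamM GM' in auto)
  then show ?thesis using G_snd by simp
 qed
 have Gam_pair: "(%z. (fst z, Gam z)) : nu >< unif ->M borel"
  by (intro borel_measurable_Pair GamM) measurable
 have EGam: "(LINT z|(nu >< unif). phi (fst z, Gam z)) = (LINT z|rho. phi z)"
  if phi[measurable]: "phi : borel_measurable borel" for phi :: "'a * 'a => real"
 proof -
  have "(LINT z|rho. phi z) = (LINT z|(nu >< unif). phi ((%(x, u). (x, G (x, u))) z))"
   unfolding G_law[symmetric] by (rule integral_distr[OF GM phi])
  also have "... = (LINT z|(nu >< unif). phi (fst z, Gam z))"
   using GamG mcompose[OF GM phi] mcompose[OF Gam_pair phi]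
   by (intro integral_cong_AE) (auto elim!: eventually_mono simp: case_prod_beta)
  finally show ?thesis by simp
 qed
 have disp: "norm (Gam z - fst z) <= 2 * R" for z
 proof (cases "fst z : B & G z : B")
  case True
  then show ?thesis
   using norm_triangle_ineq4[of "G z" "fst z"] B(2)[of "G z"] B(2)[of "fst z"] by (simp add: Gam_def)
 qed (use R_pos in \<open>auto simp: Gam_def\<close>)
 have Gamx[measurable]: "(%u. Gam (x, u)) : borel_measurable unif" for x
  using measurable_Pair2[OF GamM, of x] by simp
 define c where "c x = (LINT u|unif. Gam (x, u) - x) /\<^sub>R eta" for x
 have disp_int: "integrable unif (%u. Gam (x, u) - x)" for x
  by (rule U.integrable_const_bound[of _ "2 * R"]) (use disp[of "(x, _)"] in auto)
 have c_meas[measurable]: "c : borel_measurable borel"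
 proof -
  have "(%x. LINT u|unif. Gam (x, u) - x) : borel_measurable nu"
  proof (rule U.borel_measurable_lebesgue_integral)
   have "(%z. Gam z - fst z) : borel_measurable (nu >< unif)" using GamM by measurable
   then show "(%(x, u). Gam (x, u) - x) : borel_measurable (nu >< unif)" by (simp add: case_prod_beta)
  qed
  then show ?thesis unfolding c_def by (simp cong: measurable_cong_sets)
 qed
 have c_le: "norm (c x) <= 2 * R / eta" for x
 proof -
  have "norm (LINT u|unif. Gam (x, u) - x) <= (LINT u|unif. norm (Gam (x, u) - x))" by (rule integral_norm_bound)
  also have "... <= (LINT u|unif. 2 * R)"
   by (intro integral_mono integrable_norm disp_int) (use disp[of "(x, _)"] in auto)
  finally show ?thesis using U.prob_space eta by (simp add: c_def field_simps)
 qed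
 define bb where "bb x = (\<Sum>i\<in>F. mean_velocity i x) /\<^sub>R real (card F)" for x
 note [measurable] = mean_velocity(1) vb(1)
 have bb_meas[measurable]: "bb : borel_measurable borel" unfolding bb_def by measurable
 have bb_le: "norm (bb x) <= C" for x
 proof -
  have "norm (\<Sum>i\<in>F. mean_velocity i x) <= real (card F) * C"
   using norm_sum[of "%i. mean_velocity i x" F] sum_bounded_above[of F "%i. norm (mean_velocity i x)" C] mean_velocity(2)
   by (auto intro: order_trans)
  then show ?thesis using n by (simp add: bb_def n_def field_simps)
 qed
 have BB: "indicat_real (B \<times> B) : borel_measurable borel"
  using B(1) by (intro borel_measurable_indicator) (simp add: borel_closed closed_Times compact_imp_closed)
 have AE_BB: "AE y in Lam. (y 1, y (i + 2)) : B \<times> B" for i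
  using AE_coord_B(1) AE_coord_B(2)[of i] by eventually_elim auto
 have AE_GamB: "AE z in nu >< unif. (fst z, Gam z) : B \<times> B"
 proof -
  have "AE x in distr (nu >< unif) borel Gam. x : B" unfolding Gam_law by (rule B(3))
  then have "AE z in nu >< unif. Gam z : B" by (rule AE_distrD[OF GamM])
  then show ?thesis by eventually_elim (auto simp: Gam_def split: if_splits)
 qed
 have mean: "(LINT x|nu. g x <.> c x) = (LINT x|nu. g x <.> bb x)" if g: "g : borel_measurable borel" "bounded (range g)" for g
 proof -
  note [measurable] = g(1)
  obtain K where K: "!!x. norm (g x) <= K" using g(2) by (auto simp: bounded_iff)
  have K0: "K >= 0" using order_trans[OF norm_ge_zero K] .
  define phi where "phi z = indicat_real (B \<times> B) z * (g (fst z) <.> (snd z - fst z))" for z :: "'a * 'a"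
  have phim: "phi : borel_measurable borel" unfolding phi_def using BB by measurable
  have phiK: "\<bar>phi z\<bar> <= K * (2 * R)" for z
  proof (cases "z : B \<times> B")
   case True
   then have "norm (snd z - fst z) <= 2 * R"
    using norm_triangle_ineq4[of "snd z" "fst z"] B(2)[of "snd z"] B(2)[of "fst z"] by (auto simp: mem_Times_iff)
   then have "\<bar>g (fst z) <.> (snd z - fst z)\<bar> <= K * (2 * R)"
    by (intro order_trans[OF Cauchy_Schwarz_ineq2] mult_mono K K0) auto
   then show ?thesis using True by (simp add: phi_def)
  qed (use K0 R_pos in \<open>auto simp: phi_def\<close>)
  have yphi: "(LINT y|Lam. phi (y 1, y (i + 2))) = (1/2) ^ i * (LINT x|nu. g x <.> mean_velocity i x)" for i
  proof -
   have "(LINT y|Lam. phi (y 1, y (i + 2))) = (LINT y|Lam. g (y 1) <.> (y (i + 2) - y 1))"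
   proof (rule integral_cong_AE)
    show "AE y in Lam. phi (y 1, y (i + 2)) = g (y 1) <.> (y (i + 2) - y 1)"
     using AE_BB[of i] by eventually_elim (simp add: phi_def)
    show "(%y. phi (y 1, y (i + 2))) : borel_measurable Lam" by (rule mcompose[OF pair_meas phim])
    show "(%y. g (y 1) <.> (y (i + 2) - y 1)) : borel_measurable Lam"
     by (intro borel_measurable_inner borel_measurable_diff coord_meas mcompose[OF coord_meas g(1)])
   qed
   then show ?thesis using mean_velocity(3)[OF g, of i] by simp
  qed
  have gi: "integrable nu (%x. g x <.> mean_velocity i x)" for i
  proof (rule N.integrable_const_bound[of _ "K * C"])
   have "\<bar>g x <.> mean_velocity i x\<bar> <= K * C" for x
    by (intro order_trans[OF Cauchy_Schwarz_ineq2] mult_mono K K0 mean_velocity(2)) auto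
   then show "AE x in nu. norm (g x <.> mean_velocity i x) <= K * C" by simp
  qed (auto intro!: meas_nu)
  have "eta * (LINT x|nu. g x <.> c x) = (LINT x|nu. (LINT u|unif. g x <.> (Gam (x, u) - x)))"
  proof -
   have "(LINT u|unif. g x <.> (Gam (x, u) - x)) = eta * (g x <.> c x)" for x
   proof -
    have "(LINT u|unif. g x <.> (Gam (x, u) - x)) = g x <.> (LINT u|unif. Gam (x, u) - x)"
     by (rule integral_inner_right) (rule disp_int)
    also have "(LINT u|unif. Gam (x, u) - x) = eta *R c x" using eta by (simp add: c_def)
    finally show ?thesis by simp
   qed
   then show ?thesis by simp
  qed
  also have "... = (LINT z|(nu >< unif). g (fst z) <.> (Gam z - fst z))"
  proof -
   have "integrable (nu >< unif) (%z. g (fst z) <.> (Gam z - fst z))"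
   proof (rule NU.P.integrable_const_bound[of _ "K * (2 * R)"])
    have "\<bar>g (fst z) <.> (Gam z - fst z)\<bar> <= K * (2 * R)" for z
     by (intro order_trans[OF Cauchy_Schwarz_ineq2] mult_mono K K0 disp) auto
    then show "AE z in nu >< unif. norm (g (fst z) <.> (Gam z - fst z)) <= K * (2 * R)" by simp
   qed (use GamM in measurable)
   from NU.integral_fst'[OF this] show ?thesis by simp
  qed
  also have "... = (LINT z|(nu >< unif). phi (fst z, Gam z))"
  proof (rule integral_cong_AE)
   show "AE z in nu >< unif. g (fst z) <.> (Gam z - fst z) = phi (fst z, Gam z)"
    using AE_GamB by eventually_elim (simp add: phi_def)
   show "(%z. phi (fst z, Gam z)) : borel_measurable (nu >< unif)" by (rule mcompose[OF Gam_pair phim])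
   show "(%z. g (fst z) <.> (Gam z - fst z)) : borel_measurable (nu >< unif)" using GamM by measurable
  qed
  also have "... = (LINT z|rho. phi z)" by (rule EGam[OF phim])
  also have "... = (\<Sum>i\<in>F. p i * ((1/2) ^ i * (LINT x|nu. g x <.> mean_velocity i x))) / n"
   unfolding Erho[OF phim phiK] yphi by (simp add: phi_def)
  also have "... = eta * ((\<Sum>i\<in>F. LINT x|nu. g x <.> mean_velocity i x) / n)"
  proof -
   have "(\<Sum>i\<in>F. p i * ((1/2) ^ i * (LINT x|nu. g x <.> mean_velocity i x))) = (\<Sum>i\<in>F. eta * (LINT x|nu. g x <.> mean_velocity i x))"
    by (intro sum.cong refl) (simp add: pdl flip: mult.assoc)
   then show ?thesis by (simp add: sum_distrib_left)
  qed
  also have "(\<Sum>i\<in>F. LINT x|nu. g x <.> mean_velocity i x) / n = (LINT x|nu. g x <.> bb x)"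
  proof -
   have "(LINT x|nu. g x <.> bb x) = (LINT x|nu. (\<Sum>i\<in>F. g x <.> mean_velocity i x) / n)"
    by (simp add: bb_def inner_sum_right n_def divide_inverse mult.commute)
   also have "... = (\<Sum>i\<in>F. LINT x|nu. g x <.> mean_velocity i x) / n"
    using gi by (simp add: bo_integral_sum)
   finally show ?thesis by simp
  qed
  finally show ?thesis using eta by simp
 qed
 have c_eq: "AE x in nu. c x = bb x"
 proof -
  define d where "d x = c x - bb x" for x
  have d_meas[measurable]: "d : borel_measurable borel" unfolding d_def by measurable
  have d_le: "norm (d x) <= 2 * R / eta + C" for x
   unfolding d_def by (rule order_trans[OF norm_triangle_ineq4]) (intro add_mono c_le bb_le)
  then have d_bd: "bounded (range d)" by (auto simp: bounded_iff)
  have d0: "0 <= 2 * R / eta + C" using order_trans[OF norm_ge_zero d_le] .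
  have dint: "integrable nu (%x. d x <.> v x)" if v: "v : borel_measurable borel" "!!x. norm (v x) <= K" for v :: "'a => 'a" and K
  proof (rule N.integrable_const_bound[of _ "(2 * R / eta + C) * K"])
   have "\<bar>d x <.> v x\<bar> <= (2 * R / eta + C) * K" for x
    by (intro order_trans[OF Cauchy_Schwarz_ineq2] mult_mono d_le d0 v) auto
   then show "AE x in nu. norm (d x <.> v x) <= (2 * R / eta + C) * K" by simp
   show "(%x. d x <.> v x) : borel_measurable nu" using v(1) by (intro meas_nu) measurable
  qed
  have "(LINT x|nu. d x <.> d x) = (LINT x|nu. d x <.> c x - d x <.> bb x)"
   by (intro bo_integral_cong) (auto simp: d_def inner_diff_right)
  also have "... = 0" using mean[OF d_meas d_bd] dint[OF c_meas c_le] dint[OF bb_meas bb_le] by simp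
  finally have "AE x in nu. d x <.> d x = 0"
   by (subst (asm) integral_nonneg_eq_0_iff_AE) (use dint[OF d_meas d_le] in auto)
  then show ?thesis by eventually_elim (simp add: d_def)
 qed
 have second: "(LINT p|(nu >< unif). (norm (Gam p - fst p))\<^sup>2) <= eta * e"
 proof -
  define phi where "phi z = indicat_real (B \<times> B) z * (norm (snd z - fst z))\<^sup>2" for z :: "'a * 'a"
  have phim: "phi : borel_measurable borel" unfolding phi_def using BB by measurable
  have phiK: "\<bar>phi z\<bar> <= (2 * R)\<^sup>2" for z
  proof (cases "z : B \<times> B")
   case True
   then have "norm (snd z - fst z) <= 2 * R"
    using norm_triangle_ineq4[of "snd z" "fst z"] B(2)[of "snd z"] B(2)[of "fst z"] by (auto simp: mem_Times_iff)
   then have "(norm (snd z - fst z))\<^sup>2 <= (2 * R)\<^sup>2" by (intro power_mono) auto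
   then show ?thesis using True by (simp add: phi_def)
  qed (auto simp: phi_def)
  have "(LINT p|(nu >< unif). (norm (Gam p - fst p))\<^sup>2) = (LINT z|(nu >< unif). phi (fst z, Gam z))"
  proof (rule integral_cong_AE)
   show "AE z in nu >< unif. (norm (Gam z - fst z))\<^sup>2 = phi (fst z, Gam z)"
    using AE_GamB by eventually_elim (simp add: phi_def)
   show "(%z. phi (fst z, Gam z)) : borel_measurable (nu >< unif)" by (rule mcompose[OF Gam_pair phim])
   show "(%z. (norm (Gam z - fst z))\<^sup>2) : borel_measurable (nu >< unif)" using GamM by measurable
  qed
  also have "... = (\<Sum>i\<in>F. p i * (LINT y|Lam. phi (y 1, y (i + 2)))) / n"
   unfolding EGam[OF phim] Erho[OF phim phiK] by (simp add: phi_def)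
  also have "... <= (\<Sum>i\<in>F. eta * e) / n"
  proof (intro divide_right_mono sum_mono)
   fix i assume i: "i : F"
   have "(LINT y|Lam. phi (y 1, y (i + 2))) <= (LINT y|Lam. (C * (1/2) ^ i)\<^sup>2)"
   proof (rule integral_mono_AE)
    show "AE y in Lam. phi (y 1, y (i + 2)) <= (C * (1/2) ^ i)\<^sup>2"
     using close[of i] by eventually_elim (auto simp: phi_def split: split_indicator intro!: power_mono)
    show "integrable Lam (%y. phi (y 1, y (i + 2)))"
     by (rule L.integrable_const_bound[of _ "(2 * R)\<^sup>2"]) (use phiK mcompose[OF pair_meas phim] in auto)
   qed simp
   also have "... = (1/2) ^ i * (C\<^sup>2 * (1/2) ^ i)" using L.prob_space by (simp add: power2_eq_square)
   finally have "p i * (LINT y|Lam. phi (y 1, y (i + 2))) <= p i * ((1/2) ^ i * (C\<^sup>2 * (1/2) ^ i))"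
    using p by (intro mult_left_mono) auto
   also have "... = eta * (C\<^sup>2 * (1/2) ^ i)" using pdl[OF i] by (simp flip: mult.assoc)
   also have "... <= eta * e" using N0[of i] i F(3) eta by (intro mult_left_mono) auto
   finally show "p i * (LINT y|Lam. phi (y 1, y (i + 2))) <= eta * e" .
  qed (use n in auto)
  also have "... = eta * e" using n by (simp add: n_def)
  finally show ?thesis .
 qed
 have "AE x in nu. norm (c x) <= C" using c_eq by eventually_elim (simp add: bb_le)
 moreover have "(LINT x|nu. norm (c x - vb x)) <= e"
 proof -
  have "(LINT x|nu. norm (c x - vb x)) = (LINT x|nu. norm (bb x - vb x))"
   by (rule integral_cong_AE) (use c_eq in \<open>auto elim!: eventually_mono intro!: meas_nu\<close>)
  then show ?thesis using Fe by (simp add: bb_def)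
 qed
 moreover have "eta *R c x = (LINT u|unif. Gam (x, u) - x)" for x using eta by (simp add: c_def)
 moreover have "ALL x u. x \<notin> B --> Gam (x, u) = x" "ALL x:B. ALL u. Gam (x, u) : B" by (auto simp: Gam_def)
 ultimately show ?thesis
  using me Gam_meas c_meas Gam_law second unfolding eta_def
  by (intro exI[of _ m] exI[of _ Gam] exI[of _ c]) auto
qed

end

section \<open>Chains driven by a kernel\<close>

lemma norm_power2_le: "norm v <= K ==> norm ((norm v)\<^sup>2) <= K\<^sup>2"
 by (simp add: power_mono)

primrec chain :: "('a * real => 'a) => nat => 'a => (nat => real) => 'a" where
 "chain Gam 0 x u = x"
| "chain Gam (Suc n) x u = chain Gam n (Gam (x, u 0)) (%k. u (Suc k))"

text \<open>The chain moves from \<open>x\<close> to \<open>Gam (x, u)\<close>; \<open>c\<close> is its mean velocity for the step \<open>eta\<close>.\<close>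

locale kernel = N: prob_space nu for nu :: "'a::euclidean_space measure" +
 fixes Gam :: "'a * real => 'a" and c :: "'a => 'a" and eta e C R :: real and B :: "'a set"
 assumes sets_nu [simp, measurable_cong]: "sets nu = sets borel"
  and Gam [measurable]: "Gam : borel_measurable borel" and c [measurable]: "c : borel_measurable borel"
  and Gam_out: "!!x u. x \<notin> B ==> Gam (x, u) = x" and Gam_in: "!!x u. x : B ==> Gam (x, u) : B"
  and invariant: "distr (nu >< unif) borel Gam = nu"
  and second_moment: "(LINT p|(nu >< unif). (norm (Gam p - fst p))\<^sup>2) <= eta * e"
  and mean: "!!x. eta *R c x = (LINT u|unif. Gam (x, u) - x)"
  and c_le: "AE x in nu. norm (c x) <= C"
  and eta: "eta > 0" and e: "e >= 0" and BR: "!!x. x : B ==> norm x < R" and R: "R > 0"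
begin

lemma space_nu [simp]: "space nu = UNIV"
 using sets_eq_imp_space_eq[OF sets_nu] by simp

sublocale U: prob_space unif by (rule prob_space_unif)
sublocale S: sequence_space unif
 by unfold_locales
sublocale NU: pair_prob_space nu unif ..
sublocale NS: pair_prob_space nu S.S ..
sublocale US: pair_prob_space unif S.S ..

abbreviation "Om \<equiv> nu >< S.S"

lemma shift_meas: "(%u k. u (Suc k)) : S.S ->M S.S"
 by (rule measurable_abs_UNIV) (rule measurable_component_singleton, simp)

lemma case_nat_meas: "(%(w, u). case_nat w u) : unif >< S.S ->M S.S"
 by measurable

lemma GamM: "Gam : nu >< unif ->M borel"
proof -
 have "sets (nu >< unif) = sets (borel :: ('a * real) measure)"
  unfolding borel_prod[symmetric] by (intro sets_pair_measure_cong) auto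
 then show ?thesis using Gam by (simp cong: measurable_cong_sets)
qed

definition T where "T = (%(x, u). (Gam (x, u (0::nat)), (%k. u (Suc k) :: real)))"

lemma T_meas [measurable]: "T : Om ->M Om"
proof -
 have "(%p. (fst p, snd p 0)) : Om ->M nu >< unif"
  by (intro measurable_Pair measurable_fst mcompose[OF measurable_snd measurable_component_singleton]) auto
 then have 1: "(%p. Gam (fst p, snd p 0)) : Om ->M borel" by (rule mcompose[OF _ GamM])
 have 2: "(%p k. snd p (Suc k)) : Om ->M S.S" by (rule mcompose[OF measurable_snd shift_meas])
 have "(%p. (Gam (fst p, snd p 0), %k. snd p (Suc k))) : Om ->M Om"
  using 1 2 by (intro measurable_Pair) (auto cong: measurable_cong_sets)
 then show ?thesis by (simp add: T_def split_beta')
qed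

lemma nn_integral_S: 
 assumes f: "f : borel_measurable S.S"
 shows "(\<integral>\<^sup>+u. f u \<partial>S.S) = (\<integral>\<^sup>+w. \<integral>\<^sup>+u. f (case_nat w u) \<partial>S.S \<partial>unif)"
proof -
 have "(\<integral>\<^sup>+u. f u \<partial>S.S) = (\<integral>\<^sup>+u. f u \<partial>distr (unif >< S.S) S.S (%(w, u). case_nat w u))"
  unfolding S.PiM_iter ..
 also have "... = (\<integral>\<^sup>+p. f ((%(w, u). case_nat w u) p) \<partial>(unif >< S.S))"
  by (rule nn_integral_distr[OF case_nat_meas]) (use f in simp)
 also have "... = (\<integral>\<^sup>+w. \<integral>\<^sup>+u. f (case_nat w u) \<partial>S.S \<partial>unif)"
  using mcompose[OF case_nat_meas f] by (subst S.nn_integral_fst[symmetric]) auto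
 finally show ?thesis .
qed

lemma integral_S:
 fixes f :: "(nat => real) => 'b::euclidean_space"
 assumes f: "f : borel_measurable S.S" and K: "!!u. norm (f u) <= K"
 shows "(LINT u|S.S. f u) = (LINT w|unif. (LINT u|S.S. f (case_nat w u)))"
proof -
 have "(LINT u|S.S. f u) = (\<integral>u. f u \<partial>distr (unif >< S.S) S.S (%(w, u). case_nat w u))"
  unfolding S.PiM_iter ..
 also have "... = (LINT p|(unif >< S.S). f ((%(w, u). case_nat w u) p))"
  by (rule integral_distr[OF case_nat_meas f])
 also have "... = (LINT w|unif. (LINT u|S.S. f (case_nat w u)))"
 proof -
  have "integrable (unif >< S.S) (%p. f ((%(w, u). case_nat w u) p))"
   by (rule US.P.integrable_const_bound[of _ K]) (use K mcompose[OF case_nat_meas f] in auto)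
  from US.integral_fst'[OF this] show ?thesis by simp
 qed
 finally show ?thesis .
qed

lemma T_preserves: "distr Om Om T = Om"
proof (rule measure_eqI)
 fix A assume "A : sets (distr Om Om T)"
 then have A[measurable]: "A : sets Om" by simp
 define Psi where "Psi y = (\<integral>\<^sup>+u. indicator A (y, u) \<partial>S.S)" for y
 have Psi: "Psi : borel_measurable borel"
 proof -
  have "Psi : borel_measurable nu" unfolding Psi_def by (rule S.borel_measurable_nn_integral_fst) measurable
  then show ?thesis by (simp cong: measurable_cong_sets)
 qed
 have iA: "(%p. indicator A (T p) :: ennreal) : borel_measurable Om" by measurable
 have "emeasure (distr Om Om T) A = (\<integral>\<^sup>+p. indicator A p \<partial>distr Om Om T)" using A by simp
 also have "... = (\<integral>\<^sup>+p. indicator A (T p) \<partial>Om)" by (rule nn_integral_distr) auto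
 also have "... = (\<integral>\<^sup>+x. \<integral>\<^sup>+u. indicator A (T (x, u)) \<partial>S.S \<partial>nu)"
  by (rule S.nn_integral_fst[symmetric, OF iA])
 also have "... = (\<integral>\<^sup>+x. \<integral>\<^sup>+w. Psi (Gam (x, w)) \<partial>unif \<partial>nu)"
 proof (rule nn_integral_cong)
  fix x
  have "(%u. indicator A (T (x, u)) :: ennreal) : borel_measurable S.S"
   using measurable_Pair2[OF iA, of x] by simp
  then show "(\<integral>\<^sup>+u. indicator A (T (x, u)) \<partial>S.S) = (\<integral>\<^sup>+w. Psi (Gam (x, w)) \<partial>unif)"
   by (subst nn_integral_S) (auto simp: Psi_def T_def)
 qed
 also have "... = (\<integral>\<^sup>+p. Psi (Gam p) \<partial>(nu >< unif))"
  using mcompose[OF GamM Psi] by (subst U.nn_integral_fst[symmetric]) auto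
 also have "... = (\<integral>\<^sup>+y. Psi y \<partial>distr (nu >< unif) borel Gam)" by (rule nn_integral_distr[symmetric, OF GamM]) (use Psi in simp)
 also have "... = (\<integral>\<^sup>+y. Psi y \<partial>nu)" unfolding invariant ..
 also have "... = (\<integral>\<^sup>+p. indicator A p \<partial>Om)" unfolding Psi_def by (rule S.nn_integral_fst) measurable
 also have "... = emeasure Om A" using A by simp
 finally show "emeasure (distr Om Om T) A = emeasure Om A" .
qed simp

lemma chain_meas: "(%p. chain Gam n (fst p) (snd p)) : Om ->M borel"
proof (induction n)
 case 0 
 show ?case using measurable_fst[of nu S.S] by (simp cong: measurable_cong_sets)
next
 case (Suc n)
 from mcompose[OF T_meas Suc] show ?case by (simp add: T_def split_beta')
qed

definition Y where "Y p n = chain Gam n (fst p) (snd p)"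

lemma Y_meas [measurable]: "Y : Om ->M borel"
 by (rule measurable_coordinatewise_then_product) (use chain_meas in \<open>simp add: Y_def\<close>)

lemma Y_T: "Y (T p) n = Y p (Suc n)"
 by (simp add: Y_def T_def split_beta')

definition path_law where "path_law = distr Om borel Y"

lemma prob_path_law: "prob_space path_law"
 unfolding path_law_def by (rule NS.prob_space_distr) simp
lemma sets_path_law: "sets path_law = sets borel" by (simp add: path_law_def)

lemma shift_seq_meas: "(%y n. y (n + s)) : (borel :: (nat => 'a) measure) ->M borel"
 by (rule measurable_coordinatewise_then_product) (rule measurable_coord)

lemma path_law_shift: "distr path_law borel (%y n. y (n + s)) = path_law"
proof (induction s)
 case 0
 show ?case using distr_id2[OF sets_path_law[symmetric]] by simp
next
 case (Suc s)
 have "distr path_law borel (%y n. y (n + Suc s)) = distr (distr path_law borel (%y n. y (n + s))) borel (%y n. y (n + 1))"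
  by (subst distr_distr[OF shift_seq_meas]) (use shift_seq_meas in \<open>auto simp: comp_def path_law_def cong: measurable_cong_sets\<close>)
 also have "... = distr Om borel (%p n. Y p (n + 1))"
  unfolding Suc unfolding path_law_def by (subst distr_distr[OF shift_seq_meas Y_meas]) (simp add: comp_def)
 also have "... = distr Om borel (Y \<circ> T)" by (rule arg_cong[where f="distr Om borel"]) (auto simp: Y_T fun_eq_iff)
 also have "... = distr (distr Om Om T) borel Y" by (rule distr_distr[symmetric]) auto
 also have "... = path_law" unfolding T_preserves path_law_def ..
 finally show ?case .
qed

lemma path_law_marginal: "distr path_law borel (%y. y k) = nu"
proof -
 have 0: "distr path_law borel (%y. y 0) = nu"
 proof -
  have "distr path_law borel (%y. y 0) = distr Om borel (%p. Y p 0)"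
   unfolding path_law_def by (subst distr_distr[OF measurable_coord Y_meas]) (simp add: comp_def)
  also have "... = distr Om nu fst" by (rule distr_cong) (auto simp: Y_def)
  also have "... = nu" by (rule S.distr_pair_fst)
  finally show ?thesis .
 qed
 have "distr path_law borel (%y. y k) = distr (distr path_law borel (%y n. y (n + k))) borel (%y. y 0)"
  by (subst distr_distr[OF measurable_coord]) (use shift_seq_meas in \<open>auto simp: comp_def path_law_def cong: measurable_cong_sets\<close>)
 then show ?thesis unfolding path_law_shift 0 .
qed

lemma Y_law: "distr Om borel (%p. Y p k) = nu"
proof -
 have "distr path_law borel (%y. y k) = distr Om borel (%p. Y p k)"
  unfolding path_law_def by (subst distr_distr[OF measurable_coord Y_meas]) (simp add: comp_def)
 then show ?thesis using path_law_marginal by simp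
qed

definition D where "D x w = Gam (x, w) - x - eta *R c x"

lemma disp: "norm (Gam (x, w) - x) <= 2 * R"
proof (cases "x : B")
 case True
 then show ?thesis using norm_triangle_ineq4[of "Gam (x, w)" x] BR[OF True] BR[OF Gam_in[OF True, of w]] by simp
qed (use Gam_out R in auto)

lemma Gamx: "(%u. Gam (x, u)) : borel_measurable unif"
 using measurable_Pair2[OF GamM, of x] by simp

lemma disp_int: "integrable unif (%u. Gam (x, u) - x)"
 by (rule U.integrable_const_bound[of _ "2 * R"]) (use disp Gamx in auto)

lemma etac_le: "norm (eta *R c x) <= 2 * R"
proof -
 have "norm (LINT u|unif. Gam (x, u) - x) <= (LINT u|unif. norm (Gam (x, u) - x))" by (rule integral_norm_bound)
 also have "... <= (LINT u|unif. 2 * R)" by (intro integral_mono integrable_norm disp_int) (auto simp: disp)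
 finally show ?thesis unfolding mean using U.prob_space by simp
qed

lemma D_le: "norm (D x w) <= 4 * R"
 unfolding D_def using norm_triangle_ineq4[of "Gam (x, w) - x" "eta *R c x"] disp[of x w] etac_le[of x] by linarith

lemma D_int: "integrable unif (D x)"
 using bo_integrable_diff[OF disp_int[of x], of "%_. eta *R c x"] by (simp add: D_def[abs_def])

lemma D_mean: "(LINT w|unif. D x w) = 0"
 unfolding D_def using disp_int[of x] U.prob_space by (simp add: mean)

lemma D_second: "(LINT w|unif. (norm (D x w))\<^sup>2) <= (LINT w|unif. (norm (Gam (x, w) - x))\<^sup>2)"
proof -
 let ?v = "eta *R c x"
 have i1: "integrable unif (%w. (norm (Gam (x, w) - x))\<^sup>2)"
  by (rule U.integrable_const_bound[of _ "(2 * R)\<^sup>2"], intro AE_I2 norm_power2_le disp) (use Gamx in auto)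
 have i2: "integrable unif (%w. (Gam (x, w) - x) <.> ?v)" using disp_int by (intro integrable_inner_left) auto
 have "(LINT w|unif. (norm (D x w))\<^sup>2) = (LINT w|unif. (norm (Gam (x, w) - x))\<^sup>2 - 2 * ((Gam (x, w) - x) <.> ?v) + (norm ?v)\<^sup>2)"
  unfolding D_def by (intro bo_integral_cong refl)
   (simp only: power2_norm_eq_inner inner_diff_left inner_diff_right inner_commute, simp add: algebra_simps inner_commute)
 also have "... = (LINT w|unif. (norm (Gam (x, w) - x))\<^sup>2) - 2 * (LINT w|unif. (Gam (x, w) - x) <.> ?v) + (norm ?v)\<^sup>2"
  using i1 i2 U.prob_space by simp
 also have "(LINT w|unif. (Gam (x, w) - x) <.> ?v) = (norm ?v)\<^sup>2"
  using disp_int[of x] by (subst integral_inner_left) (auto simp: mean power2_norm_eq_inner)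
 finally show ?thesis by simp
qed

primrec mart :: "nat => 'a => (nat => real) => 'a" where
 "mart 0 x u = 0"
| "mart (Suc n) x u = D x (u 0) + mart n (Gam (x, u 0)) (%k. u (Suc k))"

lemma mart_le: "norm (mart n x u) <= real n * (4 * R)"
proof (induction n arbitrary: x u)
 case (Suc n)
 have "norm (mart (Suc n) x u) <= 4 * R + real n * (4 * R)"
  unfolding mart.simps by (rule norm_triangle_le) (intro add_mono D_le Suc)
 then show ?case by (simp add: algebra_simps)
qed simp

lemma D_meas: "(%p. D (fst p) (snd p)) : borel_measurable (nu >< unif)"
proof -
 have "(%p. c (fst p)) : borel_measurable (nu >< unif)"
  by (rule mcompose[OF measurable_fst]) (simp cong: measurable_cong_sets)
 moreover have "(%p. fst p) : nu >< unif ->M borel" using measurable_fst[of nu unif] by (simp cong: measurable_cong_sets)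
 ultimately show ?thesis unfolding D_def using GamM by simp
qed

lemma mart_meas: "(%p. mart n (fst p) (snd p)) : Om ->M borel"
proof (induction n)
 case (Suc n)
 have "(%p. (fst p, snd p 0)) : Om ->M nu >< unif"
  by (intro measurable_Pair measurable_fst mcompose[OF measurable_snd measurable_component_singleton]) auto
 from mcompose[OF this D_meas] mcompose[OF T_meas Suc] show ?case
  by (simp add: T_def split_beta')
qed simp

lemma mart_meas_x: "mart n x : borel_measurable S.S"
 using measurable_Pair2[OF mart_meas[of n], of x] by simp

lemma mart_int: "integrable S.S (mart n x)"
 by (rule S.integrable_const_bound[of _ "real n * (4 * R)"]) (use mart_le mart_meas_x in auto)

lemma mart_mean: "(LINT u|S.S. mart n x u) = 0"
proof (induction n arbitrary: x)
 case (Suc n)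
 have "(LINT u|S.S. mart (Suc n) x u) = (LINT w|unif. (LINT u|S.S. mart (Suc n) x (case_nat w u)))"
  by (rule integral_S[OF mart_meas_x mart_le])
 also have "... = (LINT w|unif. (LINT u|S.S. D x w + mart n (Gam (x, w)) u))" by simp
 also have "... = (LINT w|unif. D x w)"
  using mart_int S.P.prob_space by (intro bo_integral_cong) (auto simp: Suc)
 finally show ?case by (simp add: D_mean)
next
 case 0
 have "mart 0 x = (%_. 0)" by (simp add: fun_eq_iff)
 then show ?case by simp
qed

text \<open>Orthogonality of the martingale increments and stationarity give \<open>n\<close> times the one-step bound.\<close>

lemma mart_second: "(LINT p|Om. (norm (mart n (fst p) (snd p)))\<^sup>2) <= real n * (eta * e)"
proof (induction n)
 case (Suc n)
 define Kn where "Kn = real n * (4 * R)"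
 have K: "norm (mart n x u) <= Kn" for x u unfolding Kn_def by (rule mart_le)
 define V where "V y = (LINT u|S.S. (norm (mart n y u))\<^sup>2)" for y
 have sqi: "integrable S.S (%u. (norm (mart m y u))\<^sup>2)" for m y
  by (rule S.integrable_const_bound[of _ "(real m * (4 * R))\<^sup>2"], intro AE_I2 norm_power2_le mart_le)
    (use mart_meas_x in auto)
 have Omi: "integrable Om (%p. (norm (mart m (fst p) (snd p)))\<^sup>2)" for m
  by (rule NS.P.integrable_const_bound[of _ "(real m * (4 * R))\<^sup>2"], intro AE_I2 norm_power2_le mart_le)
    (use mart_meas in auto)
 have Vm: "V : borel_measurable borel"
 proof -
  have "V : borel_measurable nu" unfolding V_def
   by (rule S.borel_measurable_lebesgue_integral) (use borel_measurable_integrable[OF Omi[of n]] in \<open>simp add: split_beta'\<close>)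
  then show ?thesis by (simp cong: measurable_cong_sets)
 qed
 have V_le: "\<bar>V y\<bar> <= Kn\<^sup>2" for y
 proof -
  have "V y <= (LINT u|S.S. Kn\<^sup>2)" unfolding V_def
   by (intro integral_mono sqi) (auto intro!: power_mono K)
  moreover have "V y >= 0" by (simp add: V_def)
  ultimately show ?thesis using S.P.prob_space by simp
 qed
 have Vint: "integrable nu V" by (rule N.integrable_const_bound[of _ "Kn\<^sup>2"]) (use V_le Vm in \<open>auto cong: measurable_cong_sets\<close>)
 have VGami: "integrable (nu >< unif) (%p. V (Gam p))"
  by (rule NU.P.integrable_const_bound[of _ "Kn\<^sup>2"]) (use V_le mcompose[OF GamM Vm] in auto)
 have VGamxi: "integrable unif (%w. V (Gam (x, w)))" for x
  by (rule U.integrable_const_bound[of _ "Kn\<^sup>2"]) (use V_le mcompose[OF Gamx Vm] in auto)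
 have D2: "integrable unif (%w. (norm (D x w))\<^sup>2)" for x
  by (rule U.integrable_const_bound[of _ "(4 * R)\<^sup>2"], intro AE_I2 norm_power2_le D_le)
    (use borel_measurable_integrable[OF D_int[of x]] in auto)
 have DP: "integrable (nu >< unif) (%p. (norm (D (fst p) (snd p)))\<^sup>2)"
  by (rule NU.P.integrable_const_bound[of _ "(4 * R)\<^sup>2"], intro AE_I2 norm_power2_le D_le)
    (use D_meas in auto)
 have GP: "integrable (nu >< unif) (%p. (norm (Gam p - fst p))\<^sup>2)"
 proof (rule NU.P.integrable_const_bound[of _ "(2 * R)\<^sup>2"])
  have "norm (Gam p - fst p) <= 2 * R" for p using disp[of "fst p" "snd p"] by simp
  then show "AE p in nu >< unif. norm ((norm (Gam p - fst p))\<^sup>2) <= (2 * R)\<^sup>2"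
   by (intro AE_I2 norm_power2_le)
  have "fst : nu >< unif ->M borel" using measurable_fst[of nu unif] by (simp cong: measurable_cong_sets)
  then show "(%p. (norm (Gam p - fst p))\<^sup>2) : borel_measurable (nu >< unif)" using GamM by simp
 qed
 have inner: "(LINT u|S.S. (norm (mart (Suc n) x u))\<^sup>2) = (LINT w|unif. (norm (D x w))\<^sup>2) + (LINT w|unif. V (Gam (x, w)))" for x
 proof -
  have "(LINT u|S.S. (norm (mart (Suc n) x u))\<^sup>2) = (LINT w|unif. (LINT u|S.S. (norm (mart (Suc n) x (case_nat w u)))\<^sup>2))"
  proof (rule integral_S)
   show "(%u. (norm (mart (Suc n) x u))\<^sup>2) : borel_measurable S.S" by (rule borel_measurable_integrable[OF sqi])
   show "norm ((norm (mart (Suc n) x u))\<^sup>2) <= (real (Suc n) * (4 * R))\<^sup>2" for u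
    using power_mono[OF mart_le norm_ge_zero, of "Suc n" x u 2] by simp
  qed
  also have "... = (LINT w|unif. (norm (D x w))\<^sup>2 + V (Gam (x, w)))"
  proof (rule bo_integral_cong[OF refl])
   fix w
   have "(LINT u|S.S. (norm (mart (Suc n) x (case_nat w u)))\<^sup>2) =
    (LINT u|S.S. (norm (D x w))\<^sup>2 + 2 * (D x w <.> mart n (Gam (x, w)) u) + (norm (mart n (Gam (x, w)) u))\<^sup>2)"
    by (intro bo_integral_cong refl)
      (simp add: power2_norm_eq_inner inner_add_left inner_add_right inner_commute algebra_simps)
   also have "... = (norm (D x w))\<^sup>2 + 2 * (LINT u|S.S. D x w <.> mart n (Gam (x, w)) u) + V (Gam (x, w))"
    using mart_int sqi S.P.prob_space by (simp add: V_def)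
   also have "(LINT u|S.S. D x w <.> mart n (Gam (x, w)) u) = 0"
    using mart_int by (subst integral_inner_right) (auto simp: mart_mean)
   finally show "(LINT u|S.S. (norm (mart (Suc n) x (case_nat w u)))\<^sup>2) = (norm (D x w))\<^sup>2 + V (Gam (x, w))" by simp
  qed
  also have "... = (LINT w|unif. (norm (D x w))\<^sup>2) + (LINT w|unif. V (Gam (x, w)))"
   using D2 VGamxi by simp
  finally show ?thesis .
 qed
 have iD: "integrable nu (%x. LINT w|unif. (norm (D x w))\<^sup>2)" using NU.integrable_fst'[OF DP] by simp
 have iV: "integrable nu (%x. LINT w|unif. V (Gam (x, w)))" using NU.integrable_fst'[OF VGami] by simp
 have iG: "integrable nu (%x. LINT w|unif. (norm (Gam (x, w) - x))\<^sup>2)" using NU.integrable_fst'[OF GP] by simp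
 have "(LINT p|Om. (norm (mart (Suc n) (fst p) (snd p)))\<^sup>2) = (LINT x|nu. (LINT u|S.S. (norm (mart (Suc n) x u))\<^sup>2))"
  using NS.integral_fst'[OF Omi[of "Suc n"]] by (simp del: mart.simps)
 also have "... = (LINT x|nu. (LINT w|unif. (norm (D x w))\<^sup>2)) + (LINT x|nu. (LINT w|unif. V (Gam (x, w))))"
  unfolding inner by (rule bo_integral_add[OF iD iV])
 also have "(LINT x|nu. (LINT w|unif. V (Gam (x, w)))) = (LINT p|(nu >< unif). V (Gam p))"
  using NU.integral_fst'[OF VGami] by simp
 also have "... = (\<integral>y. V y \<partial>distr (nu >< unif) borel Gam)" by (rule integral_distr[symmetric, OF GamM Vm])
 also have "... = (LINT y|nu. V y)" unfolding invariant ..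
 also have "... = (LINT p|Om. (norm (mart n (fst p) (snd p)))\<^sup>2)"
  using NS.integral_fst'[OF Omi[of n]] by (simp add: V_def)
 also have "... <= real n * (eta * e)" by (rule Suc)
 also have "(LINT x|nu. (LINT w|unif. (norm (D x w))\<^sup>2)) <= (LINT x|nu. (LINT w|unif. (norm (Gam (x, w) - x))\<^sup>2))"
  by (intro integral_mono iD iG D_second)
 also have "... = (LINT p|(nu >< unif). (norm (Gam p - fst p))\<^sup>2)" using NU.integral_fst'[OF GP] by simp
 also have "... <= eta * e" by (rule second_moment)
 finally show ?case by (simp add: algebra_simps)
qed simp

text \<open>The displacement is a martingale plus the accumulated mean velocities.\<close>

lemma telescope: "chain Gam n x u - x = mart n x u + eta *R (\<Sum>k<n. c (chain Gam k x u))"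
proof (induction n arbitrary: x u)
 case (Suc n)
 have "(\<Sum>k<Suc n. c (chain Gam k x u)) = c x + (\<Sum>k<n. c (chain Gam k (Gam (x, u 0)) (%k. u (Suc k))))"
  unfolding sum.lessThan_Suc_shift by simp
 then show ?case
  using Suc[of "Gam (x, u 0)" "%k. u (Suc k)"] by (simp add: D_def scaleR_add_right algebra_simps)
qed simp

end

section \<open>Drift and speed of the chains\<close>

lemma (in prob_space) expectation_norm_le_sqrt:
 fixes f :: "'a => 'b::euclidean_space"
 assumes f: "f : borel_measurable M" and K: "!!x. norm (f x) <= K" and s: "(LINT x|M. (norm (f x))\<^sup>2) <= s"
 shows "(LINT x|M. norm (f x)) <= sqrt s"
proof -
 have i: "integrable M (%x. norm (f x))" "integrable M (%x. (norm (f x))\<^sup>2)"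
  by (rule integrable_const_bound[of _ K], use f K in simp, use f in measurable)
    (rule integrable_const_bound[of _ "K\<^sup>2"], intro AE_I2 norm_power2_le K, use f in measurable)
 have "0 <= variance (%x. norm (f x))" by (rule variance_positive)
 then have "(LINT x|M. norm (f x))\<^sup>2 <= s" using variance_eq[OF i] s by simp
 then show ?thesis by (rule real_le_rsqrt)
qed

context kernel
begin

lemma Om_prob: "prob_space Om" by (rule NS.P.prob_space_axioms)

lemma Y_n_meas: "(%p. Y p n) : Om ->M borel"
 using chain_meas by (simp add: Y_def)

lemma mart_L1: "(LINT p|Om. norm (mart n (fst p) (snd p))) <= sqrt (real n * (eta * e))"
 by (rule NS.P.expectation_norm_le_sqrt[OF mart_meas _ mart_second]) (rule mart_le)

lemma mart_norm_int: "integrable Om (%p. norm (mart n (fst p) (snd p)))"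
 by (rule NS.P.integrable_const_bound[of _ "real n * (4 * R)"]) (use mart_le mart_meas in auto)

lemma AE_Y: "AE p in Om. P (Y p k)" if "AE x in nu. P x"
proof -
 have "AE x in distr Om borel (%p. Y p k). P x" unfolding Y_law by (rule that)
 then show ?thesis by (rule AE_distrD[OF Y_n_meas])
qed

lemma c_bound: "norm (c x) <= 2 * R / eta"
 using etac_le[of x] eta by (simp add: field_simps)

lemma C_nonneg: "C >= 0"
proof -
 have "AE x in nu. 0 <= C" using c_le by eventually_elim (rule order_trans[OF norm_ge_zero])
 then show ?thesis by simp
qed

lemma increment: "AE p in Om. norm (Y p n - Y p 0) <= norm (mart n (fst p) (snd p)) + C * (real n * eta)"
proof -
 have "AE p in Om. ALL k. norm (c (Y p k)) <= C" unfolding AE_all_countable by (intro allI AE_Y c_le)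
 then show ?thesis
 proof eventually_elim
  case (elim p)
  have "norm (\<Sum>k<n. c (Y p k)) <= real n * C"
   using sum_norm_le[of "{..<n}" "%k. c (Y p k)" "%_. C"] elim by simp
  then have b: "norm (eta *R (\<Sum>k<n. c (Y p k))) <= C * (real n * eta)"
   using eta by (simp add: mult.commute mult.left_commute)
  have eq: "Y p n - Y p 0 = mart n (fst p) (snd p) + eta *R (\<Sum>k<n. c (Y p k))"
   unfolding Y_def using telescope[of n "fst p" "snd p"] by simp
  show ?case unfolding eq by (rule norm_triangle_le) (use b in simp)
 qed
qed

lemma start_speed: "(LINT p|Om. max 0 (norm (Y p n - Y p 0) - C * (real n * eta))) <= sqrt (real n * (eta * e))"
proof (rule order_trans[OF integral_mono_AE mart_L1])
 show "AE p in Om. max 0 (norm (Y p n - Y p 0) - C * (real n * eta)) <= norm (mart n (fst p) (snd p))"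
  using increment[of n] by eventually_elim auto
 show "integrable Om (%p. max 0 (norm (Y p n - Y p 0) - C * (real n * eta)))"
 proof (rule bo_integrable_bound[OF mart_norm_int[of n]])
  show "AE p in Om. norm (max 0 (norm (Y p n - Y p 0) - C * (real n * eta))) <= norm (norm (mart n (fst p) (snd p)))"
   using increment[of n] by eventually_elim auto
  show "(%p. max 0 (norm (Y p n - Y p 0) - C * (real n * eta))) : borel_measurable Om"
   using Y_n_meas[of n] Y_n_meas[of 0] by simp
 qed
qed (rule mart_norm_int)

text \<open>Up to the martingale part, \<open>w\<close> is compared with the mean velocity \<open>c\<close> at the visited points, which all have law \<open>nu\<close>, and
 then, by Lipschitz continuity, with its value at the starting point.\<close>

lemma start_drift:
 fixes w :: "'a => 'a" and n :: nat
 assumes w: "!!x. norm (w x) <= Kw" "!!x y. norm (w x - w y) <= L * norm (x - y)" "w : borel_measurable borel" and L: "L >= 0"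
 defines "s \<equiv> sqrt (real n * (eta * e))"
 shows "(LINT p|Om. norm (Y p n - Y p 0 - (real n * eta) *R w (Y p 0))) <=
  s + real n * eta * ((LINT x|nu. norm (c x - w x)) + L * (C * (real n * eta) + s))"
proof -
 note [measurable] = w(3)
 define f where "f k p = norm (c (Y p k) - w (Y p k))" for k p
 have fm: "f k : borel_measurable Om" for k
  unfolding f_def using mcompose[OF Y_n_meas, of "%x. norm (c x - w x)" borel k] by simp
 have fb: "norm (f k p) <= 2 * R / eta + Kw" for k p
  unfolding f_def real_norm_def abs_norm_cancel by (rule order_trans[OF norm_triangle_ineq4]) (intro add_mono c_bound w)
 have fi: "integrable Om (f k)" for k by (rule NS.P.integrable_const_bound[of _ "2 * R / eta + Kw"]) (use fb fm in auto)
 have fE: "(LINT p|Om. f k p) = (LINT x|nu. norm (c x - w x))" for k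
 proof -
  have "(\<integral>x. norm (c x - w x) \<partial>distr Om borel (%p. Y p k)) = (LINT p|Om. f k p)"
   unfolding f_def by (rule integral_distr[OF Y_n_meas]) measurable
  then show ?thesis unfolding Y_law by simp
 qed
 define M where "M k p = norm (mart k (fst p) (snd p))" for k and p :: "'a * (nat => real)"
 have Mi: "integrable Om (M k)" for k unfolding M_def by (rule mart_norm_int)
 have ME: "(LINT p|Om. M k p) <= s" if "k <= n" for k
 proof -
  have "real k * (eta * e) <= real n * (eta * e)" using that eta e by (intro mult_right_mono) auto
  then show ?thesis unfolding M_def s_def by (intro order_trans[OF mart_L1] real_sqrt_le_mono)
 qed
 have bound: "AE p in Om. norm (Y p n - Y p 0 - (real n * eta) *R w (Y p 0)) <=
   M n p + eta * (\<Sum>k<n. f k p + L * (M k p + C * (real n * eta)))"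
 proof -
  have "AE p in Om. ALL k. norm (Y p k - Y p 0) <= norm (mart k (fst p) (snd p)) + C * (real k * eta)"
   unfolding AE_all_countable by (intro allI increment)
  then show ?thesis
  proof eventually_elim
   case (elim p)
   have wk: "norm (c (Y p k) - w (Y p 0)) <= f k p + L * (M k p + C * (real n * eta))" if "k < n" for k
   proof -
    have "norm (w (Y p k) - w (Y p 0)) <= L * norm (Y p k - Y p 0)" by (rule w)
    also have "... <= L * (M k p + C * (real k * eta))" using elim L unfolding M_def by (intro mult_left_mono) auto
    also have "... <= L * (M k p + C * (real n * eta))"
     using that eta C_nonneg L by (intro mult_left_mono add_left_mono mult_right_mono) auto
    finally show ?thesis unfolding f_def
     using norm_triangle_ineq[of "c (Y p k) - w (Y p k)" "w (Y p k) - w (Y p 0)"] by simp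
   qed
   have "Y p n - Y p 0 - (real n * eta) *R w (Y p 0) = mart n (fst p) (snd p) + eta *R (\<Sum>k<n. c (Y p k) - w (Y p 0))"
    unfolding Y_def using telescope[of n "fst p" "snd p"]
    by (simp add: sum_subtractf scaleR_diff_right sum_constant_scaleR mult.commute)
   then have "norm (Y p n - Y p 0 - (real n * eta) *R w (Y p 0)) <= M n p + eta * norm (\<Sum>k<n. c (Y p k) - w (Y p 0))"
    unfolding M_def using norm_triangle_ineq[of "mart n (fst p) (snd p)" "eta *R (\<Sum>k<n. c (Y p k) - w (Y p 0))"] eta by simp
   also have "... <= M n p + eta * (\<Sum>k<n. f k p + L * (M k p + C * (real n * eta)))"
    using eta wk by (intro add_left_mono mult_left_mono sum_norm_le) auto
   finally show ?case .
  qed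
 qed
 have Ymeas: "(%p. norm (Y p n - Y p 0 - (real n * eta) *R w (Y p 0))) : borel_measurable Om"
  using Y_n_meas[of n] Y_n_meas[of 0] mcompose[OF Y_n_meas w(3), of 0] by simp
 have ri: "integrable Om (%p. M n p + eta * (\<Sum>k<n. f k p + L * (M k p + C * (real n * eta))))"
  using Mi fi by (intro bo_integrable_add integrable_mult_right bo_integrable_sum) auto
 have "(LINT p|Om. norm (Y p n - Y p 0 - (real n * eta) *R w (Y p 0))) <=
   (LINT p|Om. M n p + eta * (\<Sum>k<n. f k p + L * (M k p + C * (real n * eta))))"
 proof (rule integral_mono_AE[OF _ ri bound])
  show "integrable Om (%p. norm (Y p n - Y p 0 - (real n * eta) *R w (Y p 0)))"
   by (rule bo_integrable_bound[OF ri Ymeas]) (use bound in \<open>eventually_elim, auto\<close>)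
 qed
 also have "... = (LINT p|Om. M n p) + eta * (\<Sum>k<n. (LINT p|Om. f k p) + L * ((LINT p|Om. M k p) + C * (real n * eta)))"
  using Mi fi NS.P.prob_space by simp
 also have "... <= s + eta * (\<Sum>k<n. (LINT x|nu. norm (c x - w x)) + L * (s + C * (real n * eta)))"
  unfolding fE using ME eta L
  by (intro add_mono mult_left_mono sum_mono order_refl) auto
 also have "... = s + real n * eta * ((LINT x|nu. norm (c x - w x)) + L * (C * (real n * eta) + s))"
  by (simp add: algebra_simps)
 finally show ?thesis .
qed

lemma path_law_integral:
 fixes f :: "(nat => 'a) => real"
 assumes "f : borel_measurable borel"
 shows "(LINT y|path_law. f (%n. y (n + k))) = (LINT p|Om. f (Y p))"
proof -
 have m: "(%y n. y (n + k)) : path_law ->M borel"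
  using shift_seq_meas by (simp add: path_law_def cong: measurable_cong_sets)
 have "(LINT y|path_law. f (%n. y (n + k))) = (\<integral>y. f y \<partial>distr path_law borel (%y n. y (n + k)))"
  by (rule integral_distr[OF m assms, symmetric])
 also have "... = (LINT y|path_law. f y)" unfolding path_law_shift ..
 also have "... = (LINT p|Om. f (Y p))" unfolding path_law_def by (rule integral_distr[OF Y_meas assms])
 finally show ?thesis .
qed

lemma path_speed:
 "(LINT y|path_law. max 0 (norm (y (k + n) - y k) - C * (real n * eta))) <= sqrt (real n * (eta * e))"
proof -
 note [measurable] = measurable_coord
 have "(%y :: nat => 'a. max 0 (norm (y n - y 0) - C * (real n * eta))) : borel_measurable borel" by measurable
 from path_law_integral[OF this, of k] start_speed[of n] show ?thesis by (simp add: add.commute)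
qed

lemma path_drift:
 fixes w :: "'a => 'a"
 assumes w: "!!x. norm (w x) <= Kw" "!!x y. norm (w x - w y) <= L * norm (x - y)" "w : borel_measurable borel" "L >= 0"
 shows "(LINT y|path_law. norm (y (k + n) - y k - (real n * eta) *R w (y k))) <=
  sqrt (real n * (eta * e)) + real n * eta * ((LINT x|nu. norm (c x - w x)) + L * (C * (real n * eta) + sqrt (real n * (eta * e))))"
proof -
 note [measurable] = w(3)
 have "(%y :: nat => 'a. norm (y n - y 0 - (real n * eta) *R w (y 0))) : borel_measurable borel"
  using measurable_coord[of n] measurable_coord[of 0] mcompose[OF measurable_coord w(3), of 0] by simp
 from path_law_integral[OF this, of k] start_drift[OF w, of n] show ?thesis by (simp add: add.commute)
qed

end

context mimicking
begin

text \<open>A stationary law with marginal \<open>nu\<close> whose paths, with step \<open>(1/2) ^ m\<close>, have speed at most \<open>C\<close> and velocity \<open>vb\<close> up to errors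
 that vanish with \<open>e\<close>. The field \<open>vb\<close> is only measurable, so its role in the estimate along the path is taken by Lipschitz \<open>w\<close>.\<close>

definition approximates :: "(nat => 'a) measure => nat => real => bool" where
 "approximates N m e \<longleftrightarrow>
  prob_space N & sets N = sets (borel :: (nat => 'a) measure) &
  (ALL s. distr N borel (%y n. y (n + s)) = N) & (ALL k. distr N borel (%y. y k) = nu) &
  (ALL k n. (LINT y|N. max 0 (norm (y (k + n) - y k) - C * (real n * (1/2) ^ m))) <= sqrt (real n * ((1/2) ^ m * e))) &
  (ALL w Kw L k n. (ALL x. norm (w x) <= Kw) & (ALL x y. norm (w x - w y) <= L * norm (x - y)) & w : borel_measurable borel & L >= 0 -->
   (LINT y|N. norm (y (k + n) - y k - (real n * (1/2) ^ m) *R w (y k))) <=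
   sqrt (real n * ((1/2) ^ m * e)) + real n * (1/2) ^ m * ((LINT x|nu. norm (vb x - w x)) + e +
    L * (C * (real n * (1/2) ^ m) + sqrt (real n * ((1/2) ^ m * e)))))"

theorem approximating_chain:
 assumes e: "e > 0"
 shows "EX m N. (1/2) ^ m <= e & approximates N m e"
proof -
 obtain m Gam c where m: "(1/2) ^ m <= e" and Gam: "Gam : borel_measurable borel" and c: "c : borel_measurable borel"
  and out: "ALL x u. x \<notin> B --> Gam (x, u) = x" and inn: "ALL x:B. ALL u. Gam (x, u) : B"
  and inv: "distr (nu >< unif) borel Gam = nu"
  and sec: "(LINT p|(nu >< unif). (norm (Gam p - fst p))\<^sup>2) <= (1/2) ^ m * e"
  and mean: "ALL x. (1/2) ^ m *R c x = (LINT u|unif. Gam (x, u) - x)"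
  and cC: "AE x in nu. norm (c x) <= C" and cv: "(LINT x|nu. norm (c x - vb x)) <= e"
  using one_step_kernel[OF e] by (elim exE conjE) (rule that)
 interpret K: kernel nu Gam c "(1/2) ^ m" e C R B
  using Gam c out inn inv sec mean cC e B(2) R_pos
  by (intro kernel.intro N.prob_space_axioms kernel_axioms.intro) auto
 have cw: "(LINT x|nu. norm (c x - w x)) <= (LINT x|nu. norm (vb x - w x)) + e"
  if w: "ALL x. norm (w x) <= Kw" "w : borel_measurable borel" for w :: "'a => 'a" and Kw
 proof -
  note [measurable] = c vb(1) w(2)
  have i1: "integrable nu (%x. norm (c x - vb x))"
  proof (rule N.integrable_const_bound[of _ "C + C"])
   show "AE x in nu. norm (norm (c x - vb x)) <= C + C"
    using cC
   proof eventually_elim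
    case (elim x)
    then show ?case using norm_triangle_ineq4[of "c x" "vb x"] vb(2)[of x] by simp
   qed
   show "(%x. norm (c x - vb x)) : borel_measurable nu" by (rule meas_nu) measurable
  qed
  have i2: "integrable nu (%x. norm (vb x - w x))"
  proof (rule N.integrable_const_bound[of _ "C + Kw"])
   show "AE x in nu. norm (norm (vb x - w x)) <= C + Kw"
   proof (rule AE_I2)
    show "norm (norm (vb x - w x)) <= C + Kw" for x
     using norm_triangle_ineq4[of "vb x" "w x"] vb(2)[of x] w(1) by (simp add: add_mono order_trans)
   qed
   show "(%x. norm (vb x - w x)) : borel_measurable nu" by (rule meas_nu) measurable
  qed
  have le: "norm (c x - w x) <= norm (c x - vb x) + norm (vb x - w x)" for x
   using norm_triangle_ineq[of "c x - vb x" "vb x - w x"] by simp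
  have i3: "integrable nu (%x. norm (c x - w x))"
  proof (rule bo_integrable_bound[OF bo_integrable_add[OF i1 i2]])
   show "(%x. norm (c x - w x)) : borel_measurable nu" by (rule meas_nu) measurable
  qed (use le in auto)
  have "(LINT x|nu. norm (c x - w x)) <= (LINT x|nu. norm (c x - vb x) + norm (vb x - w x))"
   by (intro integral_mono i3 bo_integrable_add i1 i2 le)
  also have "... = (LINT x|nu. norm (c x - vb x)) + (LINT x|nu. norm (vb x - w x))"
   by (rule bo_integral_add[OF i1 i2])
  finally show ?thesis using cv by simp
 qed
 have drift: "(LINT y|K.path_law. norm (y (k + n) - y k - (real n * (1/2) ^ m) *R w (y k))) <=
   sqrt (real n * ((1/2) ^ m * e)) + real n * (1/2) ^ m * ((LINT x|nu. norm (vb x - w x)) + e +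
    L * (C * (real n * (1/2) ^ m) + sqrt (real n * ((1/2) ^ m * e))))"
  if w: "ALL x. norm (w x) <= Kw" "ALL x y. norm (w x - w y) <= L * norm (x - y)" "w : borel_measurable borel" "L >= 0" for w Kw L k n
 proof -
  have "real n * (1/2) ^ m * ((LINT x|nu. norm (c x - w x)) + L * (C * (real n * (1/2) ^ m) + sqrt (real n * ((1/2) ^ m * e))))
   <= real n * (1/2) ^ m * ((LINT x|nu. norm (vb x - w x)) + e + L * (C * (real n * (1/2) ^ m) + sqrt (real n * ((1/2) ^ m * e))))"
   using cw[OF w(1,3)] by (intro mult_left_mono add_right_mono) auto
  moreover have "(LINT y|K.path_law. norm (y (k + n) - y k - (real n * (1/2) ^ m) *R w (y k))) <=
   sqrt (real n * ((1/2) ^ m * e)) + real n * (1/2) ^ m * ((LINT x|nu. norm (c x - w x)) + L * (C * (real n * (1/2) ^ m) + sqrt (real n * ((1/2) ^ m * e))))"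
   by (rule K.path_drift) (use w in auto)
  ultimately show ?thesis by linarith
 qed
 show ?thesis
  unfolding approximates_def using m K.prob_path_law K.sets_path_law K.path_law_shift K.path_law_marginal K.path_speed drift
  by (intro exI[of _ m] exI[of _ K.path_law]) blast
qed

end

section \<open>The limit at dyadic times\<close>

text \<open>Numbers the dyadic times, so that a process at all dyadic times is a sequence. Times have several numbers.\<close>

definition dyad :: "nat => real" where
 "dyad i = (case prod_decode i of (n, k) => real n / 2 ^ k)"

definition dlevel :: "nat => nat" where "dlevel i = snd (prod_decode i)"

lemma dyad_nonneg: "dyad i >= 0" by (auto simp: dyad_def split: prod.split)

lemma dyad_encode [simp]: "dyad (prod_encode (n, k)) = real n / 2 ^ k" by (simp add: dyad_def)

lemma dyad_step:
 assumes "dlevel i <= m"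
 obtains n where "dyad i * 2 ^ m = real n"
proof -
 obtain n k where nk: "prod_decode i = (n, k)" by fastforce
 have "k <= m" using assms nk by (simp add: dlevel_def)
 then have "(2::real) ^ m = 2 ^ (m - k) * 2 ^ k" by (simp flip: power_add)
 then have "dyad i * 2 ^ m = real (n * 2 ^ (m - k))"
  using nk by (simp add: dyad_def)
 then show ?thesis by (rule that)
qed

context mimicking
begin

definition sample :: "nat => (nat => 'a) => nat => 'a" where
 "sample m y i = y (nat \<lfloor>dyad i * 2 ^ m\<rfloor>)"

lemma sample_meas [measurable]: "sample m : borel ->M borel"
 by (rule measurable_coordinatewise_then_product) (unfold sample_def, rule measurable_coord)

text \<open>Every fixed dyadic time is a grid point of all sufficiently fine chains, so each estimate for the chains passes to the limit at fixed
 times, and invariance of the chain under shifts by grid steps becomes invariance under dyadic shifts.\<close>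

theorem dyadic_limit:
 "EX L. prob_space L & sets L = sets (borel :: (nat => 'a) measure) &
  (ALL i. distr L borel (%y. y i) = nu) &
  (ALL i j. AE y in L. norm (y i - y j) <= C * \<bar>dyad i - dyad j\<bar>) &
  (ALL w Kw Lw i j. (ALL x. norm (w x) <= Kw) & (ALL x y. norm (w x - w y) <= Lw * norm (x - y)) & w : borel_measurable borel & Lw >= 0
   & dyad i <= dyad j -->
   (LINT y|L. norm (y j - y i - (dyad j - dyad i) *R w (y i))) <=
   (dyad j - dyad i) * ((LINT x|nu. norm (vb x - w x)) + Lw * (C * (dyad j - dyad i)))) &
  (ALL (a :: nat => nat) (b :: nat => nat) s. (ALL i. dyad (b i) = dyad (a i) + dyad s) -->
   distr L borel (%y i. y (b i)) = distr L borel (%y i. y (a i)))"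
proof -
 define e where "e j = (1/2::real) ^ j" for j :: nat
 have e: "e j > 0" for j by (simp add: e_def)
 have e_lim: "e ----> 0" unfolding e_def[abs_def] by (intro LIMSEQ_power_zero) auto
 have "EX m N. (1/2) ^ m <= e j & approximates N m (e j)" for j by (rule approximating_chain[OF e])
 then obtain m N where N: "!!j. (1/2) ^ m j <= e j & approximates (N j) (m j) (e j)" by metis
 have N1: "(1/2) ^ m j <= e j" and N2: "prob_space (N j)" and N3: "sets (N j) = sets borel"
  and N4: "distr (N j) borel (%y n. y (n + s)) = N j" and N5: "distr (N j) borel (%y. y k) = nu"
  and N6: "(LINT y|(N j). max 0 (norm (y (k + n) - y k) - C * (real n * (1/2) ^ m j))) <= sqrt (real n * ((1/2) ^ m j * e j))"
  for j s k n using N[of j] unfolding approximates_def by blast+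
 have N7: "(LINT y|(N j). norm (y (k + n) - y k - (real n * (1/2) ^ m j) *R w (y k))) <=
   sqrt (real n * ((1/2) ^ m j * e j)) + real n * (1/2) ^ m j * ((LINT x|nu. norm (vb x - w x)) + e j +
    Lw * (C * (real n * (1/2) ^ m j) + sqrt (real n * ((1/2) ^ m j * e j))))"
  if "ALL x. norm (w x) <= Kw" "ALL x y. norm (w x - w y) <= Lw * norm (x - y)" "w : borel_measurable borel" "Lw >= 0" for w Kw Lw k n j
  using N[of j] that unfolding approximates_def by blast
 have mj: "j <= m j" for j
 proof (rule ccontr)
  assume "~ j <= m j"
  then have "(1/2::real) ^ j < (1/2) ^ m j" by (intro power_strict_decreasing) auto
  then show False using N1[of j] by (simp add: e_def)
 qed
 note meas_N = measurable_cong_sets[OF N3 refl]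
 define N' where "N' j = distr (N j) borel (sample (m j))" for j
 have sm: "sample k : N j ->M borel" for k j unfolding meas_N by (rule sample_meas)
 have P1: "prob_space (N' j)" for j unfolding N'_def by (rule prob_space.prob_space_distr[OF N2 sm])
 have P2: "sets (N' j) = sets borel" for j by (simp add: N'_def)
 have P3: "AE y in N' j. ALL i. norm (y i) < R" for j
 proof -
  have "AE y in N j. y k : B" for k
  proof -
   have "AE x in distr (N j) borel (%y. y k). x : B" unfolding N5 by (rule B(3))
   then show ?thesis by (rule AE_distrD[rotated]) (unfold meas_N, rule measurable_coord)
  qed
  then have "AE y in N j. ALL k. y k : B" by (simp add: AE_all_countable)
  then have 1: "AE y in N j. ALL i. norm (sample (m j) y i) < R" by eventually_elim (use B(2) in \<open>auto simp: sample_def\<close>)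
  note [measurable] = measurable_coord
  show ?thesis unfolding N'_def by (subst AE_distr_iff[OF sm]) (use 1 in auto)
 qed
 have EN': "(LINT y|(N' j). f y) = (LINT y|(N j). f (sample (m j) y))" if "continuous_on UNIV f" for f :: "(nat => 'a) => real" and j
  unfolding N'_def by (rule integral_distr[OF sm continuous_borel[OF that]])
 from prokhorov_seq_ball[of N' R, OF P1 P2 P3]
 obtain r L where r: "strict_mono r" and L: "prob_space L" "sets L = sets (borel :: (nat => 'a) measure)"
  and LR: "AE y in L. ALL i. norm (y i) <= R"
  and conv': "ALL f b. continuous_on UNIV f & (ALL y. (ALL i. norm (y i) <= R) --> \<bar>f y\<bar> <= b) -->
    (%k. \<integral>y. f y \<partial>N' (r k)) ----> (LINT y|L. (f y :: real))"
  by (elim exE conjE) (rule that)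
 have conv: "(%k. \<integral>y. f (sample (m (r k)) y) \<partial>N (r k)) ----> (LINT y|L. (f y :: real))"
  if f: "continuous_on UNIV f" "!!y. (ALL i. norm (y i) <= R) ==> \<bar>f y\<bar> <= b" for f b
  using conv'[rule_format, of f b] f unfolding EN'[OF f(1)] by auto
 interpret Q: prob_space L by fact
 have rk: "k <= r k" for k using r by (rule seq_suble)
 have mr: "k <= m (r k)" for k using rk[of k] mj[of "r k"] by linarith
 have er: "(%k. e (r k)) ----> 0" using LIMSEQ_subseq_LIMSEQ[OF e_lim r] by (simp add: comp_def)
 note meas_L = measurable_cong_sets[OF L(2) refl]
 have contc: "continuous_on UNIV (%y :: nat => 'a. y i)" for i by (rule continuous_on_product_coordinates)
 have L0: "distr L borel (%y. y i) = nu" for i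
 proof (rule measure_eqI_continuous)
  have cm: "(%y. y k) : N j ->M borel" for k j unfolding meas_N by (rule measurable_coord)
  have cL: "(%y. y i) : L ->M borel" unfolding meas_L by (rule measurable_coord)
  fix f :: "'a => real" assume f: "continuous_on UNIV f" "!!x. 0 <= f x & f x <= 1"
  have fm: "f : borel_measurable borel" by (rule continuous_borel[OF f(1)])
  have c: "continuous_on UNIV (%y. f (y i))" by (rule continuous_on_compose2[OF f(1) contc]) auto
  have cv: "(%k. \<integral>y. f (sample (m (r k)) y i) \<partial>N (r k)) ----> (LINT y|L. f (y i))"
  proof (rule conv[OF c])
   show "\<bar>f (y i)\<bar> <= 1" for y using f(2)[of "y i"] by simp
  qed
  have "(\<integral>y. f (sample (m (r k)) y i) \<partial>N (r k)) = (LINT x|nu. f x)" for k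
  proof -
   have "(\<integral>x. f x \<partial>distr (N (r k)) borel (%y. y (nat \<lfloor>dyad i * 2 ^ m (r k)\<rfloor>))) =
     (\<integral>y. f (sample (m (r k)) y i) \<partial>N (r k))"
    unfolding sample_def by (rule integral_distr[OF cm fm])
   then show ?thesis unfolding N5 by simp
  qed
  then have "(%k. LINT x|nu. f x) ----> (LINT y|L. f (y i))" using cv by simp
  then have "(LINT y|L. f (y i)) = (LINT x|nu. f x)" using LIMSEQ_unique tendsto_const by blast
  then show "(\<integral>x. f x \<partial>distr L borel (%y. y i)) = (LINT x|nu. f x)" by (simp add: integral_distr[OF cL fm])
 next
  show "finite_measure (distr L borel (%y. y i))"
   by (rule Q.finite_measure_distr) (unfold meas_L, rule measurable_coord)
 qed (auto intro: N.finite_measure_axioms)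
 \<comment> \<open>at a fine scale two dyadic times are grid points\<close>
 have grid': "EX a n. (ALL y :: nat => 'a. sample (m (r k)) y i = y a & sample (m (r k)) y j = y (a + n)) & real n * (1/2) ^ m (r k) = dyad j - dyad i"
  if ij: "dyad i <= dyad j" and k: "k >= dlevel i" "k >= dlevel j" for i j k
 proof -
  obtain a where a: "dyad i * 2 ^ m (r k) = real a" using dyad_step[of i "m (r k)"] k(1) mr[of k] by auto
  obtain b where b: "dyad j * 2 ^ m (r k) = real b" using dyad_step[of j "m (r k)"] k(2) mr[of k] by auto
  have "real a <= real b" unfolding a[symmetric] b[symmetric] using ij by (intro mult_right_mono) auto
  then have ab: "a <= b" by simp
  have "real (b - a) = (dyad j - dyad i) * 2 ^ m (r k)" using ab a b by (simp add: of_nat_diff algebra_simps)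
  then have "real (b - a) * (1/2) ^ m (r k) = dyad j - dyad i" by (simp add: power_one_over)
  then show ?thesis using a b ab by (intro exI[of _ a] exI[of _ "b - a"]) (simp add: sample_def)
 qed
 have L1: "AE y in L. norm (y j - y i) <= C * (dyad j - dyad i)" if ij: "dyad i <= dyad j" for i j
 proof -
  define t where "t = dyad j - dyad i"
  have t: "t >= 0" using ij by (simp add: t_def)
  define phi where "phi y = max 0 (norm (y j - y i) - C * t)" for y :: "nat => 'a"
  have c: "continuous_on UNIV phi" unfolding phi_def by (intro continuous_intros contc)
  have phi0: "phi y >= 0" for y by (simp add: phi_def)
  have cb: "\<bar>phi y\<bar> <= 2 * R" if "ALL i. norm (y i) <= R" for y
  proof -
   have "norm (y j - y i) <= R + R" using that by (intro order_trans[OF norm_triangle_ineq4] add_mono) auto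
   moreover have "0 <= C * t" using C_nonneg t by simp
   ultimately show ?thesis using R_pos by (auto simp: phi_def max_def)
  qed
  have le: "(\<integral>y. phi (sample (m (r k)) y) \<partial>N (r k)) <= sqrt (t * e (r k))" if kk: "k >= max (dlevel i) (dlevel j)" for k
  proof -
   obtain a n where an: "!!y :: nat => 'a. sample (m (r k)) y i = y a" "!!y :: nat => 'a. sample (m (r k)) y j = y (a + n)"
    "real n * (1/2) ^ m (r k) = t"
   proof -
    have "EX a n. (ALL y :: nat => 'a. sample (m (r k)) y i = y a & sample (m (r k)) y j = y (a + n)) & real n * (1/2) ^ m (r k) = t"
     unfolding t_def by (rule grid'[OF ij]) (use kk in auto)
    then show ?thesis using that by blast
   qed
   have "sqrt (real n * ((1/2) ^ m (r k) * e (r k))) = sqrt (t * e (r k))" unfolding an(3)[symmetric] by (simp only: mult.assoc)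
   moreover have "(\<integral>y. max 0 (norm (y (a + n) - y a) - C * (real n * (1/2) ^ m (r k))) \<partial>N (r k)) <= sqrt (real n * ((1/2) ^ m (r k) * e (r k)))"
    by (rule N6)
   ultimately show ?thesis unfolding phi_def an(1,2) by (simp only: an(3))
  qed
  have cv: "(%k. \<integral>y. phi (sample (m (r k)) y) \<partial>N (r k)) ----> (LINT y|L. phi y)"
   by (rule conv[OF c]) (rule cb)
  have "(%k. sqrt (t * e (r k))) ----> sqrt (t * 0)" by (intro tendsto_intros er)
  then have "(LINT y|L. phi y) <= sqrt (t * 0)"
   by (rule LIMSEQ_le[OF cv]) (intro exI[of _ "max (dlevel i) (dlevel j)"] allI impI le, assumption)
  moreover have "(LINT y|L. phi y) >= 0" by (rule bo_integral_nonneg) (rule phi0)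
  ultimately have "(LINT y|L. phi y) = 0" by simp
  moreover have "integrable L phi"
  proof (rule Q.integrable_const_bound[of _ "2 * R"])
   show "AE y in L. norm (phi y) <= 2 * R" using LR by eventually_elim (use cb in auto)
   show "phi : borel_measurable L" unfolding meas_L by (rule continuous_borel[OF c])
  qed
  ultimately have "AE y in L. phi y = 0" using phi0 by (subst (asm) integral_nonneg_eq_0_iff_AE) auto
  then show ?thesis by eventually_elim (auto simp: phi_def t_def max_def split: if_splits)
 qed
 have L1': "AE y in L. norm (y i - y j) <= C * \<bar>dyad i - dyad j\<bar>" for i j
 proof (cases "dyad i <= dyad j")
  case True
  from L1[OF True] show ?thesis by eventually_elim (use True in \<open>simp add: norm_minus_commute\<close>)
 next
  case False
  from L1[of j i] False show ?thesis by simp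
 qed
 have L2: "(LINT y|L. norm (y j - y i - (dyad j - dyad i) *R w (y i))) <=
   (dyad j - dyad i) * ((LINT x|nu. norm (vb x - w x)) + Lw * (C * (dyad j - dyad i)))"
  if w: "ALL x. norm (w x) <= Kw" "ALL x y. norm (w x - w y) <= Lw * norm (x - y)" "w : borel_measurable borel" "Lw >= 0"
   and ij: "dyad i <= dyad j" for w Kw Lw i j
 proof -
  define t where "t = dyad j - dyad i"
  have t: "t >= 0" using ij by (simp add: t_def)
  have "Lw-lipschitz_on UNIV w" using w(2,4) by (intro lipschitz_onI) (auto simp: dist_norm)
  then have wc: "continuous_on UNIV w" by (rule lipschitz_on_continuous_on)
  define phi where "phi y = norm (y j - y i - t *R w (y i))" for y :: "nat => 'a"
  have c: "continuous_on UNIV phi" unfolding phi_def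
   by (intro continuous_intros contc continuous_on_compose2[OF wc contc]) auto
  have cb: "\<bar>phi y\<bar> <= R + R + t * Kw" if "ALL i. norm (y i) <= R" for y
  proof -
   have "norm (y j - y i) <= R + R" using that by (intro order_trans[OF norm_triangle_ineq4] add_mono) auto
   moreover have "norm (t *R w (y i)) <= t * Kw" using t w(1) by (simp add: mult_left_mono)
   ultimately show ?thesis unfolding phi_def
    using norm_triangle_ineq4[of "y j - y i" "t *R w (y i)"] by simp
  qed
  define K where "K = (LINT x|nu. norm (vb x - w x))"
  have le: "(\<integral>y. phi (sample (m (r k)) y) \<partial>N (r k)) <=
    sqrt (t * e (r k)) + t * (K + e (r k) + Lw * (C * t + sqrt (t * e (r k))))" if kk: "k >= max (dlevel i) (dlevel j)" for k
  proof -
   obtain a n where an: "!!y :: nat => 'a. sample (m (r k)) y i = y a" "!!y :: nat => 'a. sample (m (r k)) y j = y (a + n)"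
    "real n * (1/2) ^ m (r k) = t"
   proof -
    have "EX a n. (ALL y :: nat => 'a. sample (m (r k)) y i = y a & sample (m (r k)) y j = y (a + n)) & real n * (1/2) ^ m (r k) = t"
     unfolding t_def by (rule grid'[OF ij]) (use kk in auto)
    then show ?thesis using that by blast
   qed
   have "real n * ((1/2) ^ m (r k) * e (r k)) = t * e (r k)" unfolding an(3)[symmetric] by (simp only: mult.assoc)
   then show ?thesis using N7[OF w, of "r k" a n] unfolding phi_def an(1,2) K_def by (simp only: an(3))
  qed
  have cv: "(%k. \<integral>y. phi (sample (m (r k)) y) \<partial>N (r k)) ----> (LINT y|L. phi y)"
   by (rule conv[OF c]) (rule cb)
  have "(%k. sqrt (t * e (r k)) + t * (K + e (r k) + Lw * (C * t + sqrt (t * e (r k))))) ---->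
    sqrt (t * 0) + t * (K + 0 + Lw * (C * t + sqrt (t * 0)))" by (intro tendsto_intros er)
  then have "(LINT y|L. phi y) <= sqrt (t * 0) + t * (K + 0 + Lw * (C * t + sqrt (t * 0)))"
   by (rule LIMSEQ_le[OF cv]) (intro exI[of _ "max (dlevel i) (dlevel j)"] allI impI le, assumption)
  then show ?thesis by (simp add: phi_def K_def t_def)
 qed
 have L3: "distr L borel (%y i. y (b i)) = distr L borel (%y i. y (a i))"
  if ab: "ALL i. dyad (b i) = dyad (a i) + dyad s" for a b :: "nat => nat" and s
 proof (rule measure_eqI_continuous)
  have re: "(%y i. y (g i)) : (borel :: (nat => 'a) measure) ->M borel" for g :: "nat => nat"
   by (rule measurable_coordinatewise_then_product) (rule measurable_coord)
  have reL: "(%y i. y (g i)) : L ->M borel" for g :: "nat => nat" unfolding meas_L by (rule re)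
  fix f :: "(nat => 'a) => real" assume f: "continuous_on UNIV f" "!!x. 0 <= f x & f x <= 1"
  have fm: "f : borel_measurable borel" by (rule continuous_borel[OF f(1)])
  have c: "continuous_on UNIV (%y. f (%i. y (g i)))" for g :: "nat => nat"
   by (rule continuous_on_compose2[OF f(1)]) (auto intro!: continuous_on_coordinatewise_then_product contc)
  have cv: "(%k. \<integral>y. f (%i. sample (m (r k)) y (g i)) \<partial>N (r k)) ----> (LINT y|L. f (%i. y (g i)))" for g
  proof (rule conv[OF c])
   show "\<bar>f (%i. y (g i))\<bar> <= 1" for y using f(2)[of "%i. y (g i)"] by simp
  qed
  have eq: "(\<integral>y. f (%i. sample (m (r k)) y (b i)) \<partial>N (r k)) = (\<integral>y. f (%i. sample (m (r k)) y (a i)) \<partial>N (r k))"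
   if k: "k >= dlevel s" for k
  proof -
   obtain n where n: "dyad s * 2 ^ m (r k) = real n" using dyad_step[of s "m (r k)"] k mr[of k] by auto
   have "nat \<lfloor>dyad (b i) * 2 ^ m (r k)\<rfloor> = nat \<lfloor>dyad (a i) * 2 ^ m (r k)\<rfloor> + n" for i
   proof -
    have "dyad (b i) * 2 ^ m (r k) = dyad (a i) * 2 ^ m (r k) + of_int (int n)"
     using ab n by (simp add: distrib_right)
    then have "\<lfloor>dyad (b i) * 2 ^ m (r k)\<rfloor> = \<lfloor>dyad (a i) * 2 ^ m (r k)\<rfloor> + int n" by (simp only: floor_add_int)
    moreover have "0 <= \<lfloor>dyad (a i) * 2 ^ m (r k)\<rfloor>" using dyad_nonneg[of "a i"] by simp
    ultimately show ?thesis by (simp add: nat_add_distrib)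
   qed
   then have "(\<integral>y. f (%i. sample (m (r k)) y (b i)) \<partial>N (r k)) =
     (\<integral>y. (%z. f (%i. sample (m (r k)) z (a i))) (%l. y (l + n)) \<partial>N (r k))" by (simp add: sample_def)
   also have "... = (\<integral>z. f (%i. sample (m (r k)) z (a i)) \<partial>distr (N (r k)) borel (%y l. y (l + n)))"
   proof (rule integral_distr[symmetric])
    show "(%y l. y (l + n)) : N (r k) ->M borel" unfolding meas_N by (rule re)
    show "(%z. f (%i. sample (m (r k)) z (a i))) : borel_measurable borel"
     using mcompose[OF mcompose[OF sample_meas re] fm] .
   qed
   finally show ?thesis unfolding N4 .
  qed
  have "(%k. \<integral>y. f (%i. sample (m (r k)) y (a i)) \<partial>N (r k)) ----> (LINT y|L. f (%i. y (b i)))"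
   by (rule Lim_transform_eventually[OF cv[of b]])
     (use eq in \<open>auto simp: eventually_sequentially intro!: exI[of _ "dlevel s"]\<close>)
  from LIMSEQ_unique[OF this cv[of a]] have "(LINT y|L. f (%i. y (b i))) = (LINT y|L. f (%i. y (a i)))" .
  then show "(\<integral>x. f x \<partial>distr L borel (%y i. y (b i))) = (\<integral>x. f x \<partial>distr L borel (%y i. y (a i)))"
   by (simp add: integral_distr[OF reL fm])
 next
  have re: "(%y i. y (g i)) : L ->M borel" for g :: "nat => nat"
   unfolding meas_L by (rule measurable_coordinatewise_then_product) (rule measurable_coord)
  show "finite_measure (distr L borel (%y i. y (b i)))" "finite_measure (distr L borel (%y i. y (a i)))"
   by (rule Q.finite_measure_distr[OF re])+
 qed auto
 show ?thesis using L L0 L1' L2 L3 by (intro exI[of _ L]) blast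
qed

end

section \<open>Extension to continuous time\<close>

locale dyadic_process = L: prob_space L for L :: "(nat => 'a::euclidean_space) measure" +
 fixes nu :: "'a measure" and vb :: "'a => 'a" and C :: real and B :: "'a set"
 assumes sets_L: "sets L = sets borel"
  and marginal: "!!i. distr L borel (%y. y i) = nu"
  and lip: "!!i j. AE y in L. norm (y i - y j) <= C * \<bar>dyad i - dyad j\<bar>"
  and drift: "!!w Kw Lw i j. (!!x. norm (w x) <= Kw) ==> (!!x y. norm (w x - w y) <= Lw * norm (x - y)) ==>
   w : borel_measurable borel ==> Lw >= 0 ==> dyad i <= dyad j ==>
   (LINT y|L. norm (y j - y i - (dyad j - dyad i) *R w (y i))) <=
   (dyad j - dyad i) * ((LINT x|nu. norm (vb x - w x)) + Lw * (C * (dyad j - dyad i)))"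
  and stationary: "!!(a :: nat => nat) b s. (!!i. dyad (b i) = dyad (a i) + dyad s) ==>
   distr L borel (%y i. y (b i)) = distr L borel (%y i. y (a i))"
  and vb: "vb : borel_measurable borel" "!!x. norm (vb x) <= C"
  and B: "compact B" "AE x in nu. x : B"
begin

lemma C_nonneg: "C >= 0" using order_trans[OF norm_ge_zero vb(2)] .

lemma coordL: "(%y. y i) : L ->M borel"
 unfolding measurable_cong_sets[OF sets_L refl] by (rule measurable_coord)

lemma prob_nu: "prob_space nu" unfolding marginal[of 0, symmetric] by (rule L.prob_space_distr[OF coordL])

lemma sets_nu: "sets nu = sets borel" unfolding marginal[of 0, symmetric] by simp

lemma space_L: "space L = UNIV" using sets_eq_imp_space_eq[OF sets_L] by simp

definition good :: "(nat => 'a) => bool" where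
 "good y \<longleftrightarrow> (ALL i j. norm (y i - y j) <= C * \<bar>dyad i - dyad j\<bar>) & (ALL i. y i : B)"

lemma AE_good: "AE y in L. good y"
proof -
 have "AE y in L. y i : B" for i
 proof -
  have "AE x in distr L borel (%y. y i). x : B" unfolding marginal by (rule B(2))
  then show ?thesis by (rule AE_distrD[OF coordL])
 qed
 then show ?thesis unfolding good_def using lip by (simp add: AE_all_countable)
qed

lemma good_pred: "{y. good y} : sets borel"
proof -
 note [measurable] = measurable_coord
 have [measurable]: "B : sets borel" using B(1) by (simp add: compact_imp_closed)
 have "Measurable.pred borel good" unfolding good_def by measurable
 then show ?thesis by (simp add: pred_def)
qed

lemma B_ne: "B ~= {}"
proof
 assume "B = {}"
 interpret N: prob_space nu by (rule prob_nu)
 from B(2) \<open>B = {}\<close> have "AE x in nu. False" by simp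
 then show False by simp
qed

text \<open>On the exceptional null set the path is replaced by a constant in \<open>B\<close>, so that everything below holds for all sample points.\<close>

definition yy :: "(nat => 'a) => nat => 'a" where
 "yy y i = (if good y then y i else (SOME b. b : B))"

lemma yy_lip: "norm (yy y i - yy y j) <= C * \<bar>dyad i - dyad j\<bar>"
 using C_nonneg by (simp add: yy_def good_def)

lemma yy_B: "yy y i : B"
 using B_ne by (simp add: yy_def good_def some_in_eq)

lemma AE_yy: "AE y in L. yy y = y"
 using AE_good by eventually_elim (simp add: yy_def fun_eq_iff)

lemma yy_meas: "(%y. yy y i) : L ->M borel"
proof -
 have "{y : space L. good y} : sets L" using good_pred by (simp add: sets_L space_L)
 then show ?thesis unfolding yy_def by (intro measurable_If coordL) auto
qed

definition ix :: "real => nat => nat" where "ix t k = prod_encode (nat \<lfloor>t * 2 ^ k\<rfloor>, k)"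

lemma dyad_ix: "t >= 0 ==> dyad (ix t k) = of_int \<lfloor>t * 2 ^ k\<rfloor> / 2 ^ k"
 by (simp add: ix_def)

lemma dyad_ix_tendsto: assumes "t >= 0" shows "(%k. dyad (ix t k)) ----> t"
proof (rule tendsto_sandwich[of "%k. t - (1/2) ^ k" _ _ "%_. t"])
 have "of_int \<lfloor>t * 2 ^ k\<rfloor> / 2 ^ k <= (t * 2 ^ k) / 2 ^ k" for k :: nat by (intro divide_right_mono) auto
 then show "eventually (%k. dyad (ix t k) <= t) sequentially" using assms by (simp add: dyad_ix)
 have "(t * 2 ^ k - 1) / 2 ^ k <= of_int \<lfloor>t * 2 ^ k\<rfloor> / 2 ^ k" for k :: nat
  by (intro divide_right_mono) (linarith, simp)
 then show "eventually (%k. t - (1/2) ^ k <= dyad (ix t k)) sequentially"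
  using assms by (simp add: dyad_ix diff_divide_distrib power_one_over)
 have "(%k. t - (1/2) ^ k) ----> t - 0" by (intro tendsto_intros LIMSEQ_power_zero) auto
 then show "(%k. t - (1/2) ^ k) ----> t" by simp
qed auto

lemma dyad_ix_mono: "0 <= s ==> s <= t ==> dyad (ix s k) <= dyad (ix t k)"
 by (simp add: dyad_ix divide_right_mono floor_mono)

definition X :: "real => (nat => 'a) => 'a" where "X t y = lim (%k. yy y (ix t k))"

lemma convergent_yy:
 assumes d: "(%k. dyad (c k)) ----> t"
 shows "convergent (%k. yy y (c k))"
proof (rule Cauchy_convergent, rule metric_CauchyI)
 fix e :: real assume e: "e > 0"
 have "Cauchy (%k. dyad (c k))" using d by (rule LIMSEQ_imp_Cauchy)
 then obtain M where M: "!!m n. m >= M ==> n >= M ==> dist (dyad (c m)) (dyad (c n)) < e / (C + 1)"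
  using metric_CauchyD[of _ "e / (C + 1)"] e C_nonneg by (metis divide_pos_pos add_nonneg_pos zero_less_one)
 have "dist (yy y (c m)) (yy y (c n)) < e" if "m >= M" "n >= M" for m n
 proof -
  have "dist (yy y (c m)) (yy y (c n)) <= C * dist (dyad (c m)) (dyad (c n))"
   using yy_lip[of y "c m" "c n"] by (simp add: dist_norm)
  also have "... <= (C + 1) * dist (dyad (c m)) (dyad (c n))" by (intro mult_right_mono) auto
  also have "... < (C + 1) * (e / (C + 1))" using M[OF that] C_nonneg by (intro mult_strict_left_mono) auto
  finally show ?thesis using C_nonneg by simp
 qed
 then show "EX M. ALL m>=M. ALL n>=M. dist (yy y (c m)) (yy y (c n)) < e" by blast
qed

lemma yy_tendsto_X:
 assumes t: "t >= 0" and d: "(%k. dyad (c k)) ----> t"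
 shows "(%k. yy y (c k)) ----> X t y"
proof -
 have 1: "(%k. yy y (ix t k)) ----> X t y"
  unfolding X_def using convergent_yy[OF dyad_ix_tendsto[OF t]] by (simp add: convergent_LIMSEQ_iff)
 have "(%k. C * \<bar>dyad (c k) - dyad (ix t k)\<bar>) ----> C * \<bar>t - t\<bar>" by (intro tendsto_intros d dyad_ix_tendsto t)
 then have "(%k. yy y (c k) - yy y (ix t k)) ----> 0"
  by (intro Lim_null_comparison[of "%k. yy y (c k) - yy y (ix t k)"]) (auto simp: yy_lip)
 from tendsto_add[OF this 1] show ?thesis by simp
qed

text \<open>A Lipschitz function on the dyadic times has a unique continuous extension, with the same constant.\<close>

lemma X_lip:
 assumes "s >= 0" "t >= 0"
 shows "norm (X t y - X s y) <= C * \<bar>t - s\<bar>"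
proof (rule LIMSEQ_le)
 show "(%k. norm (yy y (ix t k) - yy y (ix s k))) ----> norm (X t y - X s y)"
  by (intro tendsto_intros yy_tendsto_X dyad_ix_tendsto assms)
 show "(%k. C * \<bar>dyad (ix t k) - dyad (ix s k)\<bar>) ----> C * \<bar>t - s\<bar>"
  by (intro tendsto_intros dyad_ix_tendsto assms)
qed (use yy_lip in auto)

lemma X_B: "t >= 0 ==> X t y : B"
 using closed_sequentially[OF compact_imp_closed[OF B(1)], of "%k. yy y (ix t k)" "X t y"] yy_B
  yy_tendsto_X[OF _ dyad_ix_tendsto] by blast

lemma X_joint: "(%p. X (fst p) (snd p)) : borel >< L ->M borel"
 unfolding X_def
proof (rule borel_measurable_lim_metric)
 fix k
 have ixm: "(%t. ix t k) : borel ->M count_space UNIV"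
 proof -
  have "(%t::real. nat \<lfloor>t * 2 ^ k\<rfloor>) : borel ->M count_space UNIV" by measurable
  from mcompose[OF this, of "%n. prod_encode (n, k)" "count_space UNIV"] show ?thesis
   by (simp add: ix_def)
 qed
 show "(%p. yy (snd p) (ix (fst p) k)) : borel_measurable (borel >< L)"
 proof (rule measurable_compose_countable[where f="%i p. yy (snd p) i" and g="%p. ix (fst p) k"])
  show "(%p. yy (snd p) i) : borel_measurable (borel >< L)" for i
   by (rule mcompose[OF measurable_snd yy_meas])
  show "(%p. ix (fst p) k) : borel >< L ->M count_space UNIV"
   by (rule mcompose[OF measurable_fst ixm])
 qed
qed

lemma X_meas: "X t : L ->M borel"
 using measurable_Pair2[OF X_joint, of t] by simp

lemma X_path: "y : space L ==> (%t. X t y) : borel ->M borel"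
 using measurable_Pair1[OF X_joint, of y] by simp

lemma seq_meas: "(!!i. (%y. g y i) : L ->M borel) ==> g : L ->M (borel :: (nat => 'a) measure)"
 by (rule measurable_coordinatewise_then_product)

text \<open>Dyadic approximations of the times and of the shift reduce the claim to dyadic shifts; dominated convergence does the rest.\<close>

lemma stationary_seq:
 fixes t :: "nat => real"
 assumes t: "!!i. t i >= 0" and tau: "tau >= 0"
 shows "distr L borel (%y i. X (t i + tau) y) = distr L borel (%y i. X (t i) y)"
proof (rule measure_eqI_continuous)
 have m1: "(%y i. X (t i + tau) y) : L ->M borel" "(%y i. X (t i) y) : L ->M borel"
  by (rule seq_meas, rule X_meas)+
 then show "finite_measure (distr L borel (%y i. X (t i + tau) y))" "finite_measure (distr L borel (%y i. X (t i) y))"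
  by (auto intro: L.finite_measure_distr)
 fix f :: "(nat => 'a) => real" assume f: "continuous_on UNIV f" "!!x. 0 <= f x & f x <= 1"
 have fm: "f : borel_measurable borel" by (rule continuous_borel[OF f(1)])
 have lim: "(%k. LINT y|L. f (%i. yy y (c i k))) ----> (LINT y|L. f (%i. X (u i) y))"
  if u: "!!i. u i >= 0" "!!i. (%k. dyad (c i k)) ----> u i" for c and u :: "nat => real"
 proof (rule integral_dominated_convergence[where w="%_. 1"])
  show "(%y. f (%i. yy y (c i k))) : borel_measurable L" for k
   by (rule mcompose[OF seq_meas fm], rule yy_meas)
  show "(%y. f (%i. X (u i) y)) : borel_measurable L"
   by (rule mcompose[OF seq_meas fm], rule X_meas)
  have "(%k. f (%i. yy y (c i k))) ----> f (%i. X (u i) y)" for y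
   by (rule continuous_on_tendsto_compose[OF f(1)])
     (auto intro!: tendsto_seq_coordinatewise yy_tendsto_X u)
  then show "AE y in L. (%k. f (%i. yy y (c i k))) ----> f (%i. X (u i) y)" by simp
  show "AE y in L. norm (f (%i. yy y (c i k))) <= 1" for k using f(2) by simp
 qed auto
 define cx where "cx i k = prod_encode (nat \<lfloor>t i * 2 ^ k\<rfloor> + nat \<lfloor>tau * 2 ^ k\<rfloor>, k)" for i k
 have cx: "dyad (cx i k) = dyad (ix (t i) k) + dyad (ix tau k)" for i k
  by (simp add: cx_def ix_def add_divide_distrib)
 have "(LINT y|L. f (%i. yy y (cx i k))) = (LINT y|L. f (%i. yy y (ix (t i) k)))" for k
 proof -
  have yyE: "(LINT y|L. f (%i. yy y (g i))) = (\<integral>z. f z \<partial>distr L borel (%y i. y (g i)))" for g :: "nat => nat"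
  proof -
   have g: "(%y i. y (g i)) : L ->M borel" by (rule seq_meas, rule coordL)
   have "(LINT y|L. f (%i. yy y (g i))) = (LINT y|L. f (%i. y (g i)))"
   proof (rule integral_cong_AE)
    show "(%y. f (%i. yy y (g i))) : borel_measurable L" by (rule mcompose[OF seq_meas fm], rule yy_meas)
    show "(%y. f (%i. y (g i))) : borel_measurable L" by (rule mcompose[OF g fm])
    show "AE y in L. f (%i. yy y (g i)) = f (%i. y (g i))" using AE_yy by eventually_elim simp
   qed
   then show ?thesis by (simp add: integral_distr[OF g fm])
  qed
  show ?thesis unfolding yyE stationary[of "%i. cx i k" "%i. ix (t i) k" "ix tau k", OF cx] ..
 qed
 moreover have "(%k. LINT y|L. f (%i. yy y (cx i k))) ----> (LINT y|L. f (%i. X (t i + tau) y))"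
  by (rule lim) (use t tau in \<open>auto simp: cx intro!: tendsto_add dyad_ix_tendsto\<close>)
 moreover have "(%k. LINT y|L. f (%i. yy y (ix (t i) k))) ----> (LINT y|L. f (%i. X (t i) y))"
  by (rule lim) (use t in \<open>auto intro!: dyad_ix_tendsto\<close>)
 ultimately have "(LINT y|L. f (%i. X (t i + tau) y)) = (LINT y|L. f (%i. X (t i) y))"
  using LIMSEQ_unique[of "%k. LINT y|L. f (%i. yy y (ix (t i) k))"] by presburger
 then show "(\<integral>x. f x \<partial>distr L borel (%y i. X (t i + tau) y)) = (\<integral>x. f x \<partial>distr L borel (%y i. X (t i) y))"
  by (simp add: integral_distr[OF m1(1) fm] integral_distr[OF m1(2) fm])
qed auto

lemma process_meas: "(%y. \<lambda>t\<in>{0..}. X (t + tau) y) : L ->M PiM {0..} (%_. borel)"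
 by (rule measurable_restrict) (rule X_meas)

text \<open>Finite-dimensional distributions determine the law, and a finite set of times can be enumerated by a sequence.\<close>

lemma stationary_PiM:
 assumes tau: "tau >= 0"
 shows "distr L (PiM {0..} (%_. borel)) (%y. \<lambda>t\<in>{0..}. X (t + tau) y) =
  distr L (PiM {0..} (%_. borel)) (%y. \<lambda>t\<in>{0..}. X t y)"
proof (rule measure_eqI_PiM_infinite)
 have m0: "(%y. \<lambda>t\<in>{0..}. X t y) : L ->M PiM {0..} (%_. borel)" using process_meas[of 0] by simp
 show "finite_measure (distr L (PiM {0..} (%_. borel)) (%y. \<lambda>t\<in>{0..}. X (t + tau) y))"
  by (rule L.finite_measure_distr[OF process_meas])
 fix A :: "real => 'a set" and J assume J: "finite J" "J \<subseteq> {0..}" and A: "!!i. i : J ==> A i : sets borel"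
 define E where "E = prod_emb {0..} (%_. borel) J (Pi\<^sub>E J A)"
 have E: "E : sets (PiM {0..} (%_. borel))" unfolding E_def by (rule sets_PiM_I) (use J A in auto)
 show "emeasure (distr L (PiM {0..} (%_. borel)) (%y. \<lambda>t\<in>{0..}. X (t + tau) y)) (prod_emb {0..} (%_. borel) J (Pi\<^sub>E J A)) =
  emeasure (distr L (PiM {0..} (%_. borel)) (%y. \<lambda>t\<in>{0..}. X t y)) (prod_emb {0..} (%_. borel) J (Pi\<^sub>E J A))"
 proof (cases "J = {}")
  case True
  have ps: "prob_space (distr L (PiM {0..} (%_. borel)) (%y. \<lambda>t\<in>{0..}. X (t + tau) y))" for tau
   by (rule L.prob_space_distr[OF process_meas])
  moreover have "prod_emb {0..} (%_. borel) J (Pi\<^sub>E J A) = space (PiM {0..} (%_. borel))"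
   using True by (auto simp: prod_emb_def space_PiM restrict_def)
  ultimately show ?thesis
   using prob_space.emeasure_space_1[OF ps[of tau]] prob_space.emeasure_space_1[OF ps[of 0]] by (simp add: space_PiM)
 next
  case False
  define t where "t = from_nat_into J"
  have tJ: "range t = J" unfolding t_def using J False by (simp add: range_from_nat_into countable_finite)
  have t0: "t i >= 0" for i using tJ J by auto
  define Z where "Z = {z :: nat => 'a. ALL i. z i : A (t i)}"
  have Z: "Z : sets borel"
  proof -
   note [measurable] = measurable_coord
   have [measurable]: "A (t i) : sets borel" for i using A tJ by auto
   have "{z : space borel. ALL i. z i : A (t i)} : sets (borel :: (nat => 'a) measure)" by measurable
   then show ?thesis by (simp add: Z_def)
  qed
  have iff: "(\<lambda>t\<in>{0..}. X (t + sigma) y) : E \<longleftrightarrow> (%i. X (t i + sigma) y) : Z" for y sigma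
  proof -
   have "(\<lambda>t\<in>{0..}. X (t + sigma) y) : E \<longleftrightarrow> (ALL j:J. X (j + sigma) y : A j)"
    using J by (auto simp: E_def prod_emb_def PiE_iff extensional_def)
   also have "... \<longleftrightarrow> (%i. X (t i + sigma) y) : Z" unfolding tJ[symmetric] Z_def by auto
   finally show ?thesis .
  qed
  have em: "emeasure (distr L (PiM {0..} (%_. borel)) (%y. \<lambda>t\<in>{0..}. X (t + sigma) y)) E =
    emeasure (distr L borel (%y i. X (t i + sigma) y)) Z" for sigma
  proof -
   have m: "(%y i. X (t i + sigma) y) : L ->M borel" by (rule seq_meas, rule X_meas)
   show ?thesis unfolding emeasure_distr[OF process_meas E] emeasure_distr[OF m Z]
    by (rule arg_cong[where f="emeasure L"]) (auto simp: iff)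
  qed
  show ?thesis using em[of tau] em[of 0] stationary_seq[of t, OF t0 tau] by (simp add: E_def)
 qed
qed auto

lemma X_law: assumes "t >= 0" shows "distr L borel (X t) = nu"
proof (rule measure_eqI_continuous)
 interpret N: prob_space nu by (rule prob_nu)
 show "finite_measure nu" by (rule N.finite_measure_axioms)
 show "finite_measure (distr L borel (X t))" by (rule L.finite_measure_distr[OF X_meas])
 fix f :: "'a => real" assume f: "continuous_on UNIV f" "!!x. 0 <= f x & f x <= 1"
 have fm: "f : borel_measurable borel" by (rule continuous_borel[OF f(1)])
 have "(LINT y|L. f (yy y i)) = (LINT x|nu. f x)" for i
 proof -
  have "(LINT y|L. f (yy y i)) = (LINT y|L. f (y i))"
  proof (rule integral_cong_AE)
   show "(%y. f (yy y i)) : borel_measurable L" by (rule mcompose[OF yy_meas fm])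
   show "(%y. f (y i)) : borel_measurable L" by (rule mcompose[OF coordL fm])
   show "AE y in L. f (yy y i) = f (y i)" using AE_yy by eventually_elim simp
  qed
  also have "... = (\<integral>x. f x \<partial>distr L borel (%y. y i))" by (rule integral_distr[OF coordL fm, symmetric])
  finally show ?thesis unfolding marginal .
 qed
 moreover have "(%k. LINT y|L. f (yy y (ix t k))) ----> (LINT y|L. f (X t y))"
 proof (rule integral_dominated_convergence[where w="%_. 1"])
  show "(%y. f (yy y (ix t k))) : borel_measurable L" for k by (rule mcompose[OF yy_meas fm])
  show "(%y. f (X t y)) : borel_measurable L" by (rule mcompose[OF X_meas fm])
  have "(%k. f (yy y (ix t k))) ----> f (X t y)" for y
   by (rule continuous_on_tendsto_compose[OF f(1)]) (auto intro!: yy_tendsto_X dyad_ix_tendsto assms)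
  then show "AE y in L. (%k. f (yy y (ix t k))) ----> f (X t y)" by simp
  show "AE y in L. norm (f (yy y (ix t k))) <= 1" for k using f(2) by simp
 qed auto
 ultimately have "(%k. LINT x|nu. f x) ----> (LINT y|L. f (X t y))" by simp
 then have "(LINT y|L. f (X t y)) = (LINT x|nu. f x)" by (rule LIMSEQ_unique[OF _ tendsto_const])
 then show "(\<integral>x. f x \<partial>distr L borel (X t)) = (LINT x|nu. f x)" by (simp add: integral_distr[OF X_meas fm])
qed (auto simp: sets_nu)

end

section \<open>The differential equation of the limit\<close>

context dyadic_process
begin

interpretation N: prob_space nu by (rule prob_nu)

definition time :: "real => real measure" where "time t = density lborel (indicator {0..t})"

lemma sets_time: "sets (time t) = sets borel" by (simp add: time_def)

lemma finite_time: assumes "t >= 0" shows "finite_measure (time t)"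
 by (rule finite_measureI) (use assms in \<open>simp add: time_def emeasure_density\<close>)

definition I :: "('a => 'b::euclidean_space) => real => (nat => 'a) => 'b" where
 "I g t y = integral {0..t} (%s. g (X s y))"

context
 fixes g :: "'a => 'b::euclidean_space" and K :: real
 assumes g: "g : borel_measurable borel" "!!x. norm (g x) <= K"
begin

lemma path_g_meas: "(%s. g (X s y)) : borel_measurable borel"
 using mcompose[OF X_path g(1)] by (simp add: space_L)

lemma path_g_set_integrable: "set_integrable lborel {a..b} (%s. g (X s y))"
 by (rule bounded_borel_set_integrable[OF path_g_meas g(2)])

lemma I_set: "I g t y = (LINT s:{0..t}|lborel. g (X s y))"
 unfolding I_def using set_borel_integral_eq_integral(2)[OF path_g_set_integrable] by simp

lemma I_time: "I g t y = (LINT s|(time t). g (X s y))"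
proof -
 have "(\<integral>s. g (X s y) \<partial>density lborel (%s. ennreal (indicator {0..t} s))) = (LINT s|lborel. indicator {0..t} s *R g (X s y))"
  by (rule integral_density) (use path_g_meas in auto)
 moreover have "density lborel (%s. ennreal (indicator {0..t} s)) = time t"
  unfolding time_def by (rule density_cong) (auto simp: ennreal_indicator)
 ultimately show ?thesis unfolding I_set set_lebesgue_integral_def by simp
qed

lemma joint_g: "(%(s, y). g (X s y)) : borel_measurable (time t >< L)"
proof -
 have "(%p. g (X (fst p) (snd p))) : borel_measurable (borel >< L)" by (rule mcompose[OF X_joint g(1)])
 moreover have "sets (time t >< L) = sets (borel >< L)" by (intro sets_pair_measure_cong sets_time refl)
 ultimately show ?thesis by (simp add: split_beta' cong: measurable_cong_sets)
qed

lemma I_meas: assumes "t >= 0" shows "I g t : borel_measurable L"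
proof -
 interpret T: finite_measure "time t" by (rule finite_time[OF assms])
 have "(%(y, s). g (X s y)) : borel_measurable (L >< time t)"
  using mcompose[OF measurable_pair_swap' joint_g, of t] by (simp add: split_beta')
 then have "(%y. \<integral>s. g (X s y) \<partial>time t) : borel_measurable L" by (rule T.borel_measurable_lebesgue_integral)
 moreover have "I g t = (%y. \<integral>s. g (X s y) \<partial>time t)" by (rule ext, rule I_time)
 ultimately show ?thesis by (simp only:)
qed

lemma I_diff: assumes "0 <= s" "s <= t" shows "norm (I g t y - I g s y) <= K * (t - s)"
 unfolding I_def by (rule primitive_lipschitz(2)[OF path_g_meas g(2) assms])

lemma I_diff_eq: assumes "0 <= s" "s <= t" shows "I g t y - I g s y = integral {s..t} (%r. g (X r y))"
 unfolding I_def by (rule primitive_lipschitz(1)[OF path_g_meas g(2) assms])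

lemma I_0: "I g 0 y = 0" by (simp add: I_def)

lemma I_expectation:
 assumes t: "t >= 0"
 shows "(LINT y|L. norm (I g t y)) <= t * (LINT x|nu. norm (g x))"
proof -
 interpret T: finite_measure "time t" by (rule finite_time[OF t])
 interpret TL: pair_sigma_finite "time t" L ..
 interpret FT: finite_measure "time t >< L"
  by (rule finite_measure_pair_measure) (rule L.finite_measure_axioms, rule T.finite_measure_axioms)
 have gi: "integrable (time t >< L) (%(s, y). norm (g (X s y)))"
 proof (rule FT.integrable_const_bound[of _ K])
  show "AE p in time t >< L. norm (case p of (s, y) => norm (g (X s y))) <= K" using g(2) by auto
  show "(%(s, y). norm (g (X s y))) : borel_measurable (time t >< L)"
   using mcompose[OF joint_g borel_measurable_norm] by (simp add: split_beta')
 qed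
 have le: "norm (I g t y) <= (LINT s|(time t). norm (g (X s y)))" for y
  unfolding I_time by (rule integral_norm_bound)
 have K0: "K >= 0" using order_trans[OF norm_ge_zero g(2)] .
 have "(LINT y|L. norm (I g t y)) <= (\<integral>y. \<integral>s. norm (g (X s y)) \<partial>time t \<partial>L)"
 proof (rule integral_mono[OF _ _ le])
  show "integrable L (%y. norm (I g t y))"
  proof (rule L.integrable_const_bound[of _ "K * t"])
   show "AE y in L. norm (norm (I g t y)) <= K * t" using I_diff[of 0 t] t by (simp add: I_0)
  qed (use I_meas[OF t] in simp)
  show "integrable L (%y. \<integral>s. norm (g (X s y)) \<partial>time t)" using TL.integrable_snd[OF gi] by simp
 qed
 also have "... = (LINT s|(time t). (LINT y|L. norm (g (X s y))))" by (rule TL.Fubini_integral[OF gi])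
 also have "... = (LINT s|(time t). (LINT x|nu. norm (g x)))"
 proof (rule integral_cong_AE)
  have "AE s in time t. s >= 0" unfolding time_def by (subst AE_density) (auto split: split_indicator)
  then show "AE s in time t. (LINT y|L. norm (g (X s y))) = (LINT x|nu. norm (g x))"
  proof eventually_elim
   case (elim s)
   have "(\<integral>x. norm (g x) \<partial>distr L borel (X s)) = (LINT y|L. norm (g (X s y)))"
    by (rule integral_distr[OF X_meas]) (use g(1) in measurable)
   then show ?case unfolding X_law[OF elim] by simp
  qed
  show "(%s. LINT y|L. norm (g (X s y))) : borel_measurable (time t)"
   using borel_measurable_integrable[OF TL.integrable_fst[OF gi]] .
 qed simp
 also have "... = t * (LINT x|nu. norm (g x))"
 proof -
  have "emeasure (time t) (space (time t)) = ennreal t"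
   using t by (simp add: time_def emeasure_density)
  then have "measure (time t) (space (time t)) = t" using t by (simp add: measure_def)
  then show ?thesis by simp
 qed
 finally show ?thesis .
qed

end

text \<open>For a Lipschitz \<open>w\<close> the deviation over a short interval is controlled by the drift estimate, up to a second-order
 term; adding over \<open>n\<close> intervals of length \<open>t / n\<close> removes that term.\<close>

lemma ode_test:
 fixes w :: "'a => 'a"
 assumes w: "bounded_lipschitz w" and t: "t >= 0"
 shows "(LINT y|L. norm (X t y - X 0 y - I w t y)) <= t * (LINT x|nu. norm (vb x - w x))"
proof -
 obtain Lw Kw where Lw: "Lw > 0" "!!x y. norm (w x - w y) <= Lw * norm (x - y)" and Kw: "Kw > 0" "!!x. norm (w x) <= Kw"
  using bounded_lipschitzE[OF w] by metis
 have wc: "continuous_on UNIV w" by (rule bounded_lipschitz_continuous[OF w])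
 have wm: "w : borel_measurable borel" by (rule bounded_lipschitz_measurable[OF w])
 define kappa where "kappa = (LINT x|nu. norm (vb x - w x))"
 obtain RB where RB: "!!x. x : B ==> norm x <= RB" using compact_imp_bounded[OF B(1)] by (auto simp: bounded_iff)
 have XR: "norm (X s y) <= RB" if "s >= 0" for s y by (rule RB[OF X_B[OF that]])
 have wX: "(%y. w (X s y)) : borel_measurable L" for s by (rule mcompose[OF X_meas wm])
 have step: "(LINT y|L. norm (X q y - X p y - (q - p) *R w (X p y))) <= (q - p) * (kappa + Lw * (C * (q - p)))"
  if pq: "0 <= p" "p <= q" for p q
 proof (rule LIMSEQ_le)
  define d where "d k = dyad (ix q k) - dyad (ix p k)" for k
  have q0: "0 <= q" using pq by simp
  have dl: "d ----> q - p" unfolding d_def[abs_def] by (intro tendsto_intros dyad_ix_tendsto pq q0)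
  have dk: "\<bar>d k\<bar> <= q + 1" for k
  proof -
   have "dyad (ix q k) <= q" unfolding dyad_ix[OF q0] by (simp add: divide_le_eq)
   then show ?thesis using dyad_nonneg[of "ix q k"] dyad_nonneg[of "ix p k"] dyad_ix_mono[OF pq, of k] by (simp add: d_def)
  qed
  show "(%k. d k * (kappa + Lw * (C * d k))) ----> (q - p) * (kappa + Lw * (C * (q - p)))" by (intro tendsto_intros dl)
  show "(%k. LINT y|L. norm (yy y (ix q k) - yy y (ix p k) - d k *R w (yy y (ix p k)))) ---->
    (LINT y|L. norm (X q y - X p y - (q - p) *R w (X p y)))"
  proof (rule integral_dominated_convergence[where w="%_. RB + RB + (q + 1) * Kw"])
   show "(%y. norm (X q y - X p y - (q - p) *R w (X p y))) : borel_measurable L"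
    by (intro mcompose[OF _ borel_measurable_norm] borel_measurable_diff borel_measurable_scaleR borel_measurable_const X_meas wX)
   show "(%y. norm (yy y (ix q k) - yy y (ix p k) - d k *R w (yy y (ix p k)))) : borel_measurable L" for k
    using yy_meas mcompose[OF yy_meas wm] by (intro mcompose[OF _ borel_measurable_norm] borel_measurable_diff borel_measurable_scaleR) auto
   have "(%k. norm (yy y (ix q k) - yy y (ix p k) - d k *R w (yy y (ix p k)))) ---->
     norm (X q y - X p y - (q - p) *R w (X p y))" for y
    by (intro tendsto_intros dl yy_tendsto_X dyad_ix_tendsto pq q0 continuous_on_tendsto_compose[OF wc]) auto
   then show "AE y in L. (%k. norm (yy y (ix q k) - yy y (ix p k) - d k *R w (yy y (ix p k)))) ---->
     norm (X q y - X p y - (q - p) *R w (X p y))" by simp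
   have "norm (yy y (ix q k) - yy y (ix p k) - d k *R w (yy y (ix p k))) <= RB + RB + (q + 1) * Kw" for y k
   proof -
    have "norm (d k *R w (yy y (ix p k))) <= (q + 1) * Kw"
     unfolding norm_scaleR by (intro mult_mono dk Kw) (use q0 in auto)
    moreover have "norm (yy y (ix q k) - yy y (ix p k)) <= RB + RB"
     by (rule order_trans[OF norm_triangle_ineq4]) (intro add_mono RB yy_B)
    ultimately show ?thesis
     using norm_triangle_ineq4[of "yy y (ix q k) - yy y (ix p k)" "d k *R w (yy y (ix p k))"] by linarith
   qed
   then show "AE y in L. norm (norm (yy y (ix q k) - yy y (ix p k) - d k *R w (yy y (ix p k)))) <= RB + RB + (q + 1) * Kw" for k by simp
  qed auto
  have "(LINT y|L. norm (yy y (ix q k) - yy y (ix p k) - d k *R w (yy y (ix p k)))) <= d k * (kappa + Lw * (C * d k))" for k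
  proof -
   have "(LINT y|L. norm (yy y (ix q k) - yy y (ix p k) - d k *R w (yy y (ix p k)))) =
    (LINT y|L. norm (y (ix q k) - y (ix p k) - d k *R w (y (ix p k))))"
   proof (rule integral_cong_AE)
    show "(%y. norm (yy y (ix q k) - yy y (ix p k) - d k *R w (yy y (ix p k)))) : borel_measurable L"
     using yy_meas mcompose[OF yy_meas wm] by (intro mcompose[OF _ borel_measurable_norm] borel_measurable_diff borel_measurable_scaleR) auto
    show "(%y. norm (y (ix q k) - y (ix p k) - d k *R w (y (ix p k)))) : borel_measurable L"
     using coordL mcompose[OF coordL wm] by (intro mcompose[OF _ borel_measurable_norm] borel_measurable_diff borel_measurable_scaleR) auto
    show "AE y in L. norm (yy y (ix q k) - yy y (ix p k) - d k *R w (yy y (ix p k))) = norm (y (ix q k) - y (ix p k) - d k *R w (y (ix p k)))"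
     using AE_yy by eventually_elim simp
   qed
   also have "... <= d k * (kappa + Lw * (C * d k))"
    unfolding d_def kappa_def by (rule drift[OF Kw(2) Lw(2) wm _ dyad_ix_mono[OF pq]]) (use Lw in auto)
   finally show ?thesis .
  qed
  then show "EX N. ALL k>=N. (LINT y|L. norm (yy y (ix q k) - yy y (ix p k) - d k *R w (yy y (ix p k)))) <= d k * (kappa + Lw * (C * d k))" by blast
 qed
 define Delta where "Delta p q y = X q y - X p y - (I w q y - I w p y)" for p q y
 have Delta_meas: "Delta p q : borel_measurable L" if "p >= 0" "q >= 0" for p q
  unfolding Delta_def using X_meas I_meas[OF wm Kw(2)] that by (intro borel_measurable_diff) auto
 have Delta_bd: "norm (Delta p q y) <= C * (q - p) + Kw * (q - p)" if "0 <= p" "p <= q" for p q y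
  unfolding Delta_def using X_lip[of p q y] I_diff[OF wm Kw(2) that, of y] that
   norm_triangle_ineq4[of "X q y - X p y" "I w q y - I w p y"] by simp
 have Delta_int: "integrable L (%y. norm (Delta p q y))" if "0 <= p" "p <= q" for p q
  by (rule L.integrable_const_bound[of _ "C * (q - p) + Kw * (q - p)"]) (use Delta_bd[OF that] Delta_meas that in auto)
 have Delta_le: "(LINT y|L. norm (Delta p q y)) <= (q - p) * (kappa + 2 * Lw * (C * (q - p)))" if pq: "0 <= p" "p <= q" for p q
 proof -
  define f where "f y = norm (X q y - X p y - (q - p) *R w (X p y))" for y
  have fm: "f : borel_measurable L" unfolding f_def
   by (intro mcompose[OF _ borel_measurable_norm] borel_measurable_diff borel_measurable_scaleR borel_measurable_const X_meas wX)
  have fb: "norm (f y) <= C * (q - p) + Kw * (q - p)" for y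
  proof -
   have "norm ((q - p) *R w (X p y)) <= Kw * (q - p)" using mult_right_mono[OF Kw(2)[of "X p y"], of "q - p"] pq by (simp add: mult.commute)
   then show ?thesis unfolding f_def using X_lip[of p q y] pq norm_triangle_ineq4[of "X q y - X p y" "(q - p) *R w (X p y)"] by simp
  qed
  have fi: "integrable L f" by (rule L.integrable_const_bound[of _ "C * (q - p) + Kw * (q - p)"]) (use fb fm in auto)
  have "norm (Delta p q y) <= f y + Lw * (C * (q - p)) * (q - p)" for y
  proof -
   have wi: "(%r. w (X r y)) integrable_on {p..q}" by (rule bounded_borel_integrable_on[OF path_g_meas[OF wm Kw(2)] Kw(2)])
   have "(I w q y - I w p y) - (q - p) *R w (X p y) = integral {p..q} (%r. w (X r y) - w (X p y))"
    unfolding I_diff_eq[OF wm Kw(2) pq] using wi pq by (subst hk_integral_diff) auto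
   also have "norm ... <= Lw * (C * (q - p)) * (q - p)"
   proof (rule integral_norm_le)
    show "(%r. w (X r y) - w (X p y)) integrable_on {p..q}" using wi by (intro integrable_diff) auto
    fix r assume r: "r : {p..q}"
    have "norm (w (X r y) - w (X p y)) <= Lw * norm (X r y - X p y)" by (rule Lw)
    also have "... <= Lw * (C * \<bar>r - p\<bar>)" using X_lip[of p r y] r pq Lw by (intro mult_left_mono) auto
    also have "... <= Lw * (C * (q - p))" using r C_nonneg Lw by (intro mult_left_mono) auto
    finally show "norm (w (X r y) - w (X p y)) <= Lw * (C * (q - p))" .
   qed (use pq in auto)
   finally have "norm ((I w q y - I w p y) - (q - p) *R w (X p y)) <= Lw * (C * (q - p)) * (q - p)" .
   moreover have "Delta p q y = (X q y - X p y - (q - p) *R w (X p y)) - ((I w q y - I w p y) - (q - p) *R w (X p y))"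
    by (simp add: Delta_def)
   ultimately show ?thesis unfolding f_def
    using norm_triangle_ineq4[of "X q y - X p y - (q - p) *R w (X p y)" "(I w q y - I w p y) - (q - p) *R w (X p y)"] by simp
  qed
  then have "(LINT y|L. norm (Delta p q y)) <= (LINT y|L. f y + Lw * (C * (q - p)) * (q - p))"
   by (intro integral_mono Delta_int[OF pq] bo_integrable_add fi) auto
  also have "... = (LINT y|L. f y) + Lw * (C * (q - p)) * (q - p)" using fi L.prob_space by simp
  also have "... <= (q - p) * (kappa + Lw * (C * (q - p))) + Lw * (C * (q - p)) * (q - p)"
   unfolding f_def using step[OF pq] by simp
  finally show ?thesis by (simp add: algebra_simps)
 qed
 have bound: "(LINT y|L. norm (Delta 0 t y)) <= t * (kappa + 2 * Lw * (C * (t / Suc n)))" for n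
 proof -
  define h where "h = t / Suc n"
  have h: "h >= 0" using t by (simp add: h_def)
  have sum: "(LINT y|L. norm (Delta 0 (real m * h) y)) <= real m * (h * (kappa + 2 * Lw * (C * h)))" for m
  proof (induction m)
   case 0
   show ?case by (simp add: Delta_def)
  next
   case (Suc m)
   have mh: "0 <= real m * h" "real m * h <= real (Suc m) * h" using h by (auto simp: mult_right_mono)
   have "(LINT y|L. norm (Delta 0 (real (Suc m) * h) y)) <= (LINT y|L. norm (Delta 0 (real m * h) y) + norm (Delta (real m * h) (real (Suc m) * h) y))"
   proof (rule integral_mono)
    show "norm (Delta 0 (real (Suc m) * h) y) <= norm (Delta 0 (real m * h) y) + norm (Delta (real m * h) (real (Suc m) * h) y)" for y
    proof -
     have "Delta 0 (real (Suc m) * h) y = Delta 0 (real m * h) y + Delta (real m * h) (real (Suc m) * h) y" by (simp add: Delta_def)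
     then show ?thesis by (simp add: norm_triangle_ineq)
    qed
   qed (use Delta_int mh in auto)
   also have "... = (LINT y|L. norm (Delta 0 (real m * h) y)) + (LINT y|L. norm (Delta (real m * h) (real (Suc m) * h) y))"
    using Delta_int mh by (intro bo_integral_add) auto
   also have "(LINT y|L. norm (Delta (real m * h) (real (Suc m) * h) y)) <= h * (kappa + 2 * Lw * (C * h))"
    using Delta_le[OF mh] by (simp add: algebra_simps)
   finally show ?case using Suc by (simp add: algebra_simps)
  qed
  have "real (Suc n) * h = t" by (simp add: h_def)
  then show ?thesis using sum[of "Suc n"] by (simp only: h_def[symmetric] flip: mult.assoc)
 qed
 have "(%n. t * (kappa + 2 * Lw * (C * (t / Suc n)))) ----> t * (kappa + 2 * Lw * (C * 0))"
  using LIMSEQ_Suc[OF lim_const_over_n[of t]] by (intro tendsto_intros) simp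
 then have "(LINT y|L. norm (Delta 0 t y)) <= t * (kappa + 2 * Lw * (C * 0))"
  by (rule LIMSEQ_le_const) (use bound in auto)
 then show ?thesis by (simp add: Delta_def I_0[OF wm Kw(2)] kappa_def)
qed

text \<open>All positions have law \<open>nu\<close>, so approximating \<open>vb\<close> in \<open>L1\<close> by Lipschitz functions approximates the primitives along the paths.\<close>

lemma ode_at: assumes t: "t >= 0" shows "AE y in L. X t y = X 0 y + I vb t y"
proof -
 define f where "f y = norm (X t y - X 0 y - I vb t y)" for y
 have Im: "I vb t : borel_measurable L" by (rule I_meas[OF vb t])
 have fm: "f : borel_measurable L" unfolding f_def by (intro mcompose[OF _ borel_measurable_norm] borel_measurable_diff X_meas Im)
 have fb: "norm (f y) <= C * t + C * t" for y
  unfolding f_def using X_lip[of 0 t y] I_diff[OF vb, of 0 t y] t norm_triangle_ineq4[of "X t y - X 0 y" "I vb t y"]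
  by (simp add: I_0[OF vb])
 have fi: "integrable L f" by (rule L.integrable_const_bound[of _ "C * t + C * t"]) (use fb fm in auto)
 have "(LINT y|L. f y) <= e" if e: "e > 0" for e
 proof -
  have vi: "integrable nu vb"
   by (rule N.integrable_const_bound[of _ C]) (use vb in \<open>auto simp: measurable_cong_sets[OF sets_nu refl]\<close>)
  define e' where "e' = e / (2 * t + 1)"
  have e': "e' > 0" using e t by (simp add: e'_def)
  obtain w where w: "bounded_lipschitz w" "(LINT x|nu. norm (vb x - w x)) < e'"
   using bounded_lipschitz_dense_L1[OF N.finite_measure_axioms sets_nu vi e'] by blast
  obtain Lw Kw where Kw: "!!x. norm (w x) <= Kw" using bounded_lipschitzE[OF w(1)] by metis
  have wm: "w : borel_measurable borel" by (rule bounded_lipschitz_measurable[OF w(1)])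
  define g where "g x = w x - vb x" for x
  have gm: "g : borel_measurable borel" unfolding g_def using wm vb(1) by measurable
  have gb: "norm (g x) <= Kw + C" for x unfolding g_def by (rule order_trans[OF norm_triangle_ineq4]) (intro add_mono Kw vb)
  have Ig: "I g t y = I w t y - I vb t y" for y
   unfolding I_def g_def
   by (intro hk_integral_diff bounded_borel_integrable_on[OF path_g_meas[OF wm Kw] Kw] bounded_borel_integrable_on[OF path_g_meas[OF vb] vb(2)])
  have i1: "integrable L (%y. norm (X t y - X 0 y - I w t y))"
  proof (rule L.integrable_const_bound[of _ "C * t + Kw * t"])
   have "norm (X t y - X 0 y - I w t y) <= C * t + Kw * t" for y
    using X_lip[of 0 t y] I_diff[OF wm Kw, of 0 t y] t norm_triangle_ineq4[of "X t y - X 0 y" "I w t y"]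
    by (simp add: I_0[OF wm Kw])
   then show "AE y in L. norm (norm (X t y - X 0 y - I w t y)) <= C * t + Kw * t" by simp
   show "(%y. norm (X t y - X 0 y - I w t y)) : borel_measurable L"
    using X_meas I_meas[OF wm Kw t] by (intro mcompose[OF _ borel_measurable_norm] borel_measurable_diff) auto
  qed
  have i2: "integrable L (%y. norm (I g t y))"
  proof (rule L.integrable_const_bound[of _ "(Kw + C) * t"])
   show "AE y in L. norm (norm (I g t y)) <= (Kw + C) * t" using I_diff[OF gm gb, of 0 t] t by (simp add: I_0[OF gm gb])
  qed (use I_meas[OF gm gb t] in simp)
  have "(LINT y|L. f y) <= (LINT y|L. norm (X t y - X 0 y - I w t y) + norm (I g t y))"
  proof (rule integral_mono[OF fi])
   show "f y <= norm (X t y - X 0 y - I w t y) + norm (I g t y)" for y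
    unfolding f_def Ig using norm_triangle_ineq[of "X t y - X 0 y - I w t y" "I w t y - I vb t y"] by simp
  qed (use i1 i2 in auto)
  also have "... = (LINT y|L. norm (X t y - X 0 y - I w t y)) + (LINT y|L. norm (I g t y))"
   by (rule bo_integral_add[OF i1 i2])
  also have "... <= t * (LINT x|nu. norm (vb x - w x)) + t * (LINT x|nu. norm (g x))"
   by (intro add_mono ode_test[OF w(1) t] I_expectation[OF gm gb t])
  also have "... = 2 * t * (LINT x|nu. norm (vb x - w x))" by (simp add: g_def norm_minus_commute)
  also have "... <= 2 * t * e'" using w(2) t by (intro mult_left_mono) auto
  also have "... <= e" unfolding e'_def using t e by (simp add: field_simps)
  finally show ?thesis .
 qed
 then have "(LINT y|L. f y) <= 0" by (rule field_le_epsilon[of _ 0, simplified])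
 moreover have "(LINT y|L. f y) >= 0" by (rule bo_integral_nonneg) (simp add: f_def)
 ultimately have "(LINT y|L. f y) = 0" by simp
 then have "AE y in L. f y = 0" by (subst (asm) integral_nonneg_eq_0_iff_AE[OF fi]) (auto simp: f_def)
 then show ?thesis by eventually_elim (simp add: f_def algebra_simps)
qed

theorem ode: "AE y in L. ALL t>=0. X t y = X 0 y + I vb t y"
proof -
 have "AE y in L. ALL t:\<rat>\<inter>{0..}. X t y = X 0 y + I vb t y"
  by (subst AE_ball_countable) (use ode_at countable_rat in auto)
 then show ?thesis
 proof eventually_elim
  case (elim y)
  show ?case
  proof (intro allI impI)
   fix t :: real assume t: "t >= 0"
   define Delta where "Delta s = X s y - X 0 y - I vb s y" for s
   have "norm (Delta t) <= e" if e: "e > 0" for e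
   proof -
    obtain q where q: "q : \<rat>" "t < q" "q < t + e / (2 * C + 1)"
     using Rats_dense_in_real[of t "t + e / (2 * C + 1)"] e C_nonneg by auto
    have "q : \<rat> \<inter> {0..}" using q t by simp
    from bspec[OF elim this] have "Delta q = 0" unfolding Delta_def by (metis add_diff_cancel_left' diff_self)
    then have "Delta t = (I vb q y - I vb t y) - (X q y - X t y)" by (simp add: Delta_def algebra_simps)
    then have "norm (Delta t) <= C * (q - t) + C * (q - t)"
     using norm_triangle_ineq4[of "I vb q y - I vb t y" "X q y - X t y"] X_lip[of t q y] I_diff[OF vb t, of q y] t q by simp
    also have "... <= (2 * C + 1) * (q - t)" using q by (simp add: algebra_simps)
    also have "... <= (2 * C + 1) * (e / (2 * C + 1))" using q C_nonneg by (intro mult_left_mono) auto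
    finally show ?thesis using C_nonneg by simp
   qed
   then have "norm (Delta t) <= 0" by (rule field_le_epsilon[of _ 0, simplified])
   then show "X t y = X 0 y + I vb t y" by (simp add: Delta_def algebra_simps)
  qed
 qed
qed

end

section \<open>Measures determined by smooth functions\<close>

lemma prob_onD:
 assumes "m : prob_on S"
 shows "prob_space m" "sets m = sets borel" "space m = UNIV" "emeasure m S = 1"
proof -
 show 1: "prob_space m" and 2: "sets m = sets borel" using assms by (auto simp: prob_on_def space_prob_algebra)
 show "space m = UNIV" using sets_eq_imp_space_eq[OF 2] by simp
 show "emeasure m S = 1" using assms by (simp add: prob_on_def)
qed

lemma prob_onI:
 assumes "prob_space m" "sets m = sets borel" "S : sets borel" "AE p in m. p : S"
 shows "m : prob_on S"
proof -
 interpret prob_space m by fact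
 have "emeasure m S = 1"
  using assms by (subst emeasure_eq_measure, subst (asm) AE_in_set_eq_1) auto
 then show ?thesis using assms by (simp add: prob_on_def space_prob_algebra)
qed

lemma prob_on_AE:
 assumes "m : prob_on S" "S : sets borel"
 shows "AE p in m. p : S"
proof -
 interpret prob_space m using assms(1) by (rule prob_onD)
 show ?thesis using assms(2) prob_onD(2,4)[OF assms(1)] by (subst AE_in_set_eq_1) (auto simp: emeasure_eq_measure)
qed

lemma prob_on_set_integral:
 fixes f :: "'b::topological_space => real"
 assumes "m : prob_on S" "S : sets borel" "f : borel_measurable borel"
 shows "(LINT p:S|m. f p) = (LINT p|m. f p)"
 unfolding set_lebesgue_integral_def
proof (rule integral_cong_AE)
 show "f : borel_measurable m" "(%p. indicator S p *R f p) : borel_measurable m"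
  using assms(2,3) by (auto simp: measurable_cong_sets[OF prob_onD(2)[OF assms(1)] refl])
 show "AE p in m. indicator S p *R f p = f p" using prob_on_AE[OF assms(1,2)] by eventually_elim simp
qed

lemma prob_on_set_integrable:
 fixes f :: "'b::t2_space => real"
 assumes m: "m : prob_on S" and S: "compact S" and f: "continuous_on S f"
 shows "set_integrable m S f"
  "(!!p. p : S ==> \<bar>f p\<bar> <= K) ==> \<bar>LINT p:S|m. f p\<bar> <= K"
proof -
 interpret prob_space m using m by (rule prob_onD)
 have Sb: "S : sets borel" using S by (simp add: compact_imp_closed)
 have fm: "(%p. indicator S p *R f p) : borel_measurable m"
  unfolding measurable_cong_sets[OF prob_onD(2)[OF m] refl] by (rule borel_measurable_continuous_on_indicator[OF Sb f])
 obtain B where B: "!!p. p : S ==> norm (f p) <= B"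
  using compact_imp_bounded[OF compact_continuous_image[OF f S]] by (auto simp: bounded_iff)
 show i: "set_integrable m S f" unfolding set_integrable_def
 proof (rule integrable_const_bound[of _ "max 0 B"])
  have "norm (indicator S p *R f p) <= max 0 B" for p
   using B[of p] by (cases "p : S") auto
  then show "AE p in m. norm (indicator S p *R f p) <= max 0 B" by simp
 qed (rule fm)
 assume K: "!!p. p : S ==> \<bar>f p\<bar> <= K"
 have K0: "K >= 0"
 proof -
  have "S ~= {}" using prob_onD(4)[OF m] by auto
  then obtain p where "p : S" by blast
  from K[OF this] show ?thesis by linarith
 qed
 have "\<bar>LINT p:S|m. f p\<bar> <= (LINT p|m. norm (indicator S p *R f p))"
  unfolding set_lebesgue_integral_def using integral_norm_bound[of m "%p. indicator S p *R f p"] by simp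
 also have "... <= (LINT p|m. K)"
  by (intro integral_mono integrable_norm i[unfolded set_integrable_def])
    (use K K0 in \<open>auto split: split_indicator\<close>)
 finally show "\<bar>LINT p:S|m. f p\<bar> <= K" using prob_space by simp
qed

text \<open>Finite sums of waves form an algebra of functions with bounded derivatives of all orders, unlike polynomials, which are unbounded.\<close>

inductive trigonometric_sum :: "('b::euclidean_space => real) => bool" where
 wave: "trigonometric_sum (%p. c * cos (u <.> p + phi))"
| add: "trigonometric_sum f ==> trigonometric_sum g ==> trigonometric_sum (%p. f p + g p)"

lemma trigonometric_sum_mult:
 assumes "trigonometric_sum f" "trigonometric_sum g"
 shows "trigonometric_sum (%p. f p * g p)"
 using assms(1)
proof induction
 case (wave c u phi)
 show ?case using assms(2)
 proof induction
  case (wave d v psi)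
  have "c * cos (u <.> p + phi) * (d * cos (v <.> p + psi)) =
   (c * d / 2) * cos ((u - v) <.> p + (phi - psi)) + (c * d / 2) * cos ((u + v) <.> p + (phi + psi))" for p
  proof -
   have e: "u <.> p + phi - (v <.> p + psi) = (u - v) <.> p + (phi - psi)" "u <.> p + phi + (v <.> p + psi) = (u + v) <.> p + (phi + psi)"
    by (auto simp: inner_diff_left inner_add_left)
   have "cos (u <.> p + phi) * cos (v <.> p + psi) = (cos ((u - v) <.> p + (phi - psi)) + cos ((u + v) <.> p + (phi + psi))) / 2"
    unfolding cos_times_cos e ..
   moreover have "c * cos (u <.> p + phi) * (d * cos (v <.> p + psi)) = (c * d) * (cos (u <.> p + phi) * cos (v <.> p + psi))" by simp
   ultimately have "c * cos (u <.> p + phi) * (d * cos (v <.> p + psi)) =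
    (c * d) * ((cos ((u - v) <.> p + (phi - psi)) + cos ((u + v) <.> p + (phi + psi))) / 2)" by presburger
   then show ?thesis by (simp only: distrib_left add_divide_distrib times_divide_eq_right times_divide_eq_left)
  qed
  then show ?case by (simp only:) (intro trigonometric_sum.intros)
 next
  case (add f g)
  then show ?case unfolding distrib_left by (intro trigonometric_sum.add)
 qed
next
 case (add f1 f2)
 then show ?case unfolding distrib_right by (intro trigonometric_sum.add)
qed

lemma trigonometric_sum_continuous: "trigonometric_sum f ==> continuous_on A f"
 by (induction rule: trigonometric_sum.induct) (auto intro!: continuous_intros)

lemma trigonometric_sum_separates:
 fixes x y :: "'b::euclidean_space"
 assumes "x ~= y"
 shows "EX f. trigonometric_sum f & f x ~= f y"
proof -
 define u where "u = (pi / (norm (x - y))\<^sup>2) *R (x - y)"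
 define f where "f p = 1 * cos (u <.> p + - (u <.> y))" for p
 have "u <.> (x - y) = pi" using assms by (simp add: u_def power2_norm_eq_inner)
 then have e: "u <.> x + - (u <.> y) = pi" by (simp add: inner_diff_right)
 have "f x = -1" unfolding f_def e by simp
 moreover have "f y = 1" by (simp add: f_def)
 moreover have "trigonometric_sum f" unfolding f_def by (rule trigonometric_sum.wave)
 ultimately show ?thesis by (intro exI[of _ f]) simp
qed

lemma C2_bounded_wave:
 fixes u :: "'b::euclidean_space"
 shows "C2_bounded (%p. c * cos (u <.> p + phi))"
proof -
 define l :: "'b \<Rightarrow>\<^sub>L real" where "l = blinfun_inner_right u"
 have l: "blinfun_apply l p = u <.> p" for p by (simp add: l_def)
 define f' where "f' p = (- c * sin (u <.> p + phi)) *R l" for p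
 define f'' where "f'' p = (- c * cos (u <.> p + phi)) *R (blinfun_scaleR_left l o\<^sub>L l)" for p
 have bd: "bounded (range (%p. r p *R v))" if "!!p. \<bar>r p\<bar> <= \<bar>c\<bar>" for r :: "'b => real" and v :: "'c::real_normed_vector"
  by (rule boundedI[of _ "\<bar>c\<bar> * norm v"]) (auto intro!: mult_right_mono that)
 have sc: "\<bar>c * sin t\<bar> <= \<bar>c\<bar>" "\<bar>c * cos t\<bar> <= \<bar>c\<bar>" for t
  by (auto simp: abs_mult intro!: mult_left_le)
 have "((%p. c * cos (u <.> p + phi)) has_derivative blinfun_apply (f' p)) (at p)" for p
 proof -
  have "((%p. c * cos (u <.> p + phi)) has_derivative (%q. (- c * sin (u <.> p + phi)) * (u <.> q))) (at p)"
   by (auto intro!: derivative_eq_intros)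
  moreover have "blinfun_apply (f' p) = (%q. (- c * sin (u <.> p + phi)) * (u <.> q))"
   unfolding f'_def by (rule ext) (simp only: blinfun.scaleR_left l real_scaleR_def)
  ultimately show ?thesis by (simp only:)
 qed
 moreover have "(f' has_derivative blinfun_apply (f'' p)) (at p)" for p
 proof -
  have "((%p. - c * sin (u <.> p + phi)) has_derivative (%q. (- c * cos (u <.> p + phi)) * (u <.> q))) (at p)"
   by (auto intro!: derivative_eq_intros)
  then have "((%p. (- c * sin (u <.> p + phi)) *R l) has_derivative (%q. ((- c * cos (u <.> p + phi)) * (u <.> q)) *R l)) (at p)"
   by (rule has_derivative_scaleR_left)
  moreover have "blinfun_apply (f'' p) = (%q. ((- c * cos (u <.> p + phi)) * (u <.> q)) *R l)"
   unfolding f''_def by (rule ext) (simp add: blinfun.scaleR_left blinfun.minus_left l)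
  ultimately show ?thesis unfolding f'_def[abs_def] by (simp only:)
 qed
 moreover have "continuous_on UNIV f''" unfolding f''_def[abs_def] by (intro continuous_intros)
 moreover have "bounded (range (%p. c * cos (u <.> p + phi)))"
  by (rule boundedI[of _ "\<bar>c\<bar>"]) (use sc in auto)
 moreover have "bounded (range f')" unfolding f'_def[abs_def] by (rule bd) (use sc in simp)
 moreover have "bounded (range f'')" unfolding f''_def[abs_def] by (rule bd) (use sc in simp)
 ultimately show ?thesis unfolding C2_bounded_def by blast
qed

lemma C2_bounded_continuous: "C2_bounded f ==> continuous_on A f"
 unfolding C2_bounded_def by (meson continuous_at_imp_continuous_on has_derivative_continuous)

text \<open>By the Stone-Weierstrass theorem trigonometric sums are uniformly dense on a compact set.\<close>

theorem prob_on_eqI_C2: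
 fixes S :: "'b::euclidean_space set"
 assumes S: "compact S" and m: "m : prob_on S" "m' : prob_on S"
  and eq: "!!f. C2_bounded f ==> (LINT p:S|m. f p) = (LINT p:S|m'. f p)"
 shows "m = m'"
proof (rule measure_eqI_continuous)
 interpret M: prob_space m using m(1) by (rule prob_onD)
 interpret M': prob_space m' using m(2) by (rule prob_onD)
 show "sets m = sets borel" "sets m' = sets borel" using m prob_onD(2) by auto
 show "finite_measure m" "finite_measure m'" by unfold_locales
 have Sb: "S : sets borel" using S by (simp add: compact_imp_closed)
 have tr: "(LINT p:S|m. f p) = (LINT p:S|m'. f p)" if "trigonometric_sum f" for f
  using that
 proof induction
  case (wave c u phi)
  show ?case by (rule eq[OF C2_bounded_wave])
 next
  case (add f g)
  note i = prob_on_set_integrable(1)[OF _ S trigonometric_sum_continuous]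
  show ?case unfolding set_integral_add(2)[OF i[OF m(1) add(1)] i[OF m(1) add(2)]]
    set_integral_add(2)[OF i[OF m(2) add(1)] i[OF m(2) add(2)]] add.IH ..
 qed
 fix f :: "'b => real" assume f: "continuous_on UNIV f"
 have fS: "continuous_on S f" using f by (rule continuous_on_subset) simp
 have "\<bar>(LINT p:S|m. f p) - (LINT p:S|m'. f p)\<bar> <= e" if e: "e > 0" for e
 proof -
  have "EX g. trigonometric_sum g & (ALL x:S. \<bar>f x - g x\<bar> < e / 2)"
  proof (rule Stone_Weierstrass_HOL[OF S _ _ _ _ _ fS])
   show "trigonometric_sum (%x. c)" for c using trigonometric_sum.wave[of c 0 0] by simp
  qed (use e in \<open>auto intro: trigonometric_sum_continuous trigonometric_sum.add trigonometric_sum_mult trigonometric_sum_separates\<close>)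
  then obtain g where g: "trigonometric_sum g" "!!x. x : S ==> \<bar>f x - g x\<bar> < e / 2" by blast
  have gS: "continuous_on S g" by (rule trigonometric_sum_continuous[OF g(1)])
  have d: "\<bar>(LINT p:S|n. f p) - (LINT p:S|n. g p)\<bar> <= e / 2" if n: "n : prob_on S" for n
  proof -
   have "(LINT p:S|n. f p) - (LINT p:S|n. g p) = (LINT p:S|n. f p - g p)"
    by (rule set_integral_diff(2)[symmetric]) (intro prob_on_set_integrable(1) n S fS gS)+
   also have "\<bar>...\<bar> <= e / 2"
    by (rule prob_on_set_integrable(2)[OF n S]) (use g(2) fS gS in \<open>auto intro!: continuous_intros less_imp_le\<close>)
   finally show ?thesis .
  qed
  show ?thesis using d[OF m(1)] d[OF m(2)] tr[OF g(1)] by linarith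
 qed
 then have "(LINT p:S|m. f p) = (LINT p:S|m'. f p)"
  using zero_less_abs_iff[of "(LINT p:S|m. f p) - (LINT p:S|m'. f p)"] by (metis field_le_epsilon add_0 abs_le_zero_iff right_minus_eq)
 then show "(LINT p|m. f p) = (LINT p|m'. f p)"
  using prob_on_set_integral[OF m(1) Sb] prob_on_set_integral[OF m(2) Sb] continuous_borel[OF f] by simp
qed

section \<open>Averages of the empirical measures\<close>

definition step_index :: "(nat => real) => real => nat" where
 "step_index a t = (THE n. algo_time a n <= t & t < algo_time a (Suc n))"

locale step_sizes =
 fixes a :: "nat => real"
 assumes a_nonneg: "!!n. a n >= 0" and a_div: "~ summable a"
begin

lemma algo_time_mono: "m <= n ==> algo_time a m <= algo_time a n"
 unfolding algo_time_def by (rule sum_mono2) (use a_nonneg in auto)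

lemma algo_time_nonneg: "algo_time a n >= 0"
 unfolding algo_time_def by (rule sum_nonneg) (use a_nonneg in auto)

lemma algo_time_unbounded: "EX n. t < algo_time a n"
proof (rule ccontr)
 assume "~ ?thesis"
 then have "(\<Sum>i<n. a i) <= t" for n by (simp add: algo_time_def not_less)
 then have "summable a" by (intro summableI_nonneg_bounded a_nonneg)
 then show False using a_div by simp
qed

lemma step_index_eq:
 assumes "algo_time a n <= t" "t < algo_time a (Suc n)"
 shows "step_index a t = n"
 unfolding step_index_def
proof (rule the_equality)
 fix m assume m: "algo_time a m <= t & t < algo_time a (Suc m)"
 show "m = n"
 proof (rule ccontr)
  assume "m ~= n"
  then have "Suc m <= n \<or> Suc n <= m" by auto
  then show False using algo_time_mono[of "Suc m" n] algo_time_mono[of "Suc n" m] m assms by auto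
 qed
qed (use assms in simp)

lemma step_index:
 assumes "t >= 0"
 shows "algo_time a (step_index a t) <= t" "t < algo_time a (Suc (step_index a t))"
proof -
 define N where "N = (LEAST n. t < algo_time a n)"
 have N: "t < algo_time a N" unfolding N_def by (rule LeastI_ex[OF algo_time_unbounded])
 have "N ~= 0" using N assms by (intro notI) (simp add: algo_time_def)
 then obtain n where n: "N = Suc n" by (cases N) auto
 have "algo_time a n <= t" using not_less_Least[of n "%n. t < algo_time a n"] n N_def by (auto simp: not_less)
 then have "algo_time a n <= t & t < algo_time a (Suc n)" using N n by simp
 then show "algo_time a (step_index a t) <= t" "t < algo_time a (Suc (step_index a t))"
  using step_index_eq[of n t] by auto
qed

lemma step_index_tendsto: "filterlim (step_index a) at_top at_top"
 unfolding filterlim_at_top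
proof
 fix Z :: nat
 have "step_index a t >= Z" if "t >= algo_time a Z" for t
 proof (rule ccontr)
  assume "~ ?thesis"
  then have "algo_time a (Suc (step_index a t)) <= algo_time a Z" by (intro algo_time_mono) simp
  moreover have "t >= 0" using that algo_time_nonneg[of Z] by simp
  ultimately show False using step_index(2)[of t] that by linarith
 qed
 then show "eventually (%t. Z <= step_index a t) at_top" by (intro eventually_at_top_linorderI[of "algo_time a Z"]) auto
qed

lemma step_index_meas: "step_index a : borel ->M count_space UNIV"
proof -
 define z where "z = (THE n::nat. False)"
 have neg: "step_index a t = z" if "t < 0" for t
 proof -
  have "(%n. algo_time a n <= t & t < algo_time a (Suc n)) = (%_. False)"
   using algo_time_nonneg that by (intro ext) (auto simp: not_le intro: less_le_trans)
  then show ?thesis by (simp only: step_index_def z_def)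
 qed
 have "step_index a -` {n} \<inter> space borel : sets borel" for n
 proof -
  have "step_index a -` {n} \<inter> space borel = {algo_time a n..<algo_time a (Suc n)} \<union> (if n = z then {..<0} else {})" (is "?L = ?R")
  proof (rule set_eqI)
   fix t
   show "t : ?L \<longleftrightarrow> t : ?R"
   proof (cases "t < 0")
    case True
    then show ?thesis using neg[OF True] algo_time_nonneg[of n] by auto
   next
    case False
    then show ?thesis using step_index[of t] step_index_eq[of n t] by auto
   qed
  qed
  then show ?thesis by simp
 qed
 then show ?thesis by (subst measurable_count_space_eq2_countable) auto
qed

lemma step_path_meas: "(%t. y (step_index a t)) : borel_measurable borel" for y :: "nat => 'b::topological_space"
 by (rule mcompose[OF step_index_meas]) simp

definition time_average :: "(nat => real) => real => real" where
 "time_average u T = 1 / T * integral {0..T} (%s. u (step_index a s))"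

text \<open>Prolonging the horizon from \<open>T\<close> to \<open>T + r\<close> adds an integral of size \<open>K * r\<close> and changes the normalization by a relative
 amount \<open>r / T\<close>.\<close>

lemma time_average_lipschitz:
 assumes u: "!!n. \<bar>u n\<bar> <= K" and T: "T > 0" "r >= 0"
 shows "\<bar>time_average u (T + r) - time_average u T\<bar> <= 2 * K * r / T" "\<bar>time_average u T\<bar> <= K"
proof -
 have K: "K >= 0" using u[of 0] by linarith
 define J where "J T = integral {0..T} (%s. u (step_index a s))" for T
 have ub: "norm (u (step_index a s)) <= K" for s using u by simp
 have J: "\<bar>J (T + r) - J T\<bar> <= K * r"
  unfolding J_def using primitive_lipschitz(2)[OF step_path_meas[of u] ub, of T "T + r"] T by simp
 have J0: "\<bar>J T\<bar> <= K * T"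
  unfolding J_def using primitive_lipschitz(2)[OF step_path_meas[of u] ub, of 0 "T"] T by simp
 then show "\<bar>time_average u T\<bar> <= K" using T by (simp add: time_average_def J_def[symmetric] abs_mult field_simps)
 have "time_average u (T + r) - time_average u T = (J (T + r) - J T) / (T + r) - r / (T * (T + r)) * J T"
 proof -
  have "r / (T * (T + r)) = 1 / T - 1 / (T + r)" using T by (simp add: field_simps)
  then show ?thesis by (simp add: time_average_def J_def[symmetric] left_diff_distrib diff_divide_distrib)
 qed
 also have "\<bar>...\<bar> <= \<bar>(J (T + r) - J T) / (T + r)\<bar> + \<bar>r / (T * (T + r)) * J T\<bar>" by (rule abs_triangle_ineq4)
 also have "\<bar>(J (T + r) - J T) / (T + r)\<bar> <= K * r / T"
  unfolding abs_divide using T J K by (intro frac_le) auto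
 also have "\<bar>r / (T * (T + r)) * J T\<bar> <= r / (T * (T + r)) * (K * T)"
  unfolding abs_mult using T J0 by (intro mult_mono) auto
 also have "... = K * r / (T + r)" using T by simp
 also have "... <= K * r / T" using T K by (intro divide_left_mono) auto
 finally show "\<bar>time_average u (T + r) - time_average u T\<bar> <= 2 * K * r / T" by simp
qed

text \<open>The law of the interpolated sequence at a uniform time in \<open>[0, t]\<close> has the required integrals, and they determine it.
 Integrals of functions continuous only on \<open>S\<close> are then known as well.\<close>

theorem averaged_empirical_integral:
 fixes y :: "nat => 'b::euclidean_space"
 assumes S: "compact S" and y: "!!n. y n : S" and f: "continuous_on S f" and t: "t > 0"
 shows "(LINT p:S|averaged_empirical S a y t. f p) = time_average (%n. f (y n)) t"
proof -
 have Sb: "S : sets borel" using S by (simp add: compact_imp_closed)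
 define U where "U = uniform_measure lborel {0..t}"
 interpret U: prob_space U unfolding U_def by (rule prob_space_uniform_measure) (use t in auto)
 have ym: "(%s. y (step_index a s)) : U ->M borel" using step_path_meas[of y] by (simp add: U_def)
 define m where "m = distr U borel (%s. y (step_index a s))"
 have m: "m : prob_on S"
 proof (rule prob_onI)
  show "prob_space m" unfolding m_def by (rule U.prob_space_distr[OF ym])
  show "AE p in m. p : S" unfolding m_def by (subst AE_distr_iff[OF ym]) (use Sb y in auto)
 qed (use Sb in \<open>auto simp: m_def\<close>)
 have int: "(LINT p:S|m. g p) = time_average (%n. g (y n)) t" if g: "continuous_on S g" for g :: "'b => real"
 proof -
  obtain K where K: "!!p. p : S ==> norm (g p) <= K"
   using compact_imp_bounded[OF compact_continuous_image[OF g S]] by (auto simp: bounded_iff)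
  have "(LINT p:S|m. g p) = (LINT s|U. indicator S (y (step_index a s)) *R g (y (step_index a s)))"
   unfolding m_def set_lebesgue_integral_def
   by (rule integral_distr[OF ym borel_measurable_continuous_on_indicator[OF Sb g]])
  also have "... = (LINT s|U. g (y (step_index a s)))" using y by simp
  also have "... = (1 / t) *R integral {0..t} (%s. g (y (step_index a s)))"
   unfolding U_def by (rule integral_uniform_time[OF step_path_meas[of "%n. g (y n)"] _ t]) (rule K[OF y])
  finally show ?thesis by (simp add: time_average_def)
 qed
 have emp: "(LINT p:S|empirical_measure a y s. g p) = g (y (step_index a s))" if g: "continuous_on S g" for g :: "'b => real" and s
  unfolding empirical_measure_def step_index_def[symmetric] set_lebesgue_integral_def
  by (subst integral_return) (use y borel_measurable_continuous_on_indicator[OF Sb g] in auto)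
 have avg: "1 / t * (LINT s:{0..t}|lborel. (LINT p:S|empirical_measure a y s. g p)) = time_average (%n. g (y n)) t"
  if g: "continuous_on S g" for g :: "'b => real"
 proof -
  obtain K where K: "!!p. p : S ==> norm (g p) <= K"
   using compact_imp_bounded[OF compact_continuous_image[OF g S]] by (auto simp: bounded_iff)
  show ?thesis unfolding emp[OF g] time_average_def
   using set_borel_integral_eq_integral(2)[OF bounded_borel_set_integrable[OF step_path_meas[of "%n. g (y n)"] K[OF y]], of 0 t] by simp
 qed
 have "averaged_empirical S a y t = m"
  unfolding averaged_empirical_def if_P[OF t]
 proof (rule the_equality)
  show "m : prob_on S & (ALL f. C2_bounded f --> (LINT p:S|m. f p) = 1 / t * (LINT s:{0..t}|lborel. (LINT p:S|empirical_measure a y s. f p)))"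
   using m int avg C2_bounded_continuous by metis
  fix m' assume m': "m' : prob_on S & (ALL f. C2_bounded f --> (LINT p:S|m'. f p) = 1 / t * (LINT s:{0..t}|lborel. (LINT p:S|empirical_measure a y s. f p)))"
  show "m' = m"
  proof (rule prob_on_eqI_C2[OF S _ m])
   show "m' : prob_on S" using m' by simp
   fix f :: "'b => real" assume f: "C2_bounded f"
   show "(LINT p:S|m'. f p) = (LINT p:S|m. f p)"
    using m' f avg[OF C2_bounded_continuous[OF f]] int[OF C2_bounded_continuous[OF f]] by metis
  qed
 qed
 then show ?thesis using int[OF f] by simp
qed

end

section \<open>Limit points are constant\<close>

lemma relaxed_integral_meas:
 fixes S :: "'b::euclidean_space set" and f :: "'b => real"
 assumes nu: "nu : relaxed_maps S" and S: "compact S" and f: "continuous_on S f"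
 shows "(%r. indicator {0..} r * (LINT p:S|nu r. f p)) : borel_measurable borel"
proof -
 have Sb: "S : sets borel" using S by (simp add: compact_imp_closed)
 have "(%m. LINT p|m. indicator S p *R f p) : subprob_algebra borel ->M borel"
  by (rule integral_measurable_subprob_algebra[OF borel_measurable_continuous_on_indicator[OF Sb f]])
 moreover have "nu : restrict_space borel {0..} ->M subprob_algebra borel"
  using nu by (auto simp: relaxed_maps_def intro: measurable_prob_algebraD)
 ultimately have "(%r. LINT p:S|nu r. f p) : restrict_space borel {0..} ->M borel"
  unfolding set_lebesgue_integral_def by (rule mcompose[rotated])
 then show ?thesis by (subst (asm) borel_measurable_restrict_space_iff) auto
qed

lemma relaxed_integral_le:
 fixes S :: "'b::euclidean_space set" and f :: "'b => real"
 assumes nu: "nu : relaxed_maps S" and S: "compact S" and f: "continuous_on S f"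
  and K: "ALL p:S. \<bar>f p\<bar> <= K" "K >= 0"
 shows "\<bar>indicator {0..} r * (LINT p:S|nu r. f p)\<bar> <= K"
proof (cases "r >= 0")
 case True
 then have "nu r : prob_on S" using nu by (auto simp: relaxed_maps_def)
 then have "\<bar>LINT p:S|nu r. f p\<bar> <= K" by (rule prob_on_set_integrable(2)[OF _ S f]) (use K in simp)
 then show ?thesis using True by simp
qed (use K in simp)

lemma relaxed_pairing_eq:
 fixes S :: "'b::euclidean_space set" and f :: "'b => real"
 assumes nu: "nu : relaxed_maps S" and S: "compact S" and f: "continuous_on S f"
  and K: "ALL p:S. \<bar>f p\<bar> <= K" "K >= 0"
  and g: "g : borel_measurable borel" "!!r. \<bar>g r\<bar> <= G"
 shows "relaxed_pairing S f g 0 n nu = integral {0..n} (%r. g r * (indicator {0..} r * (LINT p:S|nu r. f p)))"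
proof -
 have "relaxed_pairing S f g 0 n nu = (LINT r:{0..n}|lborel. g r * (indicator {0..} r * (LINT p:S|nu r. f p)))"
  unfolding relaxed_pairing_def set_lebesgue_integral_def[of lborel]
  by (intro bo_integral_cong) (auto split: split_indicator)
 also have "... = integral {0..n} (%r. g r * (indicator {0..} r * (LINT p:S|nu r. f p)))"
 proof (rule set_borel_integral_eq_integral(2), rule bounded_borel_set_integrable[of _ "G * K"])
  show "(%r. g r * (indicator {0..} r * (LINT p:S|nu r. f p))) : borel_measurable borel"
   by (intro borel_measurable_times g relaxed_integral_meas[OF nu S f])
  have G: "G >= 0" using order_trans[OF abs_ge_zero g(2)[of 0]] .
  fix r show "norm (g r * (indicator {0..} r * (LINT p:S|nu r. f p))) <= G * K"
   unfolding norm_mult real_norm_def abs_mult[symmetric]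
   unfolding abs_mult[of "g r"] by (intro mult_mono g relaxed_integral_le[OF nu S f K] G) auto
 qed
 finally show ?thesis .
qed

lemma relaxed_pairing_cong:
 fixes S :: "'b::euclidean_space set" and f :: "'b => real"
 assumes nu: "(nu, nu') : relaxed_rel S" and S: "compact S" and f: "continuous_on S f"
  and g: "g : borel_measurable borel" 
 shows "relaxed_pairing S f g 0 n nu = relaxed_pairing S f g 0 n nu'"
proof -
 have m: "nu : relaxed_maps S" "nu' : relaxed_maps S" and ae: "AE t in lborel. 0 <= t --> nu t = nu' t"
  using nu by (auto simp: relaxed_rel_def)
 have eq: "relaxed_pairing S f g 0 n mu = (LINT r:{0..n}|lborel. g r * (indicator {0..} r * (LINT p:S|mu r. f p)))" for mu
  unfolding relaxed_pairing_def set_lebesgue_integral_def[of lborel]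
  by (intro bo_integral_cong) (auto split: split_indicator)
 have meas: "(%r. indicator {0..n} r *R (g r * (indicator {0..} r * (LINT p:S|mu r. f p)))) : borel_measurable lborel"
  if "mu : relaxed_maps S" for mu
 proof -
  define k where "k r = indicator {0..} r * (LINT p:S|mu r. f p)" for r
  have "k : borel_measurable borel" unfolding k_def[abs_def] by (rule relaxed_integral_meas[OF that S f])
  then have "(%r. indicator {0..n} r *R (g r * k r)) : borel_measurable borel"
   by (intro borel_measurable_scaleR borel_measurable_times borel_measurable_indicator g) auto
  then show ?thesis by (simp add: k_def)
 qed
 show ?thesis
  unfolding eq unfolding set_lebesgue_integral_def[of lborel]
 proof (rule integral_cong_AE[OF meas[OF m(1)] meas[OF m(2)]])
  show "AE r in lborel. indicator {0..n} r *R (g r * (indicator {0..} r * (LINT p:S|nu r. f p))) =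
    indicator {0..n} r *R (g r * (indicator {0..} r * (LINT p:S|nu' r. f p)))"
   using ae by eventually_elim (simp split: split_indicator)
 qed
qed

text \<open>Indicators of the complements of the sets of a countable basis, made stable under finite
 intersections, are limits of countably many tents.\<close>

lemma ex_countable_separating:
 "EX E :: ('b::euclidean_space => real) set. countable E & (ALL f:E. continuous_on UNIV f) &
  (ALL m m'. prob_space m --> prob_space m' --> sets m = sets borel --> sets m' = sets borel -->
   (ALL f:E. (LINT p|m. f p) = (LINT p|m'. f p)) --> m = m')"
proof -
 obtain \<B> :: "'b set set" where \<B>: "countable \<B>" "topological_basis \<B>" using ex_countable_basis by blast
 define \<D> where "\<D> = Inter ` {F. finite F & F \<subseteq> \<B>}"
 have \<D>o: "open U" if "U : \<D>" for U using that \<B>(2) topological_basis_open[OF \<B>(2)] by (auto simp: \<D>_def intro!: open_Inter)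
 have "\<B> \<subseteq> \<D>"
 proof
  fix U assume "U : \<B>"
  then show "U : \<D>" unfolding \<D>_def by (intro image_eqI[of _ _ "{U}"]) auto
 qed
 then have "topological_basis \<D>"
  using \<B>(2) \<D>o unfolding topological_basis_def by (meson order_trans)
 moreover have \<D>c: "countable \<D>" unfolding \<D>_def by (intro countable_image countable_Collect_finite_subset \<B>)
 ultimately have gen: "(borel :: 'b measure) = sigma UNIV \<D>" by (rule borel_eq_countable_basis[rotated])
 have stable: "Int_stable \<D>"
 proof (rule Int_stableI)
  fix U V assume "U : \<D>" "V : \<D>"
  then obtain F G where "finite F" "F \<subseteq> \<B>" "U = \<Inter>F" "finite G" "G \<subseteq> \<B>" "V = \<Inter>G" by (auto simp: \<D>_def)
  then show "U \<inter> V : \<D>" unfolding \<D>_def by (intro image_eqI[of _ _ "F \<union> G"]) auto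
 qed
 define e where "e n U p = max 0 (1 - real n * infdist p (- U))" for n and U :: "'b set" and p
 define E where "E = (%(n, U). e n U) ` (UNIV \<times> \<D>)"
 show ?thesis
 proof (intro exI[of _ E] conjI allI impI ballI)
  show "countable E" unfolding E_def by (intro countable_image countable_SIGMA \<D>c) auto
  show "continuous_on UNIV f" if "f : E" for f
   using that by (auto simp: E_def e_def[abs_def] intro!: continuous_intros)
  fix m m' :: "'b measure" assume p: "prob_space m" "prob_space m'" and s: "sets m = sets borel" "sets m' = sets borel"
   and eq: "ALL f:E. (LINT p|m. f p) = (LINT p|m'. f p)"
  interpret M: prob_space m by fact
  interpret M': prob_space m' by fact
  show "m = m'"
  proof (rule measure_eqI_generator_eq[where A="%_. UNIV" and E=\<D> and \<Omega>=UNIV])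
   show "sets m = sigma_sets UNIV \<D>" "sets m' = sigma_sets UNIV \<D>" unfolding s by (subst gen, simp)+
   have "{} : {F. finite F & F \<subseteq> \<B>}" by simp
   from imageI[OF this, of Inter] show "range (%_. UNIV) \<subseteq> \<D>" unfolding \<D>_def by simp
   fix U assume U: "U : \<D>"
   have Ub: "U : sets m" "U : sets m'" using \<D>o[OF U] s by auto
   have sp: "space m = UNIV" "space m' = UNIV" using sets_eq_imp_space_eq[OF s(1)] sets_eq_imp_space_eq[OF s(2)] by auto
   show "emeasure m U = emeasure m' U"
   proof (cases "- U = {}")
    case True
    then have "U = UNIV" by blast
    then show ?thesis using M.emeasure_space_1 M'.emeasure_space_1 sp by simp
   next
    case False
    have cl: "closed (- U)" by (rule closed_Compl[OF \<D>o[OF U]])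
    have "(LINT p|m. e n U p) = (LINT p|m'. e n U p)" for n using eq U by (auto simp: E_def)
    then have "measure m (- U) = measure m' (- U)"
     using LIMSEQ_unique[OF bump_integral_tendsto[OF cl False s(1) M.finite_measure_axioms]]
      bump_integral_tendsto[OF cl False s(2) M'.finite_measure_axioms] by (simp add: e_def)
    moreover have "measure m (- U) = 1 - measure m U" using M.prob_compl[OF Ub(1)] by (simp only: sp Compl_eq_Diff_UNIV)
    moreover have "measure m' (- U) = 1 - measure m' U" using M'.prob_compl[OF Ub(2)] by (simp only: sp Compl_eq_Diff_UNIV)
    ultimately have "measure m U = measure m' U" by linarith
    then show ?thesis by (simp add: M.emeasure_eq_measure M'.emeasure_eq_measure)
   qed
  qed (use stable in auto)
 qed
qed

context step_sizes
begin

text \<open>Tested against \<open>g\<close>, the shifted averages behave like a constant times the integral of \<open>g\<close>. With \<open>g = 1\<close> the time averages converge,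
 to \<open>l\<close>, say; with \<open>g\<close> equal to the deviation of the limit from \<open>l\<close>, the square of this deviation has integral zero.\<close>

lemma limit_point_time_averages:
 fixes y :: "nat => 'b::euclidean_space"
 assumes S: "compact S" and y: "!!n. y n : S" and tau: "filterlim tau at_top sequentially"
  and lim: "limitin (relaxed_topology S) (%k. relaxed_class S (%s. averaged_empirical S a y (tau k + s))) (relaxed_rel S `` {nu}) sequentially"
  and nu: "nu : relaxed_maps S" and f: "continuous_on S f"
 shows "EX l. (%k. time_average (%n. f (y n)) (tau k)) ----> l & (AE r in lborel. 0 <= r --> (LINT p:S|nu r. f p) = l)"
proof -
 define A where "A = time_average (%n. f (y n))"
 obtain K0 where K0: "!!p. p : S ==> norm (f p) <= K0"
  using compact_imp_bounded[OF compact_continuous_image[OF f S]] by (auto simp: bounded_iff)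
 define K where "K = max 0 K0"
 have K: "ALL p:S. \<bar>f p\<bar> <= K" using K0 by (intro ballI) (simp add: K_def le_max_iff_disj)
 have Kp: "K >= 0" by (simp add: K_def)
 define H where "H mu r = indicator {0..} r * (LINT p:S|mu r. f p)" for mu :: "real => 'b measure" and r :: real
 have Hm: "H mu : borel_measurable borel" if "mu : relaxed_maps S" for mu
  unfolding H_def[abs_def] by (rule relaxed_integral_meas[OF that S f])
 have Hb: "\<bar>H mu r\<bar> <= K" if "mu : relaxed_maps S" for mu r
  unfolding H_def by (rule relaxed_integral_le[OF that S f K Kp])
 have gH: "(%r. g r * H mu r) integrable_on {0..n}"
  if "mu : relaxed_maps S" "g : borel_measurable borel" "!!r. \<bar>g r\<bar> <= G" for mu g G and n :: real
 proof (rule bounded_borel_integrable_on[of _ "G * K"])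
  show "(%r. g r * H mu r) : borel_measurable borel" by (intro borel_measurable_times that Hm)
  have "G >= 0" using order_trans[OF abs_ge_zero that(3)[of 0]] .
  then show "norm (g r * H mu r) <= G * K" for r unfolding real_norm_def abs_mult by (intro mult_mono that Hb) auto
 qed
 have conv: "(%k. A (tau k) * integral {0..n} g) ----> integral {0..n} (%r. g r * H nu r)"
  if g: "g : borel_measurable borel" "!!r. \<bar>g r\<bar> <= G" and n: "n > 0" for g G n
 proof (rule tendstoI)
  fix e :: real assume e: "e > 0"
  have G: "G >= 0" using order_trans[OF abs_ge_zero g(2)[of 0]] .
  define V where "V = ball (relaxed_pairing S f g 0 n nu) (e / 2)"
  define Uo where "Uo = {c : relaxed_maps S // relaxed_rel S. EX nu:c. relaxed_pairing S f g 0 n nu : V}"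
  have "set_borel_measurable lborel {0..n} g" unfolding set_borel_measurable_def using g(1) by (intro borel_measurable_scaleR) auto
  moreover have "set_integrable lborel {0..n} (%r. (g r)\<^sup>2)"
  proof (rule bounded_borel_set_integrable[of _ "G\<^sup>2"])
   show "norm ((g r)\<^sup>2) <= G\<^sup>2" for r using g(2)[of r] by (simp add: abs_le_square_iff[symmetric] G)
  qed (use g(1) in measurable)
  ultimately have "openin (relaxed_topology S) Uo"
   unfolding relaxed_topology_def Uo_def
   by (intro topology_generated_by_Basis CollectI exI[of _ f] exI[of _ g] exI[of _ 0] exI[of _ n] exI[of _ V] conjI refl f n)
     (auto simp: V_def)
  moreover have "relaxed_rel S `` {nu} : Uo"
  proof -
   have "nu : relaxed_rel S `` {nu}" using nu by (simp add: relaxed_rel_def)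
   then show ?thesis using nu e unfolding Uo_def by (auto simp: V_def intro!: quotientI bexI[of _ nu])
  qed
  ultimately have ev1: "eventually (%k. relaxed_class S (%s. averaged_empirical S a y (tau k + s)) : Uo) sequentially"
   using lim unfolding limitin_def by blast
  have "((%k. G * (2 * K * n) * n / tau k) \<longlongrightarrow> 0) sequentially"
   by (intro tendsto_divide_0[OF tendsto_const] filterlim_at_top_imp_at_infinity tau)
  then have ev2: "eventually (%k. \<bar>G * (2 * K * n) * n / tau k\<bar> < e / 2) sequentially"
   using e by (auto dest!: tendstoD[of _ _ _ "e / 2"])
  have ev3: "eventually (%k. tau k > 0) sequentially" using tau by (simp add: filterlim_at_top_dense)
  from ev1 ev2 ev3 show "eventually (%k. dist (A (tau k) * integral {0..n} g) (integral {0..n} (%r. g r * H nu r)) < e) sequentially"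
  proof eventually_elim
   case (elim k)
   define av where "av s = averaged_empirical S a y (tau k + s)" for s
   from elim(1) obtain nu' where nu': "(av, nu') : relaxed_rel S" "relaxed_pairing S f g 0 n nu' : V"
    by (auto simp: Uo_def relaxed_class_def av_def[abs_def])
   have av: "av : relaxed_maps S" using nu' by (simp add: relaxed_rel_def)
   have p: "relaxed_pairing S f g 0 n mu = integral {0..n} (%r. g r * H mu r)" if "mu : relaxed_maps S" for mu
    unfolding H_def by (rule relaxed_pairing_eq[OF that S f K Kp g])
   have d1: "\<bar>integral {0..n} (%r. g r * H av r) - integral {0..n} (%r. g r * H nu r)\<bar> < e / 2"
    using nu'(2) unfolding relaxed_pairing_cong[OF nu'(1) S f g(1), symmetric] V_def p[OF av] p[OF nu]
    by (simp add: dist_real_def abs_minus_commute)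
   have gi: "g integrable_on {0..n}" by (rule bounded_borel_integrable_on[of _ G]) (use g in auto)
   have "integral {0..n} (%r. g r * H av r) - A (tau k) * integral {0..n} g = integral {0..n} (%r. g r * H av r - A (tau k) * g r)"
    using hk_integral_diff[OF gH[OF av g, of n] integrable_cmul[OF gi, of "A (tau k)"]] by simp
   also have "\<bar>...\<bar> <= (G * (2 * K * n / tau k)) * (n - 0)"
    unfolding real_norm_def[symmetric]
   proof (rule integral_norm_le)
    show "(%r. g r * H av r - A (tau k) * g r) integrable_on {0..n}" using integrable_diff[OF gH[OF av g, of n] integrable_cmul[OF gi, of "A (tau k)"]] by simp
    fix r assume r: "r : {0..n}"
    have "H av r = A (tau k + r)"
     unfolding H_def av_def A_def using r elim(3) averaged_empirical_integral[OF S y f, of "tau k + r"] by simp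
    then have "\<bar>H av r - A (tau k)\<bar> <= 2 * K * r / tau k"
     unfolding A_def using time_average_lipschitz(1)[of "%n. f (y n)" K "tau k" r] bspec[OF K y] r elim(3) by simp
    also have "... <= 2 * K * n / tau k" using r elim(3) Kp by (intro divide_right_mono mult_left_mono) auto
    finally have "\<bar>g r\<bar> * \<bar>H av r - A (tau k)\<bar> <= G * (2 * K * n / tau k)" using g(2)[of r] G by (intro mult_mono) auto
    then show "norm (g r * H av r - A (tau k) * g r) <= G * (2 * K * n / tau k)"
     by (simp add: abs_mult[symmetric] right_diff_distrib mult.commute)
   qed (use n in auto)
   also have "... = G * (2 * K * n) * n / tau k" by simp
   also have "... <= \<bar>G * (2 * K * n) * n / tau k\<bar>" by (rule abs_ge_self)
   also note elim(2)
   finally have "\<bar>integral {0..n} (%r. g r * H av r) - A (tau k) * integral {0..n} g\<bar> < e / 2" .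
   moreover have "\<bar>u - v\<bar> < e / 2 ==> \<bar>u - w\<bar> < e / 2 ==> \<bar>w - v\<bar> < e" for u v w :: real by linarith
   ultimately show ?case using d1 unfolding dist_real_def by blast
  qed
 qed
 define l where "l = integral {0..1} (H nu)"
 have Al: "(%k. A (tau k)) ----> l"
  using conv[of "%_. 1" 1 1] by (simp add: l_def)
 have ae: "AE r in lborel. r : {0..real n} --> H nu r = l" for n
 proof (cases "n = 0")
  case True
  have "AE r in lborel. r ~= (0::real)" by (rule AE_lborel_singleton)
  then show ?thesis by eventually_elim (use True in auto)
 next
  case False
  define g where "g r = H nu r - l" for r
  have g: "g : borel_measurable borel" unfolding g_def using Hm[OF nu] by measurable
  have gb: "\<bar>g r\<bar> <= K + \<bar>l\<bar>" for r unfolding g_def using Hb[OF nu, of r] by linarith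
  have gi: "g integrable_on {0..real n}" by (rule bounded_borel_integrable_on[OF g]) (use gb in simp)
  have "l * integral {0..real n} g = integral {0..real n} (%r. g r * H nu r)"
   by (rule LIMSEQ_unique[OF tendsto_mult_right[OF Al] conv[OF g gb]]) (use False in simp)
  then have "integral {0..real n} (%r. g r * H nu r - l * g r) = 0"
   using hk_integral_diff[OF gH[OF nu g gb, of "real n"] integrable_cmul[OF gi, of l]] by simp
  moreover have "(%r. g r * H nu r - l * g r) = (%r. (g r)\<^sup>2)" by (rule ext) (simp add: g_def power2_eq_square algebra_simps)
  ultimately have z: "integral {0..real n} (%r. (g r)\<^sup>2) = 0" by simp
  have si: "set_integrable lborel {0..real n} (%r. (g r)\<^sup>2)"
  proof (rule bounded_borel_set_integrable)
   have "K + \<bar>l\<bar> >= 0" using Kp by simp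
   then show "norm ((g r)\<^sup>2) <= (K + \<bar>l\<bar>)\<^sup>2" for r using gb[of r] by (simp add: abs_le_square_iff[symmetric])
  qed (use g in measurable)
  have "(LINT r|lborel. indicator {0..real n} r *R (g r)\<^sup>2) = 0"
   using set_borel_integral_eq_integral(2)[OF si] z by (simp add: set_lebesgue_integral_def)
  then have "AE r in lborel. indicator {0..real n} r *R (g r)\<^sup>2 = 0"
   using si by (subst (asm) integral_nonneg_eq_0_iff_AE) (auto simp: set_integrable_def)
  then show ?thesis by eventually_elim (auto simp: g_def indicator_def)
 qed
 then have "AE r in lborel. ALL n. r : {0..real n} --> H nu r = l" by (simp only: AE_all_countable) simp
 then have "AE r in lborel. 0 <= r --> (LINT p:S|nu r. f p) = l"
 proof eventually_elim
  case (elim r)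
  obtain n where "r <= real n" using real_arch_simple by blast
  with elim show ?case by (auto simp: H_def)
 qed
 then show ?thesis using Al unfolding A_def by blast
qed

text \<open>The exceptional null set of times depends on the test function. Countably many test functions separate measures, so one null set
 suffices, and outside it the limit takes a single value.\<close>

theorem limit_point_averages:
 fixes y :: "nat => 'b::euclidean_space"
 assumes S: "compact S" and y: "!!n. y n : S"
  and lp: "limit_point_at_top (relaxed_topology S) (%t. relaxed_class S (%s. averaged_empirical S a y (t + s))) c"
 shows "EX mu:prob_on S. c = relaxed_class S (%_. mu) &
  (EX tau. (ALL k. tau k > 0) & filterlim tau at_top sequentially &
   (ALL f. continuous_on UNIV f --> (%k. time_average (%n. f (y n)) (tau k)) ----> (LINT p|mu. f p)))"
proof -
 have Sb: "S : sets borel" using S by (simp add: compact_imp_closed)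
 from lp obtain tau where tau: "filterlim tau at_top sequentially"
  and lim: "limitin (relaxed_topology S) (%k. relaxed_class S (%s. averaged_empirical S a y (tau k + s))) c sequentially"
  unfolding limit_point_at_top_def by blast
 have "c : topspace (relaxed_topology S)" using lim by (rule limitin_topspace)
 then have "c : relaxed_maps S // relaxed_rel S"
  unfolding relaxed_topology_def topology_generated_by_topspace by auto
 then obtain nu where nu: "nu : relaxed_maps S" and c: "c = relaxed_rel S `` {nu}" by (auto elim: quotientE)
 note avg = limit_point_time_averages[OF S y tau lim[unfolded c] nu]
 obtain E :: "('b => real) set" where E: "countable E" "!!f. f : E ==> continuous_on UNIV f"
  and sep: "!!m m'. prob_space m ==> prob_space m' ==> sets m = sets borel ==> sets m' = sets borel ==>
   (!!f. f : E ==> (LINT p|m. f p) = (LINT p|m'. f p)) ==> m = m'"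
  using ex_countable_separating by metis
 have "EX l. AE r in lborel. 0 <= r --> (LINT p:S|nu r. f p) = l" if "f : E" for f
  using avg[OF continuous_on_subset[OF E(2)[OF that]]] by blast
 then obtain l where l: "!!f. f : E ==> AE r in lborel. 0 <= r --> (LINT p:S|nu r. f p) = l f" by metis
 then have ae: "AE r in lborel. ALL f:E. 0 <= r --> (LINT p:S|nu r. f p) = l f"
  unfolding AE_ball_countable[OF E(1)] by blast
 have pos: "EX r>=0. P r" if "AE r in lborel. 0 <= r --> P r" for P :: "real => bool"
 proof (rule ccontr)
  assume "~ ?thesis"
  then have "AE r in lborel. r \<notin> {0..1::real}" using that by (auto elim: eventually_mono)
  then have "{0..1::real} : null_sets lborel" by (subst (asm) AE_iff_null_sets[symmetric]) auto
  then show False by (simp add: null_sets_def)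
 qed
 obtain r0 where r0: "r0 >= 0" "!!f. f : E ==> (LINT p:S|nu r0. f p) = l f"
 proof -
  have "AE r in lborel. 0 <= r --> (ALL f:E. (LINT p:S|nu r. f p) = l f)" using ae by eventually_elim blast
  from pos[OF this] that show ?thesis by blast
 qed
 define mu where "mu = nu r0"
 have nuS: "nu r : prob_on S" if "r >= 0" for r using nu that by (auto simp: relaxed_maps_def)
 have mu: "mu : prob_on S" unfolding mu_def by (rule nuS[OF r0(1)])
 have eq: "AE r in lborel. 0 <= r --> nu r = mu"
  using ae
 proof eventually_elim
  case (elim r)
  show ?case
  proof
   assume r: "0 <= r"
   show "nu r = mu"
   proof (rule sep)
    fix f assume f: "f : E"
    have fm: "f : borel_measurable borel" by (rule continuous_borel[OF E(2)[OF f]])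
    show "(LINT p|(nu r). f p) = (LINT p|mu. f p)"
     using elim f r r0(2)[OF f] prob_on_set_integral[OF nuS[OF r] Sb fm] prob_on_set_integral[OF mu Sb fm] by (simp add: mu_def)
   qed (use prob_onD[OF mu] prob_onD[OF nuS[OF r]] in auto)
  qed
 qed
 have const: "(%_. mu) : relaxed_maps S"
  using mu by (auto simp: relaxed_maps_def prob_on_def intro!: measurable_const)
 have cc: "c = relaxed_class S (%_. mu)"
  unfolding c relaxed_class_def
 proof (rule set_eqI)
  fix kappa
  have "(AE t in lborel. 0 <= t --> nu t = kappa t) \<longleftrightarrow> (AE t in lborel. 0 <= t --> mu = kappa t)"
  proof
   assume "AE t in lborel. 0 <= t --> nu t = kappa t" with eq show "AE t in lborel. 0 <= t --> mu = kappa t" by eventually_elim simp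
  next
   assume "AE t in lborel. 0 <= t --> mu = kappa t" with eq show "AE t in lborel. 0 <= t --> nu t = kappa t" by eventually_elim simp
  qed
  then show "kappa : relaxed_rel S `` {nu} \<longleftrightarrow> kappa : relaxed_rel S `` {%_. mu}" using nu const by (simp add: relaxed_rel_def)
 qed
 have lims: "(%k. time_average (%n. f (y n)) (tau k)) ----> (LINT p|mu. f p)" if f: "continuous_on UNIV f" for f :: "'b => real"
 proof -
  obtain l where l: "(%k. time_average (%n. f (y n)) (tau k)) ----> l" "AE r in lborel. 0 <= r --> (LINT p:S|nu r. f p) = l"
   using avg[OF continuous_on_subset[OF f]] by blast
  from l(2) eq have "AE r in lborel. 0 <= r --> (LINT p:S|nu r. f p) = l & nu r = mu" by eventually_elim blast
  from pos[OF this] have "(LINT p:S|mu. f p) = l" by blast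
  then show ?thesis using l(1) prob_on_set_integral[OF mu Sb continuous_borel[OF f]] by simp
 qed
 have "eventually (%k. tau k > 0) sequentially" using tau by (simp add: filterlim_at_top_dense)
 then obtain N where N: "!!k. k >= N ==> tau k > 0" by (auto simp: eventually_sequentially)
 have "filterlim (%k. tau (k + N)) at_top sequentially" by (rule filterlim_compose[OF tau filterlim_add_const_nat_at_top])
 moreover have "(%k. time_average (%n. f (y n)) (tau (k + N))) ----> (LINT p|mu. f p)" if "continuous_on UNIV f" for f
  using lims[OF that] by (rule LIMSEQ_ignore_initial_segment)
 ultimately show ?thesis using mu cc N by (intro bexI[of _ mu] conjI exI[of _ "%k. tau (k + N)"]) auto
qed

end

section \<open>Orthogonality, conditional laws and change of sample space\<close>

text \<open>Bessel's inequality for bounded orthogonal families that need not be normalized, uniformly over finite subfamilies.\<close>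

lemma (in prob_space) countable_correlated:
 fixes phi :: "'i => 'a => real"
 assumes phi: "!!r. r : I ==> phi r : borel_measurable M" "!!r om. r : I ==> \<bar>phi r om\<bar> <= K"
  and orth: "!!r s. r : I ==> s : I ==> r ~= s ==> (LINT om|M. phi r om * phi s om) = 0"
  and W: "W : borel_measurable M" "!!om. \<bar>W om\<bar> <= C"
 shows "countable {r\<in>I. (LINT om|M. W om * phi r om) ~= 0}"
proof -
 define E where "E r = (LINT om|M. W om * phi r om)" for r
 \<comment> \<open>bounds the second moments, and is positive even if \<open>K = 0\<close>\<close>
 define k where "k = K\<^sup>2 + 1"
 have k: "k > 0" by (simp add: k_def add_nonneg_pos)
 have C: "C >= 0" using order_trans[OF abs_ge_zero W(2)[of undefined]] .
 have bi: "integrable M (%om. f om * g om)"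
  if "f : borel_measurable M" "g : borel_measurable M" "!!om. \<bar>f om\<bar> <= c" "!!om. \<bar>g om\<bar> <= d" for f g :: "'a => real" and c d
 proof (rule integrable_const_bound[of _ "c * d"])
  have "c >= 0" using order_trans[OF abs_ge_zero that(3)[of undefined]] .
  then have "norm (f om * g om) <= c * d" for om unfolding real_norm_def abs_mult by (intro mult_mono that) auto
  then show "AE om in M. norm (f om * g om) <= c * d" by simp
 qed (intro borel_measurable_times that)
 have bessel: "(\<Sum>r\<in>F. (E r)\<^sup>2) <= k * C\<^sup>2" if F: "finite F" "F \<subseteq> I" for F
 proof -
  have FI: "r : I" if "r : F" for r using that F by blast
  have i1: "integrable M (%om. W om * W om)" by (rule bi[OF W(1) W(1) W(2) W(2)])
  have i2: "integrable M (%om. W om * phi r om)" if "r : F" for r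
   by (rule bi[OF W(1) phi(1) W(2) phi(2)]) (use that FI in auto)
  have i3: "integrable M (%om. phi r om * phi s om)" if "r : F" "s : F" for r s
   by (rule bi[OF phi(1) phi(1) phi(2) phi(2)]) (use that FI in auto)
  define S where "S om = (\<Sum>r\<in>F. E r * phi r om)" for om
  have WS: "W om * S om = (\<Sum>r\<in>F. E r * (W om * phi r om))" for om
   by (simp add: S_def sum_distrib_left algebra_simps)
  have SS: "S om * S om = (\<Sum>r\<in>F. \<Sum>s\<in>F. (E r * E s) * (phi r om * phi s om))" for om
   unfolding S_def sum_product by (intro sum.cong refl) (simp add: algebra_simps)
  have iWS: "integrable M (%om. W om * S om)" unfolding WS by (intro bo_integrable_sum integrable_mult_right i2)
  have iSS: "integrable M (%om. S om * S om)" unfolding SS by (intro bo_integrable_sum integrable_mult_right i3)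
  have eWS: "(LINT om|M. W om * S om) = (\<Sum>r\<in>F. (E r)\<^sup>2)"
   unfolding WS using i2 by (subst bo_integral_sum) (auto simp: E_def[symmetric] power2_eq_square)
  have "(LINT om|M. S om * S om) = (\<Sum>r\<in>F. \<Sum>s\<in>F. (E r * E s) * (LINT om|M. phi r om * phi s om))"
   unfolding SS using i3 by (simp add: bo_integral_sum)
  also have "... = (\<Sum>r\<in>F. (E r)\<^sup>2 * (LINT om|M. phi r om * phi r om))"
  proof (rule sum.cong[OF refl])
   fix r assume r: "r : F"
   have "(\<Sum>s\<in>F. (E r * E s) * (LINT om|M. phi r om * phi s om)) = (\<Sum>s\<in>{r}. (E r * E s) * (LINT om|M. phi r om * phi s om))"
    by (rule sum.mono_neutral_right[OF F(1)]) (use r orth FI in auto)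
   then show "(\<Sum>s\<in>F. (E r * E s) * (LINT om|M. phi r om * phi s om)) = (E r)\<^sup>2 * (LINT om|M. phi r om * phi r om)"
    by (simp add: power2_eq_square)
  qed
  also have "... <= (\<Sum>r\<in>F. (E r)\<^sup>2 * k)"
  proof (intro sum_mono mult_left_mono)
   fix r assume r: "r : F"
   have "(LINT om|M. phi r om * phi r om) <= (LINT om|M. K\<^sup>2)"
   proof (rule integral_mono[OF i3[OF r r]])
    fix om
    have "\<bar>phi r om\<bar>\<^sup>2 <= K\<^sup>2" using phi(2)[OF FI[OF r]] by (intro power_mono) auto
    then show "phi r om * phi r om <= K\<^sup>2" by (simp add: power2_eq_square)
   qed simp
   then show "(LINT om|M. phi r om * phi r om) <= k" using prob_space by (simp add: k_def)
  qed simp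
  finally have eSS: "(LINT om|M. S om * S om) <= k * (\<Sum>r\<in>F. (E r)\<^sup>2)" by (simp add: sum_distrib_left mult.commute)
  have eWW: "(LINT om|M. W om * W om) <= C\<^sup>2"
  proof -
   have "(LINT om|M. W om * W om) <= (LINT om|M. C\<^sup>2)"
   proof (rule integral_mono[OF i1])
    fix om
    have "\<bar>W om\<bar>\<^sup>2 <= C\<^sup>2" using W(2) by (intro power_mono) auto
    then show "W om * W om <= C\<^sup>2" by (simp add: power2_eq_square)
   qed simp
   then show ?thesis using prob_space by simp
  qed
  have "0 <= (LINT om|M. (k * W om - S om)\<^sup>2)" by simp
  also have "... = (LINT om|M. k\<^sup>2 * (W om * W om) - 2 * k * (W om * S om) + S om * S om)"
   by (intro bo_integral_cong) (auto simp: power2_eq_square algebra_simps)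
  also have "... = k\<^sup>2 * (LINT om|M. W om * W om) - 2 * k * (LINT om|M. W om * S om) + (LINT om|M. S om * S om)"
   using i1 iWS iSS by simp
  also have "... <= k\<^sup>2 * C\<^sup>2 - 2 * k * (\<Sum>r\<in>F. (E r)\<^sup>2) + k * (\<Sum>r\<in>F. (E r)\<^sup>2)"
   unfolding eWS using mult_left_mono[OF eWW, of "k\<^sup>2"] eSS by simp
  finally have "k * (\<Sum>r\<in>F. (E r)\<^sup>2) <= k * (k * C\<^sup>2)" by (simp add: power2_eq_square)
  then show ?thesis using k by simp
 qed
 have fin: "finite {r\<in>I. 1 / Suc n <= (E r)\<^sup>2}" for n
 proof (rule ccontr)
  assume inf: "infinite {r\<in>I. 1 / Suc n <= (E r)\<^sup>2}"
  obtain m :: nat where m: "k * C\<^sup>2 * Suc n < real m" using reals_Archimedean2 by blast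
  obtain F where F: "F \<subseteq> {r\<in>I. 1 / Suc n <= (E r)\<^sup>2}" "finite F" "card F = m" using infinite_arbitrarily_large[OF inf] by metis
  have "real m * (1 / Suc n) <= (\<Sum>r\<in>F. (E r)\<^sup>2)"
   using sum_bounded_below[of F "1 / Suc n" "%r. (E r)\<^sup>2"] F by auto
  also have "... <= k * C\<^sup>2" by (rule bessel) (use F in auto)
  finally show False using m by (simp add: field_simps)
 qed
 have "{r\<in>I. E r ~= 0} \<subseteq> (\<Union>n. {r\<in>I. 1 / Suc n <= (E r)\<^sup>2})"
 proof
  fix r assume r: "r : {r\<in>I. E r ~= 0}"
  then have "(E r)\<^sup>2 > 0" by simp
  then obtain n where "1 / Suc n < (E r)\<^sup>2" using nat_approx_posE by (metis)
  then show "r : (\<Union>n. {r\<in>I. 1 / Suc n <= (E r)\<^sup>2})" using r by (auto intro!: exI[of _ n])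
 qed
 then have "countable {r\<in>I. E r ~= 0}"
  by (rule countable_subset) (rule countable_UN, simp, rule countable_finite, rule fin)
 then show ?thesis by (simp add: E_def)
qed

lemma borel_measurable_section:
 fixes G :: "'a::euclidean_space \<times> real => 'a"
 assumes "G : borel_measurable borel"
 shows "(%u. G (x, u)) : borel_measurable borel"
proof -
 have "(%u::real. (x, u)) : borel ->M borel"
  by (intro continuous_borel continuous_on_Pair continuous_on_const continuous_on_id)
 from mcompose[OF this assms] show ?thesis .
qed

text \<open>By Fubini's theorem the conditional law of the second coordinate given the first is a function of the joint law only.\<close>

lemma conditional_law_of_joint:
 fixes X Z :: "'q => 'a::euclidean_space"
 assumes Q: "prob_space Q" and X: "X : borel_measurable Q" and Z: "Z : borel_measurable Q"
  and nu: "prob_space nu" "sets nu = sets borel" and G: "G : borel_measurable borel"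
  and law: "distr Q borel (%xi. (X xi, Z xi)) = distr (nu >< unif) borel (%(x, u). (x, G (x, u)))"
 shows "is_conditional_law Q X Z (%x. distr unif borel (%u. G (x, u)))"
 unfolding is_conditional_law_def
proof
 fix A :: "'a set" assume A: "A : sets borel"
 interpret Q: prob_space Q by fact
 interpret nu: prob_space nu by fact
 interpret U: prob_space unif by (rule prob_space_unif)
 interpret P: pair_prob_space nu unif ..
 define F where "F = vimage_algebra (space Q) X borel"
 have FQ: "subalgebra Q F"
  unfolding F_def subalgebra_def using X
  by (auto simp: sets_vimage_algebra2 measurable_sets)
 interpret F: finite_measure_subalgebra Q F by unfold_locales (rule FQ)
 have "sets (nu >< unif) = sets (borel >< borel)" by (rule sets_pair_measure_cong[OF nu(2) sets_unif])
 also have "... = sets borel" unfolding borel_prod ..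
 finally have setsP: "sets (nu >< unif) = sets borel" .
 have Gp: "(%(x, u). (x, G (x, u))) : nu >< unif ->M borel"
 proof -
  have "(%p. (fst p, G p)) : borel ->M borel" using G by (intro borel_measurable_Pair borel_measurable_fst_snd) auto
  then show ?thesis unfolding measurable_cong_sets[OF setsP refl] by (simp add: split_beta')
 qed
 have XZ: "(%xi. (X xi, Z xi)) : Q ->M borel" by (rule borel_measurable_Pair[OF X Z])
 have lawX: "distr Q borel X = nu"
 proof -
  have "distr Q borel X = distr (distr Q borel (%xi. (X xi, Z xi))) borel fst"
   by (subst distr_distr[OF _ XZ]) (auto simp: comp_def)
  also have "... = distr (nu >< unif) borel fst"
   unfolding law by (subst distr_distr[OF _ Gp]) (auto simp: comp_def split_beta')
  also have "... = distr (nu >< unif) nu fst" by (rule distr_cong) (use nu in auto)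
  also have "... = nu" by (rule U.distr_pair_fst)
  finally show ?thesis .
 qed
 define w where "w x = measure (distr unif borel (%u. G (x, u))) A" for x
 have Gx: "(%u. G (x, u)) : unif ->M borel" for x
  unfolding measurable_cong_sets[OF sets_unif refl] by (rule borel_measurable_section[OF G])
 have w: "w x = (LINT u|unif. indicat_real A (G (x, u)))" for x
 proof -
  have "w x = measure unif ((%u. G (x, u)) -` A \<inter> space unif)" unfolding w_def by (rule measure_distr[OF Gx A])
  also have "... = (LINT u|unif. indicat_real ((%u. G (x, u)) -` A \<inter> space unif) u)"
   using measurable_sets[OF Gx A] by simp
  finally show ?thesis by (simp add: indicator_def)
 qed
 have AG: "(%p. indicat_real A (G p)) : borel_measurable borel"
  by (rule mcompose[OF G]) (use A in simp)
 have AGP: "(%p. indicat_real A (G p)) : borel_measurable (nu >< unif)" using AG by (simp add: measurable_cong_sets[OF setsP refl])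
 have wm: "w : borel_measurable borel"
 proof -
  have "(%x. LINT u|unif. indicat_real A (G (x, u))) : borel_measurable nu"
   by (rule U.borel_measurable_lebesgue_integral) (use AGP in \<open>simp add: split_beta'\<close>)
  then show ?thesis unfolding w[abs_def] by (simp add: measurable_cong_sets[OF nu(2) refl])
 qed
 have w01: "0 <= w x" "w x <= 1" for x
  unfolding w_def using prob_space.prob_le_1[OF U.prob_space_distr[OF Gx]] by auto
 have XF: "X : F ->M borel" unfolding F_def by (rule measurable_vimage_algebra1) simp
 have key: "AE xi in Q. real_cond_exp Q F (%xi. indicat_real A (Z xi)) xi = w (X xi)"
 proof (rule F.real_cond_exp_charact)
  have Zi: "(%xi. indicat_real A (Z xi)) : borel_measurable Q" by (rule mcompose[OF Z]) (use A in simp)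
  show "integrable Q (%xi. indicat_real A (Z xi))" by (rule Q.integrable_const_bound[of _ 1]) (use Zi in \<open>auto split: split_indicator\<close>)
  show "integrable Q (%xi. w (X xi))"
   by (rule Q.integrable_const_bound[of _ 1]) (use w01 mcompose[OF X wm] in auto)
  show "(%xi. w (X xi)) : borel_measurable F" by (rule mcompose[OF XF wm])
  fix A' assume "A' : sets F"
  then obtain E where E: "E : sets borel" "A' = X -` E \<inter> space Q" unfolding F_def by (auto simp: sets_vimage_algebra2)
  have Em: "(%p. indicat_real E (fst p) * indicat_real A (snd p)) : borel_measurable (borel :: ('a * 'a) measure)"
   using E(1) A by (intro borel_measurable_times mcompose[OF borel_measurable_fst_snd(1)] mcompose[OF borel_measurable_fst_snd(2)]) auto
  have iP: "integrable (nu >< unif) (%(x, u). indicat_real E x * indicat_real A (G (x, u)))"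
  proof (rule P.integrable_const_bound[of _ 1])
   have "(%p. indicat_real E (fst p) * indicat_real A (G p)) : borel_measurable borel"
    using E(1) by (intro borel_measurable_times AG mcompose[OF borel_measurable_fst_snd(1)]) auto
   then show "(%(x, u). indicat_real E x * indicat_real A (G (x, u))) : borel_measurable (nu >< unif)"
    by (simp add: measurable_cong_sets[OF setsP refl] split_beta')
  qed (auto split: split_indicator)
  have "(LINT xi:A'|Q. indicat_real A (Z xi)) = (LINT xi|Q. indicat_real E (X xi) * indicat_real A (Z xi))"
   unfolding set_lebesgue_integral_def E(2) by (intro bo_integral_cong) (auto split: split_indicator)
  also have "... = (\<integral>p. indicat_real E (fst p) * indicat_real A (snd p) \<partial>distr Q borel (%xi. (X xi, Z xi)))"
   by (subst integral_distr[OF XZ Em]) simp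
  also have "... = (LINT p|(nu >< unif). (case p of (x, u) => indicat_real E x * indicat_real A (G (x, u))))"
   unfolding law by (subst integral_distr[OF Gp Em]) (simp add: split_beta')
  also have "... = (LINT x|nu. (LINT u|unif. indicat_real E x * indicat_real A (G (x, u))))"
   using P.integral_fst'[OF iP] by simp
  also have "... = (LINT x|nu. indicat_real E x * w x)" by (simp add: w)
  also have "... = (LINT xi|Q. indicat_real E (X xi) * w (X xi))"
   unfolding lawX[symmetric] by (rule integral_distr[OF X]) (use E(1) wm in \<open>intro borel_measurable_times, auto\<close>)
  also have "... = (LINT xi:A'|Q. w (X xi))"
   unfolding set_lebesgue_integral_def E(2) by (intro bo_integral_cong) (auto split: split_indicator)
  finally show "(LINT xi:A'|Q. indicat_real A (Z xi)) = (LINT xi:A'|Q. w (X xi))" .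
 qed
 then show "AE xi in Q. real_cond_exp Q (vimage_algebra (space Q) X borel) (%xi. indicat_real A (Z xi)) xi =
   measure (distr unif borel (%u. G (X xi, u))) A"
  by (simp add: F_def w_def)
qed

text \<open>Replaces the sample space of a process along an injection \<open>emb\<close> with left inverse \<open>dem\<close>. The sigma-algebra on the new space
 is the one generated by \<open>dem\<close>.\<close>

locale measure_transport = prob_space N for N :: "'n measure" +
 fixes emb :: "'n => 'q" and dem :: "'q => 'n"
 assumes space_N: "space N = UNIV" and dem_emb: "!!n. dem (emb n) = n"
begin

definition Q :: "'q measure" where "Q = distr N (vimage_algebra UNIV dem N) emb"

lemma emb_meas: "emb : N ->M vimage_algebra UNIV dem N"
 by (rule measurable_vimage_algebra2) (auto simp: dem_emb comp_def measurable_ident_sets)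

lemma dem_meas: "dem : Q ->M N"
 using measurable_vimage_algebra1[of dem UNIV N] by (simp add: Q_def space_N)

lemma prob_Q: "prob_space Q" unfolding Q_def by (rule prob_space_distr[OF emb_meas])

lemma emb_meas_Q: "emb : N ->M Q" using emb_meas by (simp add: Q_def)

lemma distr_Q: "g : N ->M M' ==> distr Q M' (%xi. g (dem xi)) = distr N M' g"
 unfolding Q_def
 using distr_distr[of "%xi. g (dem xi)" "vimage_algebra UNIV dem N" M' emb N, OF _ emb_meas]
  mcompose[OF dem_meas, of g M'] by (simp add: comp_def dem_emb Q_def)

lemma integral_Q:
 fixes f :: "'q => 'b::{banach, second_countable_topology}"
 shows "f : borel_measurable Q ==> (LINT xi|Q. f xi) = (LINT n|N. f (emb n))"
 unfolding Q_def by (rule integral_distr[OF emb_meas]) simp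

lemma AE_Q: assumes "AE n in N. P n" shows "AE xi in Q. P (dem xi)"
proof -
 have d: "distr Q N dem = N" using distr_Q[of "%n. n" N] distr_id[of N] by (simp add: id_def)
 show ?thesis by (rule AE_distrD[OF dem_meas]) (use assms in \<open>simp only: d\<close>)
qed

lemma transport_stationary:
 assumes "stationary_process N Y"
 shows "stationary_process Q (%t xi. Y t (dem xi))"
proof -
 have Y: "Y t : borel_measurable N" if "t >= 0" for t using assms that by (simp add: stationary_process_def)
 have m: "(%n. \<lambda>t\<in>{0..}. Y (t + tau) n) : N ->M PiM {0..} (%_. borel)" if "tau >= 0" for tau
  by (rule measurable_restrict) (use Y that in simp)
 show ?thesis
  unfolding stationary_process_def
 proof (intro conjI allI impI prob_Q)
  fix t :: real assume "t >= 0"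
  then show "(%xi. Y t (dem xi)) : borel_measurable Q" using mcompose[OF dem_meas Y] by simp
 next
  fix tau :: real assume tau: "tau >= 0"
  show "distr Q (PiM {0..} (%_. borel)) (%om. \<lambda>t\<in>{0..}. Y (t + tau) (dem om)) =
    distr Q (PiM {0..} (%_. borel)) (%om. \<lambda>t\<in>{0..}. Y t (dem om))"
   using assms tau distr_Q[OF m[OF tau]] distr_Q[OF m[of 0]] by (simp add: stationary_process_def)
 qed
qed

lemma transport_velocity:
 assumes v: "weak_velocity N X Z"
  and X: "!!t. t >= 0 ==> X t : borel_measurable N" and Z: "!!t. t >= 0 ==> Z t : borel_measurable N"
 shows "weak_velocity Q (%t xi. X t (dem xi)) (%t xi. Z t (dem xi))"
 unfolding weak_velocity_def
proof (intro allI impI)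
 fix W :: "'q => real" and s t :: real
 assume a: "W : borel_measurable Q & bounded (range W) & 0 <= s & s <= t"
 have Wm: "(%n. W (emb n)) : borel_measurable N" by (rule mcompose[OF emb_meas_Q]) (use a in simp)
 have "bounded (range (%n. W (emb n)))" using a by (auto intro: bounded_subset)
 with v a Wm have *: "set_integrable lborel {s..t} (%r. LINT n|N. W (emb n) *R Z r n)"
  "(LINT n|N. W (emb n) *R (X t n - X s n)) = (LINT r:{s..t}|lborel. (LINT n|N. W (emb n) *R Z r n))"
  unfolding weak_velocity_def by blast+
 have Q1: "(LINT xi|Q. W xi *R f (dem xi)) = (LINT n|N. W (emb n) *R f n)" if "f : borel_measurable N" for f :: "'n => 'a"
 proof -
  have "(%xi. W xi *R f (dem xi)) : borel_measurable Q"
   by (rule borel_measurable_scaleR[OF _ mcompose[OF dem_meas that]]) (use a in simp)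
  from integral_Q[OF this] show ?thesis by (simp add: dem_emb)
 qed
 have eq: "(LINT xi|Q. W xi *R Z r (dem xi)) = (LINT n|N. W (emb n) *R Z r n)" if "r : {s..t}" for r
  by (rule Q1) (use that a Z in auto)
 show "set_integrable lborel {s..t} (%r. LINT xi|Q. W xi *R Z r (dem xi)) &
  (LINT xi|Q. W xi *R (X t (dem xi) - X s (dem xi))) = (LINT r:{s..t}|lborel. (LINT xi|Q. W xi *R Z r (dem xi)))"
 proof
  show "set_integrable lborel {s..t} (%r. LINT xi|Q. W xi *R Z r (dem xi))"
   using *(1) by (subst set_integrable_cong[OF refl refl eq]) auto
  have "(LINT xi|Q. W xi *R (X t (dem xi) - X s (dem xi))) = (LINT n|N. W (emb n) *R (X t n - X s n))"
   by (rule Q1) (intro borel_measurable_diff X, use a in auto)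
  also have "... = (LINT r:{s..t}|lborel. (LINT xi|Q. W xi *R Z r (dem xi)))"
   unfolding *(2) set_lebesgue_integral_def[of lborel]
   by (intro bo_integral_cong refl) (auto simp: eq split: split_indicator)
  finally show "(LINT xi|Q. W xi *R (X t (dem xi) - X s (dem xi))) = (LINT r:{s..t}|lborel. (LINT xi|Q. W xi *R Z r (dem xi)))" .
 qed
qed

end

section \<open>Adding the velocities\<close>

locale relaxed_process = dyadic_process L nu vb C B
 for L :: "(nat => 'a::euclidean_space) measure" and nu vb C B +
 fixes G :: "'a * real => 'a"
 assumes G: "G : borel_measurable borel" and G_le: "!!x u. x : B ==> norm (G (x, u)) <= C"
  and G_mean: "!!x. x : B ==> (LINT u|unif. G (x, u)) = vb x"
begin

definition U :: "(real => real) measure" where "U = PiM UNIV (%_. unif)"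
definition N :: "((nat => 'a) * (real => real)) measure" where "N = L >< U"
definition Z :: "real => (nat => 'a) * (real => real) => 'a" where "Z t p = G (X t (fst p), snd p t)"

sublocale unif: prob_space unif by (rule prob_space_unif)
sublocale NU: prob_space nu by (rule prob_nu)
sublocale U: prob_space U unfolding U_def by (rule prob_space_PiM) (rule prob_space_unif)
sublocale LU: pair_prob_space L U ..
sublocale nuU: pair_prob_space nu unif ..
sublocale N: prob_space N unfolding N_def by (rule LU.P.prob_space_axioms)

lemma space_N: "space N = UNIV" by (simp add: N_def U_def space_pair_measure space_PiM space_L)

lemma coordU: "(%u. u t) : U ->M unif" unfolding U_def by (rule measurable_component_singleton) simp

lemma coordU_borel: "(%u. u t) : U ->M borel" using coordU by (simp add: measurable_cong_sets[OF refl sets_unif])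

lemma X_fst: "(%p. X t (fst p)) : N ->M borel"
 unfolding N_def by (rule mcompose[OF measurable_fst X_meas])

lemma snd_coord: "(%p. snd p t) : N ->M borel"
 unfolding N_def by (rule mcompose[OF measurable_snd coordU_borel])

lemma Z_meas: "Z t : N ->M borel"
proof -
 have "(%p. (X t (fst p), snd p t)) : N ->M borel" by (rule borel_measurable_Pair[OF X_fst snd_coord])
 from mcompose[OF this G] show ?thesis by (simp add: Z_def[abs_def])
qed

lemma Z_le: "t >= 0 ==> norm (Z t p) <= C" unfolding Z_def by (rule G_le[OF X_B])

lemma sets_borel_unif: "sets (borel >< unif) = sets (borel :: ('a * real) measure)"
proof -
 have "sets (borel >< unif) = sets ((borel :: 'a measure) >< (borel :: real measure))"
  by (rule sets_pair_measure_cong) simp_all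
 also have "... = sets borel" unfolding borel_prod ..
 finally show ?thesis .
qed

lemma sets_nu_unif: "sets (nu >< unif) = sets (borel >< unif)"
 by (rule sets_pair_measure_cong[OF sets_nu refl])

lemma XU_law:
 assumes t: "t >= 0"
 shows "distr N (borel >< unif) (%p. (X t (fst p), snd p t)) = nu >< unif"
proof -
 interpret PU: product_prob_space "%_::real. unif" UNIV ..
 have u: "distr U unif (%u. u t) = unif" unfolding U_def by (rule PU.PiM_component) simp
 have "distr L borel (X t) >< distr U unif (%u. u t) = distr (L >< U) (borel >< unif) (%(c, u). (X t c, u t))"
  by (rule pair_measure_distr[OF X_meas coordU]) (unfold u, rule unif.sigma_finite_measure_axioms)
 then show ?thesis by (simp add: u X_law[OF t] N_def split_beta')
qed

lemma G_graph_meas: "(%(x, u). (x, G (x, u))) : borel >< unif ->M borel"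
proof -
 have "(%p. (fst p, G p)) : borel ->M borel" using G by (intro borel_measurable_Pair borel_measurable_fst_snd) auto
 then show ?thesis unfolding measurable_cong_sets[OF sets_borel_unif refl] by (simp add: split_beta')
qed

lemma XZ_law:
 assumes t: "t >= 0"
 shows "distr N borel (%p. (X t (fst p), Z t p)) = distr (nu >< unif) borel (%(x, u). (x, G (x, u)))"
proof -
 have m: "(%p. (X t (fst p), snd p t)) : N ->M borel >< unif"
  using borel_measurable_Pair[OF X_fst snd_coord] by (simp add: measurable_cong_sets[OF refl sets_borel_unif])
 show ?thesis unfolding XU_law[OF t, symmetric] distr_distr[OF G_graph_meas m]
  by (simp add: comp_def Z_def)
qed

text \<open>The family of uniform variables is invariant under shifts and independent of \<open>X\<close>, and the pairs are obtained from both time by time.\<close>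

lemma XZ_stationary: "stationary_process N (%t p. (X t (fst p), Z t p))"
 unfolding stationary_process_def
proof (intro conjI allI impI N.prob_space_axioms)
 show "(%p. (X t (fst p), Z t p)) : borel_measurable N" for t by (rule borel_measurable_Pair[OF X_fst Z_meas])
 fix tau :: real assume tau: "tau >= 0"
 let ?P = "PiM {0::real..} (%_. borel :: 'a measure)" and ?V = "PiM {0::real..} (%_. unif)"
 define Phi where "Phi tau = (%(c, u :: real => real). (\<lambda>t\<in>{0..}. X (t + tau) c, \<lambda>t\<in>{0..}. u (t + tau)))" for tau :: real
 define Psi where "Psi = (%(p, q). \<lambda>t\<in>{0::real..}. (p t :: 'a, G (p t, q t)))"
 have rU: "(%u. \<lambda>t\<in>{0..}. u (t + tau)) : U ->M ?V" for tau :: real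
  by (rule measurable_restrict) (rule coordU)
 have lU: "distr U ?V (%u. \<lambda>t\<in>{0..}. u (t + tau)) = ?V" for tau :: real
  unfolding U_def
  by (rule distr_PiM_reindex[of UNIV "%_. unif" "%t. t + tau" "{0..}"]) (auto intro: prob_space_unif)
 interpret V: prob_space ?V by (rule prob_space_PiM) (rule prob_space_unif)
 have lN: "distr N (?P >< ?V) (Phi tau) = distr L ?P (%y. \<lambda>t\<in>{0..}. X (t + tau) y) >< ?V" for tau
 proof -
  have "distr L ?P (%y. \<lambda>t\<in>{0..}. X (t + tau) y) >< distr U ?V (%u. \<lambda>t\<in>{0..}. u (t + tau)) = distr (L >< U) (?P >< ?V) (Phi tau)"
   unfolding Phi_def by (rule pair_measure_distr[OF process_meas rU]) (unfold lU, rule V.sigma_finite_measure_axioms)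
  then show ?thesis by (simp add: lU N_def)
 qed
 have Phim: "Phi tau : N ->M ?P >< ?V" for tau
  unfolding Phi_def N_def split_beta'
  by (intro measurable_Pair mcompose[OF measurable_fst process_meas] mcompose[OF measurable_snd rU])
 have Psim: "Psi : ?P >< ?V ->M PiM {0..} (%_. borel)"
  unfolding Psi_def split_beta'
 proof (rule measurable_restrict)
  fix t :: real assume t: "t : {0..}"
  have 1: "(%p. fst p t) : ?P >< ?V ->M borel" by (rule mcompose[OF measurable_fst measurable_component_singleton[OF t]])
  have "(%p. snd p t) : ?P >< ?V ->M unif" by (rule mcompose[OF measurable_snd measurable_component_singleton[OF t]])
  then have 2: "(%p. snd p t) : ?P >< ?V ->M borel" by (simp add: measurable_cong_sets[OF refl sets_unif])
  show "(%p. (fst p t, G (fst p t, snd p t))) : ?P >< ?V ->M borel"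
   by (rule borel_measurable_Pair[OF 1 mcompose[OF borel_measurable_Pair[OF 1 2] G]])
 qed
 have comp: "(%p. \<lambda>t\<in>{0..}. (X (t + tau) (fst p), Z (t + tau) p)) = Psi \<circ> Phi tau" for tau
  by (rule ext) (auto simp: Psi_def Phi_def Z_def split_beta' fun_eq_iff restrict_def)
 have "distr N (PiM {0..} (%_. borel)) (%p. \<lambda>t\<in>{0..}. (X (t + tau) (fst p), Z (t + tau) p)) =
   distr (distr L ?P (%y. \<lambda>t\<in>{0..}. X (t + tau) y) >< ?V) (PiM {0..} (%_. borel)) Psi" for tau
  unfolding comp lN[symmetric] by (rule distr_distr[OF Psim Phim, symmetric])
 from this[of tau] this[of 0]
 show "distr N (PiM {0..} (%_. borel)) (%p. \<lambda>t\<in>{0..}. (X (t + tau) (fst p), Z (t + tau) p)) =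
   distr N (PiM {0..} (%_. borel)) (%p. \<lambda>t\<in>{0..}. (X t (fst p), Z t p))"
  using stationary_PiM[OF tau] by simp
qed

lemma U_independent:
 fixes f g :: "real => real"
 assumes f: "f : borel_measurable borel" "!!u. \<bar>f u\<bar> <= K" and g: "g : borel_measurable borel" "!!u. \<bar>g u\<bar> <= K"
  and rs: "r ~= s"
 shows "(LINT u|U. f (u r) * g (u s)) = (LINT u|unif. f u) * (LINT u|unif. g u)"
proof -
 interpret PU: product_sigma_finite "%_::real. unif" ..
 let ?F = "PiM {r, s} (%_. unif)"
 define k where "k i = (if i = r then f else g)" for i
 have k: "k i : borel_measurable unif" "!!u. \<bar>k i u\<bar> <= K" for i using f g by (auto simp: k_def cong: measurable_cong_sets)
 have "(\<integral>x. (\<Prod>i\<in>{r, s}. k i (x i)) \<partial>?F) = (\<Prod>i\<in>{r, s}. (LINT u|unif. k i u))"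
  by (rule PU.product_integral_prod) (use k in \<open>auto intro!: unif.integrable_const_bound[of _ K]\<close>)
 then have e: "(\<integral>x. f (x r) * g (x s) \<partial>?F) = (LINT u|unif. f u) * (LINT u|unif. g u)" using rs by (simp add: k_def)
 have d: "distr U ?F (%u. \<lambda>i\<in>{r, s}. u i) = ?F"
  unfolding U_def by (rule distr_PiM_reindex[of UNIV "%_. unif" "%t. t" "{r, s}"]) (auto intro: prob_space_unif)
 have m: "(%u. \<lambda>i\<in>{r, s}. u i) : U ->M ?F" by (rule measurable_restrict) (rule coordU)
 have c: "(%x. x i) : ?F ->M borel" if "i : {r, s}" for i
  using measurable_component_singleton[OF that, of "%_. unif"] by (simp add: measurable_cong_sets[OF refl sets_unif])
 have "(%x. f (x r) * g (x s)) : borel_measurable ?F"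
  by (intro borel_measurable_times mcompose[OF c f(1)] mcompose[OF c g(1)]) auto
 from integral_distr[OF m this] show ?thesis unfolding d e by simp
qed

text \<open>Given the positions, the deviations at two times depend on independent uniform variables and have mean zero.\<close>

lemma deviation_orthogonal:
 assumes r: "r >= 0" and s: "s >= 0" and rs: "r ~= s" and b: "b : Basis"
 shows "(LINT p|N. ((Z r p - vb (X r (fst p))) <.> b) * ((Z s p - vb (X s (fst p))) <.> b)) = 0"
proof -
 define D where "D x u = (G (x, u) - vb x) <.> b" for x u
 have Dm: "D x : borel_measurable borel" for x
  using borel_measurable_section[OF G, of x] unfolding D_def[abs_def] by measurable
 have Db: "\<bar>D x u\<bar> <= 2 * C" if "x : B" for x u
 proof -
  have "\<bar>D x u\<bar> <= norm (G (x, u) - vb x)" unfolding D_def by (rule Basis_le_norm[OF b])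
  also have "... <= C + C" using norm_triangle_ineq4[of "G (x, u)" "vb x"] G_le[OF that, of u] vb(2)[of x] by linarith
  finally show ?thesis by simp
 qed
 have D0: "(LINT u|unif. D x u) = 0" if "x : B" for x
 proof -
  have i: "integrable unif (%u. G (x, u))"
  proof (rule unif.integrable_const_bound[of _ C])
   show "(%u. G (x, u)) : borel_measurable unif"
    unfolding measurable_cong_sets[OF sets_unif refl] by (rule borel_measurable_section[OF G])
  qed (use G_le[OF that] in simp)
  have "(LINT u|unif. D x u) = (LINT u|unif. G (x, u) - vb x) <.> b"
   unfolding D_def by (rule integral_inner_left) (use i in auto)
  also have "(LINT u|unif. G (x, u) - vb x) = 0" using i G_mean[OF that] unif.prob_space by simp
  finally show ?thesis by simp
 qed
 have "integrable N (%p. D (X r (fst p)) (snd p r) * D (X s (fst p)) (snd p s))"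
 proof (rule N.integrable_const_bound[of _ "2 * C * (2 * C)"])
  have "norm (D (X r (fst p)) (snd p r) * D (X s (fst p)) (snd p s)) <= 2 * C * (2 * C)" for p
   unfolding real_norm_def abs_mult using C_nonneg by (intro mult_mono Db X_B r s) auto
  then show "AE p in N. norm (D (X r (fst p)) (snd p r) * D (X s (fst p)) (snd p s)) <= 2 * C * (2 * C)" by simp
  have "(%p. D (X t (fst p)) (snd p t)) : borel_measurable N" for t
   unfolding D_def using Z_meas[of t] mcompose[OF X_fst vb(1), of t] unfolding Z_def[abs_def] by measurable
  then show "(%p. D (X r (fst p)) (snd p r) * D (X s (fst p)) (snd p s)) : borel_measurable N" by measurable
 qed
 then have "(LINT p|N. D (X r (fst p)) (snd p r) * D (X s (fst p)) (snd p s)) =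
   (LINT c|L. (LINT u|U. D (X r c) (u r) * D (X s c) (u s)))"
  unfolding N_def by (subst LU.integral_fst'[symmetric]) (auto simp: split_beta')
 also have "... = (LINT c|L. 0)"
  by (intro bo_integral_cong refl, subst U_independent[OF Dm Db[OF X_B[OF r]] Dm Db[OF X_B[OF s]] rs])
    (simp add: D0[OF X_B[OF r]])
 finally show ?thesis by (simp add: D_def Z_def)
qed

lemma velocity_countable_exceptions:
 assumes W: "W : borel_measurable N" "!!p. \<bar>W p\<bar> <= K"
 shows "countable {r\<in>{0..}. (LINT p|N. W p *R Z r p) ~= (LINT p|N. W p *R vb (X r (fst p)))}"
proof -
 define phi where "phi b r p = (Z r p - vb (X r (fst p))) <.> b" for b r p
 have Vm: "(%p. vb (X r (fst p))) : borel_measurable N" for r by (rule mcompose[OF X_fst vb(1)])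
 have cb: "countable {r\<in>{0..}. (LINT p|N. W p * phi b r p) ~= 0}" if b: "b : Basis" for b
 proof (rule N.countable_correlated[OF _ _ _ W])
  show "phi b r : borel_measurable N" for r unfolding phi_def[abs_def] using Z_meas Vm by measurable
  show "\<bar>phi b r p\<bar> <= 2 * C" if "r : {0..}" for r p
  proof -
   have "\<bar>phi b r p\<bar> <= norm (Z r p - vb (X r (fst p)))" unfolding phi_def by (rule Basis_le_norm[OF b])
   also have "... <= C + C" using norm_triangle_ineq4[of "Z r p" "vb (X r (fst p))"] Z_le[of r p] vb(2)[of "X r (fst p)"] that by simp
   finally show ?thesis by simp
  qed
  show "(LINT p|N. phi b r p * phi b s p) = 0" if "r : {0..}" "s : {0..}" "r ~= s" for r s
   unfolding phi_def by (rule deviation_orthogonal) (use that b in auto)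
 qed
 have "{r\<in>{0..}. (LINT p|N. W p *R Z r p) ~= (LINT p|N. W p *R vb (X r (fst p)))} \<subseteq> (\<Union>b\<in>Basis. {r\<in>{0..}. (LINT p|N. W p * phi b r p) ~= 0})"
 proof
  fix r assume "r : {r\<in>{0..}. (LINT p|N. W p *R Z r p) ~= (LINT p|N. W p *R vb (X r (fst p)))}"
  then have r: "r >= 0" and ne: "(LINT p|N. W p *R Z r p) ~= (LINT p|N. W p *R vb (X r (fst p)))" by auto
  have K: "K >= 0" using order_trans[OF abs_ge_zero W(2)[of undefined]] .
  have i: "integrable N (%p. W p *R f p)" if "f : borel_measurable N" "!!p. norm (f p) <= C" for f :: "_ => 'a"
  proof (rule N.integrable_const_bound[of _ "K * C"])
   have "norm (W p *R f p) <= K * C" for p unfolding norm_scaleR by (intro mult_mono W that K) auto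
   then show "AE p in N. norm (W p *R f p) <= K * C" by simp
  qed (intro borel_measurable_scaleR W that)
  have i1: "integrable N (%p. W p *R Z r p)" by (rule i[OF Z_meas Z_le[OF r]])
  have i2: "integrable N (%p. W p *R vb (X r (fst p)))" by (rule i[OF Vm vb(2)])
  show "r : (\<Union>b\<in>Basis. {r\<in>{0..}. (LINT p|N. W p * phi b r p) ~= 0})"
  proof (rule ccontr)
   assume no: "~ ?thesis"
   have "(LINT p|N. W p *R Z r p) <.> b = (LINT p|N. W p *R vb (X r (fst p))) <.> b" if b: "b : Basis" for b
   proof -
    have "(LINT p|N. W p *R Z r p) <.> b - (LINT p|N. W p *R vb (X r (fst p))) <.> b = (LINT p|N. W p *R Z r p - W p *R vb (X r (fst p))) <.> b"
     using i1 i2 by (simp add: inner_diff_left)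
    also have "... = (LINT p|N. (W p *R Z r p - W p *R vb (X r (fst p))) <.> b)"
     by (rule integral_inner_left[symmetric]) (use i1 i2 in simp)
    also have "... = (LINT p|N. W p * phi b r p)" by (simp add: phi_def inner_diff_left right_diff_distrib)
    also have "... = 0" using no b r by auto
    finally show ?thesis by simp
   qed
   then have "(LINT p|N. W p *R Z r p) = (LINT p|N. W p *R vb (X r (fst p)))" by (rule euclidean_eqI)
   with ne show False ..
  qed
 qed
 then show ?thesis
  by (rule countable_subset) (rule countable_UN, simp add: countable_finite, rule cb)
qed

lemma AE_fst: "AE c in L. P c ==> AE p in N. P (fst p)"
proof -
 assume a: "AE c in L. P c"
 have d: "distr N L fst = L" unfolding N_def by (rule U.distr_pair_fst)
 show "AE p in N. P (fst p)"
 proof (rule AE_distrD[where f=fst and P=P])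
  show "fst : N ->M L" unfolding N_def by (rule measurable_fst)
  show "AE c in distr N L fst. P c" unfolding d by (rule a)
 qed
qed

text \<open>The velocity may be replaced by \<open>vb (X r)\<close> except at countably many times \<open>r\<close>; then the path equation and Fubini's theorem apply.\<close>

lemma XZ_velocity: "weak_velocity N (%t p. X t (fst p)) Z"
 unfolding weak_velocity_def
proof (intro allI impI)
 fix W :: "(nat => 'a) * (real => real) => real" and s t :: real
 assume a: "W : borel_measurable N & bounded (range W) & 0 <= s & s <= t"
 then have s: "0 <= s" "s <= t" and Wm: "W : borel_measurable N" by auto
 obtain K where K: "!!p. \<bar>W p\<bar> <= K" using a by (auto simp: bounded_iff)
 have K0: "K >= 0" using order_trans[OF abs_ge_zero K[of undefined]] .
 define R where "R = density lborel (%r. ennreal (indicator {s..t} r))"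
 have "emeasure R UNIV = ennreal (t - s)" unfolding R_def by (subst emeasure_density) (use s in \<open>auto simp: ennreal_indicator\<close>)
 then interpret R: finite_measure R by (intro finite_measureI) (simp add: R_def)
 interpret RN: pair_sigma_finite R N ..
 interpret F: finite_measure "R >< N" by (rule finite_measure_pair_measure) (rule N.finite_measure_axioms, rule R.finite_measure_axioms)
 have setsR: "sets R = sets borel" by (simp add: R_def)
 have intR: "(LINT r|R. f r) = (LINT r:{s..t}|lborel. f r)" if "f : borel_measurable borel" for f :: "real => 'a"
  unfolding R_def set_lebesgue_integral_def using that by (subst integral_density) auto
 define f where "f r p = W p *R vb (X r (fst p))" for r p
 have fm: "(%(r, p). f r p) : borel_measurable (R >< N)"
 proof -
  have "(%q. (fst q, fst (snd q))) : R >< N ->M borel >< L"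
  proof (rule measurable_Pair)
   show "fst : R >< N ->M borel" using measurable_fst[of R N] by (simp add: measurable_cong_sets[OF refl setsR])
   show "(%q. fst (snd q)) : R >< N ->M L" unfolding N_def by (rule mcompose[OF measurable_snd measurable_fst])
  qed
  from mcompose[OF this X_joint] have "(%q. X (fst q) (fst (snd q))) : borel_measurable (R >< N)" by simp
  from borel_measurable_scaleR[OF mcompose[OF measurable_snd Wm] mcompose[OF this vb(1)]]
  show ?thesis by (simp add: f_def split_beta')
 qed
 have fb: "norm (f r p) <= K * C" for r p unfolding f_def norm_scaleR by (intro mult_mono K vb K0) auto
 have fi: "integrable (R >< N) (%(r, p). f r p)"
  by (rule F.integrable_const_bound[of _ "K * C"]) (use fb fm in auto)
 define psi where "psi r = (LINT p|N. f r p)" for r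
 have psim: "psi : borel_measurable borel"
 proof -
  have "(%r. LINT p|N. f r p) : borel_measurable R" by (rule N.borel_measurable_lebesgue_integral[OF fm])
  then show ?thesis by (simp add: psi_def[abs_def] measurable_cong_sets[OF setsR refl])
 qed
 have psib: "norm (psi r) <= K * C" for r
 proof -
  have "norm (psi r) <= (LINT p|N. norm (f r p))" unfolding psi_def by (rule integral_norm_bound)
  also have "... <= (LINT p|N. K * C)"
  proof (rule integral_mono)
   have "f r : borel_measurable N" unfolding f_def[abs_def]
    by (rule borel_measurable_scaleR[OF Wm mcompose[OF X_fst vb(1)]])
   then show "integrable N (%p. norm (f r p))" by (intro integrable_norm N.integrable_const_bound[of _ "K * C"]) (use fb in auto)
  qed (use fb in auto)
  finally show ?thesis using N.prob_space by simp
 qed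
 have psii: "set_integrable lborel {s..t} psi" by (rule bounded_borel_set_integrable[OF psim psib])
 define J where "J = {r\<in>{0..}. (LINT p|N. W p *R Z r p) ~= (LINT p|N. W p *R vb (X r (fst p)))}"
 have J: "countable J" unfolding J_def by (rule velocity_countable_exceptions[OF Wm K])
 have eqJ: "indicator {s..t} r *R psi r = indicator {s..t} r *R (LINT p|N. W p *R Z r p)" if "r \<notin> J" for r
  using that s by (auto simp: J_def psi_def f_def split: split_indicator)
 show "set_integrable lborel {s..t} (%r. LINT p|N. W p *R Z r p) &
  (LINT p|N. W p *R (X t (fst p) - X s (fst p))) = (LINT r:{s..t}|lborel. (LINT p|N. W p *R Z r p))"
 proof
  show "set_integrable lborel {s..t} (%r. LINT p|N. W p *R Z r p)"
   using psii unfolding set_integrable_def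
   by (subst (asm) integrable_discrete_difference[OF J, of lborel _ "%r. indicator {s..t} r *R (LINT p|N. W p *R Z r p)"])
     (use eqJ in auto)
  have Xi: "AE p in N. W p *R (X t (fst p) - X s (fst p)) = (LINT r|R. f r p)"
  proof -
   have "AE p in N. ALL t>=0. X t (fst p) = X 0 (fst p) + I vb t (fst p)" by (rule AE_fst[OF ode])
   then show ?thesis
   proof eventually_elim
    case (elim p)
    have "X t (fst p) = X 0 (fst p) + I vb t (fst p)" "X s (fst p) = X 0 (fst p) + I vb s (fst p)" using elim s by (blast intro: order_trans)+
    then have "X t (fst p) - X s (fst p) = I vb t (fst p) - I vb s (fst p)" by (metis add_diff_cancel_left)
    also have "... = (LINT r:{s..t}|lborel. vb (X r (fst p)))"
     unfolding I_diff_eq[OF vb s] using set_borel_integral_eq_integral(2)[OF path_g_set_integrable[OF vb]] by simp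
    also have "... = (LINT r|R. vb (X r (fst p)))" by (rule intR[OF path_g_meas[OF vb], symmetric])
    finally show ?case by (simp add: f_def)
   qed
  qed
  have "(LINT p|N. W p *R (X t (fst p) - X s (fst p))) = (LINT p|N. (LINT r|R. f r p))"
  proof (rule integral_cong_AE[OF _ _ Xi])
   show "(%p. W p *R (X t (fst p) - X s (fst p))) : borel_measurable N" by (intro borel_measurable_scaleR borel_measurable_diff Wm X_fst)
   have "(%(p, r). f r p) : borel_measurable (N >< R)"
    using mcompose[OF measurable_pair_swap' fm] by (simp add: split_beta')
   then show "(%p. LINT r|R. f r p) : borel_measurable N" by (rule R.borel_measurable_lebesgue_integral)
  qed
  also have "... = (LINT r|R. psi r)" unfolding psi_def by (rule RN.Fubini_integral[OF fi])
  also have "... = (LINT r:{s..t}|lborel. psi r)" by (rule intR[OF psim])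
  also have "... = (LINT r:{s..t}|lborel. (LINT p|N. W p *R Z r p))"
   unfolding set_lebesgue_integral_def[of lborel] by (rule integral_discrete_difference[OF J]) (use eqJ in auto)
  finally show "(LINT p|N. W p *R (X t (fst p) - X s (fst p))) = (LINT r:{s..t}|lborel. (LINT p|N. W p *R Z r p))" .
 qed
qed

lemma control_mean: "x : B ==> (\<integral>z. z \<partial>distr unif borel (%u. G (x, u))) = vb x"
proof -
 assume x: "x : B"
 have "(%u. G (x, u)) : unif ->M borel"
  unfolding measurable_cong_sets[OF sets_unif refl] by (rule borel_measurable_section[OF G])
 then show ?thesis by (subst integral_distr) (use G_mean[OF x] in auto)
qed

text \<open>The space of functions from the reals to pairs has room for both ingredients: the path is stored at the natural numbers in the first
 component, the uniform variables in the second.\<close>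

theorem ex_stationary_relaxed_solution:
 "EX (Q :: (real => 'a * 'a) measure) X Z.
  stationary_process Q (%t xi. (X t xi, Z t xi)) & weak_velocity Q X Z &
  (ALL t>=0. distr Q borel (%xi. (X t xi, Z t xi)) = distr (nu >< unif) borel (%(x, u). (x, G (x, u)))) &
  relaxed_dynamics Q X (%x. distr unif borel (%u. G (x, u))) &
  (ALL t>=0. is_conditional_law Q (X t) (Z t) (%x. distr unif borel (%u. G (x, u))))"
proof -
 obtain b :: 'a where b: "b : Basis" using nonempty_Basis by blast
 define emb :: "(nat => 'a) * (real => real) => real => 'a * 'a"
  where "emb p t = (fst p (nat \<lfloor>t\<rfloor>), snd p t *R b)" for p t
 define dem :: "(real => 'a * 'a) => (nat => 'a) * (real => real)"
  where "dem xi = (%n. fst (xi (real n)), %t. snd (xi t) <.> b)" for xi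
 interpret T: measure_transport N emb dem
  by unfold_locales (use b in \<open>auto simp: space_N emb_def dem_def\<close>)
 define X' where "X' t xi = X t (fst (dem xi))" for t xi
 define Z' where "Z' t xi = Z t (dem xi)" for t xi
 have law: "distr T.Q borel (%xi. (X' t xi, Z' t xi)) = distr (nu >< unif) borel (%(x, u). (x, G (x, u)))" if t: "t >= 0" for t
  using T.distr_Q[OF borel_measurable_Pair[OF X_fst Z_meas], of t t] by (simp add: X'_def Z'_def XZ_law[OF t])
 have XQ: "X' t : borel_measurable T.Q" for t
  unfolding X'_def[abs_def] by (rule mcompose[OF T.dem_meas X_fst])
 have ZQ: "Z' t : borel_measurable T.Q" for t
  unfolding Z'_def[abs_def] by (rule mcompose[OF T.dem_meas Z_meas])
 show ?thesis
 proof (rule exI[of _ T.Q], rule exI[of _ X'], rule exI[of _ Z'], intro conjI allI impI)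
  show "stationary_process T.Q (%t xi. (X' t xi, Z' t xi))"
   unfolding X'_def Z'_def by (rule T.transport_stationary[OF XZ_stationary])
  show "weak_velocity T.Q X' Z'"
   unfolding X'_def[abs_def] Z'_def[abs_def] by (rule T.transport_velocity[OF XZ_velocity X_fst Z_meas])
  show "relaxed_dynamics T.Q X' (%x. distr unif borel (%u. G (x, u)))"
   unfolding relaxed_dynamics_def X'_def
  proof (rule T.AE_Q)
   have "AE p in N. ALL t>=0. X t (fst p) = X 0 (fst p) + I vb t (fst p)" by (rule AE_fst[OF ode])
   then show "AE p in N. ALL t>=0. set_integrable lborel {0..t} (%s. \<integral>z. z \<partial>distr unif borel (%u. G (X s (fst p), u))) &
     X t (fst p) = X 0 (fst p) + (LINT s:{0..t}|lborel. (\<integral>z. z \<partial>distr unif borel (%u. G (X s (fst p), u))))"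
   proof eventually_elim
    case (elim p)
    show ?case
    proof (intro allI impI)
     fix t :: real assume t: "t >= 0"
     have eq: "(\<integral>z. z \<partial>distr unif borel (%u. G (X s (fst p), u))) = vb (X s (fst p))" if "s : {0..t}" for s
      by (rule control_mean[OF X_B]) (use that in simp)
     have 1: "set_integrable lborel {0..t} (%s. \<integral>z. z \<partial>distr unif borel (%u. G (X s (fst p), u)))"
      using path_g_set_integrable[OF vb, of 0 t "fst p"] by (subst set_integrable_cong[OF refl refl eq]) auto
     have "(LINT s:{0..t}|lborel. (\<integral>z. z \<partial>distr unif borel (%u. G (X s (fst p), u)))) = (LINT s:{0..t}|lborel. vb (X s (fst p)))"
      unfolding set_lebesgue_integral_def[of lborel]
      by (intro bo_integral_cong refl) (auto simp: eq split: split_indicator)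
     then have 2: "X t (fst p) = X 0 (fst p) + (LINT s:{0..t}|lborel. (\<integral>z. z \<partial>distr unif borel (%u. G (X s (fst p), u))))"
      using elim t I_set[OF vb, of t "fst p"] by metis
     show "set_integrable lborel {0..t} (%s. \<integral>z. z \<partial>distr unif borel (%u. G (X s (fst p), u))) &
      X t (fst p) = X 0 (fst p) + (LINT s:{0..t}|lborel. (\<integral>z. z \<partial>distr unif borel (%u. G (X s (fst p), u))))"
      using 1 2 by blast
    qed
   qed
  qed
  fix t :: real assume t: "t >= 0"
  show "distr T.Q borel (%xi. (X' t xi, Z' t xi)) = distr (nu >< unif) borel (%(x, u). (x, G (x, u)))" by (rule law[OF t])
  show "is_conditional_law T.Q (X' t) (Z' t) (%x. distr unif borel (%u. G (x, u)))"
   by (rule conditional_law_of_joint[OF T.prob_Q XQ ZQ prob_nu sets_nu G law[OF t]])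
 qed
qed

end

section \<open>Limit points along one path\<close>

context step_sizes
begin

text \<open>At the interpolation nodes the difference is a partial sum of the noise series; between nodes it changes by at most \<open>C * a n\<close>.\<close>

lemma interpolated_path_converges:
 fixes x z m :: "nat => 'a::euclidean_space"
 assumes step: "!!n. x (Suc n) = x n + a n *R (z n + m n)" and a0: "a ----> 0"
  and noise: "summable (%n. a n *R m n)" and z: "!!n. norm (z n) <= C"
 shows "EX p. ((%t. x (step_index a t) - integral {0..t} (%s. z (step_index a s))) \<longlongrightarrow> p) at_top"
proof -
 define J where "J t = integral {0..t} (%s. z (step_index a s))" for t
 have zb: "norm (z (step_index a s)) <= C" for s by (rule z)
 have algo_Suc: "algo_time a (Suc n) = algo_time a n + a n" for n by (simp add: algo_time_def)
 have piece: "J t - J (algo_time a n) = (t - algo_time a n) *R z n" if t: "algo_time a n <= t" "t <= algo_time a (Suc n)" for n t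
 proof -
  have "J t - J (algo_time a n) = integral {algo_time a n..t} (%s. z (step_index a s))"
   unfolding J_def by (rule primitive_lipschitz(1)[OF step_path_meas[of z] zb algo_time_nonneg t(1)])
  also have "... = integral {algo_time a n..t} (%s. z n)"
  proof (rule integral_spike[of "{algo_time a (Suc n)}"])
   fix s assume "s : {algo_time a n..t} - {algo_time a (Suc n)}"
   then have "step_index a s = n" using t by (intro step_index_eq) auto
   then show "z n = z (step_index a s)" by simp
  qed simp
  also have "... = (t - algo_time a n) *R z n" using t by simp
  finally show ?thesis .
 qed
 have J0: "J (algo_time a n) = (\<Sum>k<n. a k *R z k)" for n
 proof (induction n)
  case 0
  show ?case by (simp add: J_def algo_time_def)
 next
  case (Suc n)
  have "J (algo_time a (Suc n)) - J (algo_time a n) = a n *R z n"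
   using piece[of n "algo_time a (Suc n)"] a_nonneg[of n] by (simp add: algo_Suc)
  then show ?case using Suc by (simp add: algebra_simps)
 qed
 have xs: "x n = x 0 + (\<Sum>k<n. a k *R z k) + (\<Sum>k<n. a k *R m k)" for n
 proof (induction n)
  case (Suc n)
  have "x (Suc n) = x n + (a n *R z n + a n *R m n)" by (simp add: step scaleR_add_right)
  also note Suc
  finally show ?case by (simp add: algebra_simps)
 qed simp
 define r where "r t = (t - algo_time a (step_index a t)) *R z (step_index a t)" for t
 have rt: "(r \<longlongrightarrow> 0) at_top"
 proof (rule Lim_null_comparison)
  have "((%t. a (step_index a t)) \<longlongrightarrow> 0) at_top" by (rule filterlim_compose[OF a0 step_index_tendsto])
  from tendsto_mult_left_zero[OF this, of C] show "((%t. a (step_index a t) * C) \<longlongrightarrow> 0) at_top" .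
  have "norm (r t) <= a (step_index a t) * C" if t: "t >= 0" for t
   unfolding r_def norm_scaleR using step_index[OF t] a_nonneg[of "step_index a t"]
   by (intro mult_mono z) (auto simp: algo_Suc)
  then show "\<forall>\<^sub>F t in at_top. norm (r t) <= a (step_index a t) * C"
   by (intro eventually_at_top_linorderI[of 0]) auto
 qed
 have "((%t. x 0 + (\<Sum>k<step_index a t. a k *R m k) - r t) \<longlongrightarrow> x 0 + (\<Sum>k. a k *R m k) - 0) at_top"
  by (intro tendsto_intros rt filterlim_compose[OF summable_LIMSEQ[OF noise] step_index_tendsto])
 moreover have "\<forall>\<^sub>F t in at_top. x 0 + (\<Sum>k<step_index a t. a k *R m k) - r t = x (step_index a t) - J t"
 proof (rule eventually_at_top_linorderI[of 0])
  fix t :: real assume t: "0 <= t"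
  define n where "n = step_index a t"
  have "J t - J (algo_time a n) = r t"
   unfolding r_def n_def[symmetric] by (rule piece) (use step_index[OF t] in \<open>auto simp: n_def\<close>)
  then have "J t = (\<Sum>k<n. a k *R z k) + r t" by (simp add: J0 algebra_simps)
  then show "x 0 + (\<Sum>k<step_index a t. a k *R m k) - r t = x (step_index a t) - J t"
   unfolding n_def[symmetric] by (simp add: xs[of n])
 qed
 ultimately show ?thesis unfolding J_def[symmetric] by (blast intro: Lim_transform_eventually)
qed

text \<open>The measure \<open>mu\<close> is carried by the graph of \<open>H\<close>, since the distance to it is a continuous function with vanishing time averages.
 The randomization \<open>G0\<close> takes values in \<open>H\<close> almost surely; a measurable selection repairs it elsewhere, where it matters only for the
 statement that \<open>v y\<close> lives on \<open>H y\<close> for every \<open>y\<close>.\<close>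

theorem limit_point_structure:
 fixes x z m :: "nat => 'a::euclidean_space" and H :: "'a => 'a set"
 assumes step: "!!n. x (Suc n) = x n + a n *R (z n + m n)" and a0: "a ----> 0"
  and noise: "summable (%n. a n *R m n)"
  and B: "compact B" "!!n. x n : B" and D: "compact D" "!!n. z n : D"
  and H: "closed (set_graph H)" "!!y. convex (H y)" "!!y. H y ~= {}"
  and growth: "!!y w. w : H y ==> norm w <= K' * (1 + norm y)" and K': "K' > 0"
  and zH: "!!n. z n : H (x n)"
  and lp: "limit_point_at_top (relaxed_topology (B \<times> D))
   (%t. relaxed_class (B \<times> D) (%s. averaged_empirical (B \<times> D) a (%n. (x n, z n)) (t + s))) c"
 shows "EX mu:prob_on (B \<times> D). c = relaxed_class (B \<times> D) (%_. mu) & mu : prob_on (set_graph H) &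
  (EX (Q :: (real => 'a * 'a) measure) X Z v.
   stationary_process Q (%t xi. (X t xi, Z t xi)) & weak_velocity Q X Z &
   (ALL t>=0. distr Q borel (%xi. (X t xi, Z t xi)) = mu) &
   v : borel ->M prob_algebra borel & (ALL y. v y : prob_on (H y)) &
   relaxed_dynamics Q X v & (ALL t>=0. is_conditional_law Q (X t) (Z t) v))"
proof -
 have S: "compact (B \<times> D)" by (rule compact_Times[OF B(1) D(1)])
 have xzS: "(x n, z n) : B \<times> D" for n using B D by simp
 obtain mu tau where mu: "mu : prob_on (B \<times> D)" and c: "c = relaxed_class (B \<times> D) (%_. mu)"
  and tau: "!!k. tau k > 0" "filterlim tau at_top sequentially"
  and lim: "!!f :: 'a * 'a => real. continuous_on UNIV f ==> (%k. time_average (%n. f (x n, z n)) (tau k)) ----> (LINT p|mu. f p)"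
  using limit_point_averages[OF S xzS lp] by blast
 note setsmu = prob_onD(2)[OF mu] and spacemu = prob_onD(3)[OF mu]
 interpret mu: prob_space mu by (rule prob_onD(1)[OF mu])
 interpret unif: prob_space unif by (rule prob_space_unif)
 have AE_S: "AE p in mu. p : B \<times> D"
  by (rule prob_on_AE[OF mu]) (use S in \<open>simp add: compact_imp_closed\<close>)
 have graph_ne: "set_graph H ~= {}" using zH[of 0] by (auto simp: set_graph_def)
 have AE_graph: "AE p in mu. p : set_graph H"
 proof -
  define g where "g p = min 1 (infdist p (set_graph H))" for p
  have g: "continuous_on UNIV g" unfolding g_def[abs_def] by (intro continuous_intros)
  have g01: "0 <= g p" "g p <= 1" for p by (auto simp: g_def infdist_nonneg)
  have "g (x n, z n) = 0" for n using zH[of n] by (simp add: g_def set_graph_def)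
  then have "time_average (%n. g (x n, z n)) T = 0" for T by (simp add: time_average_def)
  then have "(LINT p|mu. g p) = 0" using LIMSEQ_unique[OF lim[OF g]] by simp
  moreover have "integrable mu g"
  proof (rule mu.integrable_const_bound[of _ 1])
   show "g : borel_measurable mu" using continuous_borel[OF g] by (simp add: measurable_cong_sets[OF setsmu refl])
  qed (use g01 in simp)
  ultimately have "AE p in mu. g p = 0" using g01 by (simp add: integral_nonneg_eq_0_iff_AE)
  then show ?thesis
  proof eventually_elim
   case (elim p)
   then have "infdist p (set_graph H) = 0" by (simp add: g_def min_def split: if_splits)
   then show ?case using in_closed_iff_infdist_zero[OF H(1) graph_ne] by simp
  qed
 qed
 have muH: "mu : prob_on (set_graph H)"
  by (rule prob_onI[OF mu.prob_space_axioms setsmu _ AE_graph]) (use H(1) in simp)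
 obtain RB where RB: "!!y. y : B ==> norm y <= RB" using compact_imp_bounded[OF B(1)] by (auto simp: bounded_iff)
 obtain RD where RD: "!!y. y : D ==> norm y <= RD" using compact_imp_bounded[OF D(1)] by (auto simp: bounded_iff)
 define R where "R = max RB RD + 1"
 have RxB: "norm y < R" if "y : B" for y using RB[OF that] by (simp add: R_def)
 have RxD: "norm y < R" if "y : D" for y using RD[OF that] by (simp add: R_def)
 have R0: "R > 0" using order_le_less_trans[OF norm_ge_zero RxB[OF B(2)[of 0]]] .
 define C where "C = max R (K' * (1 + R))"
 have C0: "C >= 0" using R0 by (simp add: C_def)
 obtain p where p: "((%t. x (step_index a t) - integral {0..t} (%s. z (step_index a s))) \<longlongrightarrow> p) at_top"
  using interpolated_path_converges[OF step a0 noise, of R] RxD[OF D(2)] less_imp_le by blast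
 have "EX Lam. prob_space Lam & sets Lam = sets (borel :: (nat => 'a) measure) &
  distr Lam borel (%y. (y 1, y 0)) = mu &
  (ALL i. distr Lam borel (%y. y (i + 2)) = distr mu borel fst) &
  (ALL i. AE y in Lam. norm (y (i + 2) - y 1) <= C * (1/2) ^ i) &
  (ALL g. bounded_lipschitz g --> (EX K. ALL i.
    \<bar>\<integral>y. g (y 1) <.> (y (i + 2) - y 1) - (1/2) ^ i * (g (y 1) <.> y 0) \<partial>Lam\<bar> <= K * ((1/2) ^ i)\<^sup>2))"
 proof (rule joint_window_limit[OF step_path_meas[of x] _ step_path_meas[of z] _ p tau mu.prob_space_axioms setsmu])
  show "norm (x (step_index a s)) < R" for s by (rule RxB[OF B(2)])
  show "norm (z (step_index a s)) <= C" for s using RxD[OF D(2), of "step_index a s"] by (simp add: C_def)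
  show "(%k. 1 / tau k * integral {0..tau k} (%s. f (x (step_index a s), z (step_index a s)))) ----> (LINT q|mu. f q)"
   if "continuous_on UNIV f" for f :: "'a * 'a => real"
   using lim[OF that] by (simp add: time_average_def)
 qed
 then obtain Lam where Lam: "prob_space Lam" "sets Lam = sets (borel :: (nat => 'a) measure)"
  and Lammu: "distr Lam borel (%y. (y 1, y 0)) = mu"
  and Lamnu: "!!i. distr Lam borel (%y. y (i + 2)) = distr mu borel fst"
  and close: "!!i. AE y in Lam. norm (y (i + 2) - y 1) <= C * (1/2) ^ i"
  and window: "!!g. bounded_lipschitz g ==> EX K. ALL i.
    \<bar>\<integral>y. g (y 1) <.> (y (i + 2) - y 1) - (1/2) ^ i * (g (y 1) <.> y 0) \<partial>Lam\<bar> <= K * ((1/2) ^ i)\<^sup>2"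
  by blast
 interpret Lam: prob_space Lam by (rule Lam)
 have co: "(%y. y i) : Lam ->M borel" for i unfolding measurable_cong_sets[OF Lam(2) refl] by (rule measurable_coord)
 have co2: "(%y. (y 1, y 0)) : Lam ->M borel" by (rule borel_measurable_Pair[OF co co])
 define nu where "nu = distr mu borel fst"
 have fstmu: "fst : mu ->M borel" unfolding measurable_cong_sets[OF setsmu refl] by (rule borel_measurable_fst_snd)
 have setsnu: "sets nu = sets borel" by (simp add: nu_def)
 interpret nu: prob_space nu unfolding nu_def by (rule mu.prob_space_distr[OF fstmu])
 interpret nuU: pair_prob_space nu unif ..
 have Bb: "B : sets borel" using B(1) by (simp add: compact_imp_closed)
 have nuB: "AE y in nu. y : B"
  unfolding nu_def by (subst AE_distr_iff[OF fstmu]) (use Bb AE_S in auto)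
 have "sets (nu >< unif) = sets (borel >< borel)" by (rule sets_pair_measure_cong[OF setsnu sets_unif])
 also have "... = sets borel" unfolding borel_prod ..
 finally have setsP: "sets (nu >< unif) = sets borel" .
 have "AE q in mu. norm (snd q) < R" using AE_S by eventually_elim (auto intro: RxD)
 from ex_randomization[OF mu.prob_space_axioms setsmu this]
 obtain G0 where G0: "G0 : borel_measurable borel"
  and law0: "distr (nu >< unif) borel (%(x, u). (x, G0 (x, u))) = mu" by (auto simp: nu_def)
 have gm: "(%(x, u). (x, g (x, u))) : nu >< unif ->M borel" if "g : borel_measurable borel" for g :: "'a * real => 'a"
 proof -
  have "(%q. (fst q, g q)) : borel ->M borel" using that by (intro borel_measurable_Pair borel_measurable_fst_snd) auto
  then show ?thesis unfolding measurable_cong_sets[OF setsP refl] by (simp add: split_beta')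
 qed
 obtain s where s: "s : borel_measurable borel" "!!y. s y : H y"
  using ex_measurable_selection[OF H] by blast
 define G where "G q = (if (fst q, G0 q) : set_graph H then G0 q else s (fst q))" for q
 have GH: "G (y, u) : H y" for y u using s(2) by (simp add: G_def set_graph_def)
 have G: "G : borel_measurable borel"
 proof -
  have m: "(%q. (fst q, G0 q)) : (borel :: ('a * real) measure) ->M borel"
   by (rule borel_measurable_Pair[OF borel_measurable_fst_snd(1) G0])
  have "(%q. (fst q, G0 q)) -` set_graph H \<inter> space borel : sets borel"
   by (rule measurable_sets[OF m]) (use H(1) in simp)
  then have "{q : space borel. (fst q, G0 q) : set_graph H} : sets borel" by (simp add: vimage_def)
  from measurable_If[OF G0 mcompose[OF borel_measurable_fst_snd(1) s(1)] this]
  show ?thesis by (simp add: G_def[abs_def])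
 qed
 have law: "distr (nu >< unif) borel (%(x, u). (x, G (x, u))) = mu"
 proof -
  have "AE q in distr (nu >< unif) borel (%(x, u). (x, G0 (x, u))). q : set_graph H" unfolding law0 by (rule AE_graph)
  from AE_distrD[OF gm[OF G0] this]
  have "AE q in nu >< unif. (case q of (x, u) => (x, G (x, u))) = (case q of (x, u) => (x, G0 (x, u)))"
   by eventually_elim (auto simp: G_def)
  from distr_cong_AE[OF refl refl this gm[OF G] gm[OF G0]] show ?thesis using law0 by simp
 qed
 have G_le: "norm (G (y, u)) <= C" if "y : B" for y u
 proof -
  have "norm (G (y, u)) <= K' * (1 + norm y)" by (rule growth[OF GH])
  also have "... <= K' * (1 + R)" using RxB[OF that] K' by (intro mult_left_mono) auto
  finally show ?thesis by (simp add: C_def)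
 qed
 have Gu: "(%u. G (y, u)) : borel_measurable unif" for y
  unfolding measurable_cong_sets[OF sets_unif refl] by (rule borel_measurable_section[OF G])
 define vb where "vb y = (if y : B then \<integral>u. G (y, u) \<partial>unif else 0)" for y
 have vb: "vb : borel_measurable borel"
 proof -
  have "(%(y, u). G (y, u)) : borel_measurable (nu >< unif)" using G by (simp add: measurable_cong_sets[OF setsP refl])
  then have "(%y. LINT u|unif. G (y, u)) : borel_measurable nu" by (rule unif.borel_measurable_lebesgue_integral)
  then have "(%y. LINT u|unif. G (y, u)) : borel_measurable borel" by (simp add: measurable_cong_sets[OF setsnu refl])
  then show ?thesis unfolding vb_def[abs_def] using Bb by (intro measurable_If) auto
 qed
 have Gi: "integrable unif (%u. G (y, u))" if "y : B" for y
  by (rule unif.integrable_const_bound[of _ C]) (use G_le[OF that] Gu in auto)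
 have vb_le: "norm (vb y) <= C" for y
 proof (cases "y : B")
  case True
  have "norm (vb y) <= (LINT u|unif. norm (G (y, u)))" using True integral_norm_bound[of unif "%u. G (y, u)"] by (simp add: vb_def)
  also have "... <= (LINT u|unif. C)" by (intro integral_mono integrable_norm Gi[OF True]) (use G_le[OF True] in auto)
  finally show ?thesis using unif.prob_space by simp
 qed (use C0 in \<open>simp add: vb_def\<close>)
 have AE0: "AE y in Lam. y 1 : B & y 0 : D"
 proof -
  have "AE q in distr Lam borel (%y. (y 1, y 0)). q : B \<times> D" unfolding Lammu by (rule AE_S)
  from AE_distrD[OF co2 this] show ?thesis by simp
 qed
 have AEi: "AE y in Lam. y (i + 2) : B" for i
 proof -
  have "AE q in distr Lam borel (%y. y (i + 2)). q : B" unfolding Lamnu nu_def[symmetric] by (rule nuB)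
  from AE_distrD[OF co this] show ?thesis .
 qed
 have drift: "EX K. ALL i. \<bar>(LINT y|Lam. g (y 1) <.> (y (i + 2) - y 1)) - (1/2) ^ i * (LINT y|nu. g y <.> vb y)\<bar> <= K * ((1/2) ^ i)\<^sup>2"
  if g: "bounded_lipschitz g" for g :: "'a => 'a"
 proof -
  have gb: "g : borel_measurable borel" by (rule bounded_lipschitz_measurable[OF g])
  obtain Kg where Kg: "Kg > 0" "!!y. norm (g y) <= Kg" using bounded_lipschitzE[OF g] by metis
  have "(%y. g (y 1) <.> (y (i + 2) - y 1)) : borel_measurable Lam" for i
   by (intro borel_measurable_inner borel_measurable_diff co mcompose[OF co gb])
  moreover have "AE y in Lam. norm (g (y 1) <.> (y (i + 2) - y 1)) <= Kg * (2 * R)" for i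
   using AE0 AEi[of i]
  proof eventually_elim
   case (elim y)
   have "norm (y (i + 2) - y 1) <= 2 * R" using norm_triangle_ineq4[of "y (i + 2)" "y 1"] RxB elim by (smt (verit))
   then show ?case using Cauchy_Schwarz_ineq2[of "g (y 1)" "y (i + 2) - y 1"] mult_mono[OF Kg(2)[of "y 1"], of "norm (y (i + 2) - y 1)" "2 * R"] Kg(1)
    by (simp only: real_norm_def) (smt (verit) norm_ge_zero)
  qed
  ultimately have i1: "integrable Lam (%y. g (y 1) <.> (y (i + 2) - y 1))" for i by (rule Lam.integrable_const_bound[rotated])
  have "(%y. g (y 1) <.> y 0) : borel_measurable Lam"
   by (intro borel_measurable_inner co mcompose[OF co gb])
  moreover have "AE y in Lam. norm (g (y 1) <.> y 0) <= Kg * R"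
   using AE0
  proof eventually_elim
   case (elim y)
   have "norm (y 0) <= R" using RxD[of "y 0"] elim by simp
   then show ?case using Cauchy_Schwarz_ineq2[of "g (y 1)" "y 0"] mult_mono[OF Kg(2)[of "y 1"], of "norm (y 0)" "R"] Kg(1)
    by (simp only: real_norm_def) (smt (verit) norm_ge_zero)
  qed
  ultimately have i2: "integrable Lam (%y. g (y 1) <.> y 0)" by (rule Lam.integrable_const_bound[rotated])
  have pm: "(%q. g (fst q) <.> snd q) : borel_measurable (borel :: ('a * 'a) measure)"
   by (intro borel_measurable_inner mcompose[OF borel_measurable_fst_snd(1) gb] borel_measurable_fst_snd)
  have "(LINT y|Lam. g (y 1) <.> y 0) = (LINT q|mu. g (fst q) <.> snd q)"
   unfolding Lammu[symmetric] by (subst integral_distr[OF co2 pm]) simp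
  also have "... = (LINT q|(nu >< unif). g (fst q) <.> G q)"
   unfolding law[symmetric] by (subst integral_distr[OF gm[OF G] pm]) (simp add: split_beta')
  also have "... = (LINT y|nu. (LINT u|unif. g y <.> G (y, u)))"
  proof -
   have "integrable (nu >< unif) (%q. g (fst q) <.> G q)"
   proof (rule nuU.P.integrable_const_bound[of _ "Kg * R"])
    have "integrable mu (%q. g (fst q) <.> snd q)" unfolding Lammu[symmetric] by (subst integrable_distr_eq[OF co2 pm]) (use i2 in simp)
    show "(%q. g (fst q) <.> G q) : borel_measurable (nu >< unif)"
     unfolding measurable_cong_sets[OF setsP refl]
     by (intro borel_measurable_inner mcompose[OF borel_measurable_fst_snd(1) gb] G)
    have "AE q in distr (nu >< unif) borel (%(x, u). (x, G (x, u))). q : B \<times> D" unfolding law by (rule AE_S)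
    from AE_distrD[OF gm[OF G] this]
    show "AE q in nu >< unif. norm (g (fst q) <.> G q) <= Kg * R"
    proof eventually_elim
     case (elim q)
     then have "norm (G q) <= R" using RxD[of "G q"] by (simp add: split_beta')
     then show ?case using Cauchy_Schwarz_ineq2[of "g (fst q)" "G q"] mult_mono[OF Kg(2)[of "fst q"], of "norm (G q)" "R"] Kg(1)
      by (simp only: real_norm_def) (smt (verit) norm_ge_zero)
    qed
   qed
   from nuU.integral_fst'[OF this] show ?thesis by simp
  qed
  also have "... = (LINT y|nu. g y <.> vb y)"
  proof (rule integral_cong_AE)
   have "(%(y, u). g y <.> G (y, u)) : borel_measurable (nu >< unif)"
    unfolding measurable_cong_sets[OF setsP refl] split_beta'
    using borel_measurable_inner[OF mcompose[OF borel_measurable_fst_snd(1) gb] G] by simp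
   then show "(%y. LINT u|unif. g y <.> G (y, u)) : borel_measurable nu" by (rule unif.borel_measurable_lebesgue_integral)
   show "(%y. g y <.> vb y) : borel_measurable nu"
    unfolding measurable_cong_sets[OF setsnu refl] by (rule borel_measurable_inner[OF gb vb])
   show "AE y in nu. (LINT u|unif. g y <.> G (y, u)) = g y <.> vb y"
    using nuB
   proof eventually_elim
    case (elim y)
    show ?case unfolding vb_def if_P[OF elim] by (rule integral_inner_right) (rule Gi[OF elim])
   qed
  qed
  finally have e0: "(LINT y|Lam. g (y 1) <.> y 0) = (LINT y|nu. g y <.> vb y)" .
  have split: "(LINT y|Lam. g (y 1) <.> (y (i + 2) - y 1) - (1/2) ^ i * (g (y 1) <.> y 0)) =
    (LINT y|Lam. g (y 1) <.> (y (i + 2) - y 1)) - (1/2) ^ i * (LINT y|nu. g y <.> vb y)" for i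
   unfolding e0[symmetric]
   by (subst bo_integral_diff[OF i1 integrable_mult_right[OF i2]]) (simp only: integral_mult_right_zero)
  show ?thesis using window[OF g] unfolding split .
 qed
 have law1: "distr Lam borel (%y. y 1) = nu"
  unfolding nu_def Lammu[symmetric] by (subst distr_distr[OF borel_measurable_fst_snd(1) co2]) (simp add: comp_def)
 interpret M: mimicking Lam nu vb C R B
  by unfold_locales (fact Lam law1 Lamnu[folded nu_def] close vb vb_le drift B(1) RxB nuB)+
 obtain L where L: "prob_space L" "sets L = sets (borel :: (nat => 'a) measure)"
  "!!i. distr L borel (%y. y i) = nu" "!!i j. AE y in L. norm (y i - y j) <= C * \<bar>dyad i - dyad j\<bar>"
  and Ld: "!!w Kw Lw i j. (ALL x. norm (w x) <= Kw) & (ALL x y. norm (w x - w y) <= Lw * norm (x - y)) & w : borel_measurable borel & Lw >= 0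
   & dyad i <= dyad j ==>
   (LINT y|L. norm (y j - y i - (dyad j - dyad i) *R w (y i))) <=
   (dyad j - dyad i) * ((LINT x|nu. norm (vb x - w x)) + Lw * (C * (dyad j - dyad i)))"
  and Ls: "!!(a :: nat => nat) (b :: nat => nat) s. (ALL i. dyad (b i) = dyad (a i) + dyad s) ==>
   distr L borel (%y i. y (b i)) = distr L borel (%y i. y (a i))"
  using M.dyadic_limit by (elim exE conjE) blast
 interpret W: relaxed_process L nu vb C B G
 proof -
  interpret L: prob_space L by (rule L)
  show "relaxed_process L nu vb C B G"
  proof unfold_locales
   show "(LINT u|unif. G (y, u)) = vb y" if "y : B" for y using that by (simp add: vb_def)
   show "(LINT y|L. norm (y j - y i - (dyad j - dyad i) *R w (y i))) <=
    (dyad j - dyad i) * ((LINT x|nu. norm (vb x - w x)) + Lw * (C * (dyad j - dyad i)))"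
    if "!!x. norm (w x) <= Kw" "!!x y. norm (w x - w y) <= Lw * norm (x - y)" "w : borel_measurable borel" "Lw >= 0" "dyad i <= dyad j"
    for w Kw Lw i j
    using that by (intro Ld[of w Kw Lw i j]) blast
   show "distr L borel (%y i. y (b i)) = distr L borel (%y i. y (a i))" if "!!i. dyad (b i) = dyad (a i) + dyad s"
    for a b :: "nat => nat" and s
    by (rule Ls[of b a s]) (use that in blast)
  qed (fact L vb vb_le B(1) nuB G G_le)+
 qed
 define v where "v y = distr unif borel (%u. G (y, u))" for y
 have v_meas: "v : borel ->M prob_algebra borel"
  unfolding v_def[abs_def]
 proof (rule measurable_distr_prob_space2[where M=unif])
  show "(%y. unif) : borel ->M prob_algebra unif"
   by (rule measurable_const) (simp add: space_prob_algebra unif.prob_space_axioms)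
  have Gb: "(%(y, u). G (y, u)) : borel_measurable (borel >< borel)" unfolding borel_prod using G by simp
  have eq: "sets (borel >< unif) = sets ((borel :: 'a measure) >< (borel :: real measure))"
   by (rule sets_pair_measure_cong) simp_all
  show "(%(y, u). G (y, u)) : borel >< unif ->M borel"
   unfolding measurable_cong_sets[OF eq refl] by (rule Gb)
 qed
 have v_H: "v y : prob_on (H y)" for y
 proof (rule prob_onI)
  show "prob_space (v y)" unfolding v_def by (rule unif.prob_space_distr[OF Gu])
  show Hb: "H y : sets borel" using closed_section[OF H(1)] by simp
  show "AE w in v y. w : H y" unfolding v_def by (subst AE_distr_iff[OF Gu]) (use Hb GH in auto)
 qed (simp add: v_def)
 have v_eq: "(%y. distr unif borel (%u. G (y, u))) = v" by (simp add: v_def[abs_def])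
 obtain Q :: "(real => 'a * 'a) measure" and X Z where sol:
  "stationary_process Q (%t xi. (X t xi, Z t xi))" "weak_velocity Q X Z"
  "ALL t>=0. distr Q borel (%xi. (X t xi, Z t xi)) = mu" "relaxed_dynamics Q X v"
  "ALL t>=0. is_conditional_law Q (X t) (Z t) v"
  using W.ex_stationary_relaxed_solution unfolding law v_eq by (elim exE conjE)
 show ?thesis
  by (rule bexI[OF _ mu], intro conjI c muH, rule exI[of _ Q], rule exI[of _ X], rule exI[of _ Z], rule exI[of _ v],
    intro conjI sol v_meas allI v_H)
qed

end

section \<open>The stochastic algorithm\<close>

theorem theorem3p5:
  fixes P :: "'w measure"
    and h :: "'a::euclidean_space \<Rightarrow> 'a"
    and x z M :: "nat \<Rightarrow> 'w \<Rightarrow> 'a"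
    and a :: "nat \<Rightarrow> real"
    and K K' :: real
  assumes P: "prob_space P"
    and h_meas: "h \<in> borel_measurable borel"
    and K'_pos: "K' > 0"
    and growth: "\<forall>y. \<forall>w\<in>krasovskii_map h y. norm w \<le> K' * (1 + norm y)"
    and x0_meas: "x 0 \<in> borel_measurable P"
    and x_step: "\<forall>n. \<forall>\<omega>\<in>space P. x (Suc n) \<omega> = x n \<omega> + a n *\<^sub>R (z n \<omega> + M (Suc n) \<omega>)"
    and z_def: "\<forall>n. \<forall>\<omega>\<in>space P. z n \<omega> = h (x n \<omega>)"
    and a_nonneg: "\<forall>n. a n \<ge> 0"
    and a_div: "\<not> summable a"
    and a_sq: "summable (\<lambda>n. (a n)\<^sup>2)"
    and mart_diff: "martingale_difference P (noise_filtration P (x 0) M) M"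
    and fourth_moment: "(SUP n. \<integral>\<^sup>+\<omega>. ennreal (norm (M n \<omega>) ^ 4) \<partial>P) < \<infinity>"
    and K_pos: "K > 0"
    and cond_var: "\<forall>n. AE \<omega> in P.
          real_cond_exp P (noise_filtration P (x 0) M n) (\<lambda>\<omega>. (norm (M (Suc n) \<omega>))\<^sup>2) \<omega>
            \<le> K * (1 + (norm (x n \<omega>))\<^sup>2)"
    and stable: "AE \<omega> in P. bdd_above (range (\<lambda>n. norm (x n \<omega>)))"
  shows "\<exists>\<Phi>\<in>null_sets P. \<forall>\<omega>\<in>space P - \<Phi>.
    bdd_above (range (\<lambda>n. norm (x n \<omega>))) \<and>
    (\<exists>B D. compact B \<and> convex B \<and> compact D \<and> convex D \<and>
       (\<forall>n. (x n \<omega>, h (x n \<omega>)) \<in> B \<times> D)) \<and>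
    (\<forall>B D. compact B \<and> convex B \<and> compact D \<and> convex D \<and>
       (\<forall>n. (x n \<omega>, h (x n \<omega>)) \<in> B \<times> D) \<longrightarrow>
       (\<forall>c. limit_point_at_top (relaxed_topology (B \<times> D))
              (\<lambda>t. relaxed_class (B \<times> D)
                 (\<lambda>s. averaged_empirical (B \<times> D) a (\<lambda>n. (x n \<omega>, z n \<omega>)) (t + s))) c \<longrightarrow>
          (\<exists>\<mu>s\<in>prob_on (B \<times> D).
             c = relaxed_class (B \<times> D) (\<lambda>_. \<mu>s) \<and>
             \<mu>s \<in> prob_on (set_graph (krasovskii_map h)) \<and>
             (joint_law_abs_cont P x M \<longrightarrow> \<mu>s \<in> prob_on (set_graph (filippov_map h))) \<and>
             (\<exists>(Q :: (real \<Rightarrow> 'a \<times> 'a) measure) X Z v.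
                stationary_process Q (\<lambda>t \<xi>. (X t \<xi>, Z t \<xi>)) \<and>
                weak_velocity Q X Z \<and>
                (\<forall>t\<ge>0. distr Q borel (\<lambda>\<xi>. (X t \<xi>, Z t \<xi>)) = \<mu>s) \<and>
                v \<in> borel \<rightarrow>\<^sub>M prob_algebra borel \<and>
                (\<forall>y. v y \<in> prob_on (krasovskii_map h y)) \<and>
                (joint_law_abs_cont P x M \<longrightarrow> (\<forall>y. v y \<in> prob_on (filippov_map h y))) \<and>
                relaxed_dynamics Q X v \<and>
                (\<forall>t\<ge>0. is_conditional_law Q (X t) (Z t) v)))))"
proof -
 interpret prob_space P by (rule P)
 interpret step_sizes a by unfold_locales (use a_nonneg a_div in auto)
 have growth': "norm w <= K' * (1 + norm y)" if "w : krasovskii_map h y" for y w using growth that by blast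
 have growthF: "norm w <= K' * (1 + norm y)" if "w : filippov_map h y" for y w
  by (rule growth') (use filippov_subset_krasovskii that in blast)
 have a0: "a ----> 0"
 proof -
  have "(%n. sqrt ((a n)\<^sup>2)) ----> sqrt 0" by (intro tendsto_real_sqrt summable_LIMSEQ_zero a_sq)
  then show ?thesis using a_nonneg by simp
 qed
 have M_meas: "M n : borel_measurable P" for n
  using mart_diff by (auto simp: martingale_difference_def intro: borel_measurable_integrable)
 have x_meas: "x n : borel_measurable P" for n
 proof (induction n)
  case (Suc n)
  have "(%om. x n om + a n *R (h (x n om) + M (Suc n) om)) : borel_measurable P"
   by (intro borel_measurable_add borel_measurable_scaleR borel_measurable_const Suc M_meas mcompose[OF Suc h_meas])
  then show ?case by (subst measurable_cong[of _ _ "%om. x n om + a n *R (h (x n om) + M (Suc n) om)"]) (use x_step z_def in auto)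
 qed (rule x0_meas)
 obtain N0 where N0: "N0 : null_sets lborel" "!!y. y \<notin> N0 ==> h y : filippov_map h y"
  using ex_null_set_filippov[OF h_meas] by blast
 have avoid: "AE om in P. joint_law_abs_cont P x M --> (ALL n. x n om \<notin> N0)"
  using iterates_avoid_null_set[OF x_meas M_meas _ N0(1)] by (cases "joint_law_abs_cont P x M") auto
 have "AE om in P. bdd_above (range (%n. norm (x n om))) & summable (%n. a n *R M (Suc n) om) &
   (joint_law_abs_cont P x M --> (ALL n. x n om \<notin> N0))"
  using stable noise_series_converges[OF P x0_meas mart_diff fourth_moment a_sq] avoid by eventually_elim blast
 then obtain Phi where Phi: "{om : space P. ~ (bdd_above (range (%n. norm (x n om))) & summable (%n. a n *R M (Suc n) om) &
   (joint_law_abs_cont P x M --> (ALL n. x n om \<notin> N0)))} \<subseteq> Phi" "emeasure P Phi = 0" "Phi : sets P"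
  by (rule AE_E)
 have Phi0: "Phi : null_sets P" using Phi(2,3) by (simp add: null_sets_def)
 define H where "H = (if joint_law_abs_cont P x M then filippov_map h else krasovskii_map h)"
 have H_cl: "closed (set_graph H)" by (simp add: H_def closed_graph_filippov closed_graph_krasovskii)
 have H_cv: "convex (H y)" for y by (simp add: H_def convex_filippov convex_krasovskii)
 have H_ne: "H y ~= {}" for y using filippov_nonempty[OF h_meas growth', of y] in_krasovskii[of h y] by (auto simp: H_def)
 have H_growth: "norm w <= K' * (1 + norm y)" if "w : H y" for y w
  using that growth' growthF by (auto simp: H_def split: if_splits)
 have HK: "H y \<subseteq> krasovskii_map h y" for y using filippov_subset_krasovskii[of h y] by (simp add: H_def)
 have prob_on_mono: "m : prob_on T" if "m : prob_on S" "S \<subseteq> T" "closed S" "closed T" for m :: "'c::topological_space measure" and S T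
 proof (rule prob_onI)
  have "AE p in m. p : S" by (rule prob_on_AE[OF that(1)]) (use that in simp)
  then show "AE p in m. p : T" by eventually_elim (use that in blast)
 qed (use that prob_onD[OF that(1)] in auto)
 have bdd: "bdd_above (range (%n. norm (x n om)))" and noise: "summable (%n. a n *R M (Suc n) om)"
  and step: "x (Suc n) om = x n om + a n *R (z n om + M (Suc n) om)"
  and zh: "z n om = h (x n om)" and zH: "z n om : H (x n om)" if om: "om : space P - Phi" for om n
 proof -
  show "bdd_above (range (%n. norm (x n om)))" "summable (%n. a n *R M (Suc n) om)" using Phi(1) om by auto
  have av: "joint_law_abs_cont P x M ==> x n om \<notin> N0" using Phi(1) om by auto
  show "x (Suc n) om = x n om + a n *R (z n om + M (Suc n) om)" using x_step om by simp
  show zh: "z n om = h (x n om)" using z_def om by simp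
  show "z n om : H (x n om)" unfolding zh H_def using N0(2)[OF av] in_krasovskii[of h] by simp
 qed
 show ?thesis
 proof (intro bexI[OF _ Phi0] ballI conjI allI impI)
  fix om assume om: "om : space P - Phi"
  show "bdd_above (range (%n. norm (x n om)))" by (rule bdd[OF om])
  then obtain r where r: "!!n. norm (x n om) <= r" by (auto simp: bdd_above_def)
  have "norm (h (x n om)) <= K' * (1 + r)" for n
   using growth'[OF in_krasovskii] mult_left_mono[OF add_left_mono[OF r[of n]], of K' 1] K'_pos by (meson order_trans less_imp_le)
  then have BD: "ALL n. (x n om, h (x n om)) : cball 0 r \<times> cball 0 (K' * (1 + r))" using r by simp
  show "EX B D. compact B & convex B & compact D & convex D & (ALL n. (x n om, h (x n om)) : B \<times> D)"
   by (intro exI[of _ "cball 0 r"] exI[of _ "cball 0 (K' * (1 + r))"] conjI BD compact_cball convex_cball)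
 next
  fix om B D c
  assume om: "om : space P - Phi"
   and BD: "compact B & convex B & compact D & convex D & (ALL n. (x n om, h (x n om)) : B \<times> D)"
   and lp: "limit_point_at_top (relaxed_topology (B \<times> D))
       (%t. relaxed_class (B \<times> D) (%s. averaged_empirical (B \<times> D) a (%n. (x n om, z n om)) (t + s))) c"
   have xB: "x n om : B" and zD: "z n om : D" for n using BD by (auto simp: zh[OF om])
   obtain mus and Q :: "(real => 'a * 'a) measure" and X Z v
    where 1: "mus : prob_on (B \<times> D)" "c = relaxed_class (B \<times> D) (%_. mus)" "mus : prob_on (set_graph H)"
     "stationary_process Q (%t xi. (X t xi, Z t xi))" "weak_velocity Q X Z"
     "ALL t>=0. distr Q borel (%xi. (X t xi, Z t xi)) = mus" "v : borel ->M prob_algebra borel"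
     and vH: "ALL y. v y : prob_on (H y)" and 2: "relaxed_dynamics Q X v" "ALL t>=0. is_conditional_law Q (X t) (Z t) v"
    using limit_point_structure[OF step[OF om] a0 noise[OF om] _ xB _ zD H_cl H_cv H_ne H_growth K'_pos zH[OF om] lp] BD by blast
   have "mus : prob_on (set_graph (krasovskii_map h))"
    by (rule prob_on_mono[OF 1(3) _ H_cl closed_graph_krasovskii]) (use HK in \<open>auto simp: set_graph_def\<close>)
   moreover have "joint_law_abs_cont P x M --> mus : prob_on (set_graph (filippov_map h))"
   proof
    assume "joint_law_abs_cont P x M" then show "mus : prob_on (set_graph (filippov_map h))" using 1(3) by (simp only: H_def if_True)
   qed
   moreover have "ALL y. v y : prob_on (krasovskii_map h y)"
   proof
    fix y show "v y : prob_on (krasovskii_map h y)"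
     by (rule prob_on_mono[OF spec[OF vH] HK closed_section[OF H_cl] closed_section[OF closed_graph_krasovskii]])
   qed
   moreover have "joint_law_abs_cont P x M --> (ALL y. v y : prob_on (filippov_map h y))"
   proof
    assume "joint_law_abs_cont P x M" then show "ALL y. v y : prob_on (filippov_map h y)" using vH by (auto simp: H_def)
   qed
   ultimately show "EX mus:prob_on (B \<times> D).
       c = relaxed_class (B \<times> D) (%_. mus) &
       mus : prob_on (set_graph (krasovskii_map h)) &
       (joint_law_abs_cont P x M --> mus : prob_on (set_graph (filippov_map h))) &
       (EX (Q :: (real => 'a * 'a) measure) X Z v.
        stationary_process Q (%t xi. (X t xi, Z t xi)) &
        weak_velocity Q X Z &
        (ALL t>=0. distr Q borel (%xi. (X t xi, Z t xi)) = mus) &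
        v : borel ->M prob_algebra borel &
        (ALL y. v y : prob_on (krasovskii_map h y)) &
        (joint_law_abs_cont P x M --> (ALL y. v y : prob_on (filippov_map h y))) &
        relaxed_dynamics Q X v &
        (ALL t>=0. is_conditional_law Q (X t) (Z t) v))"
    using 1 2 by blast
 qed
qed

end
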